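(* Let $X$ be the variance gamma LSBM, i.e. $T$ is the gamma subordinator with zero drift and Lévy density $\mu(z)=(\nu z)^{-1}e^{-z/\nu}$ on $(0,\infty)$, $\nu>0$, so $\psi(u)=\frac1\nu\log(1+\nu u)$, and let $\tilde W$ have drift $\beta$ and initial value $x_0>0$. Set $\alpha=\sqrt{2/\nu+\beta^2}$. Then for $s>0$ and $x_1\neq0$, \[ p_1^*(x_0;s,x_1)=\frac{e^{\beta(x_1-x_0)}}{2\pi\nu}\int_{\mathbb{R}}\frac{(1+i\nu z)^{-s/\nu}}{\sqrt{\beta^2-2iz}}\,e^{-x_0\sqrt{\beta^2-2iz}}\Big[e^{|x_1|\sqrt{\beta^2-2iz}}\,\mathrm{Ei}\big(-|x_1|(\alpha+\sqrt{\beta^2-2iz})\big)-e^{-|x_1|\sqrt{\beta^2-2iz}}\,\mathrm{Ei}\big(-|x_1|(\alpha-\sqrt{\beta^2-2iz})\big)\Big]dz, \] where $\mathrm{Ei}$ is the exponential integral function and $\sqrt{\cdot}$ is the principal branch.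
   Context: Setup (LSBM): $W$ standard Brownian motion, $\tilde W_S=x_0+W_S+\beta S$, $T$ a subordinator independent of $W$, $X_t=\tilde W_{T_t}$. $T^*(x_0)=\inf\{S\ge0:\tilde W_S\le0\}$; first passage time of the second kind $t_1^*=\inf\{t\ge0:T_t\ge T^*(x_0)\}$. $p_1^*(x_0;s,x_1)=E_{x_0}[\delta(t_1^*-s)\delta(X_{t_1^*}-x_1)]$ is the joint density of $(t_1^*,X_{t_1^*})$ at $(s,x_1)$. $\mathrm{Ei}(x)=-\int_{-x}^\infty e^{-t}t^{-1}dt$ (principal value / analytic continuation for complex arguments). $(1+i\nu z)^{-s/\nu}$ uses the principal branch. *)

theory Defs
  imports "HOL-Probability.Probability"
begin

definition std_brownian_motion :: "'a measure \<Rightarrow> (real \<Rightarrow> 'a \<Rightarrow> real) \<Rightarrow> bool" where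
  "std_brownian_motion M W \<longleftrightarrow>
     (\<forall>t. W t \<in> borel_measurable M) \<and>
     (\<forall>\<omega>\<in>space M. W 0 \<omega> = 0 \<and> continuous_on {0..} (\<lambda>t. W t \<omega>)) \<and>
     (\<forall>s t. 0 \<le> s \<and> s < t \<longrightarrow>
        distributed M lborel (\<lambda>\<omega>. W t \<omega> - W s \<omega>)
          (\<lambda>x. ennreal (normal_density 0 (sqrt (t - s)) x))) \<and>
     (\<forall>ts. sorted_wrt (<) ts \<and> (\<forall>t\<in>set ts. 0 \<le> t) \<longrightarrow>
        prob_space.indep_vars M (\<lambda>_. borel)
          (\<lambda>i \<omega>. W (ts ! Suc i) \<omega> - W (ts ! i) \<omega>) {..< length ts - 1})"

text \<open>Laplace exponent of the gamma subordinator (zero drift, Levy density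
  (\<nu> z)^(-1) e^(-z/\<nu>)): psi(u) = (1/\<nu>) log(1 + \<nu> u).\<close>
definition vg_psi :: "real \<Rightarrow> real \<Rightarrow> real" where
  "vg_psi \<nu> u = ln (1 + \<nu> * u) / \<nu>"

definition gamma_subordinator :: "'a measure \<Rightarrow> real \<Rightarrow> (real \<Rightarrow> 'a \<Rightarrow> real) \<Rightarrow> bool" where
  "gamma_subordinator M \<nu> T \<longleftrightarrow>
     (\<forall>t. T t \<in> borel_measurable M) \<and>
     (\<forall>\<omega>\<in>space M. T 0 \<omega> = 0 \<and> mono_on {0..} (\<lambda>t. T t \<omega>) \<and>
        (\<forall>t\<ge>0. continuous (at_right t) (\<lambda>t. T t \<omega>))) \<and>
     (\<forall>s t u. 0 \<le> s \<and> s \<le> t \<and> 0 \<le> u \<longrightarrow>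
        prob_space.expectation M (\<lambda>\<omega>. exp (- u * (T t \<omega> - T s \<omega>))) = exp (- (t - s) * vg_psi \<nu> u)) \<and>
     (\<forall>ts. sorted_wrt (<) ts \<and> (\<forall>t\<in>set ts. 0 \<le> t) \<longrightarrow>
        prob_space.indep_vars M (\<lambda>_. borel)
          (\<lambda>i \<omega>. T (ts ! Suc i) \<omega> - T (ts ! i) \<omega>) {..< length ts - 1})"

definition Wtilde :: "real \<Rightarrow> real \<Rightarrow> (real \<Rightarrow> 'a \<Rightarrow> real) \<Rightarrow> real \<Rightarrow> 'a \<Rightarrow> real" where
  "Wtilde x0 \<beta> W S \<omega> = x0 + W S \<omega> + \<beta> * S"

definition LSBM :: "real \<Rightarrow> real \<Rightarrow> (real \<Rightarrow> 'a \<Rightarrow> real) \<Rightarrow> (real \<Rightarrow> 'a \<Rightarrow> real) \<Rightarrow> real \<Rightarrow> 'a \<Rightarrow> real" where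
  "LSBM x0 \<beta> W T t \<omega> = Wtilde x0 \<beta> W (T t \<omega>) \<omega>"

definition Tstar :: "real \<Rightarrow> real \<Rightarrow> (real \<Rightarrow> 'a \<Rightarrow> real) \<Rightarrow> 'a \<Rightarrow> ereal" where
  "Tstar x0 \<beta> W \<omega> = Inf {ereal S | S. 0 \<le> S \<and> Wtilde x0 \<beta> W S \<omega> \<le> 0}"

definition t1star :: "real \<Rightarrow> real \<Rightarrow> (real \<Rightarrow> 'a \<Rightarrow> real) \<Rightarrow> (real \<Rightarrow> 'a \<Rightarrow> real) \<Rightarrow> 'a \<Rightarrow> ereal" where
  "t1star x0 \<beta> W T \<omega> = Inf {ereal t | t. 0 \<le> t \<and> Tstar x0 \<beta> W \<omega> \<le> ereal (T t \<omega>)}"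

text \<open>Exponential integral Ei(w) = - int_{-w}^oo e^(-tau)/tau d tau, the integral taken
  along the horizontal ray -w + [0,oo); for w not in [0,oo) this is the analytic
  continuation (principal branch) of the real Ei from the negative real axis.\<close>
definition Ei :: "complex \<Rightarrow> complex" where
  "Ei w = - (LINT t:{0..}|lborel. exp (- (complex_of_real t - w)) / (complex_of_real t - w))"

definition vg_p1_formula :: "real \<Rightarrow> real \<Rightarrow> real \<Rightarrow> real \<Rightarrow> real \<Rightarrow> complex" where
  "vg_p1_formula \<nu> \<beta> x0 s x1 =
     (let \<alpha> = sqrt (2 / \<nu> + \<beta>\<^sup>2);
          r = (\<lambda>z::real. csqrt (complex_of_real (\<beta>\<^sup>2) - 2 * \<i> * complex_of_real z))
      in complex_of_real (exp (\<beta> * (x1 - x0)) / (2 * pi * \<nu>)) *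
         (LINT z|lborel.
            (1 + \<i> * complex_of_real (\<nu> * z)) powr (- complex_of_real (s / \<nu>)) / r z
            * exp (- complex_of_real x0 * r z)
            * (exp (complex_of_real \<bar>x1\<bar> * r z) * Ei (- complex_of_real \<bar>x1\<bar> * (complex_of_real \<alpha> + r z))
               - exp (- complex_of_real \<bar>x1\<bar> * r z) * Ei (- complex_of_real \<bar>x1\<bar> * (complex_of_real \<alpha> - r z)))))"

end

theory Submission
  imports Defs "HOL-Complex_Analysis.Complex_Analysis" "HOL-Real_Asymp.Real_Asymp"
begin

text \<open>
  Let \<open>\<tau>\<close> be the hitting time of 0 by \<open>x\<^sub>0 + W\<^sub>S + \<beta> S\<close>. Optional stopping of complex exponentials gives
  \<open>E[e\<^sup>i\<^sup>z\<^sup>\<tau>; \<tau> < \<infinity>] = exp (- x\<^sub>0 (\<beta> + r))\<close> with \<open>r = sqrt (\<beta>\<^sup>2 - 2 i z)\<close>. This is integrable in \<open>z\<close>, so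
  \<open>\<tau>\<close> has a density, which allows results on the passage of \<open>T\<close> over almost every level \<open>a\<close> to be
  applied to the independent random level \<open>\<tau>\<close>.

  For the subordinator, integrating over the level against \<open>e\<^sup>-\<^sup>q\<^sup>a da\<close> turns the first passage
  into a telescoping sum over a time grid. Its triple Laplace transform (passage time, overshoot, level)
  is \<open>(\<psi>(\<theta>) - \<psi>(q)) / ((\<theta> - q) (\<mu> + \<psi>(q)))\<close>; by uniqueness, passage time and overshoot have
  the density \<open>(s, k) \<mapsto> E[\<mu>(a - T\<^sub>s + k); T\<^sub>s < a]\<close>, \<open>\<mu>\<close> being here the Levy density.

  By the strong Markov property at \<open>\<tau>\<close>, an overshoot \<open>k\<close> contributes an independent normal displacement
  with mean \<open>\<beta> k\<close> and variance \<open>k\<close>. Writing \<open>\<mu>\<close> as a mixture of exponentials \<open>e\<^sup>-\<^sup>c\<^sup>z\<close> with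
  \<open>c = (y\<^sup>2 - \<beta>\<^sup>2) / 2\<close>, \<open>y > \<alpha>\<close>, the integral over \<open>k\<close> becomes explicit, and Fourier inversion for
  \<open>\<tau> - T\<^sub>s\<close> leaves \<open>\<integral>\<^sub>y\<^sub>>\<^sub>\<alpha> e\<^sup>-\<^sup>|\<^sup>x\<^sup>|\<^sup>y / (c + i z) dy\<close>, which is the bracket of exponential
  integrals divided by \<open>r\<close>, because \<open>2 (c + i z) = y\<^sup>2 - r\<^sup>2\<close>.
\<close>

text \<open>The gamma process is given by its Laplace exponent only, so no jump measure and no
  compensation formula is at hand. This is why passage time and overshoot are identified through a
  transform, and only for almost every level. On the Brownian side the increment runs over a random
  duration: once the path of \<open>T\<close> is frozen, the overshoot is a right-continuous
  deterministic function of the hitting time, and the strong Markov property is proved in exactly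
  that form. \<open>t1star\<close> uses a weak inequality, while right continuity in the level needs
  a strict one. The two passage times differ only if \<open>T\<close> rests at the level for a
  while, which has probability 0 because the level has a density. The gamma factor of the integrand
  decays like a power of \<open>z\<close> that may be arbitrarily slow for small \<open>s\<close>,
  so absolute convergence in \<open>z\<close> comes from the hitting time alone, whose transform is
  at most a constant times \<open>exp (- x0 * sqrt |z|)\<close>. Apart from the Fourier steps nearly
  all integrals are of nonnegative functions, where the order of integration is free.\<close>

section \<open>Auxiliary measure theory\<close>

text \<open>The next point of the grid of mesh \<open>1 / (n + 1)\<close>, strictly after \<open>t\<close>: approximation from the
  right, so that right continuity of paths suffices for limits. A negative \<open>t\<close> is treated as 0.\<close>
definition grid :: "nat \<Rightarrow> real \<Rightarrow> real" where
  "grid n t = real (Suc (nat \<lfloor>t * real (Suc n)\<rfloor>)) / real (Suc n)"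

lemma grid_gt: "max 0 t < grid n t"
proof -
  have "t * real (Suc n) < real (Suc (nat \<lfloor>t * real (Suc n)\<rfloor>))" by linarith
  then have "t < grid n t" unfolding grid_def by (simp add: pos_less_divide_eq)
  moreover have "0 < grid n t" unfolding grid_def by simp
  ultimately show ?thesis by simp
qed

lemma grid_le: "grid n t \<le> max 0 t + 1 / real (Suc n)"
proof -
  have "real (Suc (nat \<lfloor>t * real (Suc n)\<rfloor>)) \<le> max 0 (t * real (Suc n)) + 1" by linarith
  also have "max 0 (t * real (Suc n)) = max 0 t * real (Suc n)"
    by (auto simp: max_def zero_le_mult_iff)
  finally show ?thesis unfolding grid_def by (simp add: field_simps del: of_nat_Suc)
qed

lemma LIMSEQ_grid: "(\<lambda>n. grid n t) \<longlonglongrightarrow> max 0 t"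
proof (rule tendsto_sandwich[of "\<lambda>_. max 0 t" _ _ "\<lambda>n. max 0 t + 1 / real (Suc n)"])
  show "(\<lambda>n. max 0 t + 1 / real (Suc n)) \<longlonglongrightarrow> max 0 t"
    using tendsto_add[OF tendsto_const[of "max 0 t"] LIMSEQ_inverse_real_of_nat]
    by (simp add: inverse_eq_divide)
qed (intro always_eventually allI grid_le less_imp_le[OF grid_gt] tendsto_const)+

lemma grid_at_right: "filterlim (\<lambda>n. grid n t) (at_right (max 0 t)) sequentially"
  by (rule tendsto_imp_filterlim_at_right[OF LIMSEQ_grid]) (intro always_eventually allI grid_gt)

lemma LIMSEQ_right_continuous_grid:
  fixes f :: "real \<Rightarrow> 'b::topological_space"
  assumes "continuous (at_right (max 0 t)) f"
  shows "(\<lambda>n. f (grid n t)) \<longlonglongrightarrow> f (max 0 t)"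
  using filterlim_compose[OF assms[unfolded continuous_within] grid_at_right] .

lemma grid_measurable[measurable]: "grid n \<in> borel_measurable borel"
  unfolding grid_def[abs_def] by measurable

text \<open>Along the grid only countably many times occur, so measurability at fixed times gives
  joint measurability of the approximation, and right continuity passes it to the limit.
  \<open>max 0\<close> freezes the process at negative times, about which the paths carry no
  information.\<close>

lemma measurable_right_continuous_process:
  fixes X :: "real \<Rightarrow> 'a \<Rightarrow> real"
  assumes X[measurable]: "\<And>t. X t \<in> borel_measurable N"
    and rc: "\<And>\<omega> t. \<omega> \<in> space N \<Longrightarrow> 0 \<le> t \<Longrightarrow> continuous (at_right t) (\<lambda>t. X t \<omega>)"
  shows "(\<lambda>p. X (max 0 (fst p)) (snd p)) \<in> borel_measurable (borel \<Otimes>\<^sub>M N)"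
proof (rule borel_measurable_LIMSEQ_metric)
  fix n
  have "(\<lambda>p. (\<lambda>i p. X (real (Suc i) / real (Suc n)) (snd p)) (nat \<lfloor>fst p * real (Suc n)\<rfloor>) p)
      \<in> borel_measurable (borel \<Otimes>\<^sub>M N)"
    by (rule measurable_compose_countable) measurable
  then show "(\<lambda>p. X (grid n (fst p)) (snd p)) \<in> borel_measurable (borel \<Otimes>\<^sub>M N)"
    unfolding grid_def by simp
next
  fix p :: "real \<times> 'a" assume "p \<in> space (borel \<Otimes>\<^sub>M N)"
  then show "(\<lambda>n. X (grid n (fst p)) (snd p)) \<longlonglongrightarrow> X (max 0 (fst p)) (snd p)"
    by (intro LIMSEQ_right_continuous_grid[of _ "\<lambda>t. X t (snd p)"] rc) (auto simp: space_pair_measure)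
qed

section \<open>Measures determined by continuous functions, moments and Laplace transforms\<close>

text \<open>Truncated multiples of the distance to the complement converge to the indicator of an
  open set, and open sets form an intersection-stable generator.\<close>

lemma finite_measure_eqI_continuous:
  fixes M N :: "'a::metric_space measure"
  assumes "finite_measure M" and sets: "sets M = sets borel" "sets N = sets borel"
    and eq: "\<And>f::'a \<Rightarrow> real. continuous_on UNIV f \<Longrightarrow> (\<And>x. 0 \<le> f x \<and> f x \<le> 1) \<Longrightarrow>
       (\<integral>\<^sup>+x. ennreal (f x) \<partial>M) = (\<integral>\<^sup>+x. ennreal (f x) \<partial>N)"
  shows "M = N"
proof -
  interpret M: finite_measure M by fact
  note [measurable_cong] = sets
  have sp: "space M = UNIV" "space N = UNIV"
    using sets by (auto dest: sets_eq_imp_space_eq)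
  have "emeasure N UNIV = emeasure M UNIV"
    using eq[of "\<lambda>_. 1"] sp by simp
  then have N: "finite_measure N"
    using M.finite_emeasure_space by (intro finite_measureI) (simp add: sp)
  have fin: "emeasure L (space L) < \<infinity>" if "L \<in> {M, N}" for L
    using that M.emeasure_finite[of "space M"] finite_measure.emeasure_finite[OF N, of "space N"]
    by (auto simp: less_top[symmetric])
  show ?thesis
  proof (rule measure_eqI_generator_eq[where E="{S. open S}" and \<Omega>=UNIV and A="\<lambda>_. UNIV"])
    show "Int_stable {S::'a set. open S}" by (auto simp: Int_stable_def)
    show "sets M = sigma_sets UNIV {S. open S}" "sets N = sigma_sets UNIV {S. open S}"
      using sets by (auto simp: borel_def)
    fix X :: "'a set" assume "X \<in> {S. open S}"
    then have X: "open X" by simp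
    show "emeasure M X = emeasure N X"
    \<comment> \<open>The distance to the empty complement is 0 by convention, so the approximants
      below would vanish for the whole space; there the test function 1 is used.\<close>
    proof (cases "X = UNIV")
      case True then show ?thesis using \<open>emeasure N UNIV = _\<close> by simp
    next
      case False
      define g where "g n x = min 1 (real n * infdist x (- X))" for n x
      have cg: "continuous_on UNIV (g n)" for n
        unfolding g_def by (intro continuous_intros)
      have g01: "0 \<le> g n x \<and> g n x \<le> 1" for n x
        unfolding g_def by (auto simp: infdist_nonneg)
      have lim: "(\<lambda>n. g n x) \<longlonglongrightarrow> indicator X x" for x
      proof (cases "x \<in> X")
        case False
        then show ?thesis by (simp add: g_def)
      next
        case True
        then have pos: "infdist x (-X) > 0"
          using infdist_pos_not_in_closed[of "-X" x] X \<open>X \<noteq> UNIV\<close> by (auto simp: closed_def)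
        obtain n0 where n0: "1 / infdist x (-X) \<le> real n0" using real_arch_simple by blast
        have "\<forall>\<^sub>F n in sequentially. g n x = 1"
          using eventually_ge_at_top[of n0]
        proof eventually_elim
          case (elim n)
          then have "1 / infdist x (-X) \<le> real n" using n0 by linarith
          then show ?case using pos unfolding g_def by (simp add: field_simps)
        qed
        then show ?thesis using True by (simp add: tendsto_eventually)
      qed
      have *: "(\<lambda>n. \<integral>\<^sup>+x. ennreal (g n x) \<partial>L) \<longlonglongrightarrow> emeasure L X" if L: "L \<in> {M, N}" for L
      proof -
        have [measurable_cong]: "sets L = sets borel" using L sets by auto
        have "(\<lambda>n. \<integral>\<^sup>+x. ennreal (g n x) \<partial>L) \<longlonglongrightarrow> (\<integral>\<^sup>+x. indicator X x \<partial>L)"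
        proof (rule nn_integral_dominated_convergence[where w="\<lambda>_. 1"])
          show "(\<lambda>x. ennreal (g n x)) \<in> borel_measurable L" for n
            using borel_measurable_continuous_onI[OF cg[of n]] by measurable
          show "(indicator X :: 'a \<Rightarrow> ennreal) \<in> borel_measurable L"
            using borel_open[OF X] \<open>sets L = sets borel\<close> by simp
          show "AE x in L. (\<lambda>n. ennreal (g n x)) \<longlonglongrightarrow> indicator X x"
          proof (rule AE_I2)
            fix x
            show "(\<lambda>n. ennreal (g n x)) \<longlonglongrightarrow> indicator X x"
              using tendsto_ennrealI[OF lim[of x]] by (auto simp: indicator_def split: if_splits)
          qed
        qed (use g01 fin[OF L] in auto)
        then show ?thesis using X by (simp add: nn_integral_indicator)
      qed
      show ?thesis
        using LIMSEQ_unique[OF *[of M]] *[of N] eq[OF cg g01] by simp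
    qed
  qed (use M.emeasure_finite in auto)
qed

text \<open>Polynomials are dense in the continuous functions on the unit cube by Stone-Weierstrass,
  so moments determine the integrals of continuous functions.\<close>

lemma finite_measure_eqI_moments3:
  fixes M N :: "(real \<times> real \<times> real) measure"
  assumes fin: "finite_measure M" "finite_measure N" and sets: "sets M = sets borel" "sets N = sets borel"
    and supp: "AE (x, y, z) in M. x \<in> {0..1} \<and> y \<in> {0..1} \<and> z \<in> {0..1}"
      "AE (x, y, z) in N. x \<in> {0..1} \<and> y \<in> {0..1} \<and> z \<in> {0..1}"
    and eq: "\<And>i j k. (\<integral>(x, y, z). x ^ i * y ^ j * z ^ k \<partial>M) = (\<integral>(x, y, z). x ^ i * y ^ j * z ^ k \<partial>N)"
  shows "M = N"
proof (rule finite_measure_eqI_continuous[OF fin(1) sets])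
  fix f :: "real \<times> real \<times> real \<Rightarrow> real"
  assume f: "continuous_on UNIV f" and f01: "\<And>x. 0 \<le> f x \<and> f x \<le> 1"
  define S :: "(real \<times> real \<times> real) set" where "S = {0..1} \<times> {0..1} \<times> {0..1}"
  have S: "compact S" unfolding S_def by (intro compact_Times compact_Icc)
  note [measurable_cong] = sets
  have AES: "AE x in L. x \<in> S" if "L \<in> {M, N}" for L
    using that supp by (auto simp: S_def case_prod_unfold mem_Times_iff)
  have L: "finite_measure L" "sets L = sets borel" if "L \<in> {M, N}" for L
    using that fin sets by auto
  define bdd where "bdd h \<longleftrightarrow> h \<in> borel_measurable borel \<and> (\<exists>B. \<forall>x\<in>S. \<bar>h x :: real\<bar> \<le> B)" for h
  have int: "integrable L h" if bh: "bdd h" and Lin: "L \<in> {M, N}" for h L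
  proof -
    obtain B where B: "\<forall>x\<in>S. \<bar>h x\<bar> \<le> B" using bh unfolding bdd_def by blast
    have "h \<in> borel_measurable L" using bh L[OF Lin] unfolding bdd_def by (simp cong: measurable_cong_sets)
    then show ?thesis
      using AES[OF Lin] B by (intro finite_measure.integrable_const_bound[OF L(1)[OF Lin], of _ B]) auto
  qed
  have bdd_cont: "bdd h" if "continuous_on UNIV h" for h
  proof -
    have "compact (h ` S)" using compact_continuous_image[OF _ S] that continuous_on_subset by blast
    then obtain B where "\<forall>y\<in>h ` S. norm y \<le> B" using compact_imp_bounded bounded_iff by metis
    then show ?thesis using borel_measurable_continuous_onI[OF that] unfolding bdd_def by (auto intro!: exI[of _ B])
  qed
  have bdd_mult: "bdd (\<lambda>x. p x * h x)" if ph: "bdd p" "bdd h" for p h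
  proof -
    obtain B C where "\<forall>x\<in>S. \<bar>p x\<bar> \<le> B" "\<forall>x\<in>S. \<bar>h x\<bar> \<le> C" using ph unfolding bdd_def by blast
    then have "\<forall>x\<in>S. \<bar>p x * h x\<bar> \<le> B * C" by (auto simp: abs_mult intro!: mult_mono order_trans[OF abs_ge_zero])
    then show ?thesis using ph unfolding bdd_def by auto
  qed
  define mon where "mon i j k = (\<lambda>w::real\<times>real\<times>real. fst w ^ i * fst (snd w) ^ j * snd (snd w) ^ k)" for i j k
  have bdd_mon: "bdd (mon i j k)" for i j k
    unfolding mon_def by (intro bdd_cont continuous_intros)
  define good where "good h \<longleftrightarrow> bdd h \<and> (\<forall>i j k. (\<integral>x. h x * mon i j k x \<partial>M) = (\<integral>x. h x * mon i j k x \<partial>N))" for h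
  \<comment> \<open>The algebra for Stone-Weierstrass consists of the multipliers that preserve
    \<open>good\<close>. Closure under products is then mere composition, without a normal form of
    polynomials; applying a multiplier to the constant 1 recovers equality of its integrals.\<close>
  define P where "P p \<longleftrightarrow> continuous_on UNIV p \<and> (\<forall>h. good h \<longrightarrow> good (\<lambda>x. p x * h x))" for p
  have good1: "good (\<lambda>_. 1)"
    unfolding good_def using eq by (auto simp: mon_def case_prod_unfold intro!: bdd_cont)
  have Pc: "P (\<lambda>x. c)" for c
    unfolding P_def good_def by (auto intro!: bdd_mult[OF bdd_cont] simp: mult.assoc)
  have Padd: "P (\<lambda>x. p x + q x)" if "P p \<and> P q" for p q
    unfolding P_def
  proof (intro conjI allI impI)
    show "continuous_on UNIV (\<lambda>x. p x + q x)" using that unfolding P_def by (intro continuous_intros) auto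
    fix h assume h: "good h"
    have gp: "good (\<lambda>x. p x * h x)" "good (\<lambda>x. q x * h x)" using h that unfolding P_def by auto
    have "bdd (\<lambda>x. (p x + q x) * h x)" using h that unfolding good_def P_def
      by (intro bdd_mult[OF bdd_cont] continuous_on_add) auto
    moreover have "(\<integral>x. (p x + q x) * h x * mon i j k x \<partial>L) =
       (\<integral>x. p x * h x * mon i j k x \<partial>L) + (\<integral>x. q x * h x * mon i j k x \<partial>L)" if "L \<in> {M, N}" for L i j k
      using Bochner_Integration.integral_add[OF int[OF bdd_mult[OF _ bdd_mon] that] int[OF bdd_mult[OF _ bdd_mon] that],
          of "\<lambda>x. p x * h x" "\<lambda>x. q x * h x" i j k i j k] gp
      unfolding good_def by (simp add: distrib_right)
    ultimately show "good (\<lambda>x. (p x + q x) * h x)"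
      using gp unfolding good_def by simp
  qed
  have Pmult: "P (\<lambda>x. p x * q x)" if "P p \<and> P q" for p q
    using that unfolding P_def by (auto intro!: continuous_intros simp: mult.assoc)
  have Pcoord: "P fst" "P (\<lambda>w. fst (snd w))" "P (\<lambda>w. snd (snd w))"
  proof -
    have A: "fst x * h x * mon i j k x = h x * mon (Suc i) j k x"
      "fst (snd x) * h x * mon i j k x = h x * mon i (Suc j) k x"
      "snd (snd x) * h x * mon i j k x = h x * mon i j (Suc k) x" for x h i j k
      by (auto simp: mon_def)
    show "P fst" "P (\<lambda>w. fst (snd w))" "P (\<lambda>w. snd (snd w))"
      unfolding P_def good_def A by (auto intro!: continuous_intros bdd_mult[OF bdd_cont])
  qed
  have main: "(\<integral>x. f x \<partial>M) = (\<integral>x. f x \<partial>N)"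
  proof -
    define C where "C = measure M (space M) + measure N (space N)"
    have C0: "C \<ge> 0" unfolding C_def by simp
    have "\<bar>(\<integral>x. f x \<partial>M) - (\<integral>x. f x \<partial>N)\<bar> \<le> e" if e: "e > 0" for e
    proof -
      \<comment> \<open>\<open>C + 1\<close> instead of the total mass \<open>C\<close> avoids
        division by zero when both measures are null.\<close>
      have e': "e / (C + 1) > 0" using e C0 by simp
      have cS: "continuous_on S f" using f continuous_on_subset by blast
      obtain g where g: "P g" "\<forall>x\<in>S. \<bar>f x - g x\<bar> < e / (C + 1)"
      proof -
        have "\<exists>g. P g \<and> (\<forall>x\<in>S. \<bar>f x - g x\<bar> < e / (C + 1))"
        proof (rule Stone_Weierstrass_HOL[OF S _ _ _ _ _ cS e'])
          show "\<exists>f. P f \<and> f x \<noteq> f y" if "x \<in> S \<and> y \<in> S \<and> x \<noteq> y" for x y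
            using that Pcoord by (metis prod.collapse)
        qed (use Pc Padd Pmult in \<open>auto simp: P_def intro: continuous_on_subset\<close>)
        then show ?thesis using that by blast
      qed
      have bg: "bdd g" using g(1) unfolding P_def by (auto intro: bdd_cont)
      have gg: "(\<integral>x. g x \<partial>M) = (\<integral>x. g x \<partial>N)"
      proof -
        have "good g" using g(1) good1 unfolding P_def by fastforce
        then show ?thesis unfolding good_def by (auto dest!: spec[of _ "0::nat"] simp: mon_def)
      qed
      have d: "\<bar>(\<integral>x. f x \<partial>L) - (\<integral>x. g x \<partial>L)\<bar> \<le> e / (C + 1) * measure L (space L)" if Lin: "L \<in> {M, N}" for L
      proof -
        interpret finite_measure L using L Lin by auto
        have i: "integrable L f" "integrable L g" using int bdd_cont f bg Lin by auto
        have "\<bar>(\<integral>x. f x \<partial>L) - (\<integral>x. g x \<partial>L)\<bar> = \<bar>\<integral>x. f x - g x \<partial>L\<bar>" using i by simp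
        also have "\<dots> \<le> (\<integral>x. \<bar>f x - g x\<bar> \<partial>L)" by (rule integral_abs_bound)
        also have "\<dots> \<le> (\<integral>x. e / (C + 1) \<partial>L)"
          using AES[OF Lin] g(2) i by (intro integral_mono_AE) (auto elim!: eventually_mono intro: less_imp_le)
        finally show ?thesis by (simp add: mult.commute)
      qed
      have "\<bar>(\<integral>x. f x \<partial>M) - (\<integral>x. f x \<partial>N)\<bar> \<le> e / (C + 1) * C"
      proof -
        have "e / (C + 1) * C = e / (C + 1) * measure M (space M) + e / (C + 1) * measure N (space N)"
          unfolding C_def by (rule distrib_left)
        then show ?thesis using d[of M] d[of N] gg by auto
      qed
      also have "\<dots> \<le> e" using e C0 by (simp add: field_simps)
      finally show ?thesis .
    qed
    then have "\<bar>(\<integral>x. f x \<partial>M) - (\<integral>x. f x \<partial>N)\<bar> \<le> 0" by (rule field_le_epsilon[of _ 0, simplified])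
    then show ?thesis by simp
  qed
  show "(\<integral>\<^sup>+x. ennreal (f x) \<partial>M) = (\<integral>\<^sup>+x. ennreal (f x) \<partial>N)"
    using main f01 int[OF bdd_cont[OF f]] by (simp add: nn_integral_eq_integral)
qed

text \<open>The map \<open>E\<close> carries the orthant into the unit cube and turns Laplace
  transforms at integer points into moments. It has a measurable left inverse \<open>G\<close>, so
  the image measures determine the original ones.\<close>

lemma finite_measure_eqI_laplace3:
  fixes M N :: "(real \<times> real \<times> real) measure"
  assumes fin: "finite_measure M" "finite_measure N" and sets: "sets M = sets borel" "sets N = sets borel"
    and supp: "AE (x, y, z) in M. 0 \<le> x \<and> 0 \<le> y \<and> 0 \<le> z"
      "AE (x, y, z) in N. 0 \<le> x \<and> 0 \<le> y \<and> 0 \<le> z"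
    and eq: "\<And>i j k. (\<integral>\<^sup>+(x, y, z). ennreal (exp (- (real i * x + real j * y + real k * z))) \<partial>M) =
       (\<integral>\<^sup>+(x, y, z). ennreal (exp (- (real i * x + real j * y + real k * z))) \<partial>N)"
  shows "M = N"
proof -
  note [measurable_cong] = sets
  define E where "E = (\<lambda>w::real\<times>real\<times>real. (exp (- fst w), exp (- fst (snd w)), exp (- snd (snd w))))"
  define G where "G = (\<lambda>w::real\<times>real\<times>real. (- ln (fst w), - ln (fst (snd w)), - ln (snd (snd w))))"
  have E[measurable]: "E \<in> borel_measurable borel"
    unfolding E_def by (intro borel_measurable_continuous_onI continuous_intros)
  have G[measurable]: "G \<in> borel_measurable borel"
    unfolding G_def borel_prod[symmetric] by measurable
  have GE: "G (E w) = w" for w by (simp add: G_def E_def)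
  have inv: "distr (distr L borel E) borel G = L" if "sets L = sets borel" for L
  proof -
    have [measurable_cong]: "sets L = sets borel" by fact
    show ?thesis by (subst distr_distr) (auto simp: o_def GE intro!: distr_id2 that[symmetric])
  qed
  have "distr M borel E = distr N borel E"
  proof (rule finite_measure_eqI_moments3)
    show "finite_measure (distr M borel E)" "finite_measure (distr N borel E)"
      using fin by (auto intro!: finite_measure.finite_measure_distr)
    have AE_E: "AE (x, y, z) in distr L borel E. x \<in> {0..1} \<and> y \<in> {0..1} \<and> z \<in> {0..1}"
      if L: "sets L = sets borel" "AE (x, y, z) in L. 0 \<le> x \<and> 0 \<le> y \<and> 0 \<le> z" for L
    proof -
      have EL: "E \<in> measurable L borel" using E L(1) by (simp cong: measurable_cong_sets)
      have "AE w in L. case E w of (x, y, z) \<Rightarrow> x \<in> {0..1} \<and> y \<in> {0..1} \<and> z \<in> {0..1}"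
        using L(2) by eventually_elim (auto simp: E_def)
      moreover have st: "{w\<in>space borel. case w of (x, y, z) \<Rightarrow> x \<in> {0..1::real} \<and> y \<in> {0..1::real} \<and> z \<in> {0..1::real}} =
          {0..1::real} \<times> {0..1::real} \<times> {0..1::real}" by auto
      have "{w\<in>space borel. case w of (x, y, z) \<Rightarrow> x \<in> {0..1::real} \<and> y \<in> {0..1::real} \<and> z \<in> {0..1::real}} \<in> sets borel"
        unfolding st by (intro borel_closed closed_Times closed_atLeastAtMost)
      ultimately show ?thesis using AE_distr_iff[OF EL] by blast
    qed
    show "AE (x, y, z) in distr M borel E. x \<in> {0..1} \<and> y \<in> {0..1} \<and> z \<in> {0..1}"
      "AE (x, y, z) in distr N borel E. x \<in> {0..1} \<and> y \<in> {0..1} \<and> z \<in> {0..1}"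
      using AE_E sets supp by auto
    fix i j k
    have *: "(\<integral>(x, y, z). x ^ i * y ^ j * z ^ k \<partial>distr L borel E) =
       enn2real (\<integral>\<^sup>+(x, y, z). ennreal (exp (- (real i * x + real j * y + real k * z))) \<partial>L)"
      if [measurable_cong]: "sets L = sets borel" for L
    proof -
      have "(\<integral>(x, y, z). x ^ i * y ^ j * z ^ k \<partial>distr L borel E) =
        (\<integral>(x, y, z). exp (- (real i * x + real j * y + real k * z)) \<partial>L)"
      proof -
        have EL: "E \<in> measurable L borel" using E that by (simp cong: measurable_cong_sets)
        have pm: "(\<lambda>w::real\<times>real\<times>real. fst w ^ i * fst (snd w) ^ j * snd (snd w) ^ k) \<in> borel_measurable borel"
          by (intro borel_measurable_continuous_onI continuous_intros)
        have "fst (E w) ^ i * fst (snd (E w)) ^ j * snd (snd (E w)) ^ k =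
            exp (- (real i * fst w + real j * fst (snd w) + real k * snd (snd w)))" for w
          by (simp add: E_def exp_of_nat_mult[symmetric] exp_add[symmetric])
        then show ?thesis
          unfolding case_prod_unfold by (subst integral_distr[OF EL pm]) simp
      qed
      also have "\<dots> = enn2real (\<integral>\<^sup>+(x, y, z). ennreal (exp (- (real i * x + real j * y + real k * z))) \<partial>L)"
      proof -
        have "(\<lambda>w::real\<times>real\<times>real. exp (- (real i * fst w + real j * fst (snd w) + real k * snd (snd w)))) \<in> borel_measurable borel"
          by (intro borel_measurable_continuous_onI continuous_intros)
        then have "(\<lambda>w. exp (- (real i * fst w + real j * fst (snd w) + real k * snd (snd w)))) \<in> borel_measurable L"
          using that by (simp cong: measurable_cong_sets)
        then show ?thesis
          unfolding case_prod_unfold by (subst integral_eq_nn_integral) auto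
      qed
      finally show ?thesis .
    qed
    show "(\<integral>(x, y, z). x ^ i * y ^ j * z ^ k \<partial>distr M borel E) = (\<integral>(x, y, z). x ^ i * y ^ j * z ^ k \<partial>distr N borel E)"
      using eq by (simp add: * sets)
  qed auto
  then show ?thesis using inv[of M] inv[of N] sets by metis
qed

section \<open>The Laplace transform in time of the heat kernel\<close>

lemma DERIV_cdf_std_normal:
  "(cdf std_normal_distribution has_real_derivative std_normal_density u) (at u)"
proof -
  interpret real_distribution std_normal_distribution by (rule real_dist_normal_dist)
  let ?d = "\<lambda>y. std_normal_density y"
  have meas: "measure std_normal_distribution A = (LBINT y:A. ?d y)" if A: "A \<in> sets borel" for A
  proof -
    have "measure std_normal_distribution A = (\<integral>y. indicator A y \<partial>std_normal_distribution)"
      using A by simp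
    also have "\<dots> = (\<integral>y. ?d y *\<^sub>R indicator A y \<partial>lborel)"
      using A by (subst integral_density) auto
    finally show ?thesis unfolding set_lebesgue_integral_def by (simp add: mult.commute)
  qed
  have eq: "cdf std_normal_distribution (u - 1) + (LBINT y=ereal (u - 1)..ereal v. ?d y) = cdf std_normal_distribution v"
    if "v \<in> {u - 1..u + 1}" for v
  proof (cases "v = u - 1")
    case False
    then have "u - 1 < v" using that by auto
    then show ?thesis
      using cdf_diff_eq[OF \<open>u - 1 < v\<close>] meas[of "{u - 1<..v}"] by (simp add: interval_integral_Ioc)
  qed simp
  have c: "continuous_on {u - 1..u + 1} (\<lambda>y. ?d y)"
    unfolding normal_density_def by (intro continuous_intros) auto
  have "((\<lambda>v. LBINT y=ereal (u - 1)..ereal v. ?d y) has_vector_derivative ?d u) (at u within {u - 1..u + 1})"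
    by (rule interval_integral_FTC2[OF _ _ c]) auto
  then have "((\<lambda>v. LBINT y=ereal (u - 1)..ereal v. ?d y) has_real_derivative ?d u) (at u within {u - 1..u + 1})"
    by (simp add: has_real_derivative_iff_has_vector_derivative)
  then have "((\<lambda>v. LBINT y=ereal (u - 1)..ereal v. ?d y) has_real_derivative ?d u) (at u)"
    by (simp add: at_within_Icc_at)
  then have "((\<lambda>v. cdf std_normal_distribution (u - 1) + (LBINT y=ereal (u - 1)..ereal v. ?d y)) has_real_derivative ?d u) (at u)"
    by (auto intro!: derivative_eq_intros)
  then show ?thesis
    by (rule has_field_derivative_transform_within_open[where S="{u - 1<..<u + 1}"]) (auto simp: eq)
qed

text \<open>This is the Green function of Brownian motion killed at rate
  \<open>y\<^sup>2 / 2\<close>. The integrand has an explicit antiderivative in terms of the normal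
  distribution function.\<close>

lemma nn_integral_heat_kernel_laplace:
  fixes x y :: real
  assumes "x \<noteq> 0" "y > 0"
  shows "(\<integral>\<^sup>+k\<in>{0<..}. ennreal (1 / sqrt (2 * pi * k) * exp (- (x\<^sup>2 / (2 * k) + y\<^sup>2 * k / 2))) \<partial>lborel)
    = ennreal (exp (- \<bar>x\<bar> * y) / y)"
proof -
  interpret real_distribution std_normal_distribution by (rule real_dist_normal_dist)
  define a where "a = \<bar>x\<bar>"
  have a: "a > 0" "x\<^sup>2 = a\<^sup>2" using assms by (auto simp: a_def)
  let ?P = "cdf std_normal_distribution"
  define f where "f k = 1 / sqrt (2 * pi * k) * exp (- (a\<^sup>2 / (2 * k) + y\<^sup>2 * k / 2))" for k
  \<comment> \<open>The factors \<open>exp (- a * y)\<close> and \<open>exp (a * y)\<close> complete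
    the squares, so both normal densities yield the same Gaussian; in the sum of the two chain-rule
    terms the parts containing \<open>a\<close> cancel.\<close>
  define F where "F k = (exp (- a * y) * ?P (y * sqrt k - a / sqrt k) + exp (a * y) * ?P (y * sqrt k + a / sqrt k)) / y" for k
  have F: "(F has_real_derivative f k) (at k)" if k: "0 < k" for k
  proof -
    have [simp]: "sqrt k * sqrt k = k" "sqrt k > 0" using k by auto
    have e1: "exp (- a * y) * std_normal_density (y * sqrt k - a / sqrt k) = exp (- (a\<^sup>2 / (2 * k) + y\<^sup>2 * k / 2)) / sqrt (2 * pi)"
      and e2: "exp (a * y) * std_normal_density (y * sqrt k + a / sqrt k) = exp (- (a\<^sup>2 / (2 * k) + y\<^sup>2 * k / 2)) / sqrt (2 * pi)"
    proof -
      have sq: "(y * sqrt k - a / sqrt k)\<^sup>2 = y\<^sup>2 * k - 2 * (a * y) + a\<^sup>2 / k"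
        "(y * sqrt k + a / sqrt k)\<^sup>2 = y\<^sup>2 * k + 2 * (a * y) + a\<^sup>2 / k"
        using k by (simp_all add: power2_diff power2_sum power_mult_distrib power_divide)
      have "- a * y + - (y * sqrt k - a / sqrt k)\<^sup>2 / 2 = - (a\<^sup>2 / (2 * k) + y\<^sup>2 * k / 2)"
        "a * y + - (y * sqrt k + a / sqrt k)\<^sup>2 / 2 = - (a\<^sup>2 / (2 * k) + y\<^sup>2 * k / 2)"
        unfolding sq by (simp_all add: add_divide_distrib diff_divide_distrib)
      then show "exp (- a * y) * std_normal_density (y * sqrt k - a / sqrt k) = exp (- (a\<^sup>2 / (2 * k) + y\<^sup>2 * k / 2)) / sqrt (2 * pi)"
        "exp (a * y) * std_normal_density (y * sqrt k + a / sqrt k) = exp (- (a\<^sup>2 / (2 * k) + y\<^sup>2 * k / 2)) / sqrt (2 * pi)"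
        unfolding std_normal_density_def by (simp_all only: times_divide_eq_right mult_1_right times_divide_eq_left mult_1_left exp_add[symmetric])
    qed
    have g1: "((\<lambda>k. y * sqrt k - a / sqrt k) has_real_derivative (y / (2 * sqrt k) + a / (2 * k * sqrt k))) (at k)"
      and g2: "((\<lambda>k. y * sqrt k + a / sqrt k) has_real_derivative (y / (2 * sqrt k) - a / (2 * k * sqrt k))) (at k)"
      using k by (auto intro!: derivative_eq_intros simp: field_simps)
    have "(F has_real_derivative
       (exp (- a * y) * (std_normal_density (y * sqrt k - a / sqrt k) * (y / (2 * sqrt k) + a / (2 * k * sqrt k)))
       + exp (a * y) * (std_normal_density (y * sqrt k + a / sqrt k) * (y / (2 * sqrt k) - a / (2 * k * sqrt k)))) / y) (at k)"
      unfolding F_def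
      by (intro DERIV_cdivide DERIV_add DERIV_cmult DERIV_chain2[OF DERIV_cdf_std_normal] g1 g2)
    also have "(exp (- a * y) * (std_normal_density (y * sqrt k - a / sqrt k) * (y / (2 * sqrt k) + a / (2 * k * sqrt k)))
       + exp (a * y) * (std_normal_density (y * sqrt k + a / sqrt k) * (y / (2 * sqrt k) - a / (2 * k * sqrt k)))) / y
       = (exp (- (a\<^sup>2 / (2 * k) + y\<^sup>2 * k / 2)) / sqrt (2 * pi) * (y / (2 * sqrt k) + a / (2 * k * sqrt k))
       + exp (- (a\<^sup>2 / (2 * k) + y\<^sup>2 * k / 2)) / sqrt (2 * pi) * (y / (2 * sqrt k) - a / (2 * k * sqrt k))) / y"
      by (simp only: mult.assoc[symmetric] e1 e2)
    also have "\<dots> = exp (- (a\<^sup>2 / (2 * k) + y\<^sup>2 * k / 2)) / sqrt (2 * pi) * (y / sqrt k) / y"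
      by (simp only: distrib_left[symmetric]) simp
    also have "\<dots> = f k"
      using assms by (simp add: f_def real_sqrt_mult)
    finally show ?thesis .
  qed
  \<comment> \<open>Because \<open>a > 0\<close>, the two arguments part at 0, one tending to minus
    and the other to plus infinity. In the difference of the limits of \<open>F\<close> only
    \<open>exp (- a * y) / y\<close> survives.\<close>
  have at0: "filterlim (\<lambda>k. y * sqrt k - a / sqrt k) at_bot (at_right 0)"
    "filterlim (\<lambda>k. y * sqrt k + a / sqrt k) at_top (at_right 0)"
    "filterlim (\<lambda>k. y * sqrt k - a / sqrt k) at_top at_top"
    "filterlim (\<lambda>k. y * sqrt k + a / sqrt k) at_top at_top"
    using a assms by real_asymp+
  have F0: "(F \<longlongrightarrow> (exp (- a * y) * 0 + exp (a * y) * 1) / y) (at_right 0)"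
    unfolding F_def
    by (intro tendsto_intros filterlim_compose[OF cdf_lim_at_bot at0(1)] filterlim_compose[OF cdf_lim_at_top_prob at0(2)])
       (use assms in auto)
  have F1: "(F \<longlongrightarrow> (exp (- a * y) * 1 + exp (a * y) * 1) / y) at_top"
    unfolding F_def
    by (intro tendsto_intros filterlim_compose[OF cdf_lim_at_top_prob at0(3)] filterlim_compose[OF cdf_lim_at_top_prob at0(4)])
       (use assms in auto)
  have fc: "isCont f k" if "0 < k" for k
    unfolding f_def using that by (intro continuous_intros) auto
  have f0: "f k \<ge> 0" if "k > 0" for k using that unfolding f_def by simp
  have FTC: "set_integrable lborel (einterval 0 \<infinity>) f"
    "(LBINT k=0..\<infinity>. f k) = (exp (- a * y) * 1 + exp (a * y) * 1) / y - (exp (- a * y) * 0 + exp (a * y) * 1) / y"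
    using F0 F1
    by (intro interval_integral_FTC_nonneg[where F=F]; auto intro!: F fc f0
      simp: zero_ereal_def ereal_tendsto_simps)+
  have eint: "einterval 0 \<infinity> = {0<..}" by (auto simp: einterval_def)
  have "(\<integral>\<^sup>+k\<in>{0<..}. ennreal (f k) \<partial>lborel) = (\<integral>\<^sup>+k. ennreal (indicator {0<..} k * f k) \<partial>lborel)"
    by (intro nn_integral_cong) (auto simp: indicator_def)
  also have "\<dots> = ennreal (\<integral>k. indicator {0<..} k * f k \<partial>lborel)"
    using FTC(1) f0 unfolding eint set_integrable_def
    by (intro nn_integral_eq_integral) (auto simp: indicator_def)
  also have "(\<integral>k. indicator {0<..} k * f k \<partial>lborel) = (LBINT k=0..\<infinity>. f k)"
    by (simp add: interval_lebesgue_integral_def eint set_lebesgue_integral_def)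
  also have "\<dots> = exp (- a * y) / y" unfolding FTC(2) by (simp add: diff_divide_distrib[symmetric])
  finally show ?thesis by (simp add: f_def a_def)
qed

section \<open>Laplace transforms at complex arguments\<close>

text \<open>Differentiation under the integral: on a half-plane \<open>e < Re v\<close> the
  difference quotients are dominated by the constant \<open>1 / e\<close>, because
  \<open>X * exp (- e * X) \<le> 1 / e\<close> for nonnegative \<open>X\<close>.\<close>

lemma laplace_transform_holomorphic:
  fixes X :: "'a \<Rightarrow> real"
  assumes "prob_space M" and X[measurable]: "X \<in> borel_measurable M" and X0: "\<And>\<omega>. \<omega> \<in> space M \<Longrightarrow> 0 \<le> X \<omega>"
  shows "(\<lambda>u. \<integral>\<omega>. exp (- u * complex_of_real (X \<omega>)) \<partial>M) holomorphic_on {u. 0 < Re u}"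
proof -
  interpret prob_space M by fact
  let ?F = "\<lambda>u. \<integral>\<omega>. exp (- u * complex_of_real (X \<omega>)) \<partial>M"
  have int: "integrable M (\<lambda>\<omega>. exp (- u * complex_of_real (X \<omega>)))" if "0 \<le> Re u" for u
    using that X0 by (intro integrable_const_bound[where B=1] AE_I2) (auto simp: mult_nonneg_nonneg)
  have "(?F has_field_derivative (\<integral>\<omega>. - complex_of_real (X \<omega>) * exp (- u * complex_of_real (X \<omega>)) \<partial>M)) (at u)"
    if u: "0 < Re u" for u
  proof -
    define e where "e = Re u / 2"
    define S where "S = {v. e < Re v}"
    have e: "e > 0" "u \<in> S" using u by (auto simp: e_def S_def)
    have S: "open S" "convex S" unfolding S_def by (auto simp: open_halfspace_Re_gt convex_halfspace_Re_gt)
    have bd: "norm ((exp (- v * complex_of_real (X \<omega>)) - exp (- u * complex_of_real (X \<omega>))) / (v - u)) \<le> 1 / e"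
      if v: "v \<in> S" "v \<noteq> u" and w: "\<omega> \<in> space M" for v \<omega>
    proof -
      have "norm (exp (- v * complex_of_real (X \<omega>)) - exp (- u * complex_of_real (X \<omega>))) \<le> 1 / e * norm (v - u)"
      proof (rule field_differentiable_bound[OF S(2) _ _ v(1) e(2)])
        fix z assume z: "z \<in> S"
        show "((\<lambda>v. exp (- v * complex_of_real (X \<omega>))) has_field_derivative
          - complex_of_real (X \<omega>) * exp (- z * complex_of_real (X \<omega>))) (at z within S)"
          by (auto intro!: derivative_eq_intros)
        have "e * X \<omega> \<le> exp (e * X \<omega>)" using exp_ge_add_one_self[of "e * X \<omega>"] by linarith
        also have "\<dots> \<le> exp (Re z * X \<omega>)" using z X0[OF w] by (auto simp: S_def intro!: mult_right_mono)
        finally have "X \<omega> * exp (- Re z * X \<omega>) \<le> 1 / e"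
          using e by (simp add: exp_minus field_simps)
        then show "norm (- complex_of_real (X \<omega>) * exp (- z * complex_of_real (X \<omega>))) \<le> 1 / e"
          using X0[OF w] by (simp add: norm_mult)
      qed
      then show ?thesis using v by (simp add: norm_divide field_simps)
    qed
    have "((\<lambda>v. (?F v - ?F u) / (v - u)) \<longlongrightarrow> (\<integral>\<omega>. - complex_of_real (X \<omega>) * exp (- u * complex_of_real (X \<omega>)) \<partial>M)) (at u within S)"
      unfolding tendsto_at_iff_sequentially comp_def
    proof (intro allI impI)
      fix v :: "nat \<Rightarrow> complex" assume v: "\<forall>i. v i \<in> S - {u}" "v \<longlonglongrightarrow> u"
      have vS: "v i \<in> S" "v i \<noteq> u" "0 \<le> Re (v i)" for i using v(1) e by (auto simp: S_def less_imp_le dest!: spec[of _ i])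
      have qeq: "(?F (v i) - ?F u) / (v i - u) = (\<integral>\<omega>. (exp (- v i * complex_of_real (X \<omega>)) - exp (- u * complex_of_real (X \<omega>))) / (v i - u) \<partial>M)" for i
        using int[of "v i"] int[of u] vS u by (simp add: Bochner_Integration.integral_diff)
      moreover have "(\<lambda>i. \<integral>\<omega>. (exp (- v i * complex_of_real (X \<omega>)) - exp (- u * complex_of_real (X \<omega>))) / (v i - u) \<partial>M)
        \<longlonglongrightarrow> (\<integral>\<omega>. - complex_of_real (X \<omega>) * exp (- u * complex_of_real (X \<omega>)) \<partial>M)"
      proof (rule integral_dominated_convergence[where w="\<lambda>_. 1 / e"])
        show "AE \<omega> in M. (\<lambda>i. (exp (- v i * complex_of_real (X \<omega>)) - exp (- u * complex_of_real (X \<omega>))) / (v i - u))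
            \<longlonglongrightarrow> - complex_of_real (X \<omega>) * exp (- u * complex_of_real (X \<omega>))"
        proof (rule AE_I2)
          fix \<omega>
          have "((\<lambda>v. exp (- v * complex_of_real (X \<omega>))) has_field_derivative
             - complex_of_real (X \<omega>) * exp (- u * complex_of_real (X \<omega>))) (at u)"
            by (auto intro!: derivative_eq_intros)
          then show "(\<lambda>i. (exp (- v i * complex_of_real (X \<omega>)) - exp (- u * complex_of_real (X \<omega>))) / (v i - u))
            \<longlonglongrightarrow> - complex_of_real (X \<omega>) * exp (- u * complex_of_real (X \<omega>))"
            using v vS unfolding has_field_derivative_iff tendsto_at_iff_sequentially comp_def by auto
        qed
        show "AE \<omega> in M. norm ((exp (- v i * complex_of_real (X \<omega>)) - exp (- u * complex_of_real (X \<omega>))) / (v i - u)) \<le> 1 / e" for i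
          using bd vS by (intro AE_I2) auto
      qed auto
      ultimately show "(\<lambda>i. (?F (v i) - ?F u) / (v i - u)) \<longlonglongrightarrow> (\<integral>\<omega>. - complex_of_real (X \<omega>) * exp (- u * complex_of_real (X \<omega>)) \<partial>M)"
        by (simp only: qeq)
    qed
    then have "((\<lambda>v. (?F v - ?F u) / (v - u)) \<longlongrightarrow> (\<integral>\<omega>. - complex_of_real (X \<omega>) * exp (- u * complex_of_real (X \<omega>)) \<partial>M)) (at u)"
      using at_within_open[OF e(2) S(1)] by simp
    then show ?thesis unfolding has_field_derivative_iff .
  qed
  then show ?thesis
    by (intro holomorphic_onI) (auto intro: has_field_derivative_at_within simp: field_differentiable_def)
qed

text \<open>The identity theorem carries the real formula to the open right half-plane and dominated
  convergence carries it to the imaginary axis, where it becomes the characteristic function of the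
  gamma process. The base \<open>1 + \<nu> * u\<close> has positive real part throughout, so the
  principal power never meets its branch cut.\<close>

lemma laplace_transform_gamma_complex:
  fixes X :: "'a \<Rightarrow> real"
  assumes "prob_space M" and X[measurable]: "X \<in> borel_measurable M" and X0: "\<And>\<omega>. \<omega> \<in> space M \<Longrightarrow> 0 \<le> X \<omega>"
    and \<nu>: "\<nu> > 0" and lap: "\<And>u. 0 \<le> u \<Longrightarrow> (\<integral>\<omega>. exp (- u * X \<omega>) \<partial>M) = exp (- t * (ln (1 + \<nu> * u) / \<nu>))"
    and u: "0 \<le> Re u"
  shows "(\<integral>\<omega>. exp (- u * complex_of_real (X \<omega>)) \<partial>M) = (1 + complex_of_real \<nu> * u) powr (- complex_of_real (t / \<nu>))"
proof -
  interpret prob_space M by fact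
  let ?F = "\<lambda>u. \<integral>\<omega>. exp (- u * complex_of_real (X \<omega>)) \<partial>M"
  let ?G = "\<lambda>u. (1 + complex_of_real \<nu> * u) powr (- complex_of_real (t / \<nu>))"
  let ?S = "{u::complex. 0 < Re u}"
  have nonpos: "1 + complex_of_real \<nu> * u \<notin> \<real>\<^sub>\<le>\<^sub>0" if "0 \<le> Re u" for u
  proof -
    have "Re (1 + complex_of_real \<nu> * u) > 0" using that \<nu> by (simp add: add_pos_nonneg)
    then show ?thesis by (auto simp: complex_nonpos_Reals_iff)
  qed
  have pos: "?F u = ?G u" if u: "u \<in> ?S" for u
  proof -
    have "?F u - ?G u = 0"
    proof (rule analytic_continuation[where S="?S" and f="\<lambda>u. ?F u - ?G u" and U="complex_of_real ` {0<..}" and \<xi>=1])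
      show "(\<lambda>u. ?F u - ?G u) holomorphic_on ?S"
        by (intro holomorphic_intros laplace_transform_holomorphic[OF assms(1-3)]) (use nonpos in auto)
      show "open ?S" by (rule open_halfspace_Re_gt)
      show "connected ?S" by (intro convex_connected convex_halfspace_Re_gt)
      show "(1::complex) islimpt complex_of_real ` {0<..}"
        unfolding islimpt_sequential
      proof (intro exI[of _ "\<lambda>n. complex_of_real (1 + 1 / real (Suc n))"] conjI allI)
        have "(\<lambda>n. complex_of_real (1 + 1 / real (Suc n))) \<longlonglongrightarrow> complex_of_real (1 + 0)"
          by (intro tendsto_of_real tendsto_add tendsto_const LIMSEQ_inverse_real_of_nat[unfolded inverse_eq_divide])
        then show "(\<lambda>n. complex_of_real (1 + 1 / real (Suc n))) \<longlonglongrightarrow> 1" by simp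
        fix n
        have "1 + 1 / real (Suc n) > 1" by simp
        then have "1 + 1 / real (Suc n) \<in> {0<..}" by (simp only: greaterThan_iff)
        moreover have "complex_of_real (1 + 1 / real (Suc n)) \<noteq> 1"
          unfolding of_real_eq_1_iff by (auto simp del: of_nat_Suc)
        ultimately show "complex_of_real (1 + 1 / real (Suc n)) \<in> complex_of_real ` {0<..} - {1}"
          by blast
      qed
      fix z assume "z \<in> complex_of_real ` {0<..}"
      then obtain r where r: "z = complex_of_real r" "r > 0" by auto
      have "?F z = (\<integral>\<omega>. complex_of_real (exp (- r * X \<omega>)) \<partial>M)"
        unfolding r by (simp only: exp_of_real[symmetric] of_real_mult of_real_minus)
      also have "\<dots> = complex_of_real (exp (- t * (ln (1 + \<nu> * r) / \<nu>)))"
        using lap[of r] r by (simp only: integral_complex_of_real)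
      also have "\<dots> = complex_of_real ((1 + \<nu> * r) powr (- (t / \<nu>)))"
        using r \<nu> by (simp add: powr_def add_pos_pos field_simps) (simp add: add_nonneg_eq_0_iff)
      also have "\<dots> = ?G z" unfolding r
        using r \<nu> by (subst powr_of_real[symmetric]) (auto simp: add_nonneg_nonneg)
      finally show "?F z - ?G z = 0" by simp
    qed (use u in auto)
    then show ?thesis by simp
  qed
  show ?thesis
  proof (cases "0 < Re u")
    case True then show ?thesis using pos by simp
  next
    case False
    let ?v = "\<lambda>n. u + complex_of_real (1 / real (Suc n))"
    have "?v \<longlonglongrightarrow> u + complex_of_real 0"
      by (intro tendsto_add tendsto_const tendsto_of_real LIMSEQ_inverse_real_of_nat[unfolded inverse_eq_divide])
    then have v: "?v \<longlonglongrightarrow> u" by simp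
    have Fv: "(\<lambda>n. ?F (v n)) \<longlonglongrightarrow> ?F u" if vu: "v \<longlonglongrightarrow> u" and Rv: "\<And>n. 0 \<le> Re (v n)" for v
    proof (rule integral_dominated_convergence[where w="\<lambda>_. 1"])
      show "AE \<omega> in M. (\<lambda>n. exp (- v n * complex_of_real (X \<omega>))) \<longlonglongrightarrow> exp (- u * complex_of_real (X \<omega>))"
        by (intro AE_I2 tendsto_intros vu)
      show "AE \<omega> in M. norm (exp (- v n * complex_of_real (X \<omega>))) \<le> 1" for n
        using Rv[of n] X0 by (intro AE_I2) (simp add: mult_nonneg_nonneg)
    qed auto
    have "(\<lambda>n. ?F (?v n)) \<longlonglongrightarrow> ?F u"
      by (rule Fv[OF v]) (use u in \<open>simp add: add_nonneg_nonneg\<close>)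
    moreover have "?F (?v n) = ?G (?v n)" for n
      using u by (intro pos) (auto simp: add_nonneg_pos)
    moreover have "(\<lambda>n. ?G (?v n)) \<longlonglongrightarrow> ?G u"
      by (intro tendsto_powr_complex tendsto_intros v nonpos u)
    ultimately show ?thesis using LIMSEQ_unique by auto
  qed
qed

section \<open>Fourier inversion for measures with integrable characteristic function\<close>

text \<open>The Gaussian is its own Fourier transform up to scaling, so inversion can be read off
  from its known characteristic function.\<close>

lemma normal_density_fourier:
  assumes \<sigma>: "\<sigma> > 0"
  shows "complex_of_real (normal_density 0 \<sigma> u) =
    (CLBINT z. iexp (- (z * u)) * exp (- (\<sigma> * z)\<^sup>2 / 2)) / (2 * pi)"
    and "integrable lborel (\<lambda>z. exp (- (\<sigma> * z)\<^sup>2 / 2))"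
proof -
  have "complex_of_real (exp (- (- u / \<sigma>)\<^sup>2 / 2)) = (CLINT x|std_normal_distribution. iexp ((- u / \<sigma>) * x))"
    using char_std_normal_distribution unfolding char_def by (metis (no_types))
  also have "\<dots> = (CLBINT x. std_normal_density x *\<^sub>R iexp ((- u / \<sigma>) * x))"
    by (subst integral_density) auto
  also have "\<dots> = \<sigma> *\<^sub>R (CLBINT z. std_normal_density (0 + \<sigma> * z) *\<^sub>R iexp ((- u / \<sigma>) * (0 + \<sigma> * z)))"
    using \<sigma> by (subst lborel_integral_real_affine[where c=\<sigma> and t=0]) auto
  also have "(\<lambda>z. std_normal_density (0 + \<sigma> * z) *\<^sub>R iexp ((- u / \<sigma>) * (0 + \<sigma> * z))) =
      (\<lambda>z. (iexp (- (z * u)) * exp (- (\<sigma> * z)\<^sup>2 / 2)) * complex_of_real (1 / sqrt (2 * pi)))"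
    using \<sigma> by (auto simp: std_normal_density_def scaleR_conv_of_real exp_of_real field_simps)
  finally have "complex_of_real (exp (- (- u / \<sigma>)\<^sup>2 / 2)) =
     \<sigma> * (CLBINT z. (iexp (- (z * u)) * exp (- (\<sigma> * z)\<^sup>2 / 2))) / sqrt (2 * pi)"
    by (simp add: scaleR_conv_of_real)
  then have *: "(CLBINT z. (iexp (- (z * u)) * exp (- (\<sigma> * z)\<^sup>2 / 2))) =
    complex_of_real (exp (- (- u / \<sigma>)\<^sup>2 / 2) * sqrt (2 * pi) / \<sigma>)"
    using \<sigma> by (simp add: field_simps)
  have "normal_density 0 \<sigma> u = exp (- (- u / \<sigma>)\<^sup>2 / 2) * sqrt (2 * pi) / \<sigma> / (2 * pi)"
  proof -
    have "sqrt (2 * pi * \<sigma>\<^sup>2) = sqrt (2 * pi) * \<sigma>" using \<sigma> by (simp add: real_sqrt_mult)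
    moreover have "sqrt (2 * pi) * sqrt (2 * pi) = 2 * pi" by simp
    ultimately show ?thesis using \<sigma>
      unfolding normal_density_def by (simp add: power_divide divide_simps mult.assoc mult.commute[of 2])
  qed
  then show "complex_of_real (normal_density 0 \<sigma> u) =
    (CLBINT z. iexp (- (z * u)) * exp (- (\<sigma> * z)\<^sup>2 / 2)) / (2 * pi)"
    unfolding * by simp
  have "integrable lborel (\<lambda>z. std_normal_density (0 + \<sigma> * z))"
    using \<sigma> by (intro lborel_integrable_real_affine integrable_normal_density) auto
  then have "integrable lborel (\<lambda>z. sqrt (2 * pi) * std_normal_density (0 + \<sigma> * z))" by simp
  also have "(\<lambda>z. sqrt (2 * pi) * std_normal_density (0 + \<sigma> * z)) = (\<lambda>z. exp (- (\<sigma> * z)\<^sup>2 / 2))"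
    by (auto simp: std_normal_density_def)
  finally show "integrable lborel (\<lambda>z. exp (- (\<sigma> * z)\<^sup>2 / 2))" .
qed

text \<open>The substitution \<open>t = x + s * y\<close> moves the shrinking standard deviation
  into the argument of \<open>f\<close>, where continuity and dominated convergence apply.\<close>

lemma normal_density_approx_identity:
  fixes f :: "real \<Rightarrow> real"
  assumes f: "continuous_on UNIV f" and f01: "\<And>x. 0 \<le> f x \<and> f x \<le> 1"
  shows "(\<lambda>n. \<integral>\<^sup>+t. ennreal (f t * normal_density 0 (1 / real (Suc n)) (t - x)) \<partial>lborel) \<longlonglongrightarrow> ennreal (f x)"
proof -
  have [measurable]: "f \<in> borel_measurable borel" by (rule borel_measurable_continuous_onI[OF f])
  have norm: "(\<integral>\<^sup>+y. ennreal (std_normal_density y) \<partial>lborel) = 1"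
    using prob_space.emeasure_space_1[OF prob_space_normal_density[of 1 0]]
    by (simp add: emeasure_density)
  have eq: "(\<integral>\<^sup>+t. ennreal (f t * normal_density 0 (1 / real (Suc n)) (t - x)) \<partial>lborel) =
     (\<integral>\<^sup>+y. ennreal (f (x + (1 / real (Suc n)) * y) * std_normal_density y) \<partial>lborel)" for n
  proof -
    define s where "s = 1 / real (Suc n)"
    have s: "s > 0" by (simp add: s_def)
    have "(\<integral>\<^sup>+t. ennreal (f t * normal_density 0 s (t - x)) \<partial>lborel) =
      ennreal \<bar>s\<bar> * (\<integral>\<^sup>+y. ennreal (f (x + s * y) * normal_density 0 s ((x + s * y) - x)) \<partial>lborel)"
      using s by (intro nn_integral_real_affine) auto
    also have "\<dots> = (\<integral>\<^sup>+y. ennreal s * ennreal (f (x + s * y) * normal_density 0 s ((x + s * y) - x)) \<partial>lborel)"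
      using s by (simp add: nn_integral_cmult)
    also have "\<dots> = (\<integral>\<^sup>+y. ennreal (f (x + s * y) * std_normal_density y) \<partial>lborel)"
    proof (intro nn_integral_cong)
      fix y
      have "s * normal_density 0 s ((x + s * y) - x) = std_normal_density y"
        using s by (simp add: normal_density_def real_sqrt_mult power_mult_distrib)
      then show "ennreal s * ennreal (f (x + s * y) * normal_density 0 s ((x + s * y) - x)) = ennreal (f (x + s * y) * std_normal_density y)"
        using s by (simp only: ennreal_mult'[symmetric] less_imp_le mult.left_commute[of s])
    qed
    finally show ?thesis unfolding s_def .
  qed
  have "(\<lambda>n. \<integral>\<^sup>+y. ennreal (f (x + (1 / real (Suc n)) * y) * std_normal_density y) \<partial>lborel)
     \<longlonglongrightarrow> (\<integral>\<^sup>+y. ennreal (f x * std_normal_density y) \<partial>lborel)"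
  proof (rule nn_integral_dominated_convergence[where w="\<lambda>y. ennreal (std_normal_density y)"])
    show "AE y in lborel. (\<lambda>n. ennreal (f (x + (1 / real (Suc n)) * y) * std_normal_density y)) \<longlonglongrightarrow> ennreal (f x * std_normal_density y)"
    proof (rule AE_I2)
      fix y :: real
      have "(\<lambda>n. x + (1 / real (Suc n)) * y) \<longlonglongrightarrow> x + 0 * y"
        by (intro tendsto_intros LIMSEQ_inverse_real_of_nat[unfolded inverse_eq_divide])
      then have "(\<lambda>n. f (x + (1 / real (Suc n)) * y)) \<longlonglongrightarrow> f x"
        using continuous_on_tendsto_compose[OF f, of "\<lambda>n. x + (1 / real (Suc n)) * y" x sequentially] by simp
      then show "(\<lambda>n. ennreal (f (x + (1 / real (Suc n)) * y) * std_normal_density y)) \<longlonglongrightarrow> ennreal (f x * std_normal_density y)"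
        by (intro tendsto_ennrealI tendsto_intros)
    qed
    show "AE y in lborel. ennreal (f (x + (1 / real (Suc n)) * y) * std_normal_density y) \<le> ennreal (std_normal_density y)" for n
      using f01 by (intro AE_I2 ennreal_leI mult_left_le_one_le) auto
  qed (auto simp: norm)
  moreover have "(\<integral>\<^sup>+y. ennreal (f x * std_normal_density y) \<partial>lborel) = ennreal (f x)"
    using f01 by (simp add: ennreal_mult' nn_integral_cmult norm)
  ultimately show ?thesis unfolding eq by simp
qed

text \<open>Inversion for a finite measure convolved with a Gaussian: the Gaussian factor alone
  makes the double integral absolutely convergent, so Fubini applies whatever \<open>char m\<close>
  is.\<close>

lemma gauss_smoothing_density:
  fixes m :: "real measure"
  assumes fin: "finite_measure m" and sets: "sets m = sets borel" and \<sigma>: "\<sigma> > 0"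
  shows "complex_of_real (\<integral>x. normal_density 0 \<sigma> (t - x) \<partial>m) =
    (CLBINT z. iexp (- (z * t)) * exp (- (\<sigma> * z)\<^sup>2 / 2) * char m z) / (2 * pi)"
proof -
  interpret finite_measure m by fact
  interpret pair_sigma_finite m lborel ..
  note [measurable_cong] = sets
  let ?h = "\<lambda>x z. iexp (- (z * (t - x))) * exp (- (\<sigma> * z)\<^sup>2 / 2) :: complex"
  have "complex_of_real (\<integral>x. normal_density 0 \<sigma> (t - x) \<partial>m) = (\<integral>x. complex_of_real (normal_density 0 \<sigma> (t - x)) \<partial>m)"
    by simp
  also have "\<dots> = (\<integral>x. (CLBINT z. ?h x z) / (2 * pi) \<partial>m)"
    using normal_density_fourier(1)[OF \<sigma>] by simp
  also have "\<dots> = (\<integral>x. (CLBINT z. ?h x z) \<partial>m) / (2 * pi)" by simp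
  also have "(\<integral>x. (CLBINT z. ?h x z) \<partial>m) = (CLBINT z. (\<integral>x. ?h x z \<partial>m))"
  proof (rule Fubini_integral[symmetric])
    have "integrable (m \<Otimes>\<^sub>M lborel) (\<lambda>p. exp (- (\<sigma> * snd p)\<^sup>2 / 2))"
    proof (rule Fubini_integrable)
      show "(\<lambda>p. exp (- (\<sigma> * snd p)\<^sup>2 / 2)) \<in> borel_measurable (m \<Otimes>\<^sub>M lborel)" by measurable
    qed (use normal_density_fourier(2)[OF \<sigma>] in auto)
    then show "integrable (m \<Otimes>\<^sub>M lborel) (\<lambda>(x, z). ?h x z)"
      by (rule Bochner_Integration.integrable_bound) (auto simp: case_prod_unfold norm_mult intro!: AE_I2)
  qed
  also have "\<dots> = (CLBINT z. iexp (- (z * t)) * exp (- (\<sigma> * z)\<^sup>2 / 2) * char m z)"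
  proof (intro Bochner_Integration.integral_cong refl)
    fix z
    have "(\<integral>x. ?h x z \<partial>m) = (\<integral>x. (iexp (- (z * t)) * exp (- (\<sigma> * z)\<^sup>2 / 2)) * iexp (z * x) \<partial>m)"
      by (intro Bochner_Integration.integral_cong refl)
         (simp add: exp_add[symmetric] algebra_simps)
    also have "\<dots> = iexp (- (z * t)) * exp (- (\<sigma> * z)\<^sup>2 / 2) * char m z"
      by (simp add: char_def)
    finally show "(\<integral>x. ?h x z \<partial>m) = iexp (- (z * t)) * exp (- (\<sigma> * z)\<^sup>2 / 2) * char m z" .
  qed
  finally show ?thesis .
qed

text \<open>The variance of the smoothing tends to 0. The smoothed densities \<open>ds n\<close> are
  bounded by \<open>C\<close> uniformly, converge pointwise because \<open>char m\<close> is
  integrable, and hand their nonnegativity on to the limit \<open>d\<close>.\<close>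

lemma density_of_integrable_char:
  fixes m :: "real measure"
  assumes fin: "finite_measure m" and sets: "sets m = sets borel" and int: "integrable lborel (char m)"
  obtains d :: "real \<Rightarrow> real" where "d \<in> borel_measurable borel" "\<And>t. 0 \<le> d t"
    "\<And>t. complex_of_real (d t) = (CLBINT z. iexp (- (z * t)) * char m z) / (2 * pi)"
    "m = density lborel (\<lambda>t. ennreal (d t))"
proof -
  interpret finite_measure m by fact
  interpret pair_sigma_finite m lborel ..
  note [measurable_cong] = sets
  have [measurable]: "char m \<in> borel_measurable borel" using int by auto
  define ds where "ds n t = (\<integral>x. normal_density 0 (1 / real (Suc n)) (t - x) \<partial>m)" for n t
  define dc where "dc t = (CLBINT z. iexp (- (z * t)) * char m z) / (2 * pi)" for t
  define C where "C = (LBINT z. norm (char m z)) / (2 * pi)"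
  have dsc: "complex_of_real (ds n t) = (CLBINT z. iexp (- (z * t)) * exp (- (1 / real (Suc n) * z)\<^sup>2 / 2) * char m z) / (2 * pi)" for n t
    unfolding ds_def by (rule gauss_smoothing_density[OF fin sets]) simp
  have lim: "(\<lambda>n. complex_of_real (ds n t)) \<longlonglongrightarrow> dc t" for t
    unfolding dsc dc_def
  proof (intro tendsto_divide tendsto_const integral_dominated_convergence[where w="\<lambda>z. norm (char m z)"])
    show "AE z in lborel. (\<lambda>n. iexp (- (z * t)) * exp (- (1 / real (Suc n) * z)\<^sup>2 / 2) * char m z) \<longlonglongrightarrow> iexp (- (z * t)) * char m z"
    proof (rule AE_I2)
      fix z :: real
      have "(\<lambda>n. exp (- (1 / real (Suc n) * z)\<^sup>2 / 2)) \<longlonglongrightarrow> exp (- (0 * z)\<^sup>2 / 2)"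
        by (intro tendsto_intros LIMSEQ_inverse_real_of_nat[unfolded inverse_eq_divide]) auto
      then have "(\<lambda>n. complex_of_real (exp (- (1 / real (Suc n) * z)\<^sup>2 / 2))) \<longlonglongrightarrow> complex_of_real 1"
        by (intro tendsto_of_real) simp
      then have "(\<lambda>n. iexp (- (z * t)) * complex_of_real (exp (- (1 / real (Suc n) * z)\<^sup>2 / 2)) * char m z) \<longlonglongrightarrow> iexp (- (z * t)) * complex_of_real 1 * char m z"
        by (intro tendsto_mult tendsto_const)
      then show "(\<lambda>n. iexp (- (z * t)) * exp (- (1 / real (Suc n) * z)\<^sup>2 / 2) * char m z) \<longlonglongrightarrow> iexp (- (z * t)) * char m z"
        by simp
    qed
    show "AE z in lborel. norm (iexp (- (z * t)) * exp (- (1 / real (Suc n) * z)\<^sup>2 / 2) * char m z) \<le> norm (char m z)" for n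
      by (intro AE_I2) (auto simp: norm_mult intro!: mult_left_le_one_le)
  qed (use int in auto)
  define d where "d t = Re (dc t)" for t
  have limd: "(\<lambda>n. ds n t) \<longlonglongrightarrow> d t" for t
    unfolding d_def using tendsto_Re[OF lim[of t]] by simp
  have ds0: "0 \<le> ds n t" for n t unfolding ds_def by simp
  have d0: "0 \<le> d t" for t using LIMSEQ_le_const[OF limd] ds0 by blast
  have dcd: "complex_of_real (d t) = dc t" for t
    using LIMSEQ_unique[OF lim tendsto_of_real[OF limd]] by simp
  have dsC: "ds n t \<le> C" for n t
  proof -
    have "ds n t = norm (complex_of_real (ds n t))" using ds0 by simp
    also have "\<dots> \<le> (LBINT z. norm (iexp (- (z * t)) * exp (- (1 / real (Suc n) * z)\<^sup>2 / 2) * char m z)) / (2 * pi)"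
      unfolding dsc by (simp add: norm_divide divide_right_mono)
    also have "\<dots> \<le> C" unfolding C_def
      using int by (intro divide_right_mono integral_mono_AE' AE_I2) (auto simp: norm_mult intro!: mult_left_le_one_le)
    finally show ?thesis .
  qed
  have dm[measurable]: "d \<in> borel_measurable borel" unfolding d_def dc_def by measurable
  have dsm[measurable]: "ds n \<in> borel_measurable borel" for n unfolding ds_def by measurable
  have meas_Ioo: "emeasure m {a<..<b} = (\<integral>\<^sup>+t\<in>{a<..<b}. ennreal (d t) \<partial>lborel)" for a b
  proof -
    \<comment> \<open>Trapezoids vanishing outside a bounded interval: together with the bound
      \<open>C\<close> on the densities they provide the integrable majorant that is missing on the
      whole line.\<close>
    define g where "g k x = min 1 (real k * max 0 (min (x - a) (b - x)))" for k x
    have g: "continuous_on UNIV (g k)" "0 \<le> g k x \<and> g k x \<le> 1" "x \<notin> {a<..<b} \<Longrightarrow> g k x = 0" for k x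
      unfolding g_def by (auto intro!: continuous_intros)
    have [measurable]: "g k \<in> borel_measurable borel" for k
      using g(1) by (rule borel_measurable_continuous_onI)
    have glim: "(\<lambda>k. ennreal (g k x)) \<longlonglongrightarrow> indicator {a<..<b} x" for x
    proof (cases "x \<in> {a<..<b}")
      case False then show ?thesis by (simp add: g(3))
    next
      case True
      then have pos: "min (x - a) (b - x) > 0" by auto
      obtain n0 where n0: "1 / min (x - a) (b - x) \<le> real n0" using real_arch_simple by blast
      have "\<forall>\<^sub>F n in sequentially. ennreal (g n x) = indicator {a<..<b} x"
        using eventually_ge_at_top[of n0]
      proof eventually_elim
        case (elim n)
        then have "1 / min (x - a) (b - x) \<le> real n" using n0 by linarith
        then have "1 \<le> real n * min (x - a) (b - x)" using pos by (simp add: pos_divide_le_eq)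
        then have "g n x = 1" using pos unfolding g_def by simp
        then show ?case using True by simp
      qed
      then show ?thesis by (rule tendsto_eventually)
    qed
    have gm: "(\<integral>\<^sup>+x. ennreal (g k x) \<partial>m) = (\<integral>\<^sup>+t. ennreal (g k t * d t) \<partial>lborel)" for k
    proof -
      have "(\<lambda>n. \<integral>\<^sup>+x. (\<integral>\<^sup>+t. ennreal (g k t * normal_density 0 (1 / real (Suc n)) (t - x)) \<partial>lborel) \<partial>m) \<longlonglongrightarrow> (\<integral>\<^sup>+x. ennreal (g k x) \<partial>m)"
      proof (rule nn_integral_dominated_convergence[where w="\<lambda>_. 1"])
        show "AE x in m. (\<integral>\<^sup>+t. ennreal (g k t * normal_density 0 (1 / real (Suc n)) (t - x)) \<partial>lborel) \<le> 1" for n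
        proof (rule AE_I2)
          fix x
          have "(\<integral>\<^sup>+t. ennreal (g k t * normal_density 0 (1 / real (Suc n)) (t - x)) \<partial>lborel) \<le> (\<integral>\<^sup>+t. ennreal (normal_density x (1 / real (Suc n)) t) \<partial>lborel)"
            using g(2) by (intro nn_integral_mono ennreal_leI) (auto simp: normal_density_def intro!: mult_left_le_one_le divide_right_mono)
          also have "\<dots> = 1"
            using prob_space.emeasure_space_1[OF prob_space_normal_density[of "1 / real (Suc n)" x]]
            by (simp add: emeasure_density)
          finally show "(\<integral>\<^sup>+t. ennreal (g k t * normal_density 0 (1 / real (Suc n)) (t - x)) \<partial>lborel) \<le> 1" .
        qed
        show "AE x in m. (\<lambda>n. \<integral>\<^sup>+t. ennreal (g k t * normal_density 0 (1 / real (Suc n)) (t - x)) \<partial>lborel) \<longlonglongrightarrow> ennreal (g k x)"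
          by (intro AE_I2 normal_density_approx_identity g)
      qed (auto simp: emeasure_finite less_top[symmetric])
      moreover have "(\<integral>\<^sup>+x. (\<integral>\<^sup>+t. ennreal (g k t * normal_density 0 (1 / real (Suc n)) (t - x)) \<partial>lborel) \<partial>m)
         = (\<integral>\<^sup>+t. ennreal (g k t * ds n t) \<partial>lborel)" for n
      proof -
        have "(\<integral>\<^sup>+x. (\<integral>\<^sup>+t. ennreal (g k t * normal_density 0 (1 / real (Suc n)) (t - x)) \<partial>lborel) \<partial>m)
          = (\<integral>\<^sup>+t. (\<integral>\<^sup>+x. ennreal (g k t * normal_density 0 (1 / real (Suc n)) (t - x)) \<partial>m) \<partial>lborel)"
          by (rule Fubini'[symmetric]) measurable
        also have "\<dots> = (\<integral>\<^sup>+t. ennreal (g k t * ds n t) \<partial>lborel)"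
        proof (intro nn_integral_cong)
          fix t
          have bnd: "normal_density 0 (1 / real (Suc n)) y \<le> normal_density 0 (1 / real (Suc n)) 0" for y
            unfolding normal_density_def by (auto intro!: mult_left_mono divide_right_mono)
          have "integrable m (\<lambda>x. g k t * normal_density 0 (1 / real (Suc n)) (t - x))"
            using bnd by (intro integrable_mult_right integrable_const_bound[where B="normal_density 0 (1 / real (Suc n)) 0"] AE_I2) auto
          then show "(\<integral>\<^sup>+x. ennreal (g k t * normal_density 0 (1 / real (Suc n)) (t - x)) \<partial>m) = ennreal (g k t * ds n t)"
            using g(2) by (subst nn_integral_eq_integral) (auto simp: ds_def)
        qed
        finally show ?thesis .
      qed
      moreover have "(\<lambda>n. \<integral>\<^sup>+t. ennreal (g k t * ds n t) \<partial>lborel) \<longlonglongrightarrow> (\<integral>\<^sup>+t. ennreal (g k t * d t) \<partial>lborel)"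
      proof (rule nn_integral_dominated_convergence[where w="\<lambda>t. ennreal C * indicator {a<..<b} t"])
        show "AE t in lborel. ennreal (g k t * ds n t) \<le> ennreal C * indicator {a<..<b} t" for n
        proof (rule AE_I2)
          fix t
          show "ennreal (g k t * ds n t) \<le> ennreal C * indicator {a<..<b} t"
          proof (cases "t \<in> {a<..<b}")
            case True
            have "g k t * ds n t \<le> 1 * C" using g(2)[of k t] ds0 dsC by (intro mult_mono) auto
            then show ?thesis using True by (simp add: ennreal_leI)
          qed (simp add: g(3))
        qed
        show "(\<integral>\<^sup>+t. ennreal C * indicator {a<..<b} t \<partial>lborel) < \<infinity>"
          by (cases "a \<le> b") (auto simp: nn_integral_cmult_indicator ennreal_mult_less_top)
        show "AE t in lborel. (\<lambda>n. ennreal (g k t * ds n t)) \<longlonglongrightarrow> ennreal (g k t * d t)"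
          by (intro AE_I2 tendsto_ennrealI tendsto_intros limd)
      qed auto
      ultimately show ?thesis using LIMSEQ_unique by auto
    qed
    have g_mono: "g k x \<le> g (Suc k) x" for k x
      unfolding g_def by (intro min.mono order_refl mult_right_mono) auto
    have "(\<lambda>k. \<integral>\<^sup>+x. ennreal (g k x) \<partial>m) \<longlonglongrightarrow> (\<integral>\<^sup>+x. indicator {a<..<b} x \<partial>m)"
      using glim g_mono by (intro nn_integral_LIMSEQ) (auto intro!: incseq_SucI le_funI ennreal_leI)
    moreover have "(\<lambda>k. \<integral>\<^sup>+t. ennreal (g k t * d t) \<partial>lborel) \<longlonglongrightarrow> (\<integral>\<^sup>+t. indicator {a<..<b} t * ennreal (d t) \<partial>lborel)"
    proof (rule nn_integral_LIMSEQ)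
      show "incseq (\<lambda>k t. ennreal (g k t * d t))"
        using g_mono d0 by (auto intro!: incseq_SucI le_funI ennreal_leI mult_right_mono)
      fix t
      have "(\<lambda>k. ennreal (g k t) * ennreal (d t)) \<longlonglongrightarrow> indicator {a<..<b} t * ennreal (d t)"
        by (intro tendsto_mult_ennreal glim tendsto_const) (auto simp: indicator_def)
      then show "(\<lambda>k. ennreal (g k t * d t)) \<longlonglongrightarrow> indicator {a<..<b} t * ennreal (d t)"
        using g(2) d0 by (simp add: ennreal_mult)
    qed auto
    ultimately show ?thesis
      unfolding gm using LIMSEQ_unique by (force simp: mult.commute)
  qed
  have "m = density lborel (\<lambda>t. ennreal (d t))"
  proof (rule measure_eqI_generator_eq[where E="range (\<lambda>(a, b). {a<..<b})" and \<Omega>=UNIV and A="\<lambda>n. {- real n<..<real n}"])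
    show "Int_stable (range (\<lambda>(a, b). {a<..<b::real}))"
    proof (rule Int_stableI)
      fix S T :: "real set" assume "S \<in> range (\<lambda>(a, b). {a<..<b})" "T \<in> range (\<lambda>(a, b). {a<..<b})"
      then obtain a b c e where "S = {a<..<b}" "T = {c<..<e}" by auto
      then have "S \<inter> T = (\<lambda>(a, b). {a<..<b}) (max a c, min b e)" by auto
      then show "S \<inter> T \<in> range (\<lambda>(a, b). {a<..<b})" by blast
    qed
    show "sets m = sigma_sets UNIV (range (\<lambda>(a, b). {a<..<b}))"
      "sets (density lborel (\<lambda>t. ennreal (d t))) = sigma_sets UNIV (range (\<lambda>(a, b). {a<..<b}))"
      using sets arg_cong[OF borel_eq_box[where 'a=real], of sets] by (simp_all add: case_prod_unfold image_def box_real)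
    show "(\<Union>n. {- real n<..<real n}) = UNIV"
    proof -
      have "\<exists>n. x \<in> {- real n<..<real n}" for x
        using reals_Archimedean2[of "\<bar>x\<bar>"] by (auto simp: abs_less_iff) (metis minus_less_iff)
      then show ?thesis by auto
    qed
    show "emeasure m {- real i<..<real i} \<noteq> \<infinity>" for i by (simp add: emeasure_finite)
  qed (auto simp: meas_Ioo emeasure_density)
  with that dm d0 dcd show ?thesis unfolding dc_def by blast
qed

section \<open>Hitting times of Brownian motion with drift\<close>

lemma Wtilde_measurable:
  assumes [measurable]: "\<And>t. W t \<in> borel_measurable N"
  shows "Wtilde x0 \<beta> W t \<in> borel_measurable N"
  unfolding Wtilde_def[abs_def] by measurable

lemma Wtilde_continuous_on:
  assumes "continuous_on {0..} (\<lambda>t. W t \<omega>)"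
  shows "continuous_on {0..} (\<lambda>t. Wtilde x0 \<beta> W t \<omega>)"
  unfolding Wtilde_def by (intro continuous_intros assms)

lemma Tstar_nonneg: "0 \<le> Tstar x0 \<beta> W \<omega>"
  unfolding Tstar_def by (rule Inf_greatest) auto

lemma Wtilde_pos_before_Tstar:
  assumes "0 \<le> S" "ereal S < Tstar x0 \<beta> W \<omega>"
  shows "0 < Wtilde x0 \<beta> W S \<omega>"
proof (rule ccontr)
  assume "\<not> ?thesis"
  then have "Tstar x0 \<beta> W \<omega> \<le> ereal S"
    unfolding Tstar_def using assms(1) by (intro Inf_lower) auto
  then show False using assms(2) by simp
qed

text \<open>A path positive on \<open>{0..u}\<close> has a positive minimum there by compactness,
  and by density a lower bound can be tested at dyadic points. The condition is countable, hence
  measurable, and for fixed \<open>m\<close> and \<open>n\<close> it involves only increments before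
  \<open>u\<close>.\<close>

lemma Tstar_gt_iff:
  fixes W :: "real \<Rightarrow> 'a \<Rightarrow> real"
  assumes W: "continuous_on {0..} (\<lambda>t. W t \<omega>)" and u: "0 \<le> u"
  shows "ereal u < Tstar x0 \<beta> W \<omega> \<longleftrightarrow>
    (\<exists>m. \<forall>n. \<forall>i\<le>2 ^ n. 1 / real (Suc m) \<le> Wtilde x0 \<beta> W (u * real i / 2 ^ n) \<omega>)"
proof
  let ?w = "\<lambda>t. Wtilde x0 \<beta> W t \<omega>"
  have w: "continuous_on {0..} ?w" by (rule Wtilde_continuous_on) (rule W)
  assume L: "ereal u < Tstar x0 \<beta> W \<omega>"
  have "continuous_on {0..u} ?w" using w by (rule continuous_on_subset) auto
  then obtain s where s: "s \<in> {0..u}" "\<forall>t\<in>{0..u}. ?w s \<le> ?w t"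
    using continuous_attains_inf[of "{0..u}" ?w] u by auto
  have "0 < ?w s"
    using s(1) L by (intro Wtilde_pos_before_Tstar) (auto intro: le_less_trans[of _ "ereal u"])
  then obtain m where m: "1 / real (Suc m) < ?w s"
    using reals_Archimedean[of "?w s"] by (auto simp: inverse_eq_divide)
  have "1 / real (Suc m) \<le> ?w (u * real i / 2 ^ n)" if "i \<le> 2 ^ n" for i n
  proof -
    have "real i \<le> 2 ^ n" using that by (metis of_nat_le_iff of_nat_numeral of_nat_power)
    then have "u * real i / 2 ^ n \<in> {0..u}"
      using u by (auto simp: divide_le_eq mult_left_mono)
    then show ?thesis using s(2) m by fastforce
  qed
  then show "\<exists>m. \<forall>n. \<forall>i\<le>2 ^ n. 1 / real (Suc m) \<le> ?w (u * real i / 2 ^ n)" by blast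
next
  let ?w = "\<lambda>t. Wtilde x0 \<beta> W t \<omega>"
  have w: "continuous_on {0..} ?w" by (rule Wtilde_continuous_on) (rule W)
  assume "\<exists>m. \<forall>n. \<forall>i\<le>2 ^ n. 1 / real (Suc m) \<le> ?w (u * real i / 2 ^ n)"
  then obtain m where m: "\<And>n i. i \<le> 2 ^ n \<Longrightarrow> 1 / real (Suc m) \<le> ?w (u * real i / 2 ^ n)" by blast
  have ge: "1 / real (Suc m) \<le> ?w S" if S: "S \<in> {0..u}" for S
  proof (cases "u = 0")
    case True then show ?thesis using S m[of 0 0] by simp
  next
    case False
    then have u: "u > 0" using u by simp
    \<comment> \<open>Dyadic approximation of \<open>S\<close> from below, so that the approximating
      points stay inside \<open>{0..u}\<close>.\<close>
    define j where "j n = nat \<lfloor>2 ^ n * (S / u)\<rfloor>" for n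
    have r: "0 \<le> S / u" "S / u \<le> 1" using S u by auto
    have j1: "real (j n) \<le> 2 ^ n * (S / u)" for n
      unfolding j_def by (intro of_nat_floor mult_nonneg_nonneg r) simp
    have j2: "2 ^ n * (S / u) - 1 \<le> real (j n)" for n
      using r unfolding j_def by linarith
    have jn: "j n \<le> 2 ^ n" for n
    proof -
      have "real (j n) \<le> 2 ^ n * 1" using j1[of n] mult_left_mono[OF r(2), of "2 ^ n"] by (rule order_trans) simp
      then show ?thesis by (metis mult_1_right of_nat_le_iff of_nat_numeral of_nat_power)
    qed
    have lim: "(\<lambda>n. u * real (j n) / 2 ^ n) \<longlonglongrightarrow> S"
    proof (rule tendsto_sandwich[of "\<lambda>n. S - u * (1/2) ^ n" _ _ "\<lambda>n. S"])
      have "u * real (j n) / 2 ^ n \<le> u * (2 ^ n * (S / u)) / 2 ^ n" for n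
        using j1[of n] u by (intro divide_right_mono mult_left_mono) auto
      then show "\<forall>\<^sub>F n in sequentially. u * real (j n) / 2 ^ n \<le> S"
        using u by (intro always_eventually) auto
      have "u * (2 ^ n * (S / u) - 1) / 2 ^ n \<le> u * real (j n) / 2 ^ n" for n
        using j2[of n] u by (intro divide_right_mono mult_left_mono) auto
      then show "\<forall>\<^sub>F n in sequentially. S - u * (1/2) ^ n \<le> u * real (j n) / 2 ^ n"
        using u by (intro always_eventually) (auto simp: right_diff_distrib diff_divide_distrib power_divide)
      have "(\<lambda>n. S - u * (1/2::real) ^ n) \<longlonglongrightarrow> S - u * 0"
        by (intro tendsto_intros LIMSEQ_realpow_zero) auto
      then show "(\<lambda>n. S - u * (1/2) ^ n) \<longlonglongrightarrow> S" by simp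
    qed simp
    have "(\<lambda>n. ?w (u * real (j n) / 2 ^ n)) \<longlonglongrightarrow> ?w S"
      using S u by (intro continuous_on_tendsto_compose[OF w lim] always_eventually) auto
    then show ?thesis
      by (rule LIMSEQ_le_const) (use m jn in auto)
  qed
  \<comment> \<open>Positivity at \<open>u\<close> persists for a short time \<open>d\<close> by
    continuity; this makes the inequality for the infimum strict.\<close>
  have "?w u > 0" using ge[of u] u by (smt (verit) atLeastAtMost_iff divide_pos_pos of_nat_0_less_iff zero_less_Suc)
  then obtain d where d: "d > 0" "\<And>t. t \<ge> 0 \<Longrightarrow> dist t u < d \<Longrightarrow> dist (?w t) (?w u) < ?w u"
    using w u unfolding continuous_on_iff by (metis atLeast_iff)
  have "u + d \<le> S" if "0 \<le> S" "?w S \<le> 0" for S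
  proof (rule ccontr)
    assume "\<not> u + d \<le> S"
    show False
    proof (cases "S \<le> u")
      case True
      then have "1 / real (Suc m) \<le> ?w S" using ge[of S] that by auto
      moreover have "0 < 1 / real (Suc m)" by simp
      ultimately show False using that(2) by linarith
    next
      case False
      then have "dist (?w S) (?w u) < ?w u"
        using \<open>\<not> u + d \<le> S\<close> that d by (auto simp: dist_real_def)
      then show False using that(2) by (auto simp: dist_real_def)
    qed
  qed
  then have "ereal (u + d) \<le> Tstar x0 \<beta> W \<omega>"
    unfolding Tstar_def by (intro Inf_greatest) auto
  then show "ereal u < Tstar x0 \<beta> W \<omega>"
    using d(1) by (auto intro: less_le_trans[of _ "ereal (u + d)"])
qed

text \<open>General in \<open>N\<close> because it is applied to the whole probability space and
  also to the smaller sigma-algebra generated by the Brownian path.\<close>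

lemma Tstar_measurable:
  fixes W :: "real \<Rightarrow> 'a \<Rightarrow> real"
  assumes W[measurable]: "\<And>t. W t \<in> borel_measurable N"
    and cont: "\<And>\<omega>. \<omega> \<in> space N \<Longrightarrow> continuous_on {0..} (\<lambda>t. W t \<omega>)"
  shows "Tstar x0 \<beta> W \<in> borel_measurable N"
proof (rule borel_measurableI_greater)
  fix y :: ereal
  note [measurable] = Wtilde_measurable[OF W]
  have *: "{\<omega> \<in> space N. ereal u < Tstar x0 \<beta> W \<omega>} \<in> sets N" if u: "0 \<le> u" for u
  proof -
    have "{\<omega> \<in> space N. ereal u < Tstar x0 \<beta> W \<omega>} =
      {\<omega> \<in> space N. \<exists>m. \<forall>n. \<forall>i\<in>{..2 ^ n}. 1 / real (Suc m) \<le> Wtilde x0 \<beta> W (u * real i / 2 ^ n) \<omega>}"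
      using Tstar_gt_iff[of W _ u x0 \<beta>, OF cont u] by (auto simp: Ball_def)
    also have "\<dots> \<in> sets N" by measurable
    finally show ?thesis .
  qed
  show "{\<omega> \<in> space N. y < Tstar x0 \<beta> W \<omega>} \<in> sets N"
  proof (cases "y < 0")
    case True
    then have "y < Tstar x0 \<beta> W \<omega>" for \<omega>
      using Tstar_nonneg[of x0 \<beta> W \<omega>] by (rule less_le_trans)
    then show ?thesis by simp
  next
    case False
    then show ?thesis using * by (cases y) auto
  qed
qed

text \<open>By continuity the infimum over nonpositive times is attained, and positivity before it
  gives the reverse inequality: a continuous path has no overshoot.\<close>

lemma Wtilde_at_Tstar:
  fixes W :: "real \<Rightarrow> 'a \<Rightarrow> real"
  assumes W: "continuous_on {0..} (\<lambda>t. W t \<omega>)" and W0: "W 0 \<omega> = 0" and x0: "x0 > 0" and fin: "Tstar x0 \<beta> W \<omega> < \<infinity>"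
  shows "Wtilde x0 \<beta> W (real_of_ereal (Tstar x0 \<beta> W \<omega>)) \<omega> = 0"
proof -
  let ?w = "\<lambda>t. Wtilde x0 \<beta> W t \<omega>"
  have w: "continuous_on {0..} ?w" by (rule Wtilde_continuous_on) (rule W)
  obtain r where r: "Tstar x0 \<beta> W \<omega> = ereal r" "0 \<le> r"
    using fin Tstar_nonneg[of x0 \<beta> W \<omega>] by (cases "Tstar x0 \<beta> W \<omega>") auto
  have le: "?w r \<le> 0"
  proof (rule ccontr)
    assume "\<not> ?w r \<le> 0"
    then have "?w r > 0" by simp
    then obtain d where d: "d > 0" "\<And>t. t \<ge> 0 \<Longrightarrow> dist t r < d \<Longrightarrow> dist (?w t) (?w r) < ?w r"
      using w r unfolding continuous_on_iff by (metis atLeast_iff)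
    have "r + d \<le> S" if "0 \<le> S" "?w S \<le> 0" for S
    proof (rule ccontr)
      assume "\<not> r + d \<le> S"
      moreover have "ereal r \<le> ereal S"
        unfolding r(1)[symmetric] Tstar_def using that by (intro Inf_lower) auto
      ultimately have "dist (?w S) (?w r) < ?w r"
        using that d by (auto simp: dist_real_def)
      then show False using that(2) by (auto simp: dist_real_def)
    qed
    then have "ereal (r + d) \<le> Tstar x0 \<beta> W \<omega>"
      unfolding Tstar_def by (intro Inf_greatest) auto
    then show False using r d by simp
  qed
  have "0 < r"
  proof (rule ccontr)
    assume "\<not> 0 < r"
    then have "r = 0" using r by simp
    then show False using le W0 x0 by (simp add: Wtilde_def)
  qed
  have "(\<lambda>n. r * (1 - 1 / real (Suc n))) \<longlonglongrightarrow> r * (1 - 0)"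
    by (intro tendsto_intros LIMSEQ_inverse_real_of_nat[unfolded inverse_eq_divide])
  then have lim: "(\<lambda>n. r * (1 - 1 / real (Suc n))) \<longlonglongrightarrow> r" by simp
  have "(\<lambda>n. ?w (r * (1 - 1 / real (Suc n)))) \<longlonglongrightarrow> ?w r"
    using r by (intro continuous_on_tendsto_compose[OF w lim] always_eventually allI) auto
  moreover have "0 \<le> ?w (r * (1 - 1 / real (Suc n)))" for n
  proof -
    have "r * (1 - 1 / real (Suc n)) < r" "0 \<le> r * (1 - 1 / real (Suc n))" using \<open>0 < r\<close> by (auto simp: field_simps)
    then show ?thesis using r(1) by (intro less_imp_le[OF Wtilde_pos_before_Tstar]) (simp_all del: of_nat_Suc)
  qed
  ultimately have "0 \<le> ?w r" using LIMSEQ_le_const by blast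
  then show ?thesis using le r by simp
qed

lemma std_normal_distr_scale:
  assumes "s > 0"
  shows "distr std_normal_distribution borel (\<lambda>y. s * y) = density lborel (\<lambda>x. ennreal (normal_density 0 s x))"
proof -
  interpret prob_space std_normal_distribution by (rule prob_space_normal_density) simp
  have "distributed std_normal_distribution lborel (\<lambda>x. x) (normal_density 0 1)"
    unfolding distributed_def by (auto simp: distr_id2)
  from normal_density_affine[OF this, of s 0] assms
  have "distributed std_normal_distribution lborel (\<lambda>x. s * x) (normal_density 0 s)" by simp
  then have "distr std_normal_distribution lborel (\<lambda>y. s * y) = density lborel (\<lambda>x. ennreal (normal_density 0 s x))"
    by (simp add: distributed_def)
  moreover have "distr std_normal_distribution lborel (\<lambda>y. s * y) = distr std_normal_distribution borel (\<lambda>y. s * y)"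
    by (rule distr_cong) auto
  ultimately show ?thesis by simp
qed

section \<open>Independence of the hitting time and later increments\<close>

locale brownian_motion = prob_space M for M :: "'a measure" +
  fixes W :: "real \<Rightarrow> 'a \<Rightarrow> real"
  assumes bm: "std_brownian_motion M W"
begin

lemma W_measurable[measurable]: "W t \<in> borel_measurable M"
  using bm by (auto simp: std_brownian_motion_def)

lemma W_0: "\<omega> \<in> space M \<Longrightarrow> W 0 \<omega> = 0"
  using bm by (auto simp: std_brownian_motion_def)

lemma W_continuous: "\<omega> \<in> space M \<Longrightarrow> continuous_on {0..} (\<lambda>t. W t \<omega>)"
  using bm by (auto simp: std_brownian_motion_def)

text \<open>Phrased through a scaled standard normal variable rather than a density, so that the
  degenerate increment \<open>k = 0\<close> is included.\<close>

lemma distr_increment: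
  assumes "0 \<le> t" "0 \<le> k"
  shows "distr M borel (\<lambda>\<omega>. W (t + k) \<omega> - W t \<omega>) = distr std_normal_distribution borel (\<lambda>y. sqrt k * y)"
proof (cases "k = 0")
  case True
  interpret N: prob_space std_normal_distribution by (rule prob_space_normal_density) simp
  show ?thesis
  proof (rule measure_eqI)
    fix A assume "A \<in> sets (distr M borel (\<lambda>\<omega>. W (t + k) \<omega> - W t \<omega>))"
    then have A: "A \<in> sets borel" by simp
    have "(\<lambda>\<omega>. W (t + k) \<omega> - W t \<omega>) -` A \<inter> space M = (if 0 \<in> A then space M else {})" using True by auto
    moreover have "(\<lambda>y. sqrt k * y) -` A \<inter> space std_normal_distribution = (if 0 \<in> A then space std_normal_distribution else {})" using True by auto
    ultimately show "emeasure (distr M borel (\<lambda>\<omega>. W (t + k) \<omega> - W t \<omega>)) A = emeasure (distr std_normal_distribution borel (\<lambda>y. sqrt k * y)) A"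
      using A emeasure_space_1 N.emeasure_space_1 by (simp add: emeasure_distr)
  qed simp
next
  case False
  then have k: "k > 0" using assms by simp
  have "distributed M lborel (\<lambda>\<omega>. W (t + k) \<omega> - W t \<omega>) (\<lambda>x. ennreal (normal_density 0 (sqrt ((t + k) - t)) x))"
    using bm k assms unfolding std_brownian_motion_def by (metis less_add_same_cancel1)
  then have "distr M lborel (\<lambda>\<omega>. W (t + k) \<omega> - W t \<omega>) = density lborel (\<lambda>x. ennreal (normal_density 0 (sqrt k) x))"
    by (simp add: distributed_def)
  moreover have "distr M lborel (\<lambda>\<omega>. W (t + k) \<omega> - W t \<omega>) = distr M borel (\<lambda>\<omega>. W (t + k) \<omega> - W t \<omega>)"
    by (rule distr_cong) auto
  ultimately show ?thesis using std_normal_distr_scale[of "sqrt k"] k by simp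
qed

text \<open>The event is a limit of events about finitely many path values up to \<open>u\<close>:
  decreasing in the dyadic level \<open>n\<close>, then increasing as the margin
  \<open>1 / (m + 1)\<close> shrinks. To these the independence of increments applies
  directly.\<close>

lemma indep_Tstar_gt_increment:
  assumes u: "0 < u" "u < t" and k: "0 < k" and C[measurable]: "C \<in> sets borel"
  shows "prob {\<omega> \<in> space M. ereal u < Tstar x0 \<beta> W \<omega> \<and> W (t + k) \<omega> - W t \<omega> \<in> C} =
    prob {\<omega> \<in> space M. ereal u < Tstar x0 \<beta> W \<omega>} * prob {\<omega> \<in> space M. W (t + k) \<omega> - W t \<omega> \<in> C}"
proof -
  note [measurable] = Wtilde_measurable[OF W_measurable]
  define E where "E m n = {\<omega> \<in> space M. \<forall>i\<in>{..2 ^ n}. 1 / real (Suc m) \<le> Wtilde x0 \<beta> W (u * real i / 2 ^ n) \<omega>}" for m n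
  define B where "B = {\<omega> \<in> space M. W (t + k) \<omega> - W t \<omega> \<in> C}"
  have [measurable]: "E m n \<in> sets M" "B \<in> sets M" for m n unfolding E_def B_def by measurable
  have cyl: "prob (E m n \<inter> B) = prob (E m n) * prob B" for m n
  proof -
    define K where "K = (2::nat) ^ n"
    have K: "K > 0" by (simp add: K_def)
    \<comment> \<open>Indices 0 to \<open>K\<close> are the dyadic points of the interval from 0 to
      \<open>u\<close>. The increment with index \<open>K\<close> bridges from \<open>u\<close> to
      \<open>t\<close> and is discarded; the one with index \<open>Suc K\<close> is the increment in
      question. Strict sorting of the list is where \<open>u < t\<close> enters.\<close>
    define ts where "ts = map (\<lambda>i. u * real i / real K) [0..<Suc K] @ [t, t + k]"
    have len: "length ts = K + 3" by (simp add: ts_def)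
    have nth1: "ts ! i = u * real i / real K" if "i \<le> K" for i
      using that by (simp add: ts_def nth_append del: upt_Suc)
    have nth2: "ts ! Suc K = t" "ts ! Suc (Suc K) = t + k"
      by (simp_all add: ts_def nth_append)
    have "sorted_wrt (<) (map (\<lambda>i. u * real i / real K) [0..<Suc K])"
      unfolding sorted_wrt_map using u K
      by (intro sorted_wrt_mono_rel[OF _ sorted_wrt_upt]) (auto simp: divide_strict_right_mono)
    moreover have "u * real i / real K < t" if "i < Suc K" for i
    proof -
      have "u * real i / real K \<le> u" using that u K by (simp add: divide_le_eq mult_left_mono)
      then show ?thesis using u by linarith
    qed
    ultimately have sorted: "sorted_wrt (<) ts"
      using k unfolding ts_def by (fastforce simp: sorted_wrt_append simp del: upt_Suc)
    have nonneg: "\<forall>s\<in>set ts. 0 \<le> s" using u k by (auto simp: ts_def)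
    define X where "X i \<omega> = W (ts ! Suc i) \<omega> - W (ts ! i) \<omega>" for i \<omega>
    have ind: "indep_vars (\<lambda>_. borel) X {..<length ts - 1}"
      using bm sorted nonneg unfolding std_brownian_motion_def X_def by blast
    have ind2: "indep_var (PiM {..<K} (\<lambda>_. borel)) (\<lambda>\<omega>. restrict (\<lambda>i. X i \<omega>) {..<K})
        (PiM {Suc K} (\<lambda>_. borel)) (\<lambda>\<omega>. restrict (\<lambda>i. X i \<omega>) {Suc K})"
      by (rule indep_var_restrict[OF ind]) (auto simp: len)
    define Q where "Q = {f \<in> space (PiM {..<K} (\<lambda>_. borel)).
       \<forall>i\<in>{..K}. 1 / real (Suc m) \<le> x0 + (\<Sum>j<i. f j) + \<beta> * (u * real i / real K)}"
    define R where "R = {f \<in> space (PiM {Suc K} (\<lambda>_. borel :: real measure)). f (Suc K) \<in> C}"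
    have Q: "Q \<in> sets (PiM {..<K} (\<lambda>_. borel))"
      unfolding Q_def
    proof (intro sets.sets_Collect_finite_All' measurable_sets borel_measurable_const)
      fix i assume i: "i \<in> {..K}"
      have "(\<lambda>f. \<Sum>j<i. f j) \<in> borel_measurable (PiM {..<K} (\<lambda>_. borel :: real measure))"
        using i by (intro borel_measurable_sum measurable_component_singleton) auto
      then have [measurable]: "(\<lambda>f. sum f {..<i}) \<in> borel_measurable (PiM {..<K} (\<lambda>_. borel :: real measure))" by simp
      show "{f \<in> space (PiM {..<K} (\<lambda>_. borel)). 1 / real (Suc m) \<le> x0 + (\<Sum>j<i. f j) + \<beta> * (u * real i / real K)} \<in> sets (PiM {..<K} (\<lambda>_. borel))"
        by measurable
    qed auto
    have R: "R \<in> sets (PiM {Suc K} (\<lambda>_. borel))"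
      unfolding R_def by measurable
    have sumX: "(\<Sum>j<i. X j \<omega>) = W (u * real i / real K) \<omega>" if "i \<le> K" "\<omega> \<in> space M" for i \<omega>
    proof -
      have "(\<Sum>j<i. X j \<omega>) = W (ts ! i) \<omega> - W (ts ! 0) \<omega>"
        unfolding X_def by (rule sum_lessThan_telescope)
      then show ?thesis using that nth1[of 0] nth1[of i] W_0 by simp
    qed
    have EQ: "(\<lambda>\<omega>. restrict (\<lambda>i. X i \<omega>) {..<K}) -` Q \<inter> space M = E m n"
    proof -
      have *: "(\<Sum>j<i. restrict (\<lambda>i. X i \<omega>) {..<K} j) = W (u * real i / real K) \<omega>" if "i \<le> K" "\<omega> \<in> space M" for i \<omega>
        unfolding sumX[OF that, symmetric] using that by (intro sum.cong) auto
      show ?thesis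
        unfolding Q_def E_def Wtilde_def K_def[symmetric]
        by (auto simp: space_PiM * K_def sumX[unfolded K_def])
    qed
    have BR: "(\<lambda>\<omega>. restrict (\<lambda>i. X i \<omega>) {Suc K}) -` R \<inter> space M = B"
      unfolding R_def B_def X_def using nth2 by (auto simp: space_PiM)
    have "prob ((\<lambda>\<omega>. (restrict (\<lambda>i. X i \<omega>) {..<K}, restrict (\<lambda>i. X i \<omega>) {Suc K})) -` (Q \<times> R) \<inter> space M) =
      prob (E m n) * prob B"
      using indep_varD[OF ind2 Q R] EQ BR by simp
    also have "(\<lambda>\<omega>. (restrict (\<lambda>i. X i \<omega>) {..<K}, restrict (\<lambda>i. X i \<omega>) {Suc K})) -` (Q \<times> R) \<inter> space M = E m n \<inter> B"
      using EQ BR by auto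
    finally show ?thesis .
  qed
  have Emono: "decseq (E m)" for m
  proof (rule decseq_SucI)
    fix n
    show "E m (Suc n) \<subseteq> E m n"
    proof
      fix \<omega> assume w: "\<omega> \<in> E m (Suc n)"
      have "1 / real (Suc m) \<le> Wtilde x0 \<beta> W (u * real i / 2 ^ n) \<omega>" if "i \<le> 2 ^ n" for i
      proof -
        have "2 * i \<in> {..2 ^ Suc n}" using that by simp
        then have "1 / real (Suc m) \<le> Wtilde x0 \<beta> W (u * real (2 * i) / 2 ^ Suc n) \<omega>" using w unfolding E_def by blast
        then show ?thesis by simp
      qed
      then show "\<omega> \<in> E m n" using w unfolding E_def by auto
    qed
  qed
  define F where "F m = (\<Inter>n. E m n)" for m
  have F: "prob (F m \<inter> B) = prob (F m) * prob B" for m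
  proof -
    have eq: "(\<Inter>n. E m n \<inter> B) = F m \<inter> B" by (auto simp: F_def)
    have "(\<lambda>n. prob (E m n \<inter> B)) \<longlonglongrightarrow> prob (F m \<inter> B)"
      unfolding eq[symmetric] using Emono[of m] by (intro finite_Lim_measure_decseq) (auto simp: decseq_def)
    moreover have "(\<lambda>n. prob (E m n)) \<longlonglongrightarrow> prob (F m)"
      unfolding F_def using Emono[of m] by (intro finite_Lim_measure_decseq) auto
    ultimately have "(\<lambda>n. prob (E m n) * prob B) \<longlonglongrightarrow> prob (F m \<inter> B)" "(\<lambda>n. prob (E m n) * prob B) \<longlonglongrightarrow> prob (F m) * prob B"
      unfolding cyl by (auto intro!: tendsto_mult_right)
    then show ?thesis by (rule LIMSEQ_unique)
  qed
  have [measurable]: "F m \<in> sets M" for m unfolding F_def by measurable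
  have Finc: "incseq F"
  proof (rule incseq_SucI)
    fix m
    have "1 / real (Suc (Suc m)) \<le> 1 / real (Suc m)" by (simp add: frac_le)
    then have "1 / real (Suc (Suc m)) \<le> x" if "1 / real (Suc m) \<le> x" for x using that by linarith
    then show "F m \<subseteq> F (Suc m)" unfolding F_def E_def by blast
  qed
  have UF: "(\<Union>m. F m) = {\<omega> \<in> space M. ereal u < Tstar x0 \<beta> W \<omega>}"
    using Tstar_gt_iff[of W _ u x0 \<beta>, OF W_continuous] less_imp_le[OF u(1)] unfolding F_def E_def by (auto simp del: of_nat_Suc) (metis atMost_iff)
  have "(\<lambda>m. prob (F m \<inter> B)) \<longlonglongrightarrow> prob (\<Union>m. F m \<inter> B)"
    using Finc by (intro finite_Lim_measure_incseq) (auto simp: incseq_def)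
  moreover have "(\<lambda>m. prob (F m) * prob B) \<longlonglongrightarrow> prob (\<Union>m. F m) * prob B"
    using Finc by (intro tendsto_intros finite_Lim_measure_incseq) auto
  ultimately have "prob (\<Union>m. F m \<inter> B) = prob (\<Union>m. F m) * prob B"
    unfolding F by (rule LIMSEQ_unique)
  moreover have "(\<Union>m. F m \<inter> B) = {\<omega> \<in> space M. ereal u < Tstar x0 \<beta> W \<omega> \<and> W (t + k) \<omega> - W t \<omega> \<in> C}"
    using UF unfolding B_def by auto
  ultimately show ?thesis unfolding UF B_def by simp
qed

end

text \<open>Independence says that the law of \<open>X\<close> restricted to the event is the full
  law scaled by the probability of the event; integration of nonnegative functions follows.\<close>

lemma (in prob_space) nn_integral_indep_event:
  assumes A[measurable]: "A \<in> events" and X[measurable]: "X \<in> borel_measurable M"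
    and indep: "\<And>C. C \<in> sets borel \<Longrightarrow> prob {\<omega> \<in> space M. \<omega> \<in> A \<and> X \<omega> \<in> C} = prob A * prob {\<omega> \<in> space M. X \<omega> \<in> C}"
    and h[measurable]: "h \<in> borel_measurable (borel :: real measure)"
  shows "(\<integral>\<^sup>+\<omega>. h (X \<omega>) * indicator A \<omega> \<partial>M) = (\<integral>\<^sup>+\<omega>. (\<integral>\<^sup>+x. h x \<partial>distr M borel X) * indicator A \<omega> \<partial>M)"
proof -
  have eq: "distr (density M (indicator A)) borel X = scale_measure (emeasure M A) (distr M borel X)"
  proof (rule measure_eqI)
    fix C assume "C \<in> sets (distr (density M (indicator A)) borel X)"
    then have [measurable]: "C \<in> sets borel" by simp
    have "emeasure (distr (density M (indicator A)) borel X) C = emeasure (density M (indicator A)) (X -` C \<inter> space M)"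
      by (simp add: emeasure_distr)
    also have "\<dots> = (\<integral>\<^sup>+\<omega>. indicator {\<omega> \<in> space M. \<omega> \<in> A \<and> X \<omega> \<in> C} \<omega> \<partial>M)"
    proof -
      have "indicator A \<omega> * indicator (X -` C \<inter> space M) \<omega> = (indicator {\<omega> \<in> space M. \<omega> \<in> A \<and> X \<omega> \<in> C} \<omega> :: ennreal)" for \<omega>
        by (auto split: split_indicator)
      then show ?thesis by (subst emeasure_density) simp_all
    qed
    also have "\<dots> = emeasure M {\<omega> \<in> space M. \<omega> \<in> A \<and> X \<omega> \<in> C}" by simp
    also have "\<dots> = emeasure M A * emeasure M {\<omega> \<in> space M. X \<omega> \<in> C}"
      by (simp add: emeasure_eq_measure indep ennreal_mult)
    also have "{\<omega> \<in> space M. X \<omega> \<in> C} = X -` C \<inter> space M" by auto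
    finally show "emeasure (distr (density M (indicator A)) borel X) C = emeasure (scale_measure (emeasure M A) (distr M borel X)) C"
      by (simp add: emeasure_distr)
  qed simp
  have "(\<integral>\<^sup>+\<omega>. h (X \<omega>) * indicator A \<omega> \<partial>M) = (\<integral>\<^sup>+\<omega>. h (X \<omega>) \<partial>density M (indicator A))"
    by (subst nn_integral_density) (auto simp: mult.commute)
  also have "\<dots> = (\<integral>\<^sup>+x. h x \<partial>distr (density M (indicator A)) borel X)"
    by (subst nn_integral_distr) auto
  also have "\<dots> = emeasure M A * (\<integral>\<^sup>+x. h x \<partial>distr M borel X)"
    unfolding eq by (subst nn_integral_scale_measure) auto
  also have "\<dots> = (\<integral>\<^sup>+\<omega>. (\<integral>\<^sup>+x. h x \<partial>distr M borel X) * indicator A \<omega> \<partial>M)"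
    by (subst nn_integral_cmult_indicator) (auto simp: mult.commute)
  finally show ?thesis .
qed

locale bm_hitting = brownian_motion +
  fixes x0 \<beta> :: real
  assumes x0: "0 < x0"
begin

text \<open>\<open>real_of_ereal\<close> maps infinity to 0, so this is the hitting time only on
  \<open>Hit\<close>; it is nonnegative and measurable everywhere.\<close>

definition hit :: "'a \<Rightarrow> real" where "hit \<omega> = real_of_ereal (Tstar x0 \<beta> W \<omega>)"

definition Hit :: "'a set" where "Hit = {\<omega> \<in> space M. Tstar x0 \<beta> W \<omega> < \<infinity>}"

lemma Tstar_borel[measurable]: "Tstar x0 \<beta> W \<in> borel_measurable M"
  by (rule Tstar_measurable) (auto intro: W_continuous)

lemma hit_measurable[measurable]: "hit \<in> borel_measurable M"
  unfolding hit_def[abs_def] by measurable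

lemma Hit_measurable[measurable]: "Hit \<in> sets M"
  unfolding Hit_def by measurable

lemma hit_nonneg: "0 \<le> hit \<omega>"
  unfolding hit_def by (simp add: real_of_ereal_pos Tstar_nonneg)

lemma Tstar_eq_hit: "\<omega> \<in> Hit \<Longrightarrow> Tstar x0 \<beta> W \<omega> = ereal (hit \<omega>)"
  using Tstar_nonneg[of x0 \<beta> W \<omega>] unfolding Hit_def hit_def by (cases "Tstar x0 \<beta> W \<omega>") auto

text \<open>The closed condition is the intersection of the conditions \<open>u n < Tstar\<close>
  for \<open>u n\<close> increasing to \<open>v\<close> from strictly below. In this way
  \<open>v = t\<close> is reached, which the strict version excludes.\<close>

lemma indep_Tstar_ge_increment:
  assumes v: "v \<le> t" and t: "0 \<le> t" and k: "0 \<le> k" and C[measurable]: "C \<in> sets borel"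
  shows "prob {\<omega> \<in> space M. ereal v \<le> Tstar x0 \<beta> W \<omega> \<and> W (t + k) \<omega> - W t \<omega> \<in> C} =
    prob {\<omega> \<in> space M. ereal v \<le> Tstar x0 \<beta> W \<omega>} * prob {\<omega> \<in> space M. W (t + k) \<omega> - W t \<omega> \<in> C}"
proof -
  consider "v \<le> 0" | "k = 0" | "0 < v" "0 < k" using k by linarith
  then show ?thesis
  proof cases
    case 1
    then have "ereal v \<le> Tstar x0 \<beta> W \<omega>" for \<omega>
      using order_trans[OF _ Tstar_nonneg, of "ereal v" x0 \<beta> W \<omega>] by simp
    then show ?thesis by (simp add: prob_space)
  next
    case 2
    then show ?thesis by (cases "0 \<in> C") (auto simp: prob_space)
  next
    case 3
    \<comment> \<open>The offset 2 keeps the first value \<open>v / 2\<close> positive.\<close>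
    define u where "u n = v * (1 - 1 / real (n + 2))" for n
    have u: "0 < u n" "u n < t" "u n < v" "u n \<le> u (Suc n)" for n
    proof -
      have "0 < 1 / real (n + 2)" "1 / real (n + 2) < 1" "1 / real (Suc n + 2) \<le> 1 / real (n + 2)"
        by (auto simp: frac_le)
      then show "0 < u n" "u n < v" "u n \<le> u (Suc n)" unfolding u_def using 3 by (auto simp: mult_less_cancel_left1 intro!: mult_left_mono)
      then show "u n < t" using v by linarith
    qed
    have lim: "u \<longlonglongrightarrow> v"
    proof -
      have "(\<lambda>n. v * (1 - 1 / real (n + 2))) \<longlonglongrightarrow> v * (1 - 0)"
        using LIMSEQ_ignore_initial_segment[OF LIMSEQ_inverse_real_of_nat[unfolded inverse_eq_divide], of 1]
        by (intro tendsto_mult tendsto_diff tendsto_const) (simp add: add.commute)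
      then show ?thesis unfolding u_def by simp
    qed
    have iff: "ereal v \<le> Tstar x0 \<beta> W \<omega> \<longleftrightarrow> (\<forall>n. ereal (u n) < Tstar x0 \<beta> W \<omega>)" for \<omega>
    proof
      assume "ereal v \<le> Tstar x0 \<beta> W \<omega>"
      then show "\<forall>n. ereal (u n) < Tstar x0 \<beta> W \<omega>" using u(3) by (meson less_ereal.simps(1) less_le_trans)
    next
      assume "\<forall>n. ereal (u n) < Tstar x0 \<beta> W \<omega>"
      then show "ereal v \<le> Tstar x0 \<beta> W \<omega>"
        using lim by (intro LIMSEQ_le_const2[of "\<lambda>n. ereal (u n)"]) (auto intro: less_imp_le)
    qed
    define G where "G n = {\<omega> \<in> space M. ereal (u n) < Tstar x0 \<beta> W \<omega>}" for n
    define B where "B = {\<omega> \<in> space M. W (t + k) \<omega> - W t \<omega> \<in> C}"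
    have [measurable]: "G n \<in> sets M" "B \<in> sets M" for n unfolding G_def B_def by measurable
    have dec: "decseq G"
    proof (rule decseq_SucI)
      fix n
      have "ereal (u n) \<le> ereal (u (Suc n))" using u(4) by simp
      then show "G (Suc n) \<subseteq> G n" unfolding G_def by (blast intro: le_less_trans)
    qed
    have prod: "prob (G n \<inter> B) = prob (G n) * prob B" for n
    proof -
      have "G n \<inter> B = {\<omega> \<in> space M. ereal (u n) < Tstar x0 \<beta> W \<omega> \<and> W (t + k) \<omega> - W t \<omega> \<in> C}"
        unfolding G_def B_def by auto
      then show ?thesis
        using indep_Tstar_gt_increment[OF u(1)[of n] u(2)[of n] \<open>0 < k\<close> C, of x0 \<beta>] unfolding G_def B_def by simp
    qed
    have "(\<lambda>n. prob (G n \<inter> B)) \<longlonglongrightarrow> prob (\<Inter>n. G n \<inter> B)"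
      using dec by (intro finite_Lim_measure_decseq) (auto simp: decseq_def)
    moreover have "(\<lambda>n. prob (G n) * prob B) \<longlonglongrightarrow> prob (\<Inter>n. G n) * prob B"
      using dec by (intro tendsto_mult_right finite_Lim_measure_decseq) auto
    ultimately have "prob (\<Inter>n. G n \<inter> B) = prob (\<Inter>n. G n) * prob B"
      unfolding prod by (rule LIMSEQ_unique)
    moreover have "(\<Inter>n. G n) = {\<omega> \<in> space M. ereal v \<le> Tstar x0 \<beta> W \<omega>}"
      unfolding iff G_def by auto
    moreover have "(\<Inter>n. G n \<inter> B) = {\<omega> \<in> space M. ereal v \<le> Tstar x0 \<beta> W \<omega> \<and> W (t + k) \<omega> - W t \<omega> \<in> C}"
      unfolding iff G_def B_def by auto
    ultimately show ?thesis unfolding B_def by simp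
  qed
qed

text \<open>The cell is a difference of two nested events of the previous kind, and product formulas
  subtract.\<close>

lemma indep_hit_cell_increment:
  assumes k: "0 \<le> k" and C[measurable]: "C \<in> sets borel" and v: "v \<le> t" and t: "0 \<le> t"
  defines "A \<equiv> {\<omega> \<in> space M. ereal v \<le> Tstar x0 \<beta> W \<omega> \<and> Tstar x0 \<beta> W \<omega> < ereal t}"
  shows "prob {\<omega> \<in> space M. \<omega> \<in> A \<and> W (t + k) \<omega> - W t \<omega> \<in> C} =
    prob A * prob {\<omega> \<in> space M. W (t + k) \<omega> - W t \<omega> \<in> C}"
proof -
  let ?G = "\<lambda>v. {\<omega> \<in> space M. ereal v \<le> Tstar x0 \<beta> W \<omega>}"
  let ?H = "\<lambda>v. {\<omega> \<in> space M. ereal v \<le> Tstar x0 \<beta> W \<omega> \<and> W (t + k) \<omega> - W t \<omega> \<in> C}"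
  have "{\<omega> \<in> space M. \<omega> \<in> A \<and> W (t + k) \<omega> - W t \<omega> \<in> C} = ?H v - ?H t"
    unfolding A_def by auto
  moreover have "prob (?H v - ?H t) = prob (?H v) - prob (?H t)"
    using v by (intro finite_measure_Diff) (auto intro: order_trans[of "ereal v" "ereal t"])
  moreover have "A = ?G v - ?G t" unfolding A_def by auto
  moreover have "prob (?G v - ?G t) = prob (?G v) - prob (?G t)"
    using v by (intro finite_measure_Diff) (auto intro: order_trans[of "ereal v" "ereal t"])
  ultimately show ?thesis
    using indep_Tstar_ge_increment[OF v t k C] indep_Tstar_ge_increment[OF order_refl t k C]
    by (simp add: left_diff_distrib)
qed

section \<open>The strong Markov property at the hitting time\<close>

text \<open>On each cell of the grid the next grid time is a constant \<open>c j\<close>, and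
  membership in the cell is decided by that time. The increment over the fixed duration
  \<open>\<kappa> (c j)\<close> is therefore independent of the cell, and summation over the cells
  gives the claim.\<close>

lemma strong_markov_grid:
  fixes f :: "real \<times> real \<Rightarrow> ennreal"
  assumes \<kappa>: "\<And>a. 0 \<le> a \<Longrightarrow> 0 \<le> \<kappa> a" and [measurable]: "f \<in> borel_measurable borel"
  shows "(\<integral>\<^sup>+\<omega>. f (grid n (hit \<omega>), W (grid n (hit \<omega>) + \<kappa> (grid n (hit \<omega>))) \<omega> - W (grid n (hit \<omega>)) \<omega> + \<beta> * \<kappa> (grid n (hit \<omega>))) * indicator Hit \<omega> \<partial>M)
   = (\<integral>\<^sup>+\<omega>. (\<integral>\<^sup>+y. f (grid n (hit \<omega>), \<beta> * \<kappa> (grid n (hit \<omega>)) + sqrt (\<kappa> (grid n (hit \<omega>))) * y) \<partial>std_normal_distribution) * indicator Hit \<omega> \<partial>M)"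
proof -
  define c where "c j = real (Suc j) / real (Suc n)" for j
  \<comment> \<open>Closed on the left and open on the right, in agreement with the floor in
    \<open>grid\<close>, which takes the next grid point strictly above \<open>hit\<close>.\<close>
  define A where "A j = {\<omega> \<in> space M. ereal (real j / real (Suc n)) \<le> Tstar x0 \<beta> W \<omega> \<and> Tstar x0 \<beta> W \<omega> < ereal (c j)}" for j
  have [measurable]: "A j \<in> sets M" for j unfolding A_def by measurable
  have c0: "0 \<le> c j" "real j / real (Suc n) \<le> c j" for j unfolding c_def by (auto intro!: divide_right_mono)
  have A: "\<omega> \<in> A j \<longleftrightarrow> \<omega> \<in> Hit \<and> nat \<lfloor>hit \<omega> * real (Suc n)\<rfloor> = j" if "\<omega> \<in> space M" for \<omega> j
  proof
    assume "\<omega> \<in> A j"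
    then have "\<omega> \<in> Hit" unfolding A_def Hit_def by (auto intro: less_trans)
    then have "real j / real (Suc n) \<le> hit \<omega>" "hit \<omega> < c j"
      using \<open>\<omega> \<in> A j\<close> Tstar_eq_hit unfolding A_def by auto
    then have "real j \<le> hit \<omega> * real (Suc n)" "hit \<omega> * real (Suc n) < real j + 1"
      unfolding c_def by (auto simp: field_simps)
    then have "\<lfloor>hit \<omega> * real (Suc n)\<rfloor> = int j" by (simp add: floor_eq_iff del: of_nat_Suc)
    then show "\<omega> \<in> Hit \<and> nat \<lfloor>hit \<omega> * real (Suc n)\<rfloor> = j" using \<open>\<omega> \<in> Hit\<close> by simp
  next
    assume H: "\<omega> \<in> Hit \<and> nat \<lfloor>hit \<omega> * real (Suc n)\<rfloor> = j"
    have "0 \<le> hit \<omega> * real (Suc n)" using hit_nonneg by simp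
    then have "real j \<le> hit \<omega> * real (Suc n)" "hit \<omega> * real (Suc n) < real j + 1"
      using H by linarith+
    then have "real j / real (Suc n) \<le> hit \<omega>" "hit \<omega> < c j"
      unfolding c_def by (auto simp: field_simps)
    then show "\<omega> \<in> A j" using that H Tstar_eq_hit unfolding A_def by auto
  qed
  have grid: "grid n (hit \<omega>) = c j" if "\<omega> \<in> A j" for \<omega> j
  proof -
    have "\<omega> \<in> space M" using that unfolding A_def by auto
    then show ?thesis using A[of \<omega> j] that unfolding grid_def c_def by auto
  qed
  have split: "g \<omega> * indicator Hit \<omega> = (\<Sum>j. g \<omega> * indicator (A j) \<omega>)" if "\<omega> \<in> space M" for g :: "'a \<Rightarrow> ennreal" and \<omega>
  proof (cases "\<omega> \<in> Hit")
    case True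
    define i where "i = nat \<lfloor>hit \<omega> * real (Suc n)\<rfloor>"
    have eq: "g \<omega> * indicator (A j) \<omega> = (if j = i then g \<omega> else 0)" for j
      using A[OF that, of j] True by (auto simp: i_def)
    have "(\<lambda>j. g \<omega> * indicator (A j) \<omega>) sums g \<omega>"
      unfolding eq by (rule sums_single)
    then show ?thesis using True by (simp add: sums_iff)
  next
    case False
    then show ?thesis using A[OF that] by simp
  qed
  have cell: "(\<integral>\<^sup>+\<omega>. f (c j, W (c j + \<kappa> (c j)) \<omega> - W (c j) \<omega> + \<beta> * \<kappa> (c j)) * indicator (A j) \<omega> \<partial>M) =
     (\<integral>\<^sup>+\<omega>. (\<integral>\<^sup>+y. f (c j, \<beta> * \<kappa> (c j) + sqrt (\<kappa> (c j)) * y) \<partial>std_normal_distribution) * indicator (A j) \<omega> \<partial>M)" for j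
  proof -
    have ind: "prob {\<omega> \<in> space M. \<omega> \<in> A j \<and> W (c j + \<kappa> (c j)) \<omega> - W (c j) \<omega> \<in> C} =
        prob (A j) * prob {\<omega> \<in> space M. W (c j + \<kappa> (c j)) \<omega> - W (c j) \<omega> \<in> C}" if "C \<in> sets borel" for C
      unfolding A_def by (intro indep_hit_cell_increment \<kappa> c0 that)
    have "(\<integral>\<^sup>+\<omega>. f (c j, W (c j + \<kappa> (c j)) \<omega> - W (c j) \<omega> + \<beta> * \<kappa> (c j)) * indicator (A j) \<omega> \<partial>M) =
      (\<integral>\<^sup>+\<omega>. (\<integral>\<^sup>+x. f (c j, x + \<beta> * \<kappa> (c j)) \<partial>distr M borel (\<lambda>\<omega>. W (c j + \<kappa> (c j)) \<omega> - W (c j) \<omega>)) * indicator (A j) \<omega> \<partial>M)"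
      by (rule nn_integral_indep_event[where h="\<lambda>x. f (c j, x + \<beta> * \<kappa> (c j))"])
         (auto simp: borel_prod[symmetric] intro!: ind)
    also have "distr M borel (\<lambda>\<omega>. W (c j + \<kappa> (c j)) \<omega> - W (c j) \<omega>) = distr std_normal_distribution borel (\<lambda>y. sqrt (\<kappa> (c j)) * y)"
      by (intro distr_increment \<kappa> c0)
    also have "(\<integral>\<^sup>+x. f (c j, x + \<beta> * \<kappa> (c j)) \<partial>\<dots>) = (\<integral>\<^sup>+y. f (c j, sqrt (\<kappa> (c j)) * y + \<beta> * \<kappa> (c j)) \<partial>std_normal_distribution)"
      by (subst nn_integral_distr) (auto simp: borel_prod[symmetric])
    finally show ?thesis by (simp add: add.commute)
  qed
  have "(\<integral>\<^sup>+\<omega>. f (grid n (hit \<omega>), W (grid n (hit \<omega>) + \<kappa> (grid n (hit \<omega>))) \<omega> - W (grid n (hit \<omega>)) \<omega> + \<beta> * \<kappa> (grid n (hit \<omega>))) * indicator Hit \<omega> \<partial>M)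
    = (\<integral>\<^sup>+\<omega>. (\<Sum>j. f (c j, W (c j + \<kappa> (c j)) \<omega> - W (c j) \<omega> + \<beta> * \<kappa> (c j)) * indicator (A j) \<omega>) \<partial>M)"
  proof (intro nn_integral_cong)
    fix \<omega> assume w: "\<omega> \<in> space M"
    show "f (grid n (hit \<omega>), W (grid n (hit \<omega>) + \<kappa> (grid n (hit \<omega>))) \<omega> - W (grid n (hit \<omega>)) \<omega> + \<beta> * \<kappa> (grid n (hit \<omega>))) * indicator Hit \<omega>
      = (\<Sum>j. f (c j, W (c j + \<kappa> (c j)) \<omega> - W (c j) \<omega> + \<beta> * \<kappa> (c j)) * indicator (A j) \<omega>)"
      by (subst split[OF w]) (intro suminf_cong, auto simp: grid split: split_indicator)
  qed
  also have "\<dots> = (\<Sum>j. \<integral>\<^sup>+\<omega>. f (c j, W (c j + \<kappa> (c j)) \<omega> - W (c j) \<omega> + \<beta> * \<kappa> (c j)) * indicator (A j) \<omega> \<partial>M)"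
    by (intro nn_integral_suminf) (auto simp: borel_prod[symmetric])
  also have "\<dots> = (\<Sum>j. \<integral>\<^sup>+\<omega>. (\<integral>\<^sup>+y. f (c j, \<beta> * \<kappa> (c j) + sqrt (\<kappa> (c j)) * y) \<partial>std_normal_distribution) * indicator (A j) \<omega> \<partial>M)"
    unfolding cell ..
  also have "\<dots> = (\<integral>\<^sup>+\<omega>. (\<Sum>j. (\<integral>\<^sup>+y. f (c j, \<beta> * \<kappa> (c j) + sqrt (\<kappa> (c j)) * y) \<partial>std_normal_distribution) * indicator (A j) \<omega>) \<partial>M)"
    by (intro nn_integral_suminf[symmetric]) auto
  also have "\<dots> = (\<integral>\<^sup>+\<omega>. (\<integral>\<^sup>+y. f (grid n (hit \<omega>), \<beta> * \<kappa> (grid n (hit \<omega>)) + sqrt (\<kappa> (grid n (hit \<omega>))) * y) \<partial>std_normal_distribution) * indicator Hit \<omega> \<partial>M)"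
  proof (intro nn_integral_cong)
    fix \<omega> assume w: "\<omega> \<in> space M"
    show "(\<Sum>j. (\<integral>\<^sup>+y. f (c j, \<beta> * \<kappa> (c j) + sqrt (\<kappa> (c j)) * y) \<partial>std_normal_distribution) * indicator (A j) \<omega>) =
      (\<integral>\<^sup>+y. f (grid n (hit \<omega>), \<beta> * \<kappa> (grid n (hit \<omega>)) + sqrt (\<kappa> (grid n (hit \<omega>))) * y) \<partial>std_normal_distribution) * indicator Hit \<omega>"
      by (subst split[OF w]) (intro suminf_cong, auto simp: grid split: split_indicator)
  qed
  finally show ?thesis .
qed

lemma Wtilde_right_continuous:
  "\<omega> \<in> space M \<Longrightarrow> 0 \<le> t \<Longrightarrow> continuous (at_right t) (\<lambda>t. Wtilde x0 \<beta> W t \<omega>)"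
proof -
  assume *: "\<omega> \<in> space M" "0 \<le> t"
  have "continuous_on {0..} (\<lambda>t. Wtilde x0 \<beta> W t \<omega>)" by (intro Wtilde_continuous_on W_continuous *)
  then have "continuous (at t within {0..}) (\<lambda>t. Wtilde x0 \<beta> W t \<omega>)" using *(2) by (simp add: continuous_on_eq_continuous_within)
  then show ?thesis by (rule continuous_within_subset) (use *(2) in auto)
qed

lemma Wtilde_process_measurable:
  assumes [measurable]: "k \<in> borel_measurable M" and k: "\<And>\<omega>. \<omega> \<in> space M \<Longrightarrow> 0 \<le> k \<omega>"
  shows "(\<lambda>\<omega>. Wtilde x0 \<beta> W (k \<omega>) \<omega>) \<in> borel_measurable M"
proof -
  have [measurable]: "(\<lambda>p. Wtilde x0 \<beta> W (max 0 (fst p)) (snd p)) \<in> borel_measurable (borel \<Otimes>\<^sub>M M)"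
    by (rule measurable_right_continuous_process) (auto intro: Wtilde_right_continuous Wtilde_measurable)
  have "(\<lambda>\<omega>. (\<lambda>p. Wtilde x0 \<beta> W (max 0 (fst p)) (snd p)) (k \<omega>, \<omega>)) \<in> borel_measurable M"
    by (rule measurable_compose[of _ M "borel \<Otimes>\<^sub>M M"]) measurable
  then show ?thesis
    by (rule measurable_cong[THEN iffD1, rotated]) (use k in \<open>auto simp: max_def\<close>)
qed

text \<open>Grid times approach \<open>hit\<close> from the right, where \<open>\<kappa>\<close> is
  continuous, and \<open>f\<close> is bounded and continuous, so both sides converge. The duration
  is allowed to depend on the hitting time because the overshoot of a frozen path of
  \<open>T\<close> does.\<close>

lemma strong_markov_continuous:
  fixes f :: "real \<times> real \<Rightarrow> real"
  assumes \<kappa>: "\<And>a. 0 \<le> a \<Longrightarrow> 0 \<le> \<kappa> a" "\<And>a. 0 \<le> a \<Longrightarrow> continuous (at_right a) \<kappa>"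
    and \<kappa>m[measurable]: "\<kappa> \<in> borel_measurable borel"
    and f: "continuous_on UNIV f" and f01: "\<And>x. 0 \<le> f x \<and> f x \<le> 1"
  shows "(\<integral>\<^sup>+\<omega>. ennreal (f (hit \<omega>, Wtilde x0 \<beta> W (hit \<omega> + \<kappa> (hit \<omega>)) \<omega>)) * indicator Hit \<omega> \<partial>M)
   = (\<integral>\<^sup>+\<omega>. (\<integral>\<^sup>+y. ennreal (f (hit \<omega>, \<beta> * \<kappa> (hit \<omega>) + sqrt (\<kappa> (hit \<omega>)) * y)) \<partial>std_normal_distribution) * indicator Hit \<omega> \<partial>M)"
    (is "?L = ?R")
proof -
  interpret N: prob_space std_normal_distribution by (rule prob_space_normal_density) simp
  have [measurable]: "f \<in> borel_measurable (borel \<Otimes>\<^sub>M borel)"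
    unfolding borel_prod by (rule borel_measurable_continuous_onI[OF f])
  have max0: "max 0 (hit \<omega>) = hit \<omega>" for \<omega> using hit_nonneg by simp
  define g where "g n \<omega> = grid n (hit \<omega>)" for n \<omega>
  have g0: "0 \<le> g n \<omega>" for n \<omega> using grid_gt[of "hit \<omega>" n] unfolding g_def by simp
  have glim: "(\<lambda>n. g n \<omega>) \<longlonglongrightarrow> hit \<omega>" "(\<lambda>n. \<kappa> (g n \<omega>)) \<longlonglongrightarrow> \<kappa> (hit \<omega>)" for \<omega>
    using LIMSEQ_grid[of "hit \<omega>"] LIMSEQ_right_continuous_grid[of "hit \<omega>" \<kappa>] \<kappa>(2)[OF hit_nonneg, of \<omega>]
    unfolding g_def max0 by auto
  have [measurable]: "g n \<in> borel_measurable M" for n unfolding g_def by measurable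
  define L where "L n \<omega> = f (g n \<omega>, W (g n \<omega> + \<kappa> (g n \<omega>)) \<omega> - W (g n \<omega>) \<omega> + \<beta> * \<kappa> (g n \<omega>))" for n \<omega>
  define R where "R n \<omega> = (\<integral>\<^sup>+y. ennreal (f (g n \<omega>, \<beta> * \<kappa> (g n \<omega>) + sqrt (\<kappa> (g n \<omega>)) * y)) \<partial>std_normal_distribution)" for n \<omega>
  have eq: "(\<integral>\<^sup>+\<omega>. ennreal (L n \<omega>) * indicator Hit \<omega> \<partial>M) = (\<integral>\<^sup>+\<omega>. R n \<omega> * indicator Hit \<omega> \<partial>M)" for n
    unfolding L_def R_def g_def
    by (rule strong_markov_grid[where f="\<lambda>x. ennreal (f x)" and \<kappa>=\<kappa>, OF \<kappa>(1)]) (simp_all add: borel_prod[symmetric])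
  \<comment> \<open>Increments are rewritten in terms of \<open>Wtilde\<close>, which vanishes at
    the hitting time; in the limit the increment becomes the position itself.\<close>
  have Wt: "W (a + k) \<omega> - W a \<omega> + \<beta> * k = Wtilde x0 \<beta> W (a + k) \<omega> - Wtilde x0 \<beta> W a \<omega>" for a k \<omega>
    by (simp add: Wtilde_def algebra_simps)
  have [measurable]: "(\<lambda>\<omega>. Wtilde x0 \<beta> W (g n \<omega> + \<kappa> (g n \<omega>)) \<omega>) \<in> borel_measurable M"
    "(\<lambda>\<omega>. Wtilde x0 \<beta> W (g n \<omega>) \<omega>) \<in> borel_measurable M"
    "(\<lambda>\<omega>. Wtilde x0 \<beta> W (hit \<omega> + \<kappa> (hit \<omega>)) \<omega>) \<in> borel_measurable M" for n
    using \<kappa> g0 hit_nonneg by (auto intro!: Wtilde_process_measurable)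
  have [measurable]: "L n \<in> borel_measurable M" for n
    unfolding L_def[abs_def] Wt by measurable
  have [measurable]: "R n \<in> borel_measurable M" for n
    unfolding R_def[abs_def] by measurable
  have Llim: "(\<lambda>n. L n \<omega>) \<longlonglongrightarrow> f (hit \<omega>, Wtilde x0 \<beta> W (hit \<omega> + \<kappa> (hit \<omega>)) \<omega>)" if w: "\<omega> \<in> Hit" for \<omega>
  proof -
    have sp: "\<omega> \<in> space M" and fin: "Tstar x0 \<beta> W \<omega> < \<infinity>" using w unfolding Hit_def by auto
    have w0: "Wtilde x0 \<beta> W (hit \<omega>) \<omega> = 0"
      unfolding hit_def using W_continuous[OF sp] W_0[OF sp] x0 fin by (rule Wtilde_at_Tstar)
    have c: "continuous_on {0..} (\<lambda>t. Wtilde x0 \<beta> W t \<omega>)" by (intro Wtilde_continuous_on W_continuous sp)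
    have "(\<lambda>n. Wtilde x0 \<beta> W (g n \<omega>) \<omega>) \<longlonglongrightarrow> 0"
      unfolding w0[symmetric] using g0 hit_nonneg by (intro continuous_on_tendsto_compose[OF c glim(1)]) auto
    moreover have "(\<lambda>n. Wtilde x0 \<beta> W (g n \<omega> + \<kappa> (g n \<omega>)) \<omega>) \<longlonglongrightarrow> Wtilde x0 \<beta> W (hit \<omega> + \<kappa> (hit \<omega>)) \<omega>"
      using g0 hit_nonneg \<kappa>(1) by (intro continuous_on_tendsto_compose[OF c tendsto_add[OF glim]]) auto
    ultimately have "(\<lambda>n. Wtilde x0 \<beta> W (g n \<omega> + \<kappa> (g n \<omega>)) \<omega> - Wtilde x0 \<beta> W (g n \<omega>) \<omega>) \<longlonglongrightarrow> Wtilde x0 \<beta> W (hit \<omega> + \<kappa> (hit \<omega>)) \<omega> - 0"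
      by (intro tendsto_diff)
    then have "(\<lambda>n. W (g n \<omega> + \<kappa> (g n \<omega>)) \<omega> - W (g n \<omega>) \<omega> + \<beta> * \<kappa> (g n \<omega>)) \<longlonglongrightarrow> Wtilde x0 \<beta> W (hit \<omega> + \<kappa> (hit \<omega>)) \<omega>"
      by (simp add: Wt)
    then show ?thesis unfolding L_def
      by (intro continuous_on_tendsto_compose[OF f] tendsto_Pair glim) auto
  qed
  have Rlim: "(\<lambda>n. R n \<omega>) \<longlonglongrightarrow> (\<integral>\<^sup>+y. ennreal (f (hit \<omega>, \<beta> * \<kappa> (hit \<omega>) + sqrt (\<kappa> (hit \<omega>)) * y)) \<partial>std_normal_distribution)" for \<omega>
    unfolding R_def
  proof (rule nn_integral_dominated_convergence[where w="\<lambda>_. 1"])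
    show "AE y in std_normal_distribution. (\<lambda>n. ennreal (f (g n \<omega>, \<beta> * \<kappa> (g n \<omega>) + sqrt (\<kappa> (g n \<omega>)) * y))) \<longlonglongrightarrow>
        ennreal (f (hit \<omega>, \<beta> * \<kappa> (hit \<omega>) + sqrt (\<kappa> (hit \<omega>)) * y))"
      by (intro AE_I2 tendsto_ennrealI continuous_on_tendsto_compose[OF f] tendsto_intros glim) auto
  qed (use f01 N.emeasure_space_1 in \<open>auto simp del: space_density\<close>)
  have R1: "R n \<omega> \<le> 1" for n \<omega>
  proof -
    have "R n \<omega> \<le> (\<integral>\<^sup>+y. 1 \<partial>std_normal_distribution)"
      unfolding R_def using f01 by (intro nn_integral_mono) auto
    then show ?thesis using N.emeasure_space_1 by simp
  qed
  have "(\<lambda>n. \<integral>\<^sup>+\<omega>. ennreal (L n \<omega>) * indicator Hit \<omega> \<partial>M) \<longlonglongrightarrow> ?L"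
  proof (rule nn_integral_dominated_convergence[where w="\<lambda>_. 1"])
    show "AE \<omega> in M. (\<lambda>n. ennreal (L n \<omega>) * indicator Hit \<omega>) \<longlonglongrightarrow> ennreal (f (hit \<omega>, Wtilde x0 \<beta> W (hit \<omega> + \<kappa> (hit \<omega>)) \<omega>)) * indicator Hit \<omega>"
      using tendsto_ennrealI[OF Llim] by (intro AE_I2) (auto split: split_indicator)
    show "AE \<omega> in M. ennreal (L n \<omega>) * indicator Hit \<omega> \<le> 1" for n
      using f01 by (intro AE_I2) (auto simp: L_def split: split_indicator)
  qed (auto simp: emeasure_space_1)
  moreover have "(\<lambda>n. \<integral>\<^sup>+\<omega>. R n \<omega> * indicator Hit \<omega> \<partial>M) \<longlonglongrightarrow> ?R"
  proof (rule nn_integral_dominated_convergence[where w="\<lambda>_. 1"])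
    show "AE \<omega> in M. (\<lambda>n. R n \<omega> * indicator Hit \<omega>) \<longlonglongrightarrow> (\<integral>\<^sup>+y. ennreal (f (hit \<omega>, \<beta> * \<kappa> (hit \<omega>) + sqrt (\<kappa> (hit \<omega>)) * y)) \<partial>std_normal_distribution) * indicator Hit \<omega>"
      using Rlim by (intro AE_I2) (auto split: split_indicator)
    show "AE \<omega> in M. R n \<omega> * indicator Hit \<omega> \<le> 1" for n
      using R1 by (intro AE_I2) (auto split: split_indicator)
  qed (auto simp: emeasure_space_1)
  ultimately show ?thesis unfolding eq by (rule LIMSEQ_unique)
qed

text \<open>In general a sub-probability: integrals against it carry the condition that 0 is reached
  at all, which can fail when the drift points upwards.\<close>

definition hit_law :: "'a measure" where "hit_law = density M (indicator Hit)"

lemma sets_hit_law[measurable_cong]: "sets hit_law = sets M"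
  unfolding hit_law_def by simp

lemma finite_measure_hit_law: "finite_measure hit_law"
  unfolding hit_law_def by (rule finite_measureI) (simp add: emeasure_density emeasure_finite)

lemma nn_integral_hit_law:
  assumes "f \<in> borel_measurable M"
  shows "(\<integral>\<^sup>+\<omega>. f \<omega> \<partial>hit_law) = (\<integral>\<^sup>+\<omega>. f \<omega> * indicator Hit \<omega> \<partial>M)"
  unfolding hit_law_def using assms by (subst nn_integral_density) (auto simp: mult.commute)

text \<open>Passing from continuous test functions to an equality of laws makes the property
  available for discontinuous and for complex-valued integrands.\<close>

lemma strong_markov_distr:
  assumes \<kappa>: "\<And>a. 0 \<le> a \<Longrightarrow> 0 \<le> \<kappa> a" "\<And>a. 0 \<le> a \<Longrightarrow> continuous (at_right a) \<kappa>"
    and \<kappa>m[measurable]: "\<kappa> \<in> borel_measurable borel"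
  shows "distr hit_law (borel \<Otimes>\<^sub>M borel) (\<lambda>\<omega>. (hit \<omega>, Wtilde x0 \<beta> W (hit \<omega> + \<kappa> (hit \<omega>)) \<omega>)) =
    distr (hit_law \<Otimes>\<^sub>M std_normal_distribution) (borel \<Otimes>\<^sub>M borel)
      (\<lambda>p. (hit (fst p), \<beta> * \<kappa> (hit (fst p)) + sqrt (\<kappa> (hit (fst p))) * snd p))"
proof -
  interpret N: prob_space std_normal_distribution by (rule prob_space_normal_density) simp
  interpret D: finite_measure hit_law by (rule finite_measure_hit_law)
  interpret P: pair_sigma_finite hit_law std_normal_distribution ..
  have [measurable]: "(\<lambda>\<omega>. Wtilde x0 \<beta> W (hit \<omega> + \<kappa> (hit \<omega>)) \<omega>) \<in> borel_measurable M"
    using \<kappa> hit_nonneg by (auto intro!: Wtilde_process_measurable)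
  show ?thesis
    unfolding borel_prod
  proof (rule finite_measure_eqI_continuous)
    show "finite_measure (distr hit_law borel (\<lambda>\<omega>. (hit \<omega>, Wtilde x0 \<beta> W (hit \<omega> + \<kappa> (hit \<omega>)) \<omega>)))"
      by (rule D.finite_measure_distr) (simp add: borel_prod[symmetric])
    fix f :: "real \<times> real \<Rightarrow> real" assume f: "continuous_on UNIV f" "\<And>x. 0 \<le> f x \<and> f x \<le> 1"
    have [measurable]: "f \<in> borel_measurable (borel \<Otimes>\<^sub>M borel)"
      unfolding borel_prod by (rule borel_measurable_continuous_onI[OF f(1)])
    have "(\<integral>\<^sup>+x. ennreal (f x) \<partial>distr hit_law (borel \<Otimes>\<^sub>M borel) (\<lambda>\<omega>. (hit \<omega>, Wtilde x0 \<beta> W (hit \<omega> + \<kappa> (hit \<omega>)) \<omega>)))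
       = (\<integral>\<^sup>+\<omega>. ennreal (f (hit \<omega>, Wtilde x0 \<beta> W (hit \<omega> + \<kappa> (hit \<omega>)) \<omega>)) * indicator Hit \<omega> \<partial>M)"
      by (simp add: nn_integral_distr nn_integral_hit_law)
    also have "\<dots> = (\<integral>\<^sup>+\<omega>. (\<integral>\<^sup>+y. ennreal (f (hit \<omega>, \<beta> * \<kappa> (hit \<omega>) + sqrt (\<kappa> (hit \<omega>)) * y)) \<partial>std_normal_distribution) * indicator Hit \<omega> \<partial>M)"
      by (rule strong_markov_continuous[OF \<kappa> \<kappa>m f])
    also have "\<dots> = (\<integral>\<^sup>+\<omega>. (\<integral>\<^sup>+y. ennreal (f (hit \<omega>, \<beta> * \<kappa> (hit \<omega>) + sqrt (\<kappa> (hit \<omega>)) * y)) \<partial>std_normal_distribution) \<partial>hit_law)"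
      by (subst nn_integral_hit_law) measurable
    also have "\<dots> = (\<integral>\<^sup>+p. ennreal (f (hit (fst p), \<beta> * \<kappa> (hit (fst p)) + sqrt (\<kappa> (hit (fst p))) * snd p)) \<partial>(hit_law \<Otimes>\<^sub>M std_normal_distribution))"
    proof -
      have m: "(\<lambda>p. ennreal (f (hit (fst p), \<beta> * \<kappa> (hit (fst p)) + sqrt (\<kappa> (hit (fst p))) * snd p)))
          \<in> borel_measurable (hit_law \<Otimes>\<^sub>M std_normal_distribution)" by measurable
      show ?thesis using N.nn_integral_fst[OF m] by simp
    qed
    also have "\<dots> = (\<integral>\<^sup>+x. ennreal (f x) \<partial>distr (hit_law \<Otimes>\<^sub>M std_normal_distribution) (borel \<Otimes>\<^sub>M borel)
      (\<lambda>p. (hit (fst p), \<beta> * \<kappa> (hit (fst p)) + sqrt (\<kappa> (hit (fst p))) * snd p)))"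
      by (subst nn_integral_distr) measurable
    finally show "(\<integral>\<^sup>+x. ennreal (f x) \<partial>distr hit_law borel (\<lambda>\<omega>. (hit \<omega>, Wtilde x0 \<beta> W (hit \<omega> + \<kappa> (hit \<omega>)) \<omega>)))
       = (\<integral>\<^sup>+x. ennreal (f x) \<partial>distr (hit_law \<Otimes>\<^sub>M std_normal_distribution) borel
      (\<lambda>p. (hit (fst p), \<beta> * \<kappa> (hit (fst p)) + sqrt (\<kappa> (hit (fst p))) * snd p)))"
      unfolding borel_prod .
  qed auto
qed

end

section \<open>Laplace and Fourier transform of the hitting time\<close>

text \<open>Completing the square by a real translation: for \<open>z = a + i b\<close>, shifting by
  \<open>a\<close> leaves the characteristic function at \<open>b\<close>, so no contour has to be
  moved.\<close>

lemma normal_mgf_complex: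
  fixes z :: complex
  shows "integrable std_normal_distribution (\<lambda>y. exp (z * complex_of_real y))"
    and "(CLINT y|std_normal_distribution. exp (z * complex_of_real y)) = exp (z\<^sup>2 / 2)"
proof -
  define a b where "a = Re z" and "b = Im z"
  have z: "z = complex_of_real a + \<i> * complex_of_real b" by (simp add: a_def b_def complex_eq)
  let ?g = "\<lambda>y. std_normal_density y *\<^sub>R exp (z * complex_of_real y)"
  let ?h = "\<lambda>v. exp (complex_of_real (a\<^sup>2 / 2) + \<i> * complex_of_real (a * b)) * (std_normal_density v *\<^sub>R iexp (b * v))"
  have gh: "?g (a + 1 * v) = ?h v" for v
  proof -
    have "complex_of_real (- (a + v)\<^sup>2 / 2) + z * complex_of_real (a + v) =
      (complex_of_real (a\<^sup>2 / 2) + \<i> * complex_of_real (a * b)) + (complex_of_real (- v\<^sup>2 / 2) + \<i> * complex_of_real (b * v))"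
      unfolding z by (simp add: field_simps power2_eq_square)
    then have "exp (complex_of_real (- (a + v)\<^sup>2 / 2)) * exp (z * complex_of_real (a + v)) =
      exp (complex_of_real (a\<^sup>2 / 2) + \<i> * complex_of_real (a * b)) * (exp (complex_of_real (- v\<^sup>2 / 2)) * iexp (b * v))"
      by (simp only: exp_add[symmetric])
    then show ?thesis
      unfolding std_normal_density_def scaleR_conv_of_real of_real_mult exp_of_real[symmetric]
      by (simp only: mult_1_left mult.assoc mult.left_commute[of _ "complex_of_real (1 / sqrt (2 * pi))"])
  qed
  have char: "(CLINT v|std_normal_distribution. iexp (b * v)) = complex_of_real (exp (- b\<^sup>2 / 2))"
    using char_std_normal_distribution unfolding char_def by metis
  have inth: "integrable lborel (\<lambda>v. std_normal_density v *\<^sub>R iexp (b * v))"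
    by (rule Bochner_Integration.integrable_bound[OF integrable_normal_density[of 1 0]]) auto
  have "integrable lborel (\<lambda>v. ?g (a + 1 * v))"
    unfolding gh using inth by (rule integrable_mult_right)
  then have intg: "integrable lborel ?g"
    by (subst (asm) lborel_integrable_real_affine_iff) auto
  then show "integrable std_normal_distribution (\<lambda>y. exp (z * complex_of_real y))"
    by (subst integrable_density) auto
  have "(CLINT y|std_normal_distribution. exp (z * complex_of_real y)) = (CLBINT y. ?g y)"
    by (subst integral_density) auto
  also have "\<dots> = (CLBINT v. ?g (a + 1 * v))"
    by (subst lborel_integral_real_affine[where c=1 and t=a]) auto
  also have "\<dots> = exp (complex_of_real (a\<^sup>2 / 2) + \<i> * complex_of_real (a * b)) * (CLBINT v. std_normal_density v *\<^sub>R iexp (b * v))"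
    unfolding gh by (rule integral_mult_right_zero)
  also have "(CLBINT v. std_normal_density v *\<^sub>R iexp (b * v)) = (CLINT v|std_normal_distribution. iexp (b * v))"
    by (subst integral_density) auto
  also have "\<dots> = exp (complex_of_real (- b\<^sup>2 / 2))" unfolding char by (rule exp_of_real[symmetric])
  also have "exp (complex_of_real (a\<^sup>2 / 2) + \<i> * complex_of_real (a * b)) * exp (complex_of_real (- b\<^sup>2 / 2)) = exp (z\<^sup>2 / 2)"
    unfolding exp_add[symmetric] z by (rule arg_cong[where f=exp]) (simp add: power2_eq_square field_simps)
  finally show "(CLINT y|std_normal_distribution. exp (z * complex_of_real y)) = exp (z\<^sup>2 / 2)" .
qed

text \<open>Makes the real part of \<open>- \<beta> - csqrt (...)\<close> nonpositive whatever the
  sign of the drift.\<close>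

lemma Re_csqrt_ge_abs:
  assumes "0 \<le> Re q"
  shows "\<bar>b\<bar> \<le> Re (csqrt (complex_of_real (b\<^sup>2) + 2 * q))"
proof -
  let ?w = "complex_of_real (b\<^sup>2) + 2 * q"
  have "b\<^sup>2 \<le> Re ?w" using assms by simp
  moreover have "Re ?w \<le> cmod ?w" by (rule complex_Re_le_cmod)
  moreover have "s \<le> (c + r) / 2" if "s \<le> r" "r \<le> c" for s r c :: real using that by simp
  ultimately have "b\<^sup>2 \<le> (cmod ?w + Re ?w) / 2" by blast
  then have "sqrt (b\<^sup>2) \<le> sqrt ((cmod ?w + Re ?w) / 2)" by (rule real_sqrt_le_mono)
  then show ?thesis by simp
qed

context bm_hitting begin

lemma expectation_exp_Wtilde:
  fixes \<theta> :: complex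
  assumes t: "0 \<le> t"
  shows "integrable M (\<lambda>\<omega>. exp (\<theta> * complex_of_real (Wtilde x0 \<beta> W t \<omega>)))"
    and "(CLINT \<omega>|M. exp (\<theta> * complex_of_real (Wtilde x0 \<beta> W t \<omega>))) = exp (\<theta> * x0 + (\<theta>\<^sup>2 / 2 + \<beta> * \<theta>) * t)"
proof -
  have d: "distr M borel (\<lambda>\<omega>. W t \<omega> - W 0 \<omega>) = distr std_normal_distribution borel (\<lambda>y. sqrt t * y)"
    using distr_increment[of 0 t] t by simp
  let ?g = "\<lambda>x. exp (\<theta> * complex_of_real (x0 + x + \<beta> * t))"
  have g: "?g (sqrt t * y) = exp (\<theta> * (x0 + \<beta> * t)) * exp ((\<theta> * sqrt t) * complex_of_real y)" for y
    by (simp add: exp_add[symmetric] algebra_simps)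
  have eq: "exp (\<theta> * complex_of_real (Wtilde x0 \<beta> W t \<omega>)) = ?g (W t \<omega> - W 0 \<omega>)" if "\<omega> \<in> space M" for \<omega>
    using W_0[OF that] by (simp add: Wtilde_def)
  have "integrable std_normal_distribution (\<lambda>y. ?g (sqrt t * y))"
    unfolding g by (intro integrable_mult_right normal_mgf_complex(1))
  then have "integrable (distr std_normal_distribution borel (\<lambda>y. sqrt t * y)) ?g"
    by (subst integrable_distr_eq) auto
  then have "integrable M (\<lambda>\<omega>. ?g (W t \<omega> - W 0 \<omega>))"
    unfolding d[symmetric] by (subst (asm) integrable_distr_eq) auto
  then show "integrable M (\<lambda>\<omega>. exp (\<theta> * complex_of_real (Wtilde x0 \<beta> W t \<omega>)))"
    using eq by (simp cong: Bochner_Integration.integrable_cong)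
  have "(CLINT \<omega>|M. exp (\<theta> * complex_of_real (Wtilde x0 \<beta> W t \<omega>))) = (CLINT \<omega>|M. ?g (W t \<omega> - W 0 \<omega>))"
    using eq by (intro Bochner_Integration.integral_cong) auto
  also have "\<dots> = (CLINT x|distr M borel (\<lambda>\<omega>. W t \<omega> - W 0 \<omega>). ?g x)"
    by (subst integral_distr) auto
  also have "\<dots> = (CLINT y|std_normal_distribution. ?g (sqrt t * y))"
    unfolding d by (subst integral_distr) auto
  also have "\<dots> = exp (\<theta> * (x0 + \<beta> * t)) * exp ((\<theta> * sqrt t)\<^sup>2 / 2)"
    unfolding g integral_mult_right_zero normal_mgf_complex(2) ..
  also have "\<dots> = exp (\<theta> * x0 + (\<theta>\<^sup>2 / 2 + \<beta> * \<theta>) * t)"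
    using t by (simp add: exp_add[symmetric] algebra_simps power_mult_distrib of_real_power[symmetric] del: of_real_power)
  finally show "(CLINT \<omega>|M. exp (\<theta> * complex_of_real (Wtilde x0 \<beta> W t \<omega>))) = exp (\<theta> * x0 + (\<theta>\<^sup>2 / 2 + \<beta> * \<theta>) * t)" .
qed

text \<open>With duration \<open>max 0 (t - a)\<close> the strong Markov property restarts the path
  from 0 at the hitting time and observes it at the fixed time \<open>t\<close>; the exponential
  moment of the remaining increment is \<open>exp (q * (t - hit \<omega>))\<close>. This does the
  work of optional stopping.\<close>

lemma stopped_exp_Wtilde:
  fixes \<theta> q :: complex
  assumes t: "0 \<le> t"
  defines "q \<equiv> \<theta>\<^sup>2 / 2 + \<beta> * \<theta>"
  shows "(CLINT \<omega>|hit_law. indicator {..t} (hit \<omega>) * exp (\<theta> * complex_of_real (Wtilde x0 \<beta> W t \<omega>))) =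
    (CLINT \<omega>|hit_law. indicator {..t} (hit \<omega>) * exp (q * (t - hit \<omega>)))"
proof -
  interpret N: prob_space std_normal_distribution by (rule prob_space_normal_density) simp
  interpret D: finite_measure hit_law by (rule finite_measure_hit_law)
  interpret P: pair_sigma_finite hit_law std_normal_distribution ..
  define \<kappa> where "\<kappa> a = max 0 (t - a)" for a
  have \<kappa>: "0 \<le> \<kappa> a" "continuous (at_right a) \<kappa>" "\<kappa> \<in> borel_measurable borel" for a
    unfolding \<kappa>_def[abs_def] by (auto intro!: continuous_intros)
  note [measurable] = \<kappa>(3)
  have V[measurable]: "(\<lambda>\<omega>. Wtilde x0 \<beta> W (hit \<omega> + \<kappa> (hit \<omega>)) \<omega>) \<in> borel_measurable M"
    using \<kappa> hit_nonneg by (auto intro!: Wtilde_process_measurable)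
  define h :: "real \<times> real \<Rightarrow> complex" where "h p = indicator {..t} (fst p) * exp (\<theta> * complex_of_real (snd p))" for p
  have h[measurable]: "h \<in> borel_measurable (borel \<Otimes>\<^sub>M borel)" unfolding h_def[abs_def] by measurable
  let ?U = "\<lambda>p. (hit (fst p), \<beta> * \<kappa> (hit (fst p)) + sqrt (\<kappa> (hit (fst p))) * snd p)"
  have hU: "h (?U (\<omega>, y)) = (indicator {..t} (hit \<omega>) * exp (\<theta> * \<beta> * \<kappa> (hit \<omega>))) * exp ((\<theta> * sqrt (\<kappa> (hit \<omega>))) * complex_of_real y)" for \<omega> y
    by (simp add: h_def exp_add[symmetric] algebra_simps)
  have inner: "(CLINT y|std_normal_distribution. h (?U (\<omega>, y))) = indicator {..t} (hit \<omega>) * exp (q * \<kappa> (hit \<omega>))" for \<omega>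
  proof -
    have "(complex_of_real (sqrt (\<kappa> (hit \<omega>))))\<^sup>2 = complex_of_real (\<kappa> (hit \<omega>))"
      using \<kappa>(1) by (simp add: of_real_power[symmetric] del: of_real_power)
    then show ?thesis
      unfolding hU integral_mult_right_zero normal_mgf_complex(2) q_def
      by (simp add: exp_add[symmetric] algebra_simps power_mult_distrib)
  qed
  have "(CLINT \<omega>|hit_law. h (hit \<omega>, Wtilde x0 \<beta> W (hit \<omega> + \<kappa> (hit \<omega>)) \<omega>)) =
    (CLINT x|distr hit_law (borel \<Otimes>\<^sub>M borel) (\<lambda>\<omega>. (hit \<omega>, Wtilde x0 \<beta> W (hit \<omega> + \<kappa> (hit \<omega>)) \<omega>)). h x)"
    by (subst integral_distr) auto
  also have "\<dots> = (CLINT p|(hit_law \<Otimes>\<^sub>M std_normal_distribution). h (?U p))"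
    unfolding strong_markov_distr[OF \<kappa>] by (subst integral_distr) auto
  also have "\<dots> = (CLINT \<omega>|hit_law. (CLINT y|std_normal_distribution. h (?U (\<omega>, y))))"
  proof (rule P.integral_fst'[symmetric], rule P.Fubini_integrable)
    show "(\<lambda>p. h (?U p)) \<in> borel_measurable (hit_law \<Otimes>\<^sub>M std_normal_distribution)" by measurable
    show "AE \<omega> in hit_law. integrable std_normal_distribution (\<lambda>y. h (?U (\<omega>, y)))"
      unfolding hU by (auto intro!: normal_mgf_complex)
    have *: "(\<integral>y. norm (h (?U (\<omega>, y))) \<partial>std_normal_distribution) =
        indicator {..t} (hit \<omega>) * exp (Re \<theta> * \<beta> * \<kappa> (hit \<omega>) + (Re \<theta>)\<^sup>2 / 2 * \<kappa> (hit \<omega>))" for \<omega>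
    proof -
      have "complex_of_real (\<integral>y. norm (h (?U (\<omega>, y))) \<partial>std_normal_distribution) =
        (CLINT y|std_normal_distribution. complex_of_real (norm (h (?U (\<omega>, y)))))" by simp
      also have "\<dots> = (CLINT y|std_normal_distribution. complex_of_real (indicator {..t} (hit \<omega>) * exp (Re \<theta> * \<beta> * \<kappa> (hit \<omega>))) *
         exp ((complex_of_real (Re \<theta> * sqrt (\<kappa> (hit \<omega>)))) * complex_of_real y))"
        unfolding hU by (intro Bochner_Integration.integral_cong refl) (simp add: norm_mult exp_of_real[symmetric] split: split_indicator)
      also have "\<dots> = complex_of_real (indicator {..t} (hit \<omega>) * exp (Re \<theta> * \<beta> * \<kappa> (hit \<omega>)) * exp ((Re \<theta> * sqrt (\<kappa> (hit \<omega>)))\<^sup>2 / 2))"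
        unfolding integral_mult_right_zero normal_mgf_complex(2)
        by (simp only: of_real_mult exp_of_real[symmetric]) simp
      also have "(Re \<theta> * sqrt (\<kappa> (hit \<omega>)))\<^sup>2 / 2 = (Re \<theta>)\<^sup>2 / 2 * \<kappa> (hit \<omega>)"
        using \<kappa>(1) by (simp add: power_mult_distrib)
      finally show ?thesis by (simp only: of_real_eq_iff exp_add mult.assoc)
    qed
    show "integrable hit_law (\<lambda>\<omega>. \<integral>y. norm (h (?U (\<omega>, y))) \<partial>std_normal_distribution)"
      unfolding *
    proof (rule D.integrable_const_bound[where B="exp ((\<bar>Re \<theta> * \<beta>\<bar> + (Re \<theta>)\<^sup>2 / 2) * t)"])
      have "exp (Re \<theta> * \<beta> * \<kappa> (hit \<omega>) + (Re \<theta>)\<^sup>2 / 2 * \<kappa> (hit \<omega>)) \<le> exp ((\<bar>Re \<theta> * \<beta>\<bar> + (Re \<theta>)\<^sup>2 / 2) * t)" for \<omega>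
      proof -
        have "\<kappa> (hit \<omega>) \<le> t" using hit_nonneg[of \<omega>] t unfolding \<kappa>_def by simp
        moreover have "Re \<theta> * \<beta> * \<kappa> (hit \<omega>) \<le> \<bar>Re \<theta> * \<beta>\<bar> * \<kappa> (hit \<omega>)" using \<kappa>(1) by (intro mult_right_mono) auto
        ultimately show ?thesis
          using mult_left_mono[of "\<kappa> (hit \<omega>)" t "\<bar>Re \<theta> * \<beta>\<bar> + (Re \<theta>)\<^sup>2 / 2"] by (simp add: distrib_right)
      qed
      then show "AE \<omega> in hit_law. norm (indicator {..t} (hit \<omega>) * exp (Re \<theta> * \<beta> * \<kappa> (hit \<omega>) + (Re \<theta>)\<^sup>2 / 2 * \<kappa> (hit \<omega>))) \<le> exp ((\<bar>Re \<theta> * \<beta>\<bar> + (Re \<theta>)\<^sup>2 / 2) * t)"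
        by (intro AE_I2) (auto split: split_indicator)
    qed measurable
  qed
  also have "\<dots> = (CLINT \<omega>|hit_law. indicator {..t} (hit \<omega>) * exp (q * \<kappa> (hit \<omega>)))"
    unfolding inner ..
  also have "\<dots> = (CLINT \<omega>|hit_law. indicator {..t} (hit \<omega>) * exp (q * (t - hit \<omega>)))"
    by (intro Bochner_Integration.integral_cong refl) (auto simp: \<kappa>_def max_def split: split_indicator)
  also have "(CLINT \<omega>|hit_law. h (hit \<omega>, Wtilde x0 \<beta> W (hit \<omega> + \<kappa> (hit \<omega>)) \<omega>)) =
     (CLINT \<omega>|hit_law. indicator {..t} (hit \<omega>) * exp (\<theta> * complex_of_real (Wtilde x0 \<beta> W t \<omega>)))"
    by (intro Bochner_Integration.integral_cong refl) (auto simp: h_def \<kappa>_def max_def split: split_indicator)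
  finally show ?thesis .
qed

lemma integral_hit_law:
  fixes f :: "'a \<Rightarrow> complex"
  assumes "f \<in> borel_measurable M"
  shows "(\<integral>\<omega>. f \<omega> \<partial>hit_law) = (\<integral>\<omega>. indicator Hit \<omega> *\<^sub>R f \<omega> \<partial>M)"
proof -
  have "hit_law = density M (\<lambda>\<omega>. ennreal (indicator Hit \<omega>))"
    unfolding hit_law_def by (simp add: ennreal_indicator)
  then show ?thesis using assms by (simp add: integral_density)
qed

text \<open>The exponential moment at time \<open>n\<close> is split according to whether 0 has been
  reached. The unreached part has modulus at most 1, since there the path is positive and the
  exponent has nonpositive real part; multiplication by \<open>exp (- q * n)\<close> makes it vanish
  in the limit.\<close>

lemma laplace_hit:
  fixes q :: complex
  assumes q: "0 < Re q"
  shows "(CLINT \<omega>|hit_law. exp (- q * hit \<omega>)) = exp (- x0 * (\<beta> + csqrt (complex_of_real (\<beta>\<^sup>2) + 2 * q)))"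
proof -
  interpret D: finite_measure hit_law by (rule finite_measure_hit_law)
  \<comment> \<open>Of the two roots of \<open>\<theta>\<^sup>2 / 2 + \<beta> * \<theta> = q\<close>
    this is the one whose real part is guaranteed to be nonpositive.\<close>
  define \<theta> where "\<theta> = - \<beta> - csqrt (complex_of_real (\<beta>\<^sup>2) + 2 * q)"
  have \<theta>q: "\<theta>\<^sup>2 / 2 + \<beta> * \<theta> = q"
  proof -
    have "(\<theta> + \<beta>)\<^sup>2 = complex_of_real (\<beta>\<^sup>2) + 2 * q" unfolding \<theta>_def by simp
    then show ?thesis by (simp add: power2_eq_square field_simps)
  qed
  have Re\<theta>: "Re \<theta> \<le> 0" using Re_csqrt_ge_abs[of q \<beta>] q unfolding \<theta>_def by auto
  note [measurable] = Wtilde_measurable[OF W_measurable]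
  have bound: "norm (exp (\<theta> * x0) - (CLINT \<omega>|hit_law. indicator {..real n} (hit \<omega>) * exp (- q * hit \<omega>))) \<le> exp (- Re q * real n)" for n
  proof -
    define t where "t = real n"
    have t: "0 \<le> t" by (simp add: t_def)
    let ?E = "\<lambda>\<omega>. exp (\<theta> * complex_of_real (Wtilde x0 \<beta> W t \<omega>))"
    have int: "integrable M ?E" by (rule expectation_exp_Wtilde[OF t])
    define A where "A = {\<omega> \<in> Hit. hit \<omega> \<le> t}"
    have [measurable]: "A \<in> sets M" unfolding A_def by measurable
    have "(CLINT \<omega>|M. ?E \<omega>) = (CLINT \<omega>|M. indicator A \<omega> *\<^sub>R ?E \<omega> + indicator (space M - A) \<omega> *\<^sub>R ?E \<omega>)"
      by (intro Bochner_Integration.integral_cong refl) (auto split: split_indicator)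
    also have "\<dots> = (CLINT \<omega>|M. indicator A \<omega> *\<^sub>R ?E \<omega>) + (CLINT \<omega>|M. indicator (space M - A) \<omega> *\<^sub>R ?E \<omega>)"
      using int by (intro Bochner_Integration.integral_add integrable_mult_indicator) auto
    also have "(CLINT \<omega>|M. indicator A \<omega> *\<^sub>R ?E \<omega>) = (CLINT \<omega>|hit_law. indicator {..t} (hit \<omega>) * ?E \<omega>)"
      by (subst integral_hit_law) (auto simp: A_def intro!: Bochner_Integration.integral_cong split: split_indicator)
    also have "\<dots> = (CLINT \<omega>|hit_law. indicator {..t} (hit \<omega>) * exp (q * (t - hit \<omega>)))"
      using stopped_exp_Wtilde[OF t, of \<theta>] \<theta>q by simp
    also have "\<dots> = (CLINT \<omega>|hit_law. exp (q * t) * (indicator {..t} (hit \<omega>) * exp (- q * hit \<omega>)))"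
      by (intro Bochner_Integration.integral_cong refl) (simp add: exp_add[symmetric] algebra_simps split: split_indicator)
    also have "\<dots> = exp (q * t) * (CLINT \<omega>|hit_law. indicator {..t} (hit \<omega>) * exp (- q * hit \<omega>))"
      by simp
    finally have eq: "exp (\<theta> * x0 + q * t) = exp (q * t) * (CLINT \<omega>|hit_law. indicator {..t} (hit \<omega>) * exp (- q * hit \<omega>)) + (CLINT \<omega>|M. indicator (space M - A) \<omega> *\<^sub>R ?E \<omega>)"
      using expectation_exp_Wtilde(2)[OF t, of \<theta>] \<theta>q by simp
    have "norm (CLINT \<omega>|M. indicator (space M - A) \<omega> *\<^sub>R ?E \<omega>) \<le> (LINT \<omega>|M. norm (indicator (space M - A) \<omega> *\<^sub>R ?E \<omega>))"
      by (rule integral_norm_bound)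
    also have "\<dots> \<le> (LINT \<omega>|M. 1)"
    proof (rule integral_mono_AE')
      show "AE \<omega> in M. norm (indicator (space M - A) \<omega> *\<^sub>R ?E \<omega>) \<le> 1"
      proof (rule AE_I2)
        fix \<omega> assume w: "\<omega> \<in> space M"
        show "norm (indicator (space M - A) \<omega> *\<^sub>R ?E \<omega>) \<le> 1"
        proof (cases "\<omega> \<in> A")
          case False
          have "ereal t < Tstar x0 \<beta> W \<omega>"
          proof (cases "\<omega> \<in> Hit")
            case True then show ?thesis using False Tstar_eq_hit[OF True] unfolding A_def by auto
          next
            case False then show ?thesis using w unfolding Hit_def by auto
          qed
          then have "0 \<le> Wtilde x0 \<beta> W t \<omega>" by (rule less_imp_le[OF Wtilde_pos_before_Tstar[OF t]])
          then have "Re \<theta> * Wtilde x0 \<beta> W t \<omega> \<le> 0" using Re\<theta> by (rule mult_nonpos_nonneg[rotated])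
          then show ?thesis by (simp split: split_indicator)
        qed auto
      qed
    qed auto
    finally have r: "norm (CLINT \<omega>|M. indicator (space M - A) \<omega> *\<^sub>R ?E \<omega>) \<le> 1" by (simp add: prob_space)
    have "exp (\<theta> * x0) - (CLINT \<omega>|hit_law. indicator {..t} (hit \<omega>) * exp (- q * hit \<omega>)) =
      exp (- q * t) * (CLINT \<omega>|M. indicator (space M - A) \<omega> *\<^sub>R ?E \<omega>)"
    proof -
      have inv: "exp (- q * t) * exp (q * t) = 1" by (simp add: exp_add[symmetric])
      have "exp (- q * t) * exp (\<theta> * x0 + q * t) = exp (- q * t + (\<theta> * x0 + q * t))"
        by (rule exp_add[symmetric])
      also have "- q * t + (\<theta> * x0 + q * t) = \<theta> * x0" by simp
      finally have "exp (\<theta> * x0) = exp (- q * t) * exp (\<theta> * x0 + q * t)" by simp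
      also have "\<dots> = (CLINT \<omega>|hit_law. indicator {..t} (hit \<omega>) * exp (- q * hit \<omega>)) +
         exp (- q * t) * (CLINT \<omega>|M. indicator (space M - A) \<omega> *\<^sub>R ?E \<omega>)"
        unfolding eq by (simp only: distrib_left mult.assoc[symmetric] inv mult_1_left)
      finally show ?thesis by simp
    qed
    then have "norm (exp (\<theta> * x0) - (CLINT \<omega>|hit_law. indicator {..t} (hit \<omega>) * exp (- q * hit \<omega>))) =
      exp (- Re q * t) * norm (CLINT \<omega>|M. indicator (space M - A) \<omega> *\<^sub>R ?E \<omega>)"
      by (simp add: norm_mult)
    also have "\<dots> \<le> exp (- Re q * t) * 1" using r by (intro mult_left_mono) auto
    finally show ?thesis unfolding t_def by simp
  qed
  have "(\<lambda>n. exp (- Re q * real n)) \<longlonglongrightarrow> 0" using q by real_asymp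
  then have "(\<lambda>n. exp (\<theta> * x0) - (CLINT \<omega>|hit_law. indicator {..real n} (hit \<omega>) * exp (- q * hit \<omega>))) \<longlonglongrightarrow> 0"
    by (rule Lim_null_comparison[rotated]) (intro always_eventually allI bound)
  moreover have "(\<lambda>n. exp (\<theta> * x0) - (CLINT \<omega>|hit_law. indicator {..real n} (hit \<omega>) * exp (- q * hit \<omega>))) \<longlonglongrightarrow>
      exp (\<theta> * x0) - (CLINT \<omega>|hit_law. exp (- q * hit \<omega>))"
  proof (intro tendsto_diff tendsto_const integral_dominated_convergence[where w="\<lambda>_. 1"])
    show "AE \<omega> in hit_law. (\<lambda>n. indicator {..real n} (hit \<omega>) * exp (- q * hit \<omega>)) \<longlonglongrightarrow> exp (- q * hit \<omega>)"
    proof (rule AE_I2)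
      fix \<omega>
      obtain n0 where "hit \<omega> \<le> real n0" using real_arch_simple by blast
      then have "indicator {..real n} (hit \<omega>) * exp (- q * hit \<omega>) = exp (- q * hit \<omega>)" if "n0 \<le> n" for n
        using that by (simp add: order_trans[of "hit \<omega>" "real n0"])
      then have "\<forall>\<^sub>F n in sequentially. indicator {..real n} (hit \<omega>) * exp (- q * hit \<omega>) = exp (- q * hit \<omega>)"
        by (rule eventually_sequentiallyI)
      then show "(\<lambda>n. indicator {..real n} (hit \<omega>) * exp (- q * hit \<omega>)) \<longlonglongrightarrow> exp (- q * hit \<omega>)"
        by (rule tendsto_eventually)
    qed
    show "AE \<omega> in hit_law. norm (indicator {..real n} (hit \<omega>) * exp (- q * hit \<omega>)) \<le> 1" for n
      using q hit_nonneg by (intro AE_I2) (auto simp: norm_mult split: split_indicator)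
  qed auto
  ultimately have "exp (\<theta> * x0) - (CLINT \<omega>|hit_law. exp (- q * hit \<omega>)) = 0"
    using LIMSEQ_unique by blast
  then show ?thesis by (simp add: \<theta>_def algebra_simps)
qed

end

text \<open>From \<open>(1 + u / 4) ^ 4 \<le> exp u\<close> with \<open>u = c * sqrt |z|\<close>:
  the fourth power of \<open>u\<close> is a multiple of \<open>z\<^sup>2\<close>, so the function is
  dominated by a multiple of \<open>1 / (1 + z\<^sup>2)\<close>. Hence the 256.\<close>

lemma integrable_exp_neg_sqrt_abs:
  fixes c :: real
  assumes c: "0 < c"
  shows "integrable lborel (\<lambda>z. exp (- c * sqrt \<bar>z\<bar>))"
proof -
  have 1: "integrable lborel (\<lambda>z::real. inverse (1 + z\<^sup>2))"
    using integrable_inverse_1_plus_square by (simp add: einterval_def set_integrable_def)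
  show ?thesis
  proof (rule Bochner_Integration.integrable_bound)
    show "integrable lborel (\<lambda>z::real. (1 + 256 / c ^ 4) * inverse (1 + z\<^sup>2))"
      using 1 by (rule integrable_mult_right)
    show "AE z in lborel. norm (exp (- c * sqrt \<bar>z\<bar>)) \<le> norm ((1 + 256 / c ^ 4) * inverse (1 + z\<^sup>2))"
    proof (rule AE_I2)
      fix z :: real
      define u where "u = c * sqrt \<bar>z\<bar>"
      have u0: "0 \<le> u" using c by (simp add: u_def)
      have u4: "u ^ 4 = c ^ 4 * z\<^sup>2"
      proof -
        have "sqrt \<bar>z\<bar> ^ 4 = (sqrt \<bar>z\<bar> ^ 2) ^ 2" by (simp only: power_mult[symmetric]) simp
        also have "\<dots> = z\<^sup>2" by simp
        finally show ?thesis by (simp add: u_def power_mult_distrib)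
      qed
      have "u ^ 4 / 256 \<le> exp u"
      proof -
        have "(u / 4) ^ 4 \<le> (1 + u / 4) ^ 4" using u0 by (intro power_mono) auto
        also have "\<dots> \<le> exp u" using exp_ge_one_plus_x_over_n_power_n[of 4 u] u0 by simp
        finally show ?thesis by (simp add: power_divide)
      qed
      moreover have "1 \<le> exp u" using u0 by simp
      ultimately have e: "1 + z\<^sup>2 \<le> (1 + 256 / c ^ 4) * exp u"
      proof -
        have "z\<^sup>2 = 256 / c ^ 4 * (u ^ 4 / 256)" using c unfolding u4 by simp
        also have "\<dots> \<le> 256 / c ^ 4 * exp u" using \<open>u ^ 4 / 256 \<le> exp u\<close> c by (intro mult_left_mono) auto
        finally have "z\<^sup>2 \<le> 256 / c ^ 4 * exp u" .
        then show ?thesis using \<open>1 \<le> exp u\<close> by (simp only: distrib_right mult_1_left add_mono)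
      qed
      have p: "0 < 1 + z\<^sup>2" by (simp add: add_pos_nonneg)
      have "exp (- u) \<le> (1 + 256 / c ^ 4) * inverse (1 + z\<^sup>2)"
        using e p by (simp add: exp_minus field_simps)
      then show "norm (exp (- c * sqrt \<bar>z\<bar>)) \<le> norm ((1 + 256 / c ^ 4) * inverse (1 + z\<^sup>2))"
        using c by (simp add: u_def)
    qed
  qed measurable
qed

text \<open>The imaginary part \<open>- 2 * z\<close> of the radicand alone forces this growth,
  uniformly in the drift; it is the source of the decay in \<open>z\<close> of all later
  integrands.\<close>

lemma Re_csqrt_ge_sqrt:
  fixes z :: real
  shows "sqrt \<bar>z\<bar> \<le> Re (csqrt (complex_of_real (b\<^sup>2) - 2 * \<i> * complex_of_real z))"
proof -
  define w where "w = complex_of_real (b\<^sup>2) - 2 * \<i> * complex_of_real z"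
  have Re: "0 \<le> Re w" and Im: "Im w = - 2 * z" by (auto simp: w_def)
  have "2 * \<bar>z\<bar> \<le> cmod w" using abs_Im_le_cmod[of w] Im by simp
  then have "\<bar>z\<bar> \<le> (cmod w + Re w) / 2" using Re by (simp add: field_simps)
  then have "sqrt \<bar>z\<bar> \<le> sqrt ((cmod w + Re w) / 2)" by (rule real_sqrt_le_mono)
  then show ?thesis unfolding w_def[symmetric] by simp
qed

context bm_hitting begin

text \<open>A boundary value of the Laplace transform, taken along
  \<open>q = 1 / (n + 1) - i z\<close>. For \<open>z \<noteq> 0\<close> the limiting radicand is off
  the branch cut of \<open>csqrt\<close>, also without drift.\<close>

lemma char_hit:
  assumes z: "z \<noteq> 0"
  shows "(CLINT \<omega>|hit_law. iexp (z * hit \<omega>)) =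
    exp (- x0 * (\<beta> + csqrt (complex_of_real (\<beta>\<^sup>2) - 2 * \<i> * complex_of_real z)))"
proof -
  interpret D: finite_measure hit_law by (rule finite_measure_hit_law)
  define q where "q n = complex_of_real (1 / real (Suc n)) - \<i> * complex_of_real z" for n
  have q0: "0 < Re (q n)" for n by (simp add: q_def)
  have "q \<longlonglongrightarrow> complex_of_real 0 - \<i> * complex_of_real z"
    unfolding q_def by (intro tendsto_diff tendsto_const tendsto_of_real LIMSEQ_inverse_real_of_nat[unfolded inverse_eq_divide])
  then have q: "q \<longlonglongrightarrow> - \<i> * complex_of_real z" by simp
  have L: "(\<lambda>n. CLINT \<omega>|hit_law. exp (- q n * hit \<omega>)) \<longlonglongrightarrow> (CLINT \<omega>|hit_law. exp (- (- \<i> * complex_of_real z) * hit \<omega>))"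
  proof (rule integral_dominated_convergence[where w="\<lambda>_. 1"])
    show "AE \<omega> in hit_law. (\<lambda>n. exp (- q n * hit \<omega>)) \<longlonglongrightarrow> exp (- (- \<i> * complex_of_real z) * hit \<omega>)"
      by (intro AE_I2 tendsto_intros q)
    show "AE \<omega> in hit_law. norm (exp (- q n * hit \<omega>)) \<le> 1" for n
      using q0[of n] hit_nonneg by (intro AE_I2) (simp add: mult_nonneg_nonneg less_imp_le)
  qed auto
  have nn: "complex_of_real (\<beta>\<^sup>2) + 2 * (- \<i> * complex_of_real z) \<notin> \<real>\<^sub>\<le>\<^sub>0"
    using z by (simp add: complex_nonpos_Reals_iff)
  have "(\<lambda>n. csqrt (complex_of_real (\<beta>\<^sup>2) + 2 * q n)) \<longlonglongrightarrow> csqrt (complex_of_real (\<beta>\<^sup>2) + 2 * (- \<i> * complex_of_real z))"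
    by (rule isCont_tendsto_compose[OF continuous_at_csqrt[OF nn]]) (intro tendsto_intros q)
  then have "(\<lambda>n. exp (- x0 * (\<beta> + csqrt (complex_of_real (\<beta>\<^sup>2) + 2 * q n)))) \<longlonglongrightarrow>
     exp (- x0 * (\<beta> + csqrt (complex_of_real (\<beta>\<^sup>2) + 2 * (- \<i> * complex_of_real z))))"
    by (intro tendsto_intros)
  then have "(\<lambda>n. CLINT \<omega>|hit_law. exp (- q n * hit \<omega>)) \<longlonglongrightarrow>
     exp (- x0 * (\<beta> + csqrt (complex_of_real (\<beta>\<^sup>2) + 2 * (- \<i> * complex_of_real z))))"
    unfolding laplace_hit[OF q0] .
  from LIMSEQ_unique[OF L this] show ?thesis by (simp add: mult.assoc)
qed

lemma norm_char_hit_le: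
  assumes "z \<noteq> 0"
  shows "norm (CLINT \<omega>|hit_law. iexp (z * hit \<omega>)) \<le> exp (- x0 * \<beta>) * exp (- x0 * sqrt \<bar>z\<bar>)"
  unfolding char_hit[OF assms] using mult_left_mono[OF Re_csqrt_ge_sqrt[of z \<beta>], of x0] x0
  by (simp add: exp_add[symmetric] algebra_simps)

text \<open>The decay of the transform makes the characteristic function integrable; the point
  \<open>z = 0\<close>, where \<open>char_hit\<close> gives nothing, is a null set.\<close>

lemma hit_density:
  obtains \<rho> :: "real \<Rightarrow> real" where "\<rho> \<in> borel_measurable borel" "\<And>t. 0 \<le> \<rho> t"
    "distr hit_law borel hit = density lborel (\<lambda>t. ennreal (\<rho> t))"
proof -
  interpret D: finite_measure hit_law by (rule finite_measure_hit_law)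
  have fin: "finite_measure (distr hit_law borel hit)" by (rule D.finite_measure_distr) measurable
  have ch: "char (distr hit_law borel hit) z = (CLINT \<omega>|hit_law. iexp (z * hit \<omega>))" for z
    unfolding char_def by (subst integral_distr) auto
  have "integrable lborel (char (distr hit_law borel hit))"
  proof (rule Bochner_Integration.integrable_bound)
    show "integrable lborel (\<lambda>z. exp (- x0 * \<beta>) * exp (- x0 * sqrt \<bar>z\<bar>))"
      by (intro integrable_mult_right integrable_exp_neg_sqrt_abs x0)
    show "char (distr hit_law borel hit) \<in> borel_measurable lborel"
      unfolding ch[abs_def] by measurable
    have "AE z in lborel. z \<noteq> (0::real)" by (rule AE_lborel_singleton)
    then show "AE z in lborel. norm (char (distr hit_law borel hit) z) \<le> norm (exp (- x0 * \<beta>) * exp (- x0 * sqrt \<bar>z\<bar>))"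
      unfolding ch by eventually_elim (use norm_char_hit_le in simp)
  qed
  from density_of_integrable_char[OF fin _ this] show ?thesis using that by (metis sets_distr)
qed

end

section \<open>First passage of the gamma subordinator\<close>

text \<open>Strict exceedance, in contrast to the weak inequality in \<open>t1star\<close>: this
  version is right-continuous in the level and can be tested at rational times.\<close>

definition first_pass :: "(real \<Rightarrow> real) \<Rightarrow> real \<Rightarrow> real" where
  "first_pass X a = Inf {t. 0 \<le> t \<and> a < X t}"

locale subordinator_path =
  fixes X :: "real \<Rightarrow> real"
  assumes X_0: "X 0 = 0" and X_mono: "mono_on {0..} X"
    and X_rc: "\<And>t. 0 \<le> t \<Longrightarrow> continuous (at_right t) X"
    and X_unbounded: "\<And>a. \<exists>t\<ge>0. a < X t"
begin

lemma X_monoD: "0 \<le> s \<Longrightarrow> s \<le> t \<Longrightarrow> X s \<le> X t"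
  using X_mono by (auto simp: mono_on_def)

lemma first_pass_nonneg: "0 \<le> first_pass X a"
  unfolding first_pass_def using X_unbounded[of a] by (intro cInf_greatest) auto

lemma first_pass_le: "0 \<le> t \<Longrightarrow> a < X t \<Longrightarrow> first_pass X a \<le> t"
  unfolding first_pass_def by (intro cInf_lower bdd_belowI[of _ 0]) auto

lemma first_pass_lessD:
  assumes "first_pass X a < t" shows "a < X t"
proof -
  have "\<exists>s\<in>{t. 0 \<le> t \<and> a < X t}. s < t"
    using assms X_unbounded[of a] unfolding first_pass_def by (intro cInf_lessD) auto
  then obtain s where "0 \<le> s" "a < X s" "s < t" by auto
  then show ?thesis using X_monoD[of s t] by simp
qed

lemma X_tendsto_right:
  assumes t: "0 \<le> t" and f: "(f \<longlongrightarrow> t) F" and ge: "eventually (\<lambda>x. t \<le> f x) F"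
  shows "((\<lambda>x. X (f x)) \<longlongrightarrow> X t) F"
proof -
  have "continuous (at t within {t..}) X"
  proof -
    have "at t within {t..} = at_right t"
      unfolding at_within_def by (rule arg_cong[where f="\<lambda>S. inf (nhds t) (principal S)"]) auto
    then show ?thesis using X_rc[OF t] by simp
  qed
  then show ?thesis
    by (rule continuous_within_tendsto_compose) (use f ge in auto)
qed

lemma X_first_pass_ge: "a \<le> X (first_pass X a)"
proof -
  have "(\<lambda>n. first_pass X a + 1 / real (Suc n)) \<longlonglongrightarrow> first_pass X a + 0"
    by (intro tendsto_intros LIMSEQ_inverse_real_of_nat[unfolded inverse_eq_divide])
  then have "(\<lambda>n. X (first_pass X a + 1 / real (Suc n))) \<longlonglongrightarrow> X (first_pass X a)"
    by (intro X_tendsto_right first_pass_nonneg) auto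
  moreover have "a \<le> X (first_pass X a + 1 / real (Suc n))" for n
    by (intro less_imp_le first_pass_lessD) simp
  ultimately show ?thesis by (intro LIMSEQ_le_const) auto
qed

lemma first_pass_mono: "a \<le> b \<Longrightarrow> first_pass X a \<le> first_pass X b"
  unfolding first_pass_def using X_unbounded[of b]
  by (intro cInf_superset_mono bdd_belowI[of _ 0]) auto

text \<open>A time \<open>t < c\<close> with \<open>a < X t\<close> is an exceedance time for all
  levels between \<open>a\<close> and \<open>X t\<close> as well, which bounds their passage times;
  the other half is monotonicity.\<close>

lemma first_pass_right_continuous: "continuous (at_right a) (first_pass X)"
  unfolding continuous_within
proof (rule order_tendstoI)
  fix c assume "c < first_pass X a"
  then show "\<forall>\<^sub>F b in at_right a. c < first_pass X b"
    using first_pass_mono[of a] by (intro eventually_at_rightI[of a "a + 1"]) (auto intro: less_le_trans)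
next
  fix c assume c: "first_pass X a < c"
  define t where "t = (first_pass X a + c) / 2"
  have t: "first_pass X a < t" "t < c" "0 \<le> t" using c first_pass_nonneg[of a] by (auto simp: t_def)
  have "a < X t" by (rule first_pass_lessD[OF t(1)])
  then show "\<forall>\<^sub>F b in at_right a. first_pass X b < c"
    using t first_pass_le[OF t(3)] by (intro eventually_at_rightI[of a "X t"]) (auto intro: le_less_trans)
qed

text \<open>By monotonicity the passage times converge from the right when the level does, and that
  is the side on which \<open>X\<close> is continuous.\<close>

lemma X_first_pass_right_continuous: "continuous (at_right a) (\<lambda>a. X (first_pass X a))"
  unfolding continuous_within
  using first_pass_right_continuous[of a, unfolded continuous_within]
  by (rule X_tendsto_right[OF first_pass_nonneg])
     (auto intro!: eventually_at_rightI[of a "a + 1"] first_pass_mono)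

text \<open>The intervals between consecutive grid values of \<open>X\<close> are disjoint and cover
  the nonnegative levels, so a single term survives; its time is the first grid time at which the
  level is exceeded. Quantifying over \<open>f\<close> after \<open>t\<close> lets one time serve
  every test function.\<close>

lemma grid_sum_eq:
  assumes a: "0 \<le> a"
  shows "\<exists>t. first_pass X a \<le> t \<and> t \<le> first_pass X a + 1 / real (Suc n) \<and> a < X t \<and>
    (\<forall>f. (\<Sum>k. indicator {X (real k / real (Suc n))..<X (real (Suc k) / real (Suc n))} a
      * f (real (Suc k) / real (Suc n)) (X (real (Suc k) / real (Suc n)))) = (f t (X t) :: ennreal))"
proof -
  define s where "s n k = real k / real (Suc n)" for n k
  have s0: "0 \<le> s n k" "s n k \<le> s n (Suc k)" for n k by (auto simp: s_def divide_right_mono)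
  define K where "K n = (LEAST k. a < X (s n k))" for n
  have ex: "\<exists>k. a < X (s n k)" for n
  proof -
    obtain t where t: "t \<ge> 0" "a < X t" using X_unbounded by blast
    obtain k where "t * real (Suc n) \<le> real k" using real_arch_simple by blast
    then have "t \<le> s n k" by (simp add: s_def pos_le_divide_eq)
    then show ?thesis using X_monoD[of t "s n k"] t by (intro exI[of _ k]) auto
  qed
  have K: "a < X (s n (K n))" for n unfolding K_def using ex[of n] by (rule LeastI_ex)
  have Kless: "X (s n k) \<le> a" if "k < K n" for n k using not_less_Least[of k "\<lambda>k. a < X (s n k)"] that unfolding K_def by simp
  \<comment> \<open>Index 0 is ruled out by \<open>X 0 = 0 \<le> a\<close>, so the interval ending
    at \<open>K n\<close> has a left end \<open>j n\<close>.\<close>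
  have K0: "K n \<noteq> 0" for n using K[of n] X_0 a by (intro notI) (simp add: s_def)
  define j where "j n = K n - 1" for n
  have j: "K n = Suc (j n)" for n using K0[of n] by (simp add: j_def)
  have iff: "a \<in> {X (s n k)..<X (s n (Suc k))} \<longleftrightarrow> k = j n" for n k
  proof
    assume A: "a \<in> {X (s n k)..<X (s n (Suc k))}"
    have "K n \<le> Suc k" unfolding K_def using A by (intro Least_le) auto
    moreover have "k < K n"
    proof (rule ccontr)
      assume "\<not> k < K n"
      then have "s n (K n) \<le> s n k" by (simp add: s_def divide_right_mono)
      then have "X (s n (K n)) \<le> X (s n k)" using s0 by (intro X_monoD) auto
      then show False using A K[of n] by auto
    qed
    ultimately show "k = j n" unfolding j by simp
  next
    assume "k = j n"
    then show "a \<in> {X (s n k)..<X (s n (Suc k))}" using K[of n] Kless[of k n] unfolding j by auto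
  qed
  have sum: "(\<Sum>k. indicator {X (s n k)..<X (s n (Suc k))} a * f (s n (Suc k)) (X (s n (Suc k)))) = f (s n (K n)) (X (s n (K n)))" for n and f :: "real \<Rightarrow> real \<Rightarrow> ennreal"
  proof -
    have "indicator {X (s n k)..<X (s n (Suc k))} a * f (s n (Suc k)) (X (s n (Suc k))) =
       (if k = j n then f (s n (Suc k)) (X (s n (Suc k))) else 0)" for k
      using iff[of n k] by (auto simp: indicator_def)
    then have "(\<lambda>k. indicator {X (s n k)..<X (s n (Suc k))} a * f (s n (Suc k)) (X (s n (Suc k)))) sums f (s n (Suc (j n))) (X (s n (Suc (j n))))"
      using sums_single[of "j n" "\<lambda>k. f (s n (Suc k)) (X (s n (Suc k)))"] by simp
    then show ?thesis by (simp add: sums_iff j)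
  qed
  have lower: "first_pass X a \<le> s n (K n)" for n by (intro first_pass_le s0 K)
  have upper: "s n (K n) \<le> first_pass X a + 1 / real (Suc n)" for n
  proof -
    have "X (s n (j n)) \<le> a" using Kless[of "j n" n] j by simp
    then have "s n (j n) \<le> first_pass X a" using first_pass_lessD[of a "s n (j n)"] by force
    then show ?thesis unfolding j s_def by (simp add: add_divide_distrib)
  qed
  show ?thesis
    using lower[of n] upper[of n] K[of n] sum[of n] unfolding s_def by blast
qed

lemma grid_sum_tendsto:
  fixes f :: "real \<Rightarrow> real \<Rightarrow> ennreal"
  assumes a: "0 \<le> a" and f: "continuous_on UNIV (\<lambda>p. f (fst p) (snd p))"
  shows "(\<lambda>n. \<Sum>k. indicator {X (real k / real (Suc n))..<X (real (Suc k) / real (Suc n))} a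
      * f (real (Suc k) / real (Suc n)) (X (real (Suc k) / real (Suc n)))) \<longlonglongrightarrow> f (first_pass X a) (X (first_pass X a))"
proof -
  from grid_sum_eq[OF a] obtain t where t: "\<And>n. first_pass X a \<le> t n" "\<And>n. t n \<le> first_pass X a + 1 / real (Suc n)"
    and sum: "\<And>n. (\<Sum>k. indicator {X (real k / real (Suc n))..<X (real (Suc k) / real (Suc n))} a
      * f (real (Suc k) / real (Suc n)) (X (real (Suc k) / real (Suc n)))) = f (t n) (X (t n))"
    by metis
  have lim: "t \<longlonglongrightarrow> first_pass X a"
  proof (rule tendsto_sandwich[of "\<lambda>_. first_pass X a" _ _ "\<lambda>n. first_pass X a + 1 / real (Suc n)"])
    have "(\<lambda>n. first_pass X a + 1 / real (Suc n)) \<longlonglongrightarrow> first_pass X a + 0"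
      by (intro tendsto_intros LIMSEQ_inverse_real_of_nat[unfolded inverse_eq_divide])
    then show "(\<lambda>n. first_pass X a + 1 / real (Suc n)) \<longlonglongrightarrow> first_pass X a" by simp
  qed (intro always_eventually allI t tendsto_const)+
  have "(\<lambda>n. (t n, X (t n))) \<longlonglongrightarrow> (first_pass X a, X (first_pass X a))"
    using t by (intro tendsto_Pair lim X_tendsto_right first_pass_nonneg always_eventually) auto
  then have "(\<lambda>n. f (t n) (X (t n))) \<longlonglongrightarrow> f (first_pass X a) (X (first_pass X a))"
    using continuous_on_tendsto_compose[OF f] by fastforce
  then show ?thesis unfolding sum .
qed

end

text \<open>Integer levels and integer times keep the condition countable; for monotone paths it
  amounts to unboundedness.\<close>

definition unbounded_path :: "(real \<Rightarrow> 'a \<Rightarrow> real) \<Rightarrow> 'a \<Rightarrow> bool" where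
  "unbounded_path T \<omega> \<longleftrightarrow> (\<forall>n::nat. \<exists>k::nat. real n < T (real k) \<omega>)"

text \<open>Paths that stay bounded form a null set; on them the passage time is set to 0.\<close>
definition passage :: "(real \<Rightarrow> 'a \<Rightarrow> real) \<Rightarrow> real \<Rightarrow> 'a \<Rightarrow> real" where
  "passage T a \<omega> = (if unbounded_path T \<omega> then first_pass (\<lambda>t. T t \<omega>) a else 0)"

lemma subordinator_pathI:
  assumes "T 0 \<omega> = 0" "mono_on {0..} (\<lambda>t. T t \<omega>)" "\<And>t. 0 \<le> t \<Longrightarrow> continuous (at_right t) (\<lambda>t. T t \<omega>)"
    and "unbounded_path T \<omega>"
  shows "subordinator_path (\<lambda>t. T t \<omega>)"
proof
  fix a :: real
  obtain n :: nat where "a \<le> real n" using real_arch_simple by blast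
  moreover obtain k :: nat where "real n < T (real k) \<omega>" using assms(4) unfolding unbounded_path_def by blast
  ultimately show "\<exists>t\<ge>0. a < T t \<omega>" by (intro exI[of _ "real k"]) auto
qed (use assms in auto)

lemma unbounded_path_measurable:
  assumes [measurable]: "\<And>t. T t \<in> borel_measurable N"
  shows "Measurable.pred N (unbounded_path T)"
  unfolding unbounded_path_def[abs_def] by measurable

text \<open>By strict exceedance and monotonicity, a passage before \<open>c\<close> is witnessed by
  a rational time, which replaces the uncountable infimum by a countable union.\<close>

lemma passage_measurable:
  assumes T[measurable]: "\<And>t. T t \<in> borel_measurable N"
    and path: "\<And>\<omega>. \<omega> \<in> space N \<Longrightarrow> T 0 \<omega> = 0" "\<And>\<omega>. \<omega> \<in> space N \<Longrightarrow> mono_on {0..} (\<lambda>t. T t \<omega>)"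
      "\<And>\<omega> t. \<omega> \<in> space N \<Longrightarrow> 0 \<le> t \<Longrightarrow> continuous (at_right t) (\<lambda>t. T t \<omega>)"
  shows "(\<lambda>p. passage T (fst p) (snd p)) \<in> borel_measurable (borel \<Otimes>\<^sub>M N)"
proof (rule borel_measurableI_less)
  fix c :: real
  note [measurable] = unbounded_path_measurable[OF T]
  have iff: "passage T (fst p) (snd p) < c \<longleftrightarrow>
      (if unbounded_path T (snd p) then \<exists>r::rat. 0 \<le> real_of_rat r \<and> real_of_rat r < c \<and> fst p < T (real_of_rat r) (snd p) else 0 < c)"
    if "p \<in> space (borel \<Otimes>\<^sub>M N)" for p
  proof (cases "unbounded_path T (snd p)")
    case True
    have sp: "snd p \<in> space N" using that by (auto simp: space_pair_measure)
    interpret subordinator_path "\<lambda>t. T t (snd p)"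
      using path[OF sp] True by (intro subordinator_pathI) auto
    have "first_pass (\<lambda>t. T t (snd p)) (fst p) < c \<longleftrightarrow> (\<exists>r::rat. 0 \<le> real_of_rat r \<and> real_of_rat r < c \<and> fst p < T (real_of_rat r) (snd p))"
    proof
      assume "first_pass (\<lambda>t. T t (snd p)) (fst p) < c"
      then obtain r :: rat where r: "first_pass (\<lambda>t. T t (snd p)) (fst p) < real_of_rat r" "real_of_rat r < c"
        using of_rat_dense by blast
      then have "fst p < T (real_of_rat r) (snd p)" by (intro first_pass_lessD)
      moreover have "0 \<le> real_of_rat r" using r(1) first_pass_nonneg[of "fst p"] by linarith
      ultimately show "\<exists>r::rat. 0 \<le> real_of_rat r \<and> real_of_rat r < c \<and> fst p < T (real_of_rat r) (snd p)" using r by blast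
    next
      assume "\<exists>r::rat. 0 \<le> real_of_rat r \<and> real_of_rat r < c \<and> fst p < T (real_of_rat r) (snd p)"
      then show "first_pass (\<lambda>t. T t (snd p)) (fst p) < c" using first_pass_le by (blast intro: le_less_trans)
    qed
    then show ?thesis using True by (simp add: passage_def)
  qed (simp add: passage_def)
  have "{p \<in> space (borel \<Otimes>\<^sub>M N). passage T (fst p) (snd p) < c} =
    {p \<in> space (borel \<Otimes>\<^sub>M N). (unbounded_path T (snd p) \<longrightarrow> (\<exists>r::rat. 0 \<le> real_of_rat r \<and> real_of_rat r < c \<and> fst p < T (real_of_rat r) (snd p))) \<and> (\<not> unbounded_path T (snd p) \<longrightarrow> 0 < c)}"
    using iff by auto
  also have "\<dots> \<in> sets (borel \<Otimes>\<^sub>M N)" by measurable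
  finally show "{p \<in> space (borel \<Otimes>\<^sub>M N). passage T (fst p) (snd p) < c} \<in> sets (borel \<Otimes>\<^sub>M N)" .
qed

lemma passage_nonneg:
  assumes "\<omega> \<in> space N" and path: "\<And>\<omega>. \<omega> \<in> space N \<Longrightarrow> T 0 \<omega> = 0" "\<And>\<omega>. \<omega> \<in> space N \<Longrightarrow> mono_on {0..} (\<lambda>t. T t \<omega>)"
      "\<And>\<omega> t. \<omega> \<in> space N \<Longrightarrow> 0 \<le> t \<Longrightarrow> continuous (at_right t) (\<lambda>t. T t \<omega>)"
  shows "0 \<le> passage T a \<omega>"
proof (cases "unbounded_path T \<omega>")
  case True
  interpret subordinator_path "\<lambda>t. T t \<omega>"
    using path[OF assms(1)] True by (intro subordinator_pathI) auto
  show ?thesis using first_pass_nonneg True by (simp add: passage_def)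
qed (simp add: passage_def)

section \<open>Basic properties of the gamma process\<close>

locale gamma_process = prob_space M for M :: "'a measure" +
  fixes T :: "real \<Rightarrow> 'a \<Rightarrow> real" and \<nu> :: real
  assumes gamma: "gamma_subordinator M \<nu> T" and nu: "0 < \<nu>"
begin

lemma T_measurable[measurable]: "T t \<in> borel_measurable M"
  using gamma by (auto simp: gamma_subordinator_def)

lemma T_0: "\<omega> \<in> space M \<Longrightarrow> T 0 \<omega> = 0"
  and T_mono: "\<omega> \<in> space M \<Longrightarrow> mono_on {0..} (\<lambda>t. T t \<omega>)"
  and T_rc: "\<omega> \<in> space M \<Longrightarrow> 0 \<le> t \<Longrightarrow> continuous (at_right t) (\<lambda>t. T t \<omega>)"
  using gamma by (auto simp: gamma_subordinator_def)

lemma T_monoD: "\<omega> \<in> space M \<Longrightarrow> 0 \<le> s \<Longrightarrow> s \<le> t \<Longrightarrow> T s \<omega> \<le> T t \<omega>"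
  using T_mono[of \<omega>] by (auto simp: mono_on_def)

lemma T_nonneg: "\<omega> \<in> space M \<Longrightarrow> 0 \<le> t \<Longrightarrow> 0 \<le> T t \<omega>"
  using T_monoD[of \<omega> 0 t] T_0 by simp

lemma laplace_increment:
  "0 \<le> s \<Longrightarrow> s \<le> t \<Longrightarrow> 0 \<le> u \<Longrightarrow> expectation (\<lambda>\<omega>. exp (- u * (T t \<omega> - T s \<omega>))) = exp (- (t - s) * vg_psi \<nu> u)"
  using gamma unfolding gamma_subordinator_def by blast

lemma laplace_T:
  assumes "0 \<le> t" "0 \<le> u"
  shows "expectation (\<lambda>\<omega>. exp (- u * T t \<omega>)) = exp (- t * vg_psi \<nu> u)"
proof -
  have "expectation (\<lambda>\<omega>. exp (- u * T t \<omega>)) = expectation (\<lambda>\<omega>. exp (- u * (T t \<omega> - T 0 \<omega>)))"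
    by (intro Bochner_Integration.integral_cong) (auto simp: T_0)
  then show ?thesis using laplace_increment[of 0 t u] assms by simp
qed

lemma vg_psi_pos: "0 < u \<Longrightarrow> 0 < vg_psi \<nu> u"
  unfolding vg_psi_def using nu by (intro divide_pos_pos ln_gt_zero) (auto simp: mult_pos_pos)

text \<open>On the event that \<open>T\<close> stays below \<open>n\<close>, the variable
  \<open>exp (- T k)\<close> is at least \<open>exp (- n)\<close> for every \<open>k\<close>,
  whereas its expectation \<open>exp (- k * vg_psi \<nu> 1)\<close> tends to 0.\<close>

lemma AE_unbounded_path: "AE \<omega> in M. unbounded_path T \<omega>"
proof -
  have "AE \<omega> in M. \<exists>k::nat. real n < T (real k) \<omega>" for n :: nat
  proof -
    define B where "B = {\<omega> \<in> space M. \<forall>k::nat. T (real k) \<omega> \<le> real n}"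
    have [measurable]: "B \<in> sets M" unfolding B_def by measurable
    have le: "exp (- real n) * prob B \<le> exp (- real k * vg_psi \<nu> 1)" for k :: nat
    proof -
      have "exp (- real n) * prob B = expectation (\<lambda>\<omega>. exp (- real n) * indicator B \<omega>)" by simp
      also have "\<dots> \<le> expectation (\<lambda>\<omega>. exp (- 1 * T (real k) \<omega>))"
      proof (rule integral_mono_AE)
        show "integrable M (\<lambda>\<omega>. exp (- real n) * indicator B \<omega>)"
          by (intro integrable_mult_right integrable_const_bound[where B=1] AE_I2) (auto split: split_indicator)
        show "integrable M (\<lambda>\<omega>. exp (- 1 * T (real k) \<omega>))"
          using T_nonneg by (intro integrable_const_bound[where B=1] AE_I2) auto
        show "AE \<omega> in M. exp (- real n) * indicator B \<omega> \<le> exp (- 1 * T (real k) \<omega>)"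
          by (intro AE_I2) (auto simp: B_def split: split_indicator)
      qed
      also have "\<dots> = exp (- real k * vg_psi \<nu> 1)" by (rule laplace_T) auto
      finally show ?thesis .
    qed
    have p: "vg_psi \<nu> 1 > 0" by (rule vg_psi_pos) simp
    have "(\<lambda>k. exp (- real k * vg_psi \<nu> 1)) \<longlonglongrightarrow> 0" using p by real_asymp
    then have "exp (- real n) * prob B \<le> 0" by (rule LIMSEQ_le_const) (use le in auto)
    then have "prob B = 0" using measure_nonneg[of M B] by (simp add: mult_le_0_iff)
    then have "AE \<omega> in M. \<omega> \<notin> B" by (simp add: AE_iff_measurable[of B M] emeasure_eq_measure B_def)
    then show ?thesis by (rule AE_mp) (auto intro!: AE_I2 simp: B_def not_le)
  qed
  then show ?thesis unfolding unbounded_path_def by (subst AE_all_countable) auto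
qed

lemma subordinator_path: "\<omega> \<in> space M \<Longrightarrow> unbounded_path T \<omega> \<Longrightarrow> subordinator_path (\<lambda>t. T t \<omega>)"
  by (intro subordinator_pathI T_0 T_mono T_rc)

end

section \<open>Transform of passage time, overshoot and level\<close>

lemma nn_integral_exp_step:
  fixes q \<theta> s t :: real
  assumes "q \<noteq> \<theta>" "s \<le> t"
  shows "(\<integral>\<^sup>+a. indicator {s..<t} a * ennreal (exp (- (q * a + \<theta> * (t - a)))) \<partial>lborel) =
    ennreal ((exp (- q * t) - exp (- q * s) * exp (- \<theta> * (t - s))) / (\<theta> - q))"
proof -
  define F where "F a = exp (- (q * a + \<theta> * (t - a))) / (\<theta> - q)" for a
  have "(\<integral>\<^sup>+a. indicator {s..<t} a * ennreal (exp (- (q * a + \<theta> * (t - a)))) \<partial>lborel) =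
      (\<integral>\<^sup>+a\<in>{s..t}. ennreal (exp (- (q * a + \<theta> * (t - a)))) \<partial>lborel)"
  proof (rule nn_integral_cong_AE)
    have "AE a in lborel. a \<noteq> t" by (rule AE_lborel_singleton)
    then show "AE a in lborel. indicator {s..<t} a * ennreal (exp (- (q * a + \<theta> * (t - a)))) =
       ennreal (exp (- (q * a + \<theta> * (t - a)))) * indicator {s..t} a"
      by eventually_elim (auto simp: indicator_def)
  qed
  also have "\<dots> = ennreal (F t - F s)"
  proof (rule nn_integral_FTC_Icc)
    fix a show "(F has_real_derivative exp (- (q * a + \<theta> * (t - a)))) (at a)"
    proof -
      have "((\<lambda>a. exp (- (q * a + \<theta> * (t - a)))) has_real_derivative exp (- (q * a + \<theta> * (t - a))) * (\<theta> - q)) (at a)"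
        by (auto intro!: derivative_eq_intros simp: algebra_simps)
      from DERIV_cdivide[OF this, of "\<theta> - q"] show ?thesis unfolding F_def using assms by simp
    qed
  qed (use assms in auto)
  also have "F t - F s = (exp (- q * t) - exp (- q * s) * exp (- \<theta> * (t - s))) / (\<theta> - q)"
    unfolding F_def by (simp add: exp_add[symmetric] diff_divide_distrib)
  finally show ?thesis .
qed

lemma nn_integral_exp_tail:
  fixes r t :: real
  assumes r: "0 < r"
  shows "(\<integral>\<^sup>+a. indicator {t<..} a * ennreal (exp (- r * a)) \<partial>lborel) = ennreal (exp (- r * t) / r)"
proof -
  have "(\<integral>\<^sup>+a. indicator {t<..} a * ennreal (exp (- r * a)) \<partial>lborel) = (\<integral>\<^sup>+a\<in>{t..}. ennreal (exp (- r * a)) \<partial>lborel)"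
  proof (rule nn_integral_cong_AE)
    have "AE a in lborel. a \<noteq> t" by (rule AE_lborel_singleton)
    then show "AE a in lborel. indicator {t<..} a * ennreal (exp (- r * a)) = ennreal (exp (- r * a)) * indicator {t..} a"
      by eventually_elim (auto simp: indicator_def)
  qed
  also have "\<dots> = ennreal (0 - (- exp (- r * t) / r))"
  proof (rule nn_integral_FTC_atLeast)
    show "((\<lambda>a. - exp (- r * a) / r) has_real_derivative exp (- r * a)) (at a)" for a
      using r by (auto intro!: derivative_eq_intros)
    show "((\<lambda>a. - exp (- r * a) / r) \<longlongrightarrow> 0) at_top" using r by real_asymp
  qed auto
  finally show ?thesis by simp
qed

lemma nn_integral_exp_atLeast_0:
  fixes r :: real
  assumes r: "0 < r"
  shows "(\<integral>\<^sup>+a. indicator {0..} a * ennreal (exp (- r * a)) \<partial>lborel) = ennreal (1 / r)"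
proof -
  have "(\<integral>\<^sup>+a. indicator {0..} a * ennreal (exp (- r * a)) \<partial>lborel) = (\<integral>\<^sup>+a. indicator {0<..} a * ennreal (exp (- r * a)) \<partial>lborel)"
  proof (rule nn_integral_cong_AE)
    have "AE a in lborel. a \<noteq> (0::real)" by (rule AE_lborel_singleton)
    then show "AE a in lborel. indicator {0..} a * ennreal (exp (- r * a)) = indicator {0<..} a * ennreal (exp (- r * a))"
      by eventually_elim (auto simp: indicator_def)
  qed
  then show ?thesis using nn_integral_exp_tail[OF r, of 0] by simp
qed

context gamma_process begin

text \<open>Independence is available for strictly increasing lists of times only, so
  \<open>[0, s, t]\<close> does not serve for \<open>s = 0\<close>, which is treated apart.\<close>

lemma laplace_two_times:
  assumes s: "0 \<le> s" "s < t" and uv: "0 \<le> u" "0 \<le> v"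
  shows "expectation (\<lambda>\<omega>. exp (- u * T s \<omega>) * exp (- v * (T t \<omega> - T s \<omega>))) =
    exp (- s * vg_psi \<nu> u) * exp (- (t - s) * vg_psi \<nu> v)"
proof (cases "s = 0")
  case True
  have "expectation (\<lambda>\<omega>. exp (- u * T s \<omega>) * exp (- v * (T t \<omega> - T s \<omega>))) = expectation (\<lambda>\<omega>. exp (- v * (T t \<omega> - T s \<omega>)))"
    using True by (intro Bochner_Integration.integral_cong) (auto simp: T_0)
  then show ?thesis using laplace_increment[of s t v] s uv True by simp
next
  case False
  then have s0: "0 < s" using s by simp
  define ts where "ts = [0, s, t]"
  have "sorted_wrt (<) ts \<and> (\<forall>t\<in>set ts. 0 \<le> t)" using s0 s by (auto simp: ts_def)
  then have ind: "indep_vars (\<lambda>_. borel) (\<lambda>i \<omega>. T (ts ! Suc i) \<omega> - T (ts ! i) \<omega>) {..<length ts - 1}"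
    using gamma unfolding gamma_subordinator_def by blast
  have "indep_var borel ((\<lambda>f. exp (- u * f 0)) \<circ> (\<lambda>\<omega>. restrict (\<lambda>i. T (ts ! Suc i) \<omega> - T (ts ! i) \<omega>) {0}))
    borel ((\<lambda>f. exp (- v * f 1)) \<circ> (\<lambda>\<omega>. restrict (\<lambda>i. T (ts ! Suc i) \<omega> - T (ts ! i) \<omega>) {1}))"
    by (rule indep_var_compose[OF indep_var_restrict[OF ind, of "{0}" "{1}"]]) (auto simp: ts_def)
  then have ind2: "indep_var borel (\<lambda>\<omega>. exp (- u * (T s \<omega> - T 0 \<omega>))) borel (\<lambda>\<omega>. exp (- v * (T t \<omega> - T s \<omega>)))"
    by (simp add: ts_def comp_def)
  have int: "integrable M (\<lambda>\<omega>. exp (- u * (T s \<omega> - T 0 \<omega>)))" "integrable M (\<lambda>\<omega>. exp (- v * (T t \<omega> - T s \<omega>)))"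
    using uv s T_monoD by (auto intro!: integrable_const_bound[where B=1] AE_I2 mult_nonneg_nonneg)
  have "expectation (\<lambda>\<omega>. exp (- u * T s \<omega>) * exp (- v * (T t \<omega> - T s \<omega>))) =
     expectation (\<lambda>\<omega>. exp (- u * (T s \<omega> - T 0 \<omega>)) * exp (- v * (T t \<omega> - T s \<omega>)))"
    by (intro Bochner_Integration.integral_cong) (auto simp: T_0)
  also have "\<dots> = expectation (\<lambda>\<omega>. exp (- u * (T s \<omega> - T 0 \<omega>))) * expectation (\<lambda>\<omega>. exp (- v * (T t \<omega> - T s \<omega>)))"
    by (rule indep_var_lebesgue_integral[OF ind2 int])
  finally show ?thesis using laplace_increment[of 0 s u] laplace_increment[of s t v] s uv by simp
qed

text \<open>What one time step contributes: the levels crossed within the step, weighted by level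
  and by overshoot at its end. Independence of the increment from \<open>T s\<close> factorises the
  expectation.\<close>

lemma nn_integral_grid_step:
  assumes q: "0 \<le> q" and \<theta>: "0 \<le> \<theta>" "q \<noteq> \<theta>" and s: "0 \<le> s" "s < t"
  shows "(\<integral>\<^sup>+\<omega>. (\<integral>\<^sup>+a. indicator {T s \<omega>..<T t \<omega>} a * ennreal (exp (- (q * a + \<theta> * (T t \<omega> - a)))) \<partial>lborel) \<partial>M) =
    ennreal (exp (- s * vg_psi \<nu> q) * (exp (- (t - s) * vg_psi \<nu> q) - exp (- (t - s) * vg_psi \<nu> \<theta>)) / (\<theta> - q))"
proof -
  define g where "g \<omega> = (exp (- q * T t \<omega>) - exp (- q * T s \<omega>) * exp (- \<theta> * (T t \<omega> - T s \<omega>))) / (\<theta> - q)" for \<omega>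
  have st: "T s \<omega> \<le> T t \<omega>" if "\<omega> \<in> space M" for \<omega> using T_monoD[OF that] s by simp
  have g0: "0 \<le> g \<omega>" if w: "\<omega> \<in> space M" for \<omega>
  proof -
    have e: "exp (- q * T t \<omega>) = exp (- q * T s \<omega>) * exp (- q * (T t \<omega> - T s \<omega>))"
      by (simp add: exp_add[symmetric] algebra_simps)
    have "g \<omega> = exp (- q * T s \<omega>) * ((exp (- q * (T t \<omega> - T s \<omega>)) - exp (- \<theta> * (T t \<omega> - T s \<omega>))) / (\<theta> - q))"
      unfolding g_def e by (simp add: right_diff_distrib)
    moreover have "0 \<le> (exp (- q * (T t \<omega> - T s \<omega>)) - exp (- \<theta> * (T t \<omega> - T s \<omega>))) / (\<theta> - q)"
      using st[OF w] by (cases "q < \<theta>") (auto simp: zero_le_divide_iff mult_right_mono)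
    ultimately show ?thesis by (metis exp_ge_zero mult_nonneg_nonneg)
  qed
  have i1: "integrable M (\<lambda>\<omega>. exp (- q * T t \<omega>))"
    using q s T_nonneg by (auto intro!: integrable_const_bound[where B=1] AE_I2)
  have i2: "integrable M (\<lambda>\<omega>. exp (- q * T s \<omega>) * exp (- \<theta> * (T t \<omega> - T s \<omega>)))"
  proof (rule integrable_const_bound[where B=1])
    show "AE \<omega> in M. norm (exp (- q * T s \<omega>) * exp (- \<theta> * (T t \<omega> - T s \<omega>))) \<le> 1"
    proof (rule AE_I2)
      fix \<omega> assume w: "\<omega> \<in> space M"
      have "0 \<le> q * T s \<omega>" "0 \<le> \<theta> * (T t \<omega> - T s \<omega>)" using q \<theta> st[OF w] T_nonneg[OF w s(1)] by auto
      then have "exp (- q * T s \<omega>) * exp (- \<theta> * (T t \<omega> - T s \<omega>)) \<le> 1"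
        by (intro mult_le_one) auto
      then show "norm (exp (- q * T s \<omega>) * exp (- \<theta> * (T t \<omega> - T s \<omega>))) \<le> 1" by simp
    qed
  qed measurable
  have int: "integrable M g" unfolding g_def using i1 i2 by auto
  have "(\<integral>\<^sup>+\<omega>. (\<integral>\<^sup>+a. indicator {T s \<omega>..<T t \<omega>} a * ennreal (exp (- (q * a + \<theta> * (T t \<omega> - a)))) \<partial>lborel) \<partial>M) = (\<integral>\<^sup>+\<omega>. ennreal (g \<omega>) \<partial>M)"
    unfolding g_def using st \<theta> by (intro nn_integral_cong nn_integral_exp_step) auto
  also have "\<dots> = ennreal (expectation g)"
    using int g0 by (intro nn_integral_eq_integral) auto
  also have "expectation g = (expectation (\<lambda>\<omega>. exp (- q * T t \<omega>)) - expectation (\<lambda>\<omega>. exp (- q * T s \<omega>) * exp (- \<theta> * (T t \<omega> - T s \<omega>)))) / (\<theta> - q)"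
    unfolding g_def using i1 i2 by simp
  also have "\<dots> = (exp (- t * vg_psi \<nu> q) - exp (- s * vg_psi \<nu> q) * exp (- (t - s) * vg_psi \<nu> \<theta>)) / (\<theta> - q)"
    using laplace_T[of t q] laplace_two_times[OF s q \<theta>(1)] q s by simp
  also have "exp (- t * vg_psi \<nu> q) = exp (- s * vg_psi \<nu> q) * exp (- (t - s) * vg_psi \<nu> q)"
    by (simp add: exp_add[symmetric] algebra_simps)
  finally show ?thesis by (simp add: right_diff_distrib)
qed

lemma vg_psi_strict_mono: "0 \<le> u \<Longrightarrow> u < v \<Longrightarrow> vg_psi \<nu> u < vg_psi \<nu> v"
  unfolding vg_psi_def using nu
  by (intro divide_strict_right_mono) (auto simp: add_pos_nonneg intro!: ln_less_cancel_iff[THEN iffD2])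

text \<open>Increments being stationary, step \<open>k\<close> contributes what step 0 does times
  the \<open>k\<close>-th power of \<open>exp (- d * (\<mu> + vg_psi \<nu> q))\<close>, so the
  series over the grid is geometric.\<close>

lemma nn_integral_grid_sum:
  assumes q: "0 < q" and \<mu>: "0 < \<mu>" and \<theta>: "0 < \<theta>" "q \<noteq> \<theta>" and d: "0 < d"
  shows "(\<integral>\<^sup>+\<omega>. (\<integral>\<^sup>+a. (\<Sum>k. indicator {T (real k * d) \<omega>..<T (real (Suc k) * d) \<omega>} a *
      ennreal (exp (- (q * a + \<mu> * (real (Suc k) * d) + \<theta> * (T (real (Suc k) * d) \<omega> - a))))) \<partial>lborel) \<partial>M) =
    ennreal (exp (- \<mu> * d) * (exp (- d * vg_psi \<nu> q) - exp (- d * vg_psi \<nu> \<theta>)) / (\<theta> - q) / (1 - exp (- d * (\<mu> + vg_psi \<nu> q))))"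
proof -
  let ?r = "exp (- d * (\<mu> + vg_psi \<nu> q))"
  define A where "A = (exp (- d * vg_psi \<nu> q) - exp (- d * vg_psi \<nu> \<theta>)) / (\<theta> - q)"
  have A0: "0 \<le> A"
  proof (cases "q < \<theta>")
    case True
    then show ?thesis using vg_psi_strict_mono[of q \<theta>] q d unfolding A_def by (intro divide_nonneg_pos) auto
  next
    case False
    then have "\<theta> < q" using \<theta> by simp
    then show ?thesis using vg_psi_strict_mono[of \<theta> q] \<theta> d unfolding A_def by (intro divide_nonpos_neg) auto
  qed
  have [measurable]: "(\<lambda>p. indicator {T s (fst p)..<T t (fst p)} (snd p) :: ennreal) \<in> borel_measurable (M \<Otimes>\<^sub>M lborel)" for s t
    unfolding indicator_def atLeastLessThan_iff of_bool_def by measurable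
  have trm: "(\<integral>\<^sup>+\<omega>. (\<integral>\<^sup>+a. indicator {T (real k * d) \<omega>..<T (real (Suc k) * d) \<omega>} a *
      ennreal (exp (- (q * a + \<mu> * (real (Suc k) * d) + \<theta> * (T (real (Suc k) * d) \<omega> - a)))) \<partial>lborel) \<partial>M) = ennreal (exp (- \<mu> * d) * A * ?r ^ k)" for k
  proof -
    have e: "ennreal (exp (- (q * a + \<mu> * (real (Suc k) * d) + \<theta> * (T (real (Suc k) * d) \<omega> - a)))) =
      ennreal (exp (- \<mu> * (real (Suc k) * d))) * ennreal (exp (- (q * a + \<theta> * (T (real (Suc k) * d) \<omega> - a))))" for a \<omega>
      by (simp add: ennreal_mult[symmetric] exp_add[symmetric] algebra_simps)
    have "(\<integral>\<^sup>+\<omega>. (\<integral>\<^sup>+a. indicator {T (real k * d) \<omega>..<T (real (Suc k) * d) \<omega>} a *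
      ennreal (exp (- (q * a + \<mu> * (real (Suc k) * d) + \<theta> * (T (real (Suc k) * d) \<omega> - a)))) \<partial>lborel) \<partial>M) =
      ennreal (exp (- \<mu> * (real (Suc k) * d))) * (\<integral>\<^sup>+\<omega>. (\<integral>\<^sup>+a. indicator {T (real k * d) \<omega>..<T (real (Suc k) * d) \<omega>} a *
         ennreal (exp (- (q * a + \<theta> * (T (real (Suc k) * d) \<omega> - a)))) \<partial>lborel) \<partial>M)"
      unfolding e by (simp add: nn_integral_cmult mult.left_commute)
    also have "\<dots> = ennreal (exp (- \<mu> * (real (Suc k) * d))) * ennreal (exp (- (real k * d) * vg_psi \<nu> q) * A)"
      using q \<theta> d by (subst nn_integral_grid_step) (auto simp: A_def algebra_simps)
    also have "\<dots> = ennreal (exp (- \<mu> * (real (Suc k) * d)) * (exp (- (real k * d) * vg_psi \<nu> q) * A))"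
      using A0 by (simp add: ennreal_mult)
    also have "exp (- \<mu> * (real (Suc k) * d)) * (exp (- (real k * d) * vg_psi \<nu> q) * A) = exp (- \<mu> * d) * A * ?r ^ k"
      by (simp add: exp_of_nat_mult[symmetric] exp_add[symmetric] algebra_simps)
    finally show ?thesis .
  qed
  have r: "0 \<le> ?r" "?r < 1" using vg_psi_pos[OF q] \<mu> d by (auto simp: mult_pos_pos add_pos_pos)
  have "(\<integral>\<^sup>+\<omega>. (\<integral>\<^sup>+a. (\<Sum>k. indicator {T (real k * d) \<omega>..<T (real (Suc k) * d) \<omega>} a *
      ennreal (exp (- (q * a + \<mu> * (real (Suc k) * d) + \<theta> * (T (real (Suc k) * d) \<omega> - a))))) \<partial>lborel) \<partial>M)
    = (\<Sum>k. \<integral>\<^sup>+\<omega>. (\<integral>\<^sup>+a. indicator {T (real k * d) \<omega>..<T (real (Suc k) * d) \<omega>} a *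
      ennreal (exp (- (q * a + \<mu> * (real (Suc k) * d) + \<theta> * (T (real (Suc k) * d) \<omega> - a)))) \<partial>lborel) \<partial>M)"
    by (subst nn_integral_suminf[symmetric], measurable) (intro nn_integral_cong nn_integral_suminf; measurable)
  also have "\<dots> = (\<Sum>k. ennreal (exp (- \<mu> * d) * A * ?r ^ k))" unfolding trm ..
  also have "\<dots> = ennreal (\<Sum>k. exp (- \<mu> * d) * A * ?r ^ k)"
    using A0 r by (intro suminf_ennreal2 summable_mult summable_geometric) auto
  also have "(\<Sum>k. exp (- \<mu> * d) * A * ?r ^ k) = exp (- \<mu> * d) * A * (1 / (1 - ?r))"
    using r by (subst suminf_mult) (auto simp: suminf_geometric summable_geometric)
  finally show ?thesis unfolding A_def by simp
qed

lemma passage_measurable_M[measurable]: "(\<lambda>p. passage T (fst p) (snd p)) \<in> borel_measurable (borel \<Otimes>\<^sub>M M)"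
  by (rule passage_measurable) (auto intro: T_0 T_mono T_rc)

lemma passage_ge0: "\<omega> \<in> space M \<Longrightarrow> 0 \<le> passage T a \<omega>"
  by (rule passage_nonneg[of \<omega> M]) (auto intro: T_0 T_mono T_rc)

lemma T_process_measurable[measurable]: "(\<lambda>p. T (max 0 (fst p)) (snd p)) \<in> borel_measurable (borel \<Otimes>\<^sub>M M)"
  by (rule measurable_right_continuous_process) (auto intro: T_rc)

lemma T_passage_measurable[measurable]: "(\<lambda>p. T (passage T (fst p) (snd p)) (snd p)) \<in> borel_measurable (borel \<Otimes>\<^sub>M M)"
proof -
  have "(\<lambda>p. (\<lambda>p. T (max 0 (fst p)) (snd p)) (passage T (fst p) (snd p), snd p)) \<in> borel_measurable (borel \<Otimes>\<^sub>M M)"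
    by (rule measurable_compose[OF _ T_process_measurable]) measurable
  then show ?thesis
    by (rule measurable_cong[THEN iffD1, rotated]) (auto simp: space_pair_measure max_absorb2 passage_ge0)
qed

lemma passage_swap_measurable[measurable]:
  "(\<lambda>p. passage T (snd p) (fst p)) \<in> borel_measurable (M \<Otimes>\<^sub>M borel)"
  "(\<lambda>p. T (passage T (snd p) (fst p)) (fst p)) \<in> borel_measurable (M \<Otimes>\<^sub>M borel)"
  using measurable_compose[OF measurable_pair_swap'[of M borel] passage_measurable_M]
    measurable_compose[OF measurable_pair_swap'[of M borel] T_passage_measurable]
  by (simp_all add: case_prod_unfold)

text \<open>The mesh tends to 0. For a fixed level the grid series is one exponential with
  nonnegative time and overshoot, hence at most \<open>exp (- q * a)\<close> for every mesh; this
  dominates first the integral over levels and then the expectation.\<close>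

lemma laplace_first_passage:
  assumes q: "0 < q" and \<mu>: "0 < \<mu>" and \<theta>: "0 < \<theta>" "q \<noteq> \<theta>"
  shows "(\<integral>\<^sup>+\<omega>. (\<integral>\<^sup>+a. indicator {0..} a * ennreal (exp (- (q * a + \<mu> * passage T a \<omega> + \<theta> * (T (passage T a \<omega>) \<omega> - a)))) \<partial>lborel) \<partial>M)
    = ennreal ((vg_psi \<nu> \<theta> - vg_psi \<nu> q) / ((\<theta> - q) * (\<mu> + vg_psi \<nu> q)))"
proof -
  define d where "d n = 1 / real (Suc n)" for n
  define G where "G n \<omega> a = (\<Sum>k. indicator {T (real k * d n) \<omega>..<T (real (Suc k) * d n) \<omega>} a *
      ennreal (exp (- (q * a + \<mu> * (real (Suc k) * d n) + \<theta> * (T (real (Suc k) * d n) \<omega> - a)))))" for n \<omega> a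
  have [measurable]: "(\<lambda>p. indicator {T s (fst p)..<T t (fst p)} (snd p) :: ennreal) \<in> borel_measurable (M \<Otimes>\<^sub>M borel)" for s t
    unfolding indicator_def atLeastLessThan_iff of_bool_def by measurable
  have Gm[measurable]: "(\<lambda>p. G n (fst p) (snd p)) \<in> borel_measurable (M \<Otimes>\<^sub>M borel)" for n
    unfolding G_def by measurable
  have Gm2[measurable]: "G n \<omega> \<in> borel_measurable borel" for n \<omega>
    unfolding G_def[abs_def] by measurable
  note wint = nn_integral_exp_atLeast_0[OF q]
  define H where "H \<omega> a = ennreal (exp (- (q * a + \<mu> * passage T a \<omega> + \<theta> * (T (passage T a \<omega>) \<omega> - a))))" for \<omega> a
  have Hm[measurable]: "(\<lambda>p. H (fst p) (snd p)) \<in> borel_measurable (M \<Otimes>\<^sub>M borel)"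
    unfolding H_def by measurable
  have Hm2[measurable]: "H \<omega> \<in> borel_measurable borel" if "\<omega> \<in> space M" for \<omega>
    using measurable_compose[OF measurable_Pair1'[OF that, of borel] Hm] by simp
  have G_div: "G n \<omega> a = (\<Sum>k. indicator {T (real k / real (Suc n)) \<omega>..<T (real (Suc k) / real (Suc n)) \<omega>} a *
      ennreal (exp (- (q * a + \<mu> * (real (Suc k) / real (Suc n)) + \<theta> * (T (real (Suc k) / real (Suc n)) \<omega> - a)))))" for n \<omega> a
    unfolding G_def d_def by (simp only: times_divide_eq_right mult_1_right)
  have le: "G n \<omega> a \<le> indicator {0..} a * ennreal (exp (- q * a))" if w: "\<omega> \<in> space M" "unbounded_path T \<omega>" for n \<omega> a
  proof (cases "0 \<le> a")
    case False
    have "indicator {T (real k * d n) \<omega>..<T (real (Suc k) * d n) \<omega>} a = (0::ennreal)" for k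
      using False T_nonneg[OF w(1), of "real k * d n"] by (auto simp: d_def)
    then show ?thesis by (simp add: G_def)
  next
    case True
    interpret P: subordinator_path "\<lambda>t. T t \<omega>" by (rule subordinator_path[OF w])
    obtain t where t': "first_pass (\<lambda>t. T t \<omega>) a \<le> t" "a < T t \<omega>"
      and S: "\<forall>f. (\<Sum>k. indicator {T (real k / real (Suc n)) \<omega>..<T (real (Suc k) / real (Suc n)) \<omega>} a
      * f (real (Suc k) / real (Suc n)) (T (real (Suc k) / real (Suc n)) \<omega>)) = (f t (T t \<omega>) :: ennreal)"
      using P.grid_sum_eq[OF True, of n] by blast
    note t = t' S[rule_format, of "\<lambda>t x. ennreal (exp (- (q * a + \<mu> * t + \<theta> * (x - a))))", folded G_div]
    have "0 \<le> t" using t(1) P.first_pass_nonneg[of a] by linarith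
    then have "0 \<le> \<mu> * t" "0 \<le> \<theta> * (T t \<omega> - a)" using \<mu> \<theta> t(2) by auto
    then show ?thesis unfolding t(3) using True by (simp add: ennreal_leI)
  qed
  have lim: "(\<lambda>n. G n \<omega> a) \<longlonglongrightarrow> indicator {0..} a * H \<omega> a" if w: "\<omega> \<in> space M" "unbounded_path T \<omega>" for \<omega> a
  proof (cases "0 \<le> a")
    case False
    then have "G n \<omega> a = 0" for n using le[OF w, of n a] by simp
    then show ?thesis using False by simp
  next
    case True
    interpret P: subordinator_path "\<lambda>t. T t \<omega>" by (rule subordinator_path[OF w])
    have "continuous_on UNIV (\<lambda>p. ennreal (exp (- (q * a + \<mu> * fst p + \<theta> * (snd p - a)))))"
      by (intro continuous_on_ennreal continuous_intros)
    from P.grid_sum_tendsto[OF True, of "\<lambda>t x. ennreal (exp (- (q * a + \<mu> * t + \<theta> * (x - a))))", OF this]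
    show ?thesis using True w(2) unfolding G_div H_def passage_def by (simp del: of_nat_Suc)
  qed
  have inner: "(\<lambda>n. \<integral>\<^sup>+a. G n \<omega> a \<partial>lborel) \<longlonglongrightarrow> (\<integral>\<^sup>+a. indicator {0..} a * H \<omega> a \<partial>lborel)"
    if w: "\<omega> \<in> space M" "unbounded_path T \<omega>" for \<omega>
    using w le[OF w] lim[OF w]
    by (intro nn_integral_dominated_convergence[where w="\<lambda>a. indicator {0..} a * ennreal (exp (- q * a))"]) (auto simp: wint[unfolded mult_minus_left])
  have outer: "(\<lambda>n. \<integral>\<^sup>+\<omega>. (\<integral>\<^sup>+a. G n \<omega> a \<partial>lborel) \<partial>M) \<longlonglongrightarrow> (\<integral>\<^sup>+\<omega>. (\<integral>\<^sup>+a. indicator {0..} a * H \<omega> a \<partial>lborel) \<partial>M)"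
  proof (rule nn_integral_dominated_convergence[where w="\<lambda>_. ennreal (1 / q)"])
    show "AE \<omega> in M. (\<integral>\<^sup>+a. G n \<omega> a \<partial>lborel) \<le> ennreal (1 / q)" for n
      using AE_unbounded_path AE_space
    proof eventually_elim
      case (elim \<omega>)
      then show ?case unfolding wint[symmetric] by (intro nn_integral_mono le) auto
    qed
    show "AE \<omega> in M. (\<lambda>n. \<integral>\<^sup>+a. G n \<omega> a \<partial>lborel) \<longlonglongrightarrow> (\<integral>\<^sup>+a. indicator {0..} a * H \<omega> a \<partial>lborel)"
      using AE_unbounded_path AE_space by eventually_elim (rule inner)
  qed (auto simp: emeasure_space_1)
  let ?v = "\<lambda>d. exp (- \<mu> * d) * (exp (- d * vg_psi \<nu> q) - exp (- d * vg_psi \<nu> \<theta>)) / (\<theta> - q) / (1 - exp (- d * (\<mu> + vg_psi \<nu> q)))"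
  have Gv: "(\<integral>\<^sup>+\<omega>. (\<integral>\<^sup>+a. G n \<omega> a \<partial>lborel) \<partial>M) = ennreal (?v (d n))" for n
    unfolding G_def by (rule nn_integral_grid_sum[OF q \<mu> \<theta>]) (simp add: d_def)
  have "(\<lambda>n. ?v (d n)) \<longlonglongrightarrow> (vg_psi \<nu> \<theta> - vg_psi \<nu> q) / ((\<theta> - q) * (\<mu> + vg_psi \<nu> q))"
  proof -
    define A B where "A = vg_psi \<nu> q" and "B = vg_psi \<nu> \<theta>"
    have AB: "0 < A" "0 < B" "\<theta> - q \<noteq> 0" "\<mu> + A > 0" using vg_psi_pos q \<theta> \<mu> by (auto simp: A_def B_def add_pos_pos)
    \<comment> \<open>Numerator and denominator vanish linearly in the mesh with slopes
      \<open>B - A\<close> and \<open>\<mu> + A\<close>.\<close>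
    have "((\<lambda>x::real. (exp (- x * A) - exp (- x * B)) / (1 - exp (- x * (\<mu> + A)))) \<longlongrightarrow> (B - A) * inverse (A + \<mu>)) (at_right 0)"
      using AB by real_asymp
    then have "((\<lambda>x::real. (exp (- x * A) - exp (- x * B)) / (1 - exp (- x * (\<mu> + A)))) \<longlongrightarrow> (B - A) / (\<mu> + A)) (at_right 0)"
      by (simp add: divide_inverse add.commute)
    moreover have "((\<lambda>x::real. exp (- \<mu> * x) / (\<theta> - q)) \<longlongrightarrow> 1 / (\<theta> - q)) (at_right 0)"
      using AB by (auto intro!: tendsto_eq_intros)
    ultimately have "((\<lambda>x::real. exp (- \<mu> * x) / (\<theta> - q) * ((exp (- x * A) - exp (- x * B)) / (1 - exp (- x * (\<mu> + A))))) \<longlongrightarrow> 1 / (\<theta> - q) * ((B - A) / (\<mu> + A))) (at_right 0)"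
      by (intro tendsto_mult)
    moreover have "filterlim d (at_right 0) sequentially"
      unfolding d_def by (rule tendsto_imp_filterlim_at_right[OF LIMSEQ_inverse_real_of_nat[unfolded inverse_eq_divide]]) (intro always_eventually, simp)
    ultimately have "(\<lambda>n. exp (- \<mu> * d n) / (\<theta> - q) * ((exp (- d n * A) - exp (- d n * B)) / (1 - exp (- d n * (\<mu> + A))))) \<longlonglongrightarrow> 1 / (\<theta> - q) * ((B - A) / (\<mu> + A))"
      by (rule filterlim_compose)
    then show ?thesis unfolding A_def B_def by (simp add: mult.commute)
  qed
  then have "(\<lambda>n. ennreal (?v (d n))) \<longlonglongrightarrow> ennreal ((vg_psi \<nu> \<theta> - vg_psi \<nu> q) / ((\<theta> - q) * (\<mu> + vg_psi \<nu> q)))"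
    by (rule tendsto_ennrealI)
  from LIMSEQ_unique[OF outer[unfolded Gv] this] show ?thesis unfolding H_def .
qed

end

section \<open>The Levy density as a mixture of exponentials\<close>

text \<open>With \<open>c = (y\<^sup>2 - \<beta>\<^sup>2) / 2\<close> the gamma Levy density is
  \<open>\<mu>(z) = \<integral>\<^sub>y\<^sub>>\<^sub>\<alpha> (y / \<nu>) exp (- c z) dy\<close>: in this mixture of exponentials the variable \<open>y\<close>
  becomes the one of the exponential integral.\<close>
definition vg_rate :: "real \<Rightarrow> real \<Rightarrow> real" where "vg_rate \<beta> y = (y\<^sup>2 - \<beta>\<^sup>2) / 2"

definition vg_alpha :: "real \<Rightarrow> real \<Rightarrow> real" where "vg_alpha \<nu> \<beta> = sqrt (2 / \<nu> + \<beta>\<^sup>2)"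

lemma vg_rate_measurable[measurable]: "vg_rate \<beta> \<in> borel_measurable borel"
  unfolding vg_rate_def[abs_def] by measurable

lemma vg_alpha_pos: "0 < \<nu> \<Longrightarrow> 0 < vg_alpha \<nu> \<beta>"
  unfolding vg_alpha_def by (auto intro!: real_sqrt_gt_zero add_pos_nonneg)

text \<open>The meaning of \<alpha>: the slowest rate in the mixture is \<open>1 / \<nu>\<close>,
  the exponential decay rate of the Levy density.\<close>

lemma vg_rate_alpha: "0 < \<nu> \<Longrightarrow> vg_rate \<beta> (vg_alpha \<nu> \<beta>) = 1 / \<nu>"
  unfolding vg_rate_def vg_alpha_def by (simp add: add_nonneg_nonneg)

lemma vg_rate_ge:
  assumes "0 < \<nu>" "vg_alpha \<nu> \<beta> \<le> y"
  shows "1 / \<nu> \<le> vg_rate \<beta> y"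
proof -
  have "(vg_alpha \<nu> \<beta>)\<^sup>2 \<le> y\<^sup>2" using assms vg_alpha_pos[of \<nu> \<beta>] by (intro power_mono) auto
  then show ?thesis using vg_rate_alpha[of \<nu> \<beta>] assms(1) unfolding vg_rate_def by simp
qed

text \<open>The integrand is what the rate of \<open>y\<close> contributes once overshoot and level
  have been integrated out. Since \<open>vg_rate \<beta>\<close> has derivative \<open>y\<close>,
  partial fractions give a logarithmic antiderivative, and the rate \<open>1 / \<nu>\<close> at the
  lower limit turns it into values of the Laplace exponent.\<close>

lemma nn_integral_vg_mixture:
  assumes \<nu>: "0 < \<nu>" and q: "0 < q" and \<theta>: "0 < \<theta>" "q \<noteq> \<theta>"
  shows "(\<integral>\<^sup>+y. indicator {vg_alpha \<nu> \<beta><..} y * ennreal (y / \<nu> / ((q + vg_rate \<beta> y) * (\<theta> + vg_rate \<beta> y))) \<partial>lborel) =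
    ennreal ((vg_psi \<nu> \<theta> - vg_psi \<nu> q) / (\<theta> - q))"
proof -
  let ?a = "vg_alpha \<nu> \<beta>"
  have pos: "0 < q + vg_rate \<beta> y" "0 < \<theta> + vg_rate \<beta> y" "0 < y" if "?a \<le> y" for y
  proof -
    have "0 < 1 / \<nu>" using \<nu> by simp
    then have "0 < vg_rate \<beta> y" using vg_rate_ge[OF \<nu> that] by linarith
    then show "0 < q + vg_rate \<beta> y" "0 < \<theta> + vg_rate \<beta> y" "0 < y"
      using q \<theta> vg_alpha_pos[OF \<nu>, of \<beta>] that by auto
  qed
  define F where "F y = (ln (q + vg_rate \<beta> y) - ln (\<theta> + vg_rate \<beta> y)) / (\<nu> * (\<theta> - q))" for y
  have "(\<integral>\<^sup>+y. indicator {?a<..} y * ennreal (y / \<nu> / ((q + vg_rate \<beta> y) * (\<theta> + vg_rate \<beta> y))) \<partial>lborel) =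
    (\<integral>\<^sup>+y\<in>{?a..}. ennreal (y / \<nu> / ((q + vg_rate \<beta> y) * (\<theta> + vg_rate \<beta> y))) \<partial>lborel)"
  proof (rule nn_integral_cong_AE)
    have "AE a in lborel. a \<noteq> ?a" by (rule AE_lborel_singleton)
    then show "AE y in lborel. indicator {?a<..} y * ennreal (y / \<nu> / ((q + vg_rate \<beta> y) * (\<theta> + vg_rate \<beta> y))) =
       ennreal (y / \<nu> / ((q + vg_rate \<beta> y) * (\<theta> + vg_rate \<beta> y))) * indicator {?a..} y"
      by eventually_elim (auto simp: indicator_def)
  qed
  also have "\<dots> = ennreal (0 - F ?a)"
  proof (rule nn_integral_FTC_atLeast)
    show "(\<lambda>y. y / \<nu> / ((q + vg_rate \<beta> y) * (\<theta> + vg_rate \<beta> y))) \<in> borel_measurable borel" by measurable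
    fix y assume y: "?a \<le> y"
    have d: "((\<lambda>y. ln (r + vg_rate \<beta> y)) has_real_derivative y / (r + vg_rate \<beta> y)) (at y)" if "0 < r + vg_rate \<beta> y" for r
      using that unfolding vg_rate_def by (auto intro!: derivative_eq_intros simp: divide_simps)
    have "(F has_real_derivative (y / (q + vg_rate \<beta> y) - y / (\<theta> + vg_rate \<beta> y)) / (\<nu> * (\<theta> - q))) (at y)"
      unfolding F_def by (intro DERIV_cdivide DERIV_diff d pos y)
    moreover have "(y / (q + vg_rate \<beta> y) - y / (\<theta> + vg_rate \<beta> y)) / (\<nu> * (\<theta> - q)) = y / \<nu> / ((q + vg_rate \<beta> y) * (\<theta> + vg_rate \<beta> y))"
    proof -
      have "y / (q + vg_rate \<beta> y) - y / (\<theta> + vg_rate \<beta> y) = (\<theta> - q) * (y / ((q + vg_rate \<beta> y) * (\<theta> + vg_rate \<beta> y)))"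
        using pos[OF y] by (simp add: divide_simps) (simp add: algebra_simps)
      then show ?thesis using \<theta> \<nu> by simp
    qed
    ultimately show "(F has_real_derivative y / \<nu> / ((q + vg_rate \<beta> y) * (\<theta> + vg_rate \<beta> y))) (at y)" by simp
    show "0 \<le> y / \<nu> / ((q + vg_rate \<beta> y) * (\<theta> + vg_rate \<beta> y))" using pos[OF y] \<nu> by simp
  next
    have "((\<lambda>y. ln (q + (y\<^sup>2 - \<beta>\<^sup>2) / 2) - ln (\<theta> + (y\<^sup>2 - \<beta>\<^sup>2) / 2)) \<longlongrightarrow> 0) at_top" by real_asymp
    then show "(F \<longlongrightarrow> 0) at_top" unfolding F_def vg_rate_def by (rule tendsto_divide_zero)
  qed
  also have "0 - F ?a = (vg_psi \<nu> \<theta> - vg_psi \<nu> q) / (\<theta> - q)"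
  proof -
    have e: "ln (1 + \<nu> * r) = ln \<nu> + ln (r + 1 / \<nu>)" if "0 < r" for r
    proof -
      have "1 + \<nu> * r = \<nu> * (r + 1 / \<nu>)" using \<nu> by (simp add: field_simps)
      moreover have "0 < r + 1 / \<nu>" using that \<nu> by (intro add_pos_pos) auto
      ultimately show ?thesis using \<nu> by (simp add: ln_mult)
    qed
    show ?thesis unfolding F_def vg_rate_alpha[OF \<nu>] vg_psi_def e[OF q] e[OF \<theta>(1)]
      using \<nu> \<theta> by (simp add: divide_simps)
  qed
  finally show ?thesis .
qed

section \<open>Joint density of passage time and overshoot\<close>

context gamma_process begin

text \<open>Density in \<open>(s, k)\<close> of the pair (passage time over level \<open>a\<close>, overshoot).\<close>
definition passage_density :: "real \<Rightarrow> real \<Rightarrow> real \<Rightarrow> real \<Rightarrow> ennreal" where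
  "passage_density \<beta> s k a = (\<integral>\<^sup>+y. indicator {vg_alpha \<nu> \<beta><..} y *
     (\<integral>\<^sup>+\<omega>. indicator {T (max 0 s) \<omega><..} a * ennreal (y / \<nu> * exp (- vg_rate \<beta> y * (a - T (max 0 s) \<omega> + k))) \<partial>M) \<partial>lborel)"

lemma T_process_comp[measurable (raw)]:
  assumes [measurable]: "f \<in> borel_measurable N" "g \<in> measurable N M"
  shows "(\<lambda>x. T (max 0 (f x)) (g x)) \<in> borel_measurable N"
  using measurable_compose[OF measurable_Pair[OF assms] T_process_measurable] by simp

lemma indicator_greaterThan_measurable[measurable (raw)]:
  assumes [measurable]: "f \<in> borel_measurable N" "g \<in> borel_measurable N"
  shows "(\<lambda>x. indicator {f x<..} (g x :: real) :: ennreal) \<in> borel_measurable N"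
  unfolding indicator_def greaterThan_iff of_bool_def by measurable

lemma passage_density_measurable[measurable]:
  "(\<lambda>p. passage_density \<beta> (fst p) (fst (snd p)) (snd (snd p))) \<in> borel_measurable (borel \<Otimes>\<^sub>M (borel \<Otimes>\<^sub>M borel))"
  unfolding passage_density_def by measurable

text \<open>For a fixed rate and fixed \<open>T s\<close> the integrals over level and overshoot are
  elementary. The level runs from \<open>T s\<close> upwards, which leaves
  \<open>exp (- q * T s)\<close>; its expectation is exponential in \<open>s\<close>, so the time
  integral yields \<open>1 / (\<mu> + vg_psi \<nu> q)\<close>, and the rates are summed by the
  mixture formula.\<close>

lemma laplace_passage_density:
  assumes q: "0 < q" and \<mu>: "0 < \<mu>" and \<theta>: "0 < \<theta>" "q \<noteq> \<theta>"
  shows "(\<integral>\<^sup>+s. indicator {0..} s * (\<integral>\<^sup>+k. indicator {0..} k * (\<integral>\<^sup>+a. indicator {0..} a *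
      (ennreal (exp (- (\<mu> * s + \<theta> * k + q * a))) * passage_density \<beta> s k a) \<partial>lborel) \<partial>lborel) \<partial>lborel)
    = ennreal ((vg_psi \<nu> \<theta> - vg_psi \<nu> q) / ((\<theta> - q) * (\<mu> + vg_psi \<nu> q)))"
proof -
  let ?\<alpha> = "vg_alpha \<nu> \<beta>"
  interpret LM: pair_sigma_finite lborel M ..
  define J where "J s k = (\<integral>\<^sup>+a. indicator {0..} a * (ennreal (exp (- (\<mu> * s + \<theta> * k + q * a))) * passage_density \<beta> s k a) \<partial>lborel)" for s k
  define h where "h y = y / \<nu> / (q + vg_rate \<beta> y)" for y
  have rate: "0 < vg_rate \<beta> y" "0 < y" if "?\<alpha> < y" for y
    using vg_rate_ge[OF nu, of \<beta> y] that nu vg_alpha_pos[OF nu, of \<beta>]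
    by (auto intro: less_le_trans[of 0 "1 / \<nu>"])
  have J: "J s k = (\<integral>\<^sup>+y. indicator {?\<alpha><..} y * ennreal (exp (- (\<mu> + vg_psi \<nu> q) * s) * (exp (- (\<theta> + vg_rate \<beta> y) * k) * h y)) \<partial>lborel)"
    if s: "0 \<le> s" for s k
  proof -
    let ?f = "\<lambda>a y \<omega>. indicator {?\<alpha><..} y * (indicator {T s \<omega><..} a * ennreal (exp (- (\<mu> * s + \<theta> * k + q * a)) * (y / \<nu> * exp (- vg_rate \<beta> y * (a - T s \<omega> + k)))))"
    have ms: "max 0 s = s" using s by simp
    have "J s k = (\<integral>\<^sup>+a. (\<integral>\<^sup>+y. (\<integral>\<^sup>+\<omega>. ?f a y \<omega> \<partial>M) \<partial>lborel) \<partial>lborel)"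
      unfolding J_def passage_density_def ms
    proof (intro nn_integral_cong)
      fix a :: real
      have ind0: "indicator {0..} a * ?f a y \<omega> = ?f a y \<omega>" if "\<omega> \<in> space M" for y \<omega>
        using T_nonneg[OF that s] by (auto simp: indicator_def)
      have "indicator {0..} a * (ennreal (exp (- (\<mu> * s + \<theta> * k + q * a))) * (\<integral>\<^sup>+y. indicator {?\<alpha><..} y *
          (\<integral>\<^sup>+\<omega>. indicator {T s \<omega><..} a * ennreal (y / \<nu> * exp (- vg_rate \<beta> y * (a - T s \<omega> + k))) \<partial>M) \<partial>lborel)) =
        (\<integral>\<^sup>+y. (\<integral>\<^sup>+\<omega>. indicator {0..} a * ?f a y \<omega> \<partial>M) \<partial>lborel)"
        by (simp add: nn_integral_cmult[symmetric] ennreal_mult'[symmetric] mult_ac)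
      also have "\<dots> = (\<integral>\<^sup>+y. (\<integral>\<^sup>+\<omega>. ?f a y \<omega> \<partial>M) \<partial>lborel)"
        by (intro nn_integral_cong ind0)
      finally show "indicator {0..} a * (ennreal (exp (- (\<mu> * s + \<theta> * k + q * a))) * (\<integral>\<^sup>+y. indicator {?\<alpha><..} y *
          (\<integral>\<^sup>+\<omega>. indicator {T s \<omega><..} a * ennreal (y / \<nu> * exp (- vg_rate \<beta> y * (a - T s \<omega> + k))) \<partial>M) \<partial>lborel)) =
        (\<integral>\<^sup>+y. (\<integral>\<^sup>+\<omega>. ?f a y \<omega> \<partial>M) \<partial>lborel)" .
    qed
    also have "\<dots> = (\<integral>\<^sup>+y. (\<integral>\<^sup>+a. (\<integral>\<^sup>+\<omega>. ?f a y \<omega> \<partial>M) \<partial>lborel) \<partial>lborel)"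
      by (rule lborel_pair.Fubini') measurable
    also have "\<dots> = (\<integral>\<^sup>+y. (\<integral>\<^sup>+\<omega>. (\<integral>\<^sup>+a. ?f a y \<omega> \<partial>lborel) \<partial>M) \<partial>lborel)"
      by (intro nn_integral_cong LM.Fubini'[symmetric]) measurable
    also have "\<dots> = (\<integral>\<^sup>+y. indicator {?\<alpha><..} y * ennreal (exp (- (\<mu> + vg_psi \<nu> q) * s) * (exp (- (\<theta> + vg_rate \<beta> y) * k) * h y)) \<partial>lborel)"
    proof (intro nn_integral_cong)
      fix y
      show "(\<integral>\<^sup>+\<omega>. (\<integral>\<^sup>+a. ?f a y \<omega> \<partial>lborel) \<partial>M) = indicator {?\<alpha><..} y * ennreal (exp (- (\<mu> + vg_psi \<nu> q) * s) * (exp (- (\<theta> + vg_rate \<beta> y) * k) * h y))"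
      proof (cases "?\<alpha> < y")
        case True
        let ?c = "vg_rate \<beta> y"
        note r = rate[OF True]
        define B where "B = exp (- \<mu> * s) * (exp (- (\<theta> + ?c) * k) * (y / \<nu>))"
        have B0: "0 \<le> B" using r nu by (simp add: B_def)
        have "(\<integral>\<^sup>+\<omega>. (\<integral>\<^sup>+a. ?f a y \<omega> \<partial>lborel) \<partial>M) = (\<integral>\<^sup>+\<omega>. ennreal (B / (q + ?c) * exp (- q * T s \<omega>)) \<partial>M)"
        proof (intro nn_integral_cong)
          fix \<omega>
          have "?f a y \<omega> = ennreal (B * exp (?c * T s \<omega>)) * (indicator {T s \<omega><..} a * ennreal (exp (- (q + ?c) * a)))" for a
          proof -
            have "exp (- (\<mu> * s + \<theta> * k + q * a)) * (y / \<nu> * exp (- ?c * (a - T s \<omega> + k))) = (B * exp (?c * T s \<omega>)) * exp (- (q + ?c) * a)"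
            proof -
              have "exp (- (\<mu> * s + \<theta> * k + q * a)) * exp (- ?c * (a - T s \<omega> + k)) =
                exp (- \<mu> * s) * exp (- (\<theta> + ?c) * k) * exp (?c * T s \<omega>) * exp (- (q + ?c) * a)"
                by (simp add: exp_add[symmetric] algebra_simps)
              then show ?thesis unfolding B_def by (simp only: mult_ac)
            qed
            then show ?thesis using True B0 by (simp add: ennreal_mult mult_ac)
          qed
          then have "(\<integral>\<^sup>+a. ?f a y \<omega> \<partial>lborel) = (\<integral>\<^sup>+a. ennreal (B * exp (?c * T s \<omega>)) * (indicator {T s \<omega><..} a * ennreal (exp (- (q + ?c) * a))) \<partial>lborel)"
            by (intro nn_integral_cong)
          also have "\<dots> = ennreal (B * exp (?c * T s \<omega>)) * (\<integral>\<^sup>+a. indicator {T s \<omega><..} a * ennreal (exp (- (q + ?c) * a)) \<partial>lborel)"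
            by (rule nn_integral_cmult) measurable
          also have "\<dots> = ennreal (B * exp (?c * T s \<omega>)) * ennreal (exp (- (q + ?c) * T s \<omega>) / (q + ?c))"
            using r q by (subst nn_integral_exp_tail) auto
          also have "\<dots> = ennreal (B * exp (?c * T s \<omega>) * (exp (- (q + ?c) * T s \<omega>) / (q + ?c)))"
            using B0 r q by (intro ennreal_mult[symmetric]) auto
          also have "B * exp (?c * T s \<omega>) * (exp (- (q + ?c) * T s \<omega>) / (q + ?c)) = B / (q + ?c) * (exp (?c * T s \<omega>) * exp (- (q + ?c) * T s \<omega>))"
            by simp
          also have "exp (?c * T s \<omega>) * exp (- (q + ?c) * T s \<omega>) = exp (- q * T s \<omega>)"
            by (simp add: exp_add[symmetric] algebra_simps)
          finally show "(\<integral>\<^sup>+a. ?f a y \<omega> \<partial>lborel) = ennreal (B / (q + ?c) * exp (- q * T s \<omega>))" .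
        qed
        also have "\<dots> = ennreal (B / (q + ?c)) * (\<integral>\<^sup>+\<omega>. ennreal (exp (- q * T s \<omega>)) \<partial>M)"
        proof -
          have "0 \<le> B / (q + ?c)" using B0 r q by simp
          then have "(\<integral>\<^sup>+\<omega>. ennreal (B / (q + ?c) * exp (- q * T s \<omega>)) \<partial>M) = (\<integral>\<^sup>+\<omega>. ennreal (B / (q + ?c)) * ennreal (exp (- q * T s \<omega>)) \<partial>M)"
            by (intro nn_integral_cong ennreal_mult) auto
          then show ?thesis by (simp only:) (rule nn_integral_cmult, measurable)
        qed
        also have "(\<integral>\<^sup>+\<omega>. ennreal (exp (- q * T s \<omega>)) \<partial>M) = ennreal (exp (- s * vg_psi \<nu> q))"
        proof -
          have "integrable M (\<lambda>\<omega>. exp (- q * T s \<omega>))"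
            using q T_nonneg s by (auto intro!: integrable_const_bound[where B=1] AE_I2)
          then show ?thesis using laplace_T[OF s, of q] q by (subst nn_integral_eq_integral) auto
        qed
        also have "ennreal (B / (q + ?c)) * ennreal (exp (- s * vg_psi \<nu> q)) = ennreal (B / (q + ?c) * exp (- s * vg_psi \<nu> q))"
          using B0 r q by (intro ennreal_mult[symmetric]) auto
        also have "B / (q + ?c) * exp (- s * vg_psi \<nu> q) = exp (- (\<mu> + vg_psi \<nu> q) * s) * (exp (- (\<theta> + ?c) * k) * h y)"
        proof -
          have "exp (- (\<mu> + vg_psi \<nu> q) * s) = exp (- \<mu> * s) * exp (- s * vg_psi \<nu> q)"
            by (simp add: exp_add[symmetric] algebra_simps)
          then show ?thesis unfolding B_def h_def by simp
        qed
        finally show ?thesis using True by simp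
      qed simp
    qed
    finally show ?thesis .
  qed
  have hm[measurable]: "h \<in> borel_measurable borel" unfolding h_def[abs_def] by measurable
  have h0: "0 \<le> h y" if "?\<alpha> < y" for y using rate[OF that] q nu by (simp add: h_def)
  let ?H = "\<integral>\<^sup>+y. indicator {?\<alpha><..} y * ennreal (h y / (\<theta> + vg_rate \<beta> y)) \<partial>lborel"
  have "(\<integral>\<^sup>+s. indicator {0..} s * (\<integral>\<^sup>+k. indicator {0..} k * J s k \<partial>lborel) \<partial>lborel) =
    (\<integral>\<^sup>+s. (indicator {0..} s * ennreal (exp (- (\<mu> + vg_psi \<nu> q) * s))) * ?H \<partial>lborel)"
  proof (intro nn_integral_cong)
    fix s :: real
    show "indicator {0..} s * (\<integral>\<^sup>+k. indicator {0..} k * J s k \<partial>lborel) = (indicator {0..} s * ennreal (exp (- (\<mu> + vg_psi \<nu> q) * s))) * ?H"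
    proof (cases "0 \<le> s")
      case True
      let ?e = "ennreal (exp (- (\<mu> + vg_psi \<nu> q) * s))"
      have "(\<integral>\<^sup>+k. indicator {0..} k * J s k \<partial>lborel) =
         (\<integral>\<^sup>+k. (\<integral>\<^sup>+y. ?e * (indicator {?\<alpha><..} y * (ennreal (h y) * (indicator {0..} k * ennreal (exp (- (\<theta> + vg_rate \<beta> y) * k))))) \<partial>lborel) \<partial>lborel)"
        unfolding J[OF True]
      proof (intro nn_integral_cong)
        fix k :: real
        have "indicator {0..} k * (\<integral>\<^sup>+y. indicator {?\<alpha><..} y * ennreal (exp (- (\<mu> + vg_psi \<nu> q) * s) * (exp (- (\<theta> + vg_rate \<beta> y) * k) * h y)) \<partial>lborel)
          = (\<integral>\<^sup>+y. indicator {0..} k * (indicator {?\<alpha><..} y * ennreal (exp (- (\<mu> + vg_psi \<nu> q) * s) * (exp (- (\<theta> + vg_rate \<beta> y) * k) * h y))) \<partial>lborel)"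
          by (subst nn_integral_cmult) auto
        also have "\<dots> = (\<integral>\<^sup>+y. ?e * (indicator {?\<alpha><..} y * (ennreal (h y) * (indicator {0..} k * ennreal (exp (- (\<theta> + vg_rate \<beta> y) * k))))) \<partial>lborel)"
        proof (intro nn_integral_cong)
          fix y
          show "indicator {0..} k * (indicator {?\<alpha><..} y * ennreal (exp (- (\<mu> + vg_psi \<nu> q) * s) * (exp (- (\<theta> + vg_rate \<beta> y) * k) * h y)))
             = ?e * (indicator {?\<alpha><..} y * (ennreal (h y) * (indicator {0..} k * ennreal (exp (- (\<theta> + vg_rate \<beta> y) * k)))))"
            using h0[of y] by (cases "?\<alpha> < y") (simp_all add: ennreal_mult mult_ac)
        qed
        finally show "indicator {0..} k * (\<integral>\<^sup>+y. indicator {?\<alpha><..} y * ennreal (exp (- (\<mu> + vg_psi \<nu> q) * s) * (exp (- (\<theta> + vg_rate \<beta> y) * k) * h y)) \<partial>lborel)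
          = (\<integral>\<^sup>+y. ?e * (indicator {?\<alpha><..} y * (ennreal (h y) * (indicator {0..} k * ennreal (exp (- (\<theta> + vg_rate \<beta> y) * k))))) \<partial>lborel)" .
      qed
      also have "\<dots> = (\<integral>\<^sup>+y. (\<integral>\<^sup>+k. ?e * (indicator {?\<alpha><..} y * (ennreal (h y) * (indicator {0..} k * ennreal (exp (- (\<theta> + vg_rate \<beta> y) * k))))) \<partial>lborel) \<partial>lborel)"
        by (rule lborel_pair.Fubini') measurable
      also have "\<dots> = (\<integral>\<^sup>+y. ?e * (indicator {?\<alpha><..} y * ennreal (h y / (\<theta> + vg_rate \<beta> y))) \<partial>lborel)"
      proof (intro nn_integral_cong)
        fix y
        show "(\<integral>\<^sup>+k. ?e * (indicator {?\<alpha><..} y * (ennreal (h y) * (indicator {0..} k * ennreal (exp (- (\<theta> + vg_rate \<beta> y) * k))))) \<partial>lborel) =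
          ?e * (indicator {?\<alpha><..} y * ennreal (h y / (\<theta> + vg_rate \<beta> y)))"
        proof (cases "?\<alpha> < y")
          case True
          have "(\<integral>\<^sup>+k. ?e * (indicator {?\<alpha><..} y * (ennreal (h y) * (indicator {0..} k * ennreal (exp (- (\<theta> + vg_rate \<beta> y) * k))))) \<partial>lborel) =
            ?e * (indicator {?\<alpha><..} y * (ennreal (h y) * (\<integral>\<^sup>+k. indicator {0..} k * ennreal (exp (- (\<theta> + vg_rate \<beta> y) * k)) \<partial>lborel)))"
          proof -
            define C :: ennreal where "C = ?e * (indicator {?\<alpha><..} y * ennreal (h y))"
            have "(\<integral>\<^sup>+k. C * (indicator {0..} k * ennreal (exp (- (\<theta> + vg_rate \<beta> y) * k))) \<partial>lborel) =
               C * (\<integral>\<^sup>+k. indicator {0..} k * ennreal (exp (- (\<theta> + vg_rate \<beta> y) * k)) \<partial>lborel)"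
              by (rule nn_integral_cmult) measurable
            then show ?thesis unfolding C_def by (simp only: mult.assoc)
          qed
          also have "\<dots> = ?e * (indicator {?\<alpha><..} y * (ennreal (h y) * ennreal (1 / (\<theta> + vg_rate \<beta> y))))"
            using rate[OF True] \<theta> by (subst nn_integral_exp_atLeast_0) auto
          also have "ennreal (h y) * ennreal (1 / (\<theta> + vg_rate \<beta> y)) = ennreal (h y / (\<theta> + vg_rate \<beta> y))"
            using rate[OF True] \<theta> h0[OF True] by (subst ennreal_mult[symmetric]) auto
          finally show ?thesis .
        qed simp
      qed
      also have "\<dots> = ?e * ?H" by (rule nn_integral_cmult) measurable
      finally show ?thesis using True by simp
    qed simp
  qed
  also have "\<dots> = (\<integral>\<^sup>+s. indicator {0..} s * ennreal (exp (- (\<mu> + vg_psi \<nu> q) * s)) \<partial>lborel) * ?H"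
    by (rule nn_integral_multc) measurable
  also have "(\<integral>\<^sup>+s. indicator {0..} s * ennreal (exp (- (\<mu> + vg_psi \<nu> q) * s)) \<partial>lborel) = ennreal (1 / (\<mu> + vg_psi \<nu> q))"
    using vg_psi_pos[OF q] \<mu> by (intro nn_integral_exp_atLeast_0) simp
  also have "?H = ennreal ((vg_psi \<nu> \<theta> - vg_psi \<nu> q) / (\<theta> - q))"
    using nn_integral_vg_mixture[OF nu q \<theta>, of \<beta>] by (simp add: h_def mult.assoc)
  also have "ennreal (1 / (\<mu> + vg_psi \<nu> q)) * ennreal ((vg_psi \<nu> \<theta> - vg_psi \<nu> q) / (\<theta> - q)) =
    ennreal ((vg_psi \<nu> \<theta> - vg_psi \<nu> q) / ((\<theta> - q) * (\<mu> + vg_psi \<nu> q)))"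
    using vg_psi_pos[OF q] \<mu> by (subst ennreal_mult'[symmetric]) (auto simp: mult.commute)
  finally show ?thesis unfolding J_def .
qed

lemma T_passage_ge: "\<omega> \<in> space M \<Longrightarrow> unbounded_path T \<omega> \<Longrightarrow> a \<le> T (passage T a \<omega>) \<omega>"
  using subordinator_path.X_first_pass_ge[OF subordinator_path] by (simp add: passage_def)

text \<open>Both sides integrate \<open>\<Phi>\<close> against measures on triples (time, overshoot,
  level), which agree by uniqueness of Laplace transforms. The level is integrated against Lebesgue
  measure, so the identity is about almost every level.\<close>

lemma nn_integral_passage:
  fixes \<Phi> :: "real \<times> real \<times> real \<Rightarrow> ennreal"
  assumes \<Phi>: "\<Phi> \<in> borel_measurable (borel \<Otimes>\<^sub>M (borel \<Otimes>\<^sub>M borel))"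
  shows "(\<integral>\<^sup>+\<omega>. (\<integral>\<^sup>+a. indicator {0..} a * \<Phi> (passage T a \<omega>, T (passage T a \<omega>) \<omega> - a, a) \<partial>lborel) \<partial>M) =
    (\<integral>\<^sup>+s. indicator {0..} s * (\<integral>\<^sup>+k. indicator {0..} k * (\<integral>\<^sup>+a. indicator {0..} a *
      (\<Phi> (s, k, a) * passage_density \<beta> s k a) \<partial>lborel) \<partial>lborel) \<partial>lborel)"
proof -
  interpret P: pair_sigma_finite M lborel ..
  let ?B = "borel \<Otimes>\<^sub>M (borel \<Otimes>\<^sub>M borel) :: (real \<times> real \<times> real) measure"
  \<comment> \<open>The weight makes both measures finite, as Lebesgue measure on the levels is not.
    With weight rate 1 for the level and \<open>1 / 2\<close> for the overshoot, the transforms are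
    evaluated at \<open>q = 1 + l\<close> and \<open>\<theta> = 1 / 2 + j\<close>; these never
    coincide, as the transform formulas demand.\<close>
  define wt :: "real \<times> real \<times> real \<Rightarrow> ennreal" where
    "wt v = ennreal (exp (- (fst v + fst (snd v) / 2 + snd (snd v))))" for v
  define U :: "'a \<times> real \<Rightarrow> real \<times> real \<times> real" where
    "U p = (passage T (snd p) (fst p), T (passage T (snd p) (fst p)) (fst p) - snd p, snd p)" for p
  have wtm[measurable]: "wt \<in> borel_measurable ?B" unfolding wt_def[abs_def] by measurable
  have Um[measurable]: "U \<in> measurable (M \<Otimes>\<^sub>M lborel) ?B"
    unfolding U_def[abs_def] by measurable
  define m1 where "m1 = distr (density (M \<Otimes>\<^sub>M lborel) (\<lambda>p. indicator {0..} (snd p) * wt (U p))) ?B U"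
  define g where "g v = indicator {0..} (fst v) * (indicator {0..} (fst (snd v)) * (indicator {0..} (snd (snd v)) *
     (wt v * passage_density \<beta> (fst v) (fst (snd v)) (snd (snd v)))))" for v
  have gm[measurable]: "g \<in> borel_measurable ?B" unfolding g_def[abs_def] by measurable
  have sl: "sets (lborel \<Otimes>\<^sub>M (lborel \<Otimes>\<^sub>M lborel)) = sets ?B"
    by (intro sets_pair_measure_cong sets_lborel)
  have gm'[measurable]: "g \<in> borel_measurable (lborel \<Otimes>\<^sub>M (lborel \<Otimes>\<^sub>M lborel))"
    unfolding measurable_cong_sets[OF sl refl] by (rule gm)
  define m2 where "m2 = density (lborel \<Otimes>\<^sub>M (lborel \<Otimes>\<^sub>M lborel)) g"
  have B: "?B = borel" by (simp add: borel_prod)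
  have sets: "sets m1 = sets borel" "sets m2 = sets borel"
    unfolding m1_def m2_def by (simp_all add: B lborel_prod)
  have int1: "(\<integral>\<^sup>+v. F v \<partial>m1) = (\<integral>\<^sup>+\<omega>. (\<integral>\<^sup>+a. indicator {0..} a * (wt (U (\<omega>, a)) * F (U (\<omega>, a))) \<partial>lborel) \<partial>M)"
    if F[measurable]: "F \<in> borel_measurable ?B" for F
  proof -
    have "(\<integral>\<^sup>+v. F v \<partial>m1) = (\<integral>\<^sup>+p. indicator {0..} (snd p) * wt (U p) * F (U p) \<partial>(M \<Otimes>\<^sub>M lborel))"
      unfolding m1_def by (simp add: nn_integral_distr nn_integral_density)
    also have "\<dots> = (\<integral>\<^sup>+\<omega>. (\<integral>\<^sup>+a. indicator {0..} (snd (\<omega>, a)) * wt (U (\<omega>, a)) * F (U (\<omega>, a)) \<partial>lborel) \<partial>M)"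
      by (rule lborel.nn_integral_fst[symmetric]) measurable
    finally show ?thesis by (simp add: mult.assoc)
  qed
  have int2: "(\<integral>\<^sup>+v. F v \<partial>m2) = (\<integral>\<^sup>+s. indicator {0..} s * (\<integral>\<^sup>+k. indicator {0..} k * (\<integral>\<^sup>+a. indicator {0..} a *
      (wt (s, k, a) * F (s, k, a) * passage_density \<beta> s k a) \<partial>lborel) \<partial>lborel) \<partial>lborel)"
    if F[measurable]: "F \<in> borel_measurable ?B" for F
  proof -
    have Fm'[measurable]: "F \<in> borel_measurable (lborel \<Otimes>\<^sub>M (lborel \<Otimes>\<^sub>M lborel))"
      unfolding measurable_cong_sets[OF sl refl] by (rule F)
    have s3: "sigma_finite_measure (lborel \<Otimes>\<^sub>M lborel :: (real \<times> real) measure)"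
      unfolding lborel_prod by (rule lborel.sigma_finite_measure_axioms)
    have "(\<integral>\<^sup>+v. F v \<partial>m2) = (\<integral>\<^sup>+v. g v * F v \<partial>(lborel \<Otimes>\<^sub>M (lborel \<Otimes>\<^sub>M lborel)))"
      unfolding m2_def by (simp add: nn_integral_density)
    also have "\<dots> = (\<integral>\<^sup>+s. (\<integral>\<^sup>+u. g (s, u) * F (s, u) \<partial>(lborel \<Otimes>\<^sub>M lborel)) \<partial>lborel)"
      by (rule sigma_finite_measure.nn_integral_fst[OF s3, symmetric]) measurable
    also have "\<dots> = (\<integral>\<^sup>+s. (\<integral>\<^sup>+k. (\<integral>\<^sup>+a. g (s, k, a) * F (s, k, a) \<partial>lborel) \<partial>lborel) \<partial>lborel)"
      by (intro nn_integral_cong lborel.nn_integral_fst[symmetric]) measurable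
    also have "\<dots> = (\<integral>\<^sup>+s. indicator {0..} s * (\<integral>\<^sup>+k. indicator {0..} k * (\<integral>\<^sup>+a. indicator {0..} a *
      (wt (s, k, a) * F (s, k, a) * passage_density \<beta> s k a) \<partial>lborel) \<partial>lborel) \<partial>lborel)"
    proof (intro nn_integral_cong)
      fix s :: real
      show "(\<integral>\<^sup>+k. (\<integral>\<^sup>+a. g (s, k, a) * F (s, k, a) \<partial>lborel) \<partial>lborel) = indicator {0..} s * (\<integral>\<^sup>+k. indicator {0..} k * (\<integral>\<^sup>+a. indicator {0..} a *
        (wt (s, k, a) * F (s, k, a) * passage_density \<beta> s k a) \<partial>lborel) \<partial>lborel)"
      proof (cases "0 \<le> s")
        case True
        have "(\<integral>\<^sup>+a. g (s, k, a) * F (s, k, a) \<partial>lborel) = indicator {0..} k * (\<integral>\<^sup>+a. indicator {0..} a *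
          (wt (s, k, a) * F (s, k, a) * passage_density \<beta> s k a) \<partial>lborel)" for k
          using True by (cases "0 \<le> k") (simp_all add: g_def mult_ac)
        then show ?thesis using True by simp
      qed (simp add: g_def)
    qed
    finally show ?thesis .
  qed
  define E :: "nat \<Rightarrow> nat \<Rightarrow> nat \<Rightarrow> real \<times> real \<times> real \<Rightarrow> ennreal" where
    "E i j l = (\<lambda>(x, y, z). ennreal (exp (- (real i * x + real j * y + real l * z))))" for i j l
  have Em[measurable]: "E i j l \<in> borel_measurable ?B" for i j l unfolding E_def by measurable
  have wtE: "wt (x, y, z) * E i j l (x, y, z) = ennreal (exp (- ((1 + real l) * z + (1 + real i) * x + (1 / 2 + real j) * y)))" for i j l x y z
    unfolding wt_def E_def by (simp add: ennreal_mult[symmetric] exp_add[symmetric] algebra_simps)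
  have ne: "1 + real l \<noteq> 1 / 2 + real j" for l j
  proof
    assume "1 + real l = 1 / 2 + real j"
    then have "real (2 * l + 1) = real (2 * j)" by simp
    then have "2 * l + 1 = 2 * j" by (simp only: of_nat_eq_iff)
    then show False by presburger
  qed
  have lap1: "(\<integral>\<^sup>+v. E i j l v \<partial>m1) = ennreal ((vg_psi \<nu> (1 / 2 + real j) - vg_psi \<nu> (1 + real l)) / ((1 / 2 + real j - (1 + real l)) * (1 + real i + vg_psi \<nu> (1 + real l))))" for i j l
  proof -
    have "(\<integral>\<^sup>+v. E i j l v \<partial>m1) = (\<integral>\<^sup>+\<omega>. (\<integral>\<^sup>+a. indicator {0..} a * ennreal (exp (- ((1 + real l) * a + (1 + real i) * passage T a \<omega> + (1 / 2 + real j) * (T (passage T a \<omega>) \<omega> - a)))) \<partial>lborel) \<partial>M)"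
      unfolding int1[OF Em] by (simp add: U_def wtE)
    also have "\<dots> = ennreal ((vg_psi \<nu> (1 / 2 + real j) - vg_psi \<nu> (1 + real l)) / ((1 / 2 + real j - (1 + real l)) * (1 + real i + vg_psi \<nu> (1 + real l))))"
      using ne by (intro laplace_first_passage) (auto simp: add_pos_nonneg)
    finally show ?thesis .
  qed
  have lap2: "(\<integral>\<^sup>+v. E i j l v \<partial>m2) = ennreal ((vg_psi \<nu> (1 / 2 + real j) - vg_psi \<nu> (1 + real l)) / ((1 / 2 + real j - (1 + real l)) * (1 + real i + vg_psi \<nu> (1 + real l))))" for i j l
  proof -
    have "(\<integral>\<^sup>+v. E i j l v \<partial>m2) = (\<integral>\<^sup>+s. indicator {0..} s * (\<integral>\<^sup>+k. indicator {0..} k * (\<integral>\<^sup>+a. indicator {0..} a *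
      (ennreal (exp (- ((1 + real i) * s + (1 / 2 + real j) * k + (1 + real l) * a))) * passage_density \<beta> s k a) \<partial>lborel) \<partial>lborel) \<partial>lborel)"
      unfolding int2[OF Em] wtE by (simp add: add_ac)
    also have "\<dots> = ennreal ((vg_psi \<nu> (1 / 2 + real j) - vg_psi \<nu> (1 + real l)) / ((1 / 2 + real j - (1 + real l)) * (1 + real i + vg_psi \<nu> (1 + real l))))"
      using ne by (intro laplace_passage_density) (auto simp: add_pos_nonneg)
    finally show ?thesis .
  qed
  have E0: "E 0 0 0 v = 1" for v by (simp add: E_def case_prod_unfold)
  have meq: "m1 = m2"
  proof (rule finite_measure_eqI_laplace3[OF _ _ sets])
    show "finite_measure m1" "finite_measure m2"
      using lap1[of 0 0 0] lap2[of 0 0 0] unfolding E0 by (auto intro!: finite_measureI)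
    show "AE (x, y, z) in m1. 0 \<le> x \<and> 0 \<le> y \<and> 0 \<le> z"
    proof -
      have "AE p in density (M \<Otimes>\<^sub>M lborel) (\<lambda>p. indicator {0..} (snd p) * wt (U p)). case U p of (x, y, z) \<Rightarrow> 0 \<le> x \<and> 0 \<le> y \<and> 0 \<le> z"
      proof (subst AE_density)
        have "AE p in M \<Otimes>\<^sub>M lborel. unbounded_path T (fst p)"
        proof (rule P.AE_pair_measure)
          have [measurable]: "Measurable.pred M (unbounded_path T)" by (rule unbounded_path_measurable) simp
          show "{p \<in> space (M \<Otimes>\<^sub>M lborel). unbounded_path T (fst p)} \<in> sets (M \<Otimes>\<^sub>M lborel)" by measurable
          show "AE x in M. AE y in lborel. unbounded_path T (fst (x, y))" using AE_unbounded_path by eventually_elim simp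
        qed
        then show "AE p in M \<Otimes>\<^sub>M lborel. 0 < indicator {0..} (snd p) * wt (U p) \<longrightarrow> (case U p of (x, y, z) \<Rightarrow> 0 \<le> x \<and> 0 \<le> y \<and> 0 \<le> z)"
          using AE_space
        proof eventually_elim
          case (elim p)
          then have "fst p \<in> space M" by (auto simp: space_pair_measure)
          then show ?case
            using T_passage_ge[of "fst p" "snd p"] passage_ge0[of "fst p" "snd p"] elim by (auto simp: U_def indicator_def)
        qed
      qed measurable
      then show ?thesis unfolding m1_def
        by (subst AE_distr_iff) (auto simp: case_prod_unfold)
    qed
    show "AE (x, y, z) in m2. 0 \<le> x \<and> 0 \<le> y \<and> 0 \<le> z"
      unfolding m2_def by (subst AE_density) (auto simp: g_def indicator_def case_prod_unfold)
    fix i j l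
    show "(\<integral>\<^sup>+(x, y, z). ennreal (exp (- (real i * x + real j * y + real l * z))) \<partial>m1) =
       (\<integral>\<^sup>+(x, y, z). ennreal (exp (- (real i * x + real j * y + real l * z))) \<partial>m2)"
      using lap1[of i j l] lap2[of i j l] unfolding E_def by simp
  qed
  \<comment> \<open>Dividing by the weight extends the identity to arbitrary nonnegative
    \<open>\<Phi>\<close>.\<close>
  define F where "F v = ennreal (exp (fst v + fst (snd v) / 2 + snd (snd v))) * \<Phi> v" for v
  have Fm[measurable]: "F \<in> borel_measurable ?B" unfolding F_def[abs_def] using \<Phi> by measurable
  have wF: "wt v * F v = \<Phi> v" for v
  proof -
    have "wt v * F v = ennreal (exp (- (fst v + fst (snd v) / 2 + snd (snd v))) * exp (fst v + fst (snd v) / 2 + snd (snd v))) * \<Phi> v"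
      unfolding wt_def F_def by (simp only: mult.assoc[symmetric] ennreal_mult[OF exp_ge_zero exp_ge_zero])
    also have "exp (- (fst v + fst (snd v) / 2 + snd (snd v))) * exp (fst v + fst (snd v) / 2 + snd (snd v)) = 1"
      by (simp only: exp_add[symmetric]) simp
    finally show ?thesis by simp
  qed
  show ?thesis
    using int1[OF Fm] int2[OF Fm] unfolding meq wF by (simp add: U_def)
qed

end

section \<open>The joint law of passage time and position\<close>

locale vg_setting = bm_hitting M W x0 \<beta> + gamma_process M T \<nu>
  for M :: "'a measure" and W x0 \<beta> T \<nu> +
  assumes indep: "indep_var (Pi\<^sub>M UNIV (\<lambda>_. borel)) (\<lambda>\<omega> t. W t \<omega>) (Pi\<^sub>M UNIV (\<lambda>_. borel)) (\<lambda>\<omega> t. T t \<omega>)"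
begin

text \<open>Hitting and passage times are not measurable on the uncountable product \<open>Pi\<^sub>M UNIV borel\<close> of path
  space; pulled back to \<open>space M\<close>, where paths are regular, they are measurable for the following
  \<open>\<sigma>\<close>-algebras.\<close>
definition FW :: "'a measure" where "FW = vimage_algebra (space M) (\<lambda>\<omega> t. W t \<omega>) (Pi\<^sub>M UNIV (\<lambda>_. borel))"
definition FT :: "'a measure" where "FT = vimage_algebra (space M) (\<lambda>\<omega> t. T t \<omega>) (Pi\<^sub>M UNIV (\<lambda>_. borel))"

lemma space_FW[simp]: "space FW = space M" and space_FT[simp]: "space FT = space M"
  by (simp_all add: FW_def FT_def)

lemma W_FW[measurable]: "W t \<in> borel_measurable FW"
proof -
  have "(\<lambda>\<omega> t. W t \<omega>) \<in> measurable FW (Pi\<^sub>M UNIV (\<lambda>_. borel))"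
    unfolding FW_def by (rule measurable_vimage_algebra1) (auto simp: space_PiM)
  from measurable_compose[OF this measurable_component_singleton[of t UNIV "\<lambda>_. borel"]] show ?thesis by simp
qed

lemma T_FT[measurable]: "T t \<in> borel_measurable FT"
proof -
  have "(\<lambda>\<omega> t. T t \<omega>) \<in> measurable FT (Pi\<^sub>M UNIV (\<lambda>_. borel))"
    unfolding FT_def by (rule measurable_vimage_algebra1) (auto simp: space_PiM)
  from measurable_compose[OF this measurable_component_singleton[of t UNIV "\<lambda>_. borel"]] show ?thesis by simp
qed

text \<open>Independence of the two paths means that the diagonal map into
  \<open>FW \<Otimes>\<^sub>M FT\<close> has a product law. The path of \<open>T\<close> can thus be
  frozen while the Brownian path is integrated, although both live on the same space.\<close>

lemma nn_integral_coupling: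
  assumes \<Phi>[measurable]: "\<Phi> \<in> borel_measurable (FW \<Otimes>\<^sub>M FT)"
  shows "(\<integral>\<^sup>+\<omega>. \<Phi> (\<omega>, \<omega>) \<partial>M) = (\<integral>\<^sup>+\<omega>'. (\<integral>\<^sup>+\<omega>. \<Phi> (\<omega>, \<omega>') \<partial>M) \<partial>M)"
proof -
  let ?P = "Pi\<^sub>M UNIV (\<lambda>_::real. borel :: real measure)"
  have rv: "(\<lambda>\<omega> t. W t \<omega>) \<in> measurable M ?P" "(\<lambda>\<omega> t. T t \<omega>) \<in> measurable M ?P"
    using indep by (auto dest: indep_var_rv1 indep_var_rv2)
  have idW[measurable]: "(\<lambda>\<omega>. \<omega>) \<in> measurable M FW" unfolding FW_def
    by (rule measurable_vimage_algebra2) (use rv in auto)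
  have idT[measurable]: "(\<lambda>\<omega>. \<omega>) \<in> measurable M FT" unfolding FT_def
    by (rule measurable_vimage_algebra2) (use rv in auto)
  have setsW: "{(\<lambda>\<omega>. \<omega>) -` A \<inter> space M |A. A \<in> sets FW} = {(\<lambda>\<omega> t. W t \<omega>) -` A \<inter> space M |A. A \<in> sets ?P}"
  proof -
    have "sets FW = {(\<lambda>\<omega> t. W t \<omega>) -` A \<inter> space M |A. A \<in> sets ?P}"
      unfolding FW_def by (rule sets_vimage_algebra2) (auto simp: space_PiM)
    moreover have "{(\<lambda>\<omega>. \<omega>) -` A \<inter> space M |A. A \<in> sets FW} = sets FW"
      using sets.sets_into_space[of _ FW] by (auto simp: Int_absorb2)
    ultimately show ?thesis by simp
  qed
  have setsT: "{(\<lambda>\<omega>. \<omega>) -` A \<inter> space M |A. A \<in> sets FT} = {(\<lambda>\<omega> t. T t \<omega>) -` A \<inter> space M |A. A \<in> sets ?P}"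
  proof -
    have "sets FT = {(\<lambda>\<omega> t. T t \<omega>) -` A \<inter> space M |A. A \<in> sets ?P}"
      unfolding FT_def by (rule sets_vimage_algebra2) (auto simp: space_PiM)
    moreover have "{(\<lambda>\<omega>. \<omega>) -` A \<inter> space M |A. A \<in> sets FT} = sets FT"
      using sets.sets_into_space[of _ FT] by (auto simp: Int_absorb2)
    ultimately show ?thesis by simp
  qed
  have "indep_var FW (\<lambda>\<omega>. \<omega>) FT (\<lambda>\<omega>. \<omega>)"
    using indep unfolding indep_var_eq setsW setsT using idW idT by simp
  then have prod: "distr M FW (\<lambda>\<omega>. \<omega>) \<Otimes>\<^sub>M distr M FT (\<lambda>\<omega>. \<omega>) = distr M (FW \<Otimes>\<^sub>M FT) (\<lambda>\<omega>. (\<omega>, \<omega>))"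
    unfolding indep_var_distribution_eq by simp
  interpret DW: prob_space "distr M FW (\<lambda>\<omega>. \<omega>)" by (rule prob_space_distr) simp
  interpret DT: prob_space "distr M FT (\<lambda>\<omega>. \<omega>)" by (rule prob_space_distr) simp
  interpret D: pair_sigma_finite "distr M FW (\<lambda>\<omega>. \<omega>)" "distr M FT (\<lambda>\<omega>. \<omega>)" ..
  have m: "case_prod (\<lambda>\<omega> \<omega>'. \<Phi> (\<omega>, \<omega>')) \<in> borel_measurable (distr M FW (\<lambda>\<omega>. \<omega>) \<Otimes>\<^sub>M distr M FT (\<lambda>\<omega>. \<omega>))"
    by measurable
  have "(\<integral>\<^sup>+\<omega>. \<Phi> (\<omega>, \<omega>) \<partial>M) = (\<integral>\<^sup>+p. \<Phi> p \<partial>distr M (FW \<Otimes>\<^sub>M FT) (\<lambda>\<omega>. (\<omega>, \<omega>)))"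
    by (subst nn_integral_distr) auto
  also have "\<dots> = (\<integral>\<^sup>+\<omega>'. (\<integral>\<^sup>+\<omega>. \<Phi> (\<omega>, \<omega>') \<partial>distr M FW (\<lambda>\<omega>. \<omega>)) \<partial>distr M FT (\<lambda>\<omega>. \<omega>))"
    unfolding prod[symmetric] using D.nn_integral_snd[OF m] by simp
  also have "\<dots> = (\<integral>\<^sup>+\<omega>'. (\<integral>\<^sup>+\<omega>. \<Phi> (\<omega>, \<omega>') \<partial>distr M FW (\<lambda>\<omega>. \<omega>)) \<partial>M)"
  proof -
    have "(\<lambda>\<omega>'. \<integral>\<^sup>+\<omega>. \<Phi> (\<omega>, \<omega>') \<partial>distr M FW (\<lambda>\<omega>. \<omega>)) \<in> borel_measurable FT" by measurable
    then show ?thesis by (subst nn_integral_distr) auto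
  qed
  also have "\<dots> = (\<integral>\<^sup>+\<omega>'. (\<integral>\<^sup>+\<omega>. \<Phi> (\<omega>, \<omega>') \<partial>M) \<partial>M)"
    by (intro nn_integral_cong, subst nn_integral_distr) auto
  finally show ?thesis .
qed

lemma hit_FW[measurable]: "hit \<in> borel_measurable FW" "Hit \<in> sets FW"
proof -
  have [measurable]: "Tstar x0 \<beta> W \<in> borel_measurable FW"
    by (rule Tstar_measurable) (auto intro: W_continuous)
  show "hit \<in> borel_measurable FW" unfolding hit_def[abs_def] by measurable
  have "{\<omega> \<in> space FW. Tstar x0 \<beta> W \<omega> < \<infinity>} \<in> sets FW" by measurable
  then show "Hit \<in> sets FW" unfolding Hit_def by simp
qed

text \<open>The decoupling requires measurability with the two arguments drawn from different
  factors: the hitting time and the position use the Brownian path, the passage over the hitting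
  level uses the path of \<open>T\<close>.\<close>

lemma passage_at_hit_measurable:
  "(\<lambda>p. passage T (hit (fst p)) (snd p)) \<in> borel_measurable (FW \<Otimes>\<^sub>M FT)"
  "(\<lambda>p. T (passage T (hit (fst p)) (snd p)) (snd p)) \<in> borel_measurable (FW \<Otimes>\<^sub>M FT)"
  "(\<lambda>p. Wtilde x0 \<beta> W (T (passage T (hit (fst p)) (snd p)) (snd p)) (fst p)) \<in> borel_measurable (FW \<Otimes>\<^sub>M FT)"
proof -
  have pm: "(\<lambda>p. passage T (fst p) (snd p)) \<in> borel_measurable (borel \<Otimes>\<^sub>M FT)"
    by (rule passage_measurable) (auto intro: T_0 T_mono T_rc)
  have Tm: "(\<lambda>p. T (max 0 (fst p)) (snd p)) \<in> borel_measurable (borel \<Otimes>\<^sub>M FT)"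
    by (rule measurable_right_continuous_process) (auto intro: T_rc)
  have Wm: "(\<lambda>p. Wtilde x0 \<beta> W (max 0 (fst p)) (snd p)) \<in> borel_measurable (borel \<Otimes>\<^sub>M FW)"
    by (rule measurable_right_continuous_process) (auto intro: Wtilde_right_continuous Wtilde_measurable)
  have p[measurable]: "(\<lambda>p. passage T (hit (fst p)) (snd p)) \<in> borel_measurable (FW \<Otimes>\<^sub>M FT)"
    using measurable_compose[OF _ pm, of "\<lambda>p. (hit (fst p), snd p)" "FW \<Otimes>\<^sub>M FT"] by simp
  then show "(\<lambda>p. passage T (hit (fst p)) (snd p)) \<in> borel_measurable (FW \<Otimes>\<^sub>M FT)" .
  have "(\<lambda>p. T (max 0 (passage T (hit (fst p)) (snd p))) (snd p)) \<in> borel_measurable (FW \<Otimes>\<^sub>M FT)"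
    using measurable_compose[OF _ Tm, of "\<lambda>p. (passage T (hit (fst p)) (snd p), snd p)" "FW \<Otimes>\<^sub>M FT"] by simp
  then show t[measurable]: "(\<lambda>p. T (passage T (hit (fst p)) (snd p)) (snd p)) \<in> borel_measurable (FW \<Otimes>\<^sub>M FT)"
    by (rule measurable_cong[THEN iffD1, rotated]) (auto simp: space_pair_measure max_absorb2 passage_ge0)
  have "(\<lambda>p. Wtilde x0 \<beta> W (max 0 (T (passage T (hit (fst p)) (snd p)) (snd p))) (fst p)) \<in> borel_measurable (FW \<Otimes>\<^sub>M FT)"
    using measurable_compose[OF _ Wm, of "\<lambda>p. (T (passage T (hit (fst p)) (snd p)) (snd p), fst p)" "FW \<Otimes>\<^sub>M FT"] by simp
  then show "(\<lambda>p. Wtilde x0 \<beta> W (T (passage T (hit (fst p)) (snd p)) (snd p)) (fst p)) \<in> borel_measurable (FW \<Otimes>\<^sub>M FT)"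
    by (rule measurable_cong[THEN iffD1, rotated]) (auto simp: space_pair_measure max_absorb2 passage_ge0 T_nonneg)
qed

text \<open>For a frozen path of \<open>T\<close> the overshoot over level \<open>a\<close> is a
  deterministic function \<open>\<kappa> a\<close>, and its right continuity is what the strong
  Markov property asks for.\<close>

lemma strong_markov_passage:
  assumes w': "\<omega>' \<in> space M" "unbounded_path T \<omega>'" and \<phi>[measurable]: "\<phi> \<in> borel_measurable (borel \<Otimes>\<^sub>M borel)"
  shows "(\<integral>\<^sup>+\<omega>. \<phi> (passage T (hit \<omega>) \<omega>', Wtilde x0 \<beta> W (T (passage T (hit \<omega>) \<omega>') \<omega>') \<omega>) * indicator Hit \<omega> \<partial>M) =
    (\<integral>\<^sup>+\<omega>. (\<integral>\<^sup>+y. \<phi> (passage T (hit \<omega>) \<omega>', \<beta> * (T (passage T (hit \<omega>) \<omega>') \<omega>' - hit \<omega>) +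
      sqrt (T (passage T (hit \<omega>) \<omega>') \<omega>' - hit \<omega>) * y) \<partial>std_normal_distribution) \<partial>hit_law)"
proof -
  interpret N: prob_space std_normal_distribution by (rule prob_space_normal_density) simp
  interpret D: finite_measure hit_law by (rule finite_measure_hit_law)
  interpret P: pair_sigma_finite hit_law std_normal_distribution ..
  interpret S: subordinator_path "\<lambda>t. T t \<omega>'" by (rule subordinator_path[OF w'])
  define u where "u a = passage T a \<omega>'" for a
  \<comment> \<open>With this duration, \<open>hit \<omega> + \<kappa> (hit \<omega>)\<close> is the
    value of \<open>T\<close> at the passage over the level \<open>hit \<omega>\<close>.\<close>
  define \<kappa> where "\<kappa> a = T (u a) \<omega>' - a" for a
  have um[measurable]: "u \<in> borel_measurable borel"
    using measurable_compose[OF measurable_Pair2'[OF w'(1), of borel] passage_measurable_M] by (simp add: u_def[abs_def])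
  have \<kappa>m[measurable]: "\<kappa> \<in> borel_measurable borel"
    using measurable_compose[OF measurable_Pair2'[OF w'(1), of borel] T_passage_measurable] by (simp add: u_def[abs_def] \<kappa>_def[abs_def])
  have \<kappa>0: "0 \<le> \<kappa> a" for a using T_passage_ge[OF w'] by (simp add: \<kappa>_def u_def)
  have \<kappa>c: "continuous (at_right a) \<kappa>" for a
    using S.X_first_pass_right_continuous[of a] w'(2) unfolding \<kappa>_def u_def passage_def by (auto intro!: continuous_intros)
  let ?V = "\<lambda>\<omega>. (hit \<omega>, Wtilde x0 \<beta> W (hit \<omega> + \<kappa> (hit \<omega>)) \<omega>)"
  let ?U = "\<lambda>p. (hit (fst p), \<beta> * \<kappa> (hit (fst p)) + sqrt (\<kappa> (hit (fst p))) * snd p)"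
  define f where "f v = \<phi> (u (fst v), snd v)" for v
  have fm[measurable]: "f \<in> borel_measurable (borel \<Otimes>\<^sub>M borel)" unfolding f_def[abs_def] by measurable
  have Vm[measurable]: "(\<lambda>\<omega>. Wtilde x0 \<beta> W (hit \<omega> + \<kappa> (hit \<omega>)) \<omega>) \<in> borel_measurable M"
    using \<kappa>0 hit_nonneg by (auto intro!: Wtilde_process_measurable)
  have fV: "f (?V \<omega>) = \<phi> (passage T (hit \<omega>) \<omega>', Wtilde x0 \<beta> W (T (passage T (hit \<omega>) \<omega>') \<omega>') \<omega>)" for \<omega>
    by (simp add: f_def u_def \<kappa>_def)
  have Um: "(\<lambda>p. f (?U p)) \<in> borel_measurable (hit_law \<Otimes>\<^sub>M std_normal_distribution)" by measurable
  have "(\<integral>\<^sup>+\<omega>. f (?V \<omega>) * indicator Hit \<omega> \<partial>M) = (\<integral>\<^sup>+\<omega>. f (?V \<omega>) \<partial>hit_law)"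
    by (rule nn_integral_hit_law[symmetric]) measurable
  also have "\<dots> = (\<integral>\<^sup>+v. f v \<partial>distr hit_law (borel \<Otimes>\<^sub>M borel) ?V)"
    by (subst nn_integral_distr) auto
  also have "\<dots> = (\<integral>\<^sup>+p. f (?U p) \<partial>(hit_law \<Otimes>\<^sub>M std_normal_distribution))"
    unfolding strong_markov_distr[OF \<kappa>0 \<kappa>c \<kappa>m] by (subst nn_integral_distr) auto
  also have "\<dots> = (\<integral>\<^sup>+\<omega>. (\<integral>\<^sup>+y. f (?U (\<omega>, y)) \<partial>std_normal_distribution) \<partial>hit_law)"
    by (rule N.nn_integral_fst[symmetric, OF Um])
  finally show ?thesis unfolding fV by (simp add: f_def u_def \<kappa>_def)
qed

end

section \<open>Integrating out the overshoot\<close>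

lemma nn_integral_normal_affine:
  assumes k: "0 < k" and f[measurable]: "f \<in> borel_measurable borel"
  shows "(\<integral>\<^sup>+y. f (b + sqrt k * y) \<partial>std_normal_distribution) = (\<integral>\<^sup>+x. f x * ennreal (normal_density 0 (sqrt k) (x - b)) \<partial>lborel)"
proof -
  have "(\<integral>\<^sup>+y. f (b + sqrt k * y) \<partial>std_normal_distribution) = (\<integral>\<^sup>+v. f (b + v) \<partial>distr std_normal_distribution borel (\<lambda>y. sqrt k * y))"
    by (subst nn_integral_distr) auto
  also have "\<dots> = (\<integral>\<^sup>+v. ennreal (normal_density 0 (sqrt k) v) * f (b + v) \<partial>lborel)"
    using k by (subst std_normal_distr_scale) (auto simp: nn_integral_density)
  also have "\<dots> = (\<integral>\<^sup>+v. (\<lambda>x. f x * ennreal (normal_density 0 (sqrt k) (x - b))) (b + 1 * v) \<partial>lborel)"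
    by (simp add: mult.commute)
  also have "\<dots> = (\<integral>\<^sup>+x. f x * ennreal (normal_density 0 (sqrt k) (x - b)) \<partial>lborel)"
    by (subst (2) nn_integral_real_affine[where c=1 and t=b]) auto
  finally show ?thesis .
qed

text \<open>Expanding the square, the drift contributes \<open>exp (\<beta> * x)\<close> and an
  extra rate \<open>\<beta>\<^sup>2 / 2\<close>; added to \<open>vg_rate \<beta> y\<close> it leaves
  exactly \<open>y\<^sup>2 / 2\<close>. This is why the rates are parametrised by \<open>y\<close>;
  what remains is the heat kernel integral.\<close>

lemma nn_integral_normal_vg_rate:
  assumes x: "x \<noteq> 0" and y: "0 < y"
  shows "(\<integral>\<^sup>+k. indicator {0<..} k * (ennreal (normal_density 0 (sqrt k) (x - \<beta> * k)) * ennreal (exp (- vg_rate \<beta> y * k))) \<partial>lborel) =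
    ennreal (exp (\<beta> * x - \<bar>x\<bar> * y) / y)"
proof -
  have eq: "indicator {0<..} k * (ennreal (normal_density 0 (sqrt k) (x - \<beta> * k)) * ennreal (exp (- vg_rate \<beta> y * k))) =
    ennreal (exp (\<beta> * x)) * (ennreal (1 / sqrt (2 * pi * k) * exp (- (x\<^sup>2 / (2 * k) + y\<^sup>2 * k / 2))) * indicator {0<..} k)" for k
  proof (cases "0 < k")
    case True
    have "- (x - \<beta> * k)\<^sup>2 / (2 * k) + - vg_rate \<beta> y * k = \<beta> * x + - (x\<^sup>2 / (2 * k) + y\<^sup>2 * k / 2)"
      using True by (simp add: vg_rate_def field_simps power2_eq_square)
    then have "exp (- (x - \<beta> * k)\<^sup>2 / (2 * k)) * exp (- vg_rate \<beta> y * k) = exp (\<beta> * x) * exp (- (x\<^sup>2 / (2 * k) + y\<^sup>2 * k / 2))"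
      by (simp only: exp_add[symmetric])
    then have "normal_density 0 (sqrt k) (x - \<beta> * k) * exp (- vg_rate \<beta> y * k) =
      exp (\<beta> * x) * (1 / sqrt (2 * pi * k) * exp (- (x\<^sup>2 / (2 * k) + y\<^sup>2 * k / 2)))"
      using True unfolding normal_density_def by simp
    then show ?thesis using True by (simp add: ennreal_mult'[symmetric])
  qed simp
  have "(\<integral>\<^sup>+k. indicator {0<..} k * (ennreal (normal_density 0 (sqrt k) (x - \<beta> * k)) * ennreal (exp (- vg_rate \<beta> y * k))) \<partial>lborel) =
    ennreal (exp (\<beta> * x)) * (\<integral>\<^sup>+k\<in>{0<..}. ennreal (1 / sqrt (2 * pi * k) * exp (- (x\<^sup>2 / (2 * k) + y\<^sup>2 * k / 2))) \<partial>lborel)"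
    unfolding eq by (rule nn_integral_cmult) measurable
  also have "\<dots> = ennreal (exp (\<beta> * x)) * ennreal (exp (- \<bar>x\<bar> * y) / y)"
    unfolding nn_integral_heat_kernel_laplace[OF x y] ..
  also have "\<dots> = ennreal (exp (\<beta> * x) * (exp (- \<bar>x\<bar> * y) / y))"
    using y by (intro ennreal_mult[symmetric]) auto
  also have "exp (\<beta> * x) * (exp (- \<bar>x\<bar> * y) / y) = exp (\<beta> * x - \<bar>x\<bar> * y) / y"
    by (simp add: exp_add[symmetric])
  finally show ?thesis .
qed

context vg_setting begin

text \<open>\<open>vg_kernel s y\<close> is \<open>E[exp (- c (\<tau> - T\<^sub>s)); T\<^sub>s < \<tau> < \<infinity>]\<close> for the hitting time \<open>\<tau>\<close>, with
  \<open>c = vg_rate \<beta> y\<close> and with independent copies of \<open>\<tau>\<close> and \<open>T\<^sub>s\<close>.\<close>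
definition vg_kernel :: "real \<Rightarrow> real \<Rightarrow> ennreal" where
  "vg_kernel s y = (\<integral>\<^sup>+\<omega>. (\<integral>\<^sup>+\<omega>'. indicator {T (max 0 s) \<omega>'<..} (hit \<omega>) *
     ennreal (exp (- vg_rate \<beta> y * (hit \<omega> - T (max 0 s) \<omega>'))) \<partial>M) \<partial>hit_law)"

text \<open>The joint density at time \<open>s\<close> and position \<open>x\<close> before Fourier
  inversion. The factor \<open>y / \<nu>\<close> of the mixture has met the \<open>1 / y\<close>
  from the overshoot integral, hence the plain \<open>1 / \<nu>\<close>.\<close>

definition vg_p1 :: "real \<Rightarrow> real \<Rightarrow> ennreal" where
  "vg_p1 s x = (\<integral>\<^sup>+y. indicator {vg_alpha \<nu> \<beta><..} y * (ennreal (exp (\<beta> * x - \<bar>x\<bar> * y) / \<nu>) * vg_kernel s y) \<partial>lborel)"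

lemma sigma_finite_hit_law: "sigma_finite_measure hit_law"
proof -
  interpret finite_measure hit_law by (rule finite_measure_hit_law)
  show ?thesis ..
qed

lemma vg_kernel_measurable[measurable]: "(\<lambda>p. vg_kernel (fst p) (snd p)) \<in> borel_measurable (borel \<Otimes>\<^sub>M borel)"
proof -
  interpret sigma_finite_measure hit_law by (rule sigma_finite_hit_law)
  show ?thesis unfolding vg_kernel_def by measurable
qed

lemma vg_kernel_comp[measurable (raw)]:
  assumes [measurable]: "f \<in> borel_measurable N" "g \<in> borel_measurable N"
  shows "(\<lambda>x. vg_kernel (f x) (g x)) \<in> borel_measurable N"
  using measurable_compose[OF measurable_Pair[OF assms] vg_kernel_measurable] by simp

lemma vg_p1_measurable[measurable]: "(\<lambda>p. vg_p1 (fst p) (snd p)) \<in> borel_measurable (borel \<Otimes>\<^sub>M borel)"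
  unfolding vg_p1_def by measurable

text \<open>The exponential in \<open>passage_density\<close> splits into a factor in the overshoot
  \<open>k\<close> and one in the gap between hitting time and \<open>T s\<close>; the latter
  integrates to the kernel.\<close>

lemma nn_integral_passage_density_hit:
  "(\<integral>\<^sup>+\<omega>. passage_density \<beta> s k (hit \<omega>) \<partial>hit_law) =
    (\<integral>\<^sup>+y. indicator {vg_alpha \<nu> \<beta><..} y * (ennreal (y / \<nu> * exp (- vg_rate \<beta> y * k)) * vg_kernel s y) \<partial>lborel)"
proof -
  interpret H: sigma_finite_measure hit_law by (rule sigma_finite_hit_law)
  interpret HL: pair_sigma_finite hit_law lborel ..
  let ?f = "\<lambda>y \<omega> \<omega>'. indicator {T (max 0 s) \<omega>'<..} (hit \<omega>) * ennreal (exp (- vg_rate \<beta> y * (hit \<omega> - T (max 0 s) \<omega>')))"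
  let ?c = "\<lambda>y. indicator {vg_alpha \<nu> \<beta><..} y * ennreal (y / \<nu> * exp (- vg_rate \<beta> y * k))"
  have 1: "indicator {vg_alpha \<nu> \<beta><..} y * (\<integral>\<^sup>+\<omega>'. indicator {T (max 0 s) \<omega>'<..} (hit \<omega>) * ennreal (y / \<nu> * exp (- vg_rate \<beta> y * (hit \<omega> - T (max 0 s) \<omega>' + k))) \<partial>M)
     = ?c y * (\<integral>\<^sup>+\<omega>'. ?f y \<omega> \<omega>' \<partial>M)" for y \<omega>
  proof (cases "vg_alpha \<nu> \<beta> < y")
    case True
    then have y: "0 \<le> y / \<nu>" using vg_alpha_pos[OF nu, of \<beta>] nu by simp
    have "indicator {T (max 0 s) \<omega>'<..} (hit \<omega>) * ennreal (y / \<nu> * exp (- vg_rate \<beta> y * (hit \<omega> - T (max 0 s) \<omega>' + k))) =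
       ennreal (y / \<nu> * exp (- vg_rate \<beta> y * k)) * ?f y \<omega> \<omega>'" for \<omega>'
    proof -
      have e: "y / \<nu> * exp (- vg_rate \<beta> y * (hit \<omega> - T (max 0 s) \<omega>' + k)) =
         (y / \<nu> * exp (- vg_rate \<beta> y * k)) * exp (- vg_rate \<beta> y * (hit \<omega> - T (max 0 s) \<omega>'))"
        by (simp add: exp_add[symmetric] algebra_simps)
      show ?thesis
        unfolding e ennreal_mult[OF mult_nonneg_nonneg[OF y exp_ge_zero] exp_ge_zero] by (rule mult.left_commute)
    qed
    then have "(\<integral>\<^sup>+\<omega>'. indicator {T (max 0 s) \<omega>'<..} (hit \<omega>) * ennreal (y / \<nu> * exp (- vg_rate \<beta> y * (hit \<omega> - T (max 0 s) \<omega>' + k))) \<partial>M) =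
      (\<integral>\<^sup>+\<omega>'. ennreal (y / \<nu> * exp (- vg_rate \<beta> y * k)) * ?f y \<omega> \<omega>' \<partial>M)"
      by (intro nn_integral_cong)
    also have "\<dots> = ennreal (y / \<nu> * exp (- vg_rate \<beta> y * k)) * (\<integral>\<^sup>+\<omega>'. ?f y \<omega> \<omega>' \<partial>M)"
      by (rule nn_integral_cmult) measurable
    finally show ?thesis using True by simp
  qed simp
  have "(\<integral>\<^sup>+\<omega>. passage_density \<beta> s k (hit \<omega>) \<partial>hit_law) = (\<integral>\<^sup>+\<omega>. (\<integral>\<^sup>+y. ?c y * (\<integral>\<^sup>+\<omega>'. ?f y \<omega> \<omega>' \<partial>M) \<partial>lborel) \<partial>hit_law)"
    unfolding passage_density_def 1 ..
  also have "\<dots> = (\<integral>\<^sup>+y. (\<integral>\<^sup>+\<omega>. ?c y * (\<integral>\<^sup>+\<omega>'. ?f y \<omega> \<omega>' \<partial>M) \<partial>hit_law) \<partial>lborel)"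
    by (rule HL.Fubini'[symmetric]) measurable
  also have "\<dots> = (\<integral>\<^sup>+y. ?c y * vg_kernel s y \<partial>lborel)"
    unfolding vg_kernel_def by (intro nn_integral_cong nn_integral_cmult) measurable
  finally show ?thesis by (simp only: mult.assoc)
qed

text \<open>Tonelli moves the overshoot integral innermost, where displacement and rate combine in
  closed form. The value \<open>k = 0\<close>, with its degenerate normal law, and the position
  \<open>x = 0\<close> are null sets.\<close>

lemma nn_integral_marginal_overshoot:
  assumes \<phi>[measurable]: "\<phi> \<in> borel_measurable (borel \<Otimes>\<^sub>M borel)"
  shows "(\<integral>\<^sup>+k. indicator {0..} k * ((\<integral>\<^sup>+y. \<phi> (s, \<beta> * k + sqrt k * y) \<partial>std_normal_distribution) *
      (\<integral>\<^sup>+\<omega>. passage_density \<beta> s k (hit \<omega>) \<partial>hit_law)) \<partial>lborel) = (\<integral>\<^sup>+x. \<phi> (s, x) * vg_p1 s x \<partial>lborel)"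
proof -
  let ?\<alpha> = "vg_alpha \<nu> \<beta>"
  define n where "n k x = ennreal (normal_density 0 (sqrt k) (x - \<beta> * k))" for k x
  define e where "e k y = ennreal (exp (- vg_rate \<beta> y * k))" for k y
  define v where "v y = indicator {?\<alpha><..} y * (ennreal (y / \<nu>) * vg_kernel s y)" for y
  have nm: "(\<lambda>p. n (fst p) (snd p)) \<in> borel_measurable (borel \<Otimes>\<^sub>M borel)"
    and em: "(\<lambda>p. e (fst p) (snd p)) \<in> borel_measurable (borel \<Otimes>\<^sub>M borel)"
    unfolding n_def e_def normal_density_def by measurable
  have nm1[measurable]: "(\<lambda>p. n (snd (fst p)) (fst (fst p))) \<in> borel_measurable ((borel \<Otimes>\<^sub>M borel) \<Otimes>\<^sub>M (borel :: real measure))"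
    and em1[measurable]: "(\<lambda>p. e (snd (fst p)) (snd p)) \<in> borel_measurable ((borel \<Otimes>\<^sub>M borel) \<Otimes>\<^sub>M borel)"
    unfolding n_def e_def normal_density_def by measurable
  note [measurable] = nm em
  have [measurable]: "n k \<in> borel_measurable borel" "e k \<in> borel_measurable borel"
    "(\<lambda>p. e (snd p) (fst p)) \<in> borel_measurable (borel \<Otimes>\<^sub>M borel)"
    "(\<lambda>p. n (snd p) (fst p)) \<in> borel_measurable (borel \<Otimes>\<^sub>M borel)"
    "(\<lambda>k. n k x) \<in> borel_measurable borel" "(\<lambda>k. e k x) \<in> borel_measurable borel" for k x
    unfolding n_def e_def normal_density_def by measurable
  have km: "vg_kernel s \<in> borel_measurable borel"
    using measurable_compose[OF measurable_Pair1'[of s borel borel] vg_kernel_measurable] by simp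
  then have [measurable]: "v \<in> borel_measurable borel" unfolding v_def[abs_def] by measurable
  have R: "(\<integral>\<^sup>+\<omega>. passage_density \<beta> s k (hit \<omega>) \<partial>hit_law) = (\<integral>\<^sup>+y. v y * e k y \<partial>lborel)" for k
    unfolding nn_integral_passage_density_hit
  proof (intro nn_integral_cong)
    fix y
    show "indicator {?\<alpha><..} y * (ennreal (y / \<nu> * exp (- vg_rate \<beta> y * k)) * vg_kernel s y) = v y * e k y"
    proof (cases "?\<alpha> < y")
      case True
      then have "0 \<le> y / \<nu>" using vg_alpha_pos[OF nu, of \<beta>] nu by simp
      then show ?thesis unfolding v_def e_def ennreal_mult[OF \<open>0 \<le> y / \<nu>\<close> exp_ge_zero] by (simp only: mult_ac)
    qed (simp add: v_def)
  qed
  have "(\<integral>\<^sup>+k. indicator {0..} k * ((\<integral>\<^sup>+y. \<phi> (s, \<beta> * k + sqrt k * y) \<partial>std_normal_distribution) *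
      (\<integral>\<^sup>+\<omega>. passage_density \<beta> s k (hit \<omega>) \<partial>hit_law)) \<partial>lborel) =
    (\<integral>\<^sup>+k. (\<integral>\<^sup>+x. (\<integral>\<^sup>+y. \<phi> (s, x) * (v y * (indicator {0<..} k * (n k x * e k y))) \<partial>lborel) \<partial>lborel) \<partial>lborel)"
  proof (rule nn_integral_cong_AE)
    have "AE k in lborel. k \<noteq> (0::real)" by (rule AE_lborel_singleton)
    then show "AE k in lborel. indicator {0..} k * ((\<integral>\<^sup>+y. \<phi> (s, \<beta> * k + sqrt k * y) \<partial>std_normal_distribution) *
      (\<integral>\<^sup>+\<omega>. passage_density \<beta> s k (hit \<omega>) \<partial>hit_law)) = (\<integral>\<^sup>+x. (\<integral>\<^sup>+y. \<phi> (s, x) * (v y * (indicator {0<..} k * (n k x * e k y))) \<partial>lborel) \<partial>lborel)"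
    proof eventually_elim
      case (elim k)
      show ?case
      proof (cases "0 < k")
        case True
        have "(\<integral>\<^sup>+y. \<phi> (s, \<beta> * k + sqrt k * y) \<partial>std_normal_distribution) * (\<integral>\<^sup>+y. v y * e k y \<partial>lborel) =
           (\<integral>\<^sup>+x. (\<phi> (s, x) * n k x) * (\<integral>\<^sup>+y. v y * e k y \<partial>lborel) \<partial>lborel)"
          unfolding n_def using nn_integral_normal_affine[OF True, of "\<lambda>x. \<phi> (s, x)" "\<beta> * k"]
          by (simp add: nn_integral_multc)
        also have "\<dots> = (\<integral>\<^sup>+x. (\<integral>\<^sup>+y. (\<phi> (s, x) * n k x) * (v y * e k y) \<partial>lborel) \<partial>lborel)"
          by (intro nn_integral_cong nn_integral_cmult[symmetric]) measurable
        finally show ?thesis using True unfolding R by (simp add: mult_ac)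
      qed (use elim in simp)
    qed
  qed
  also have "\<dots> = (\<integral>\<^sup>+x. (\<integral>\<^sup>+k. (\<integral>\<^sup>+y. \<phi> (s, x) * (v y * (indicator {0<..} k * (n k x * e k y))) \<partial>lborel) \<partial>lborel) \<partial>lborel)"
    by (rule lborel_pair.Fubini') measurable
  also have "\<dots> = (\<integral>\<^sup>+x. (\<integral>\<^sup>+y. (\<integral>\<^sup>+k. \<phi> (s, x) * (v y * (indicator {0<..} k * (n k x * e k y))) \<partial>lborel) \<partial>lborel) \<partial>lborel)"
    by (rule nn_integral_cong, rule lborel_pair.Fubini') measurable
  also have "\<dots> = (\<integral>\<^sup>+x. \<phi> (s, x) * vg_p1 s x \<partial>lborel)"
  proof (rule nn_integral_cong_AE)
    have "AE x in lborel. x \<noteq> (0::real)" by (rule AE_lborel_singleton)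
    then show "AE x in lborel. (\<integral>\<^sup>+y. (\<integral>\<^sup>+k. \<phi> (s, x) * (v y * (indicator {0<..} k * (n k x * e k y))) \<partial>lborel) \<partial>lborel) = \<phi> (s, x) * vg_p1 s x"
    proof eventually_elim
      case (elim x)
      have "(\<integral>\<^sup>+k. \<phi> (s, x) * (v y * (indicator {0<..} k * (n k x * e k y))) \<partial>lborel) =
        \<phi> (s, x) * (indicator {?\<alpha><..} y * (ennreal (exp (\<beta> * x - \<bar>x\<bar> * y) / \<nu>) * vg_kernel s y))" for y
      proof -
        have "(\<integral>\<^sup>+k. (\<phi> (s, x) * v y) * (indicator {0<..} k * (n k x * e k y)) \<partial>lborel) =
          (\<phi> (s, x) * v y) * (\<integral>\<^sup>+k. indicator {0<..} k * (n k x * e k y) \<partial>lborel)"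
          by (rule nn_integral_cmult) measurable
        also have "\<dots> = \<phi> (s, x) * (indicator {?\<alpha><..} y * (ennreal (exp (\<beta> * x - \<bar>x\<bar> * y) / \<nu>) * vg_kernel s y))"
        proof (cases "?\<alpha> < y")
          case True
          then have y: "0 < y" using vg_alpha_pos[OF nu, of \<beta>] by simp
          have "ennreal (y / \<nu>) * ennreal (exp (\<beta> * x - \<bar>x\<bar> * y) / y) = ennreal (exp (\<beta> * x - \<bar>x\<bar> * y) / \<nu>)"
            using y nu by (simp add: ennreal_mult[symmetric])
          then show ?thesis
            unfolding n_def e_def nn_integral_normal_vg_rate[OF elim y] using True
            by (simp add: v_def mult.assoc mult.left_commute[of "vg_kernel s y"] mult.commute[of _ "vg_kernel s y"])
        qed (simp add: v_def)
        finally show ?thesis by (simp only: mult.assoc)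
      qed
      then have "(\<integral>\<^sup>+y. (\<integral>\<^sup>+k. \<phi> (s, x) * (v y * (indicator {0<..} k * (n k x * e k y))) \<partial>lborel) \<partial>lborel) =
        (\<integral>\<^sup>+y. \<phi> (s, x) * (indicator {?\<alpha><..} y * (ennreal (exp (\<beta> * x - \<bar>x\<bar> * y) / \<nu>) * vg_kernel s y)) \<partial>lborel)"
        by (intro nn_integral_cong)
      also have "\<dots> = \<phi> (s, x) * vg_p1 s x"
        unfolding vg_p1_def using km by (intro nn_integral_cmult) measurable
      finally show ?case .
    qed
  qed
  finally show ?thesis .
qed

text \<open>After decoupling, the strong Markov property for each frozen path of \<open>T\<close>
  reduces the left side to passage time and overshoot at an independent random level, whose density
  makes the Lebesgue-level identity applicable.\<close>

lemma passage_law: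
  assumes \<phi>[measurable]: "\<phi> \<in> borel_measurable (borel \<Otimes>\<^sub>M borel)"
  shows "(\<integral>\<^sup>+\<omega>. \<phi> (passage T (hit \<omega>) \<omega>, Wtilde x0 \<beta> W (T (passage T (hit \<omega>) \<omega>) \<omega>) \<omega>) * indicator Hit \<omega> \<partial>M) =
    (\<integral>\<^sup>+s. indicator {0..} s * (\<integral>\<^sup>+x. \<phi> (s, x) * vg_p1 s x \<partial>lborel) \<partial>lborel)"
proof -
  interpret N: prob_space std_normal_distribution by (rule prob_space_normal_density) simp
  interpret H: sigma_finite_measure hit_law by (rule sigma_finite_hit_law)
  obtain \<rho> where \<rho>m[measurable]: "\<rho> \<in> borel_measurable borel" and \<rho>0: "\<And>t. 0 \<le> \<rho> t"
    and \<rho>: "distr hit_law borel hit = density lborel (\<lambda>t. ennreal (\<rho> t))"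
    using hit_density by blast
  define \<Psi> where "\<Psi> s k = (\<integral>\<^sup>+y. \<phi> (s, \<beta> * k + sqrt k * y) \<partial>std_normal_distribution)" for s k
  have \<Psi>m[measurable]: "(\<lambda>p. \<Psi> (fst p) (snd p)) \<in> borel_measurable (borel \<Otimes>\<^sub>M borel)"
    unfolding \<Psi>_def by measurable
  have \<rho>int: "(\<integral>\<^sup>+\<omega>. F (hit \<omega>) \<partial>hit_law) = (\<integral>\<^sup>+a. indicator {0..} a * (ennreal (\<rho> a) * F a) \<partial>lborel)"
    if F[measurable]: "F \<in> borel_measurable borel" for F
  proof -
    have "(\<integral>\<^sup>+\<omega>. F (hit \<omega>) \<partial>hit_law) = (\<integral>\<^sup>+\<omega>. (\<lambda>a. indicator {0..} a * F a) (hit \<omega>) \<partial>hit_law)"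
      using hit_nonneg by simp
    also have "\<dots> = (\<integral>\<^sup>+a. indicator {0..} a * F a \<partial>distr hit_law borel hit)"
      by (subst nn_integral_distr) auto
    also have "\<dots> = (\<integral>\<^sup>+a. ennreal (\<rho> a) * (indicator {0..} a * F a) \<partial>lborel)"
      unfolding \<rho> by (subst nn_integral_density) auto
    finally show ?thesis by (simp add: mult.left_commute)
  qed
  let ?\<Phi> = "\<lambda>p. \<phi> (passage T (hit (fst p)) (snd p), Wtilde x0 \<beta> W (T (passage T (hit (fst p)) (snd p)) (snd p)) (fst p)) * indicator Hit (fst p)"
  note [measurable] = passage_at_hit_measurable
  have "?\<Phi> \<in> borel_measurable (FW \<Otimes>\<^sub>M FT)" by measurable
  from nn_integral_coupling[OF this]
  have "(\<integral>\<^sup>+\<omega>. \<phi> (passage T (hit \<omega>) \<omega>, Wtilde x0 \<beta> W (T (passage T (hit \<omega>) \<omega>) \<omega>) \<omega>) * indicator Hit \<omega> \<partial>M) =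
     (\<integral>\<^sup>+\<omega>'. (\<integral>\<^sup>+\<omega>. \<phi> (passage T (hit \<omega>) \<omega>', Wtilde x0 \<beta> W (T (passage T (hit \<omega>) \<omega>') \<omega>') \<omega>) * indicator Hit \<omega> \<partial>M) \<partial>M)"
    by simp
  also have "\<dots> = (\<integral>\<^sup>+\<omega>'. (\<integral>\<^sup>+\<omega>. \<Psi> (passage T (hit \<omega>) \<omega>') (T (passage T (hit \<omega>) \<omega>') \<omega>' - hit \<omega>) \<partial>hit_law) \<partial>M)"
  proof (rule nn_integral_cong_AE)
    show "AE \<omega>' in M. (\<integral>\<^sup>+\<omega>. \<phi> (passage T (hit \<omega>) \<omega>', Wtilde x0 \<beta> W (T (passage T (hit \<omega>) \<omega>') \<omega>') \<omega>) * indicator Hit \<omega> \<partial>M) =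
        (\<integral>\<^sup>+\<omega>. \<Psi> (passage T (hit \<omega>) \<omega>') (T (passage T (hit \<omega>) \<omega>') \<omega>' - hit \<omega>) \<partial>hit_law)"
      using AE_unbounded_path AE_space unfolding \<Psi>_def
      by eventually_elim (rule strong_markov_passage[OF _ _ \<phi>])
  qed
  also have "\<dots> = (\<integral>\<^sup>+\<omega>'. (\<integral>\<^sup>+a. indicator {0..} a * (ennreal (\<rho> a) * \<Psi> (passage T a \<omega>') (T (passage T a \<omega>') \<omega>' - a)) \<partial>lborel) \<partial>M)"
  proof (intro nn_integral_cong)
    fix \<omega>' assume w: "\<omega>' \<in> space M"
    have [measurable]: "(\<lambda>a. passage T a \<omega>') \<in> borel_measurable borel" "(\<lambda>a. T (passage T a \<omega>') \<omega>') \<in> borel_measurable borel"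
      using measurable_compose[OF measurable_Pair2'[OF w, of borel] passage_measurable_M]
        measurable_compose[OF measurable_Pair2'[OF w, of borel] T_passage_measurable] by simp_all
    have "(\<lambda>a. \<Psi> (passage T a \<omega>') (T (passage T a \<omega>') \<omega>' - a)) \<in> borel_measurable borel"
      using measurable_compose[OF _ \<Psi>m, of "\<lambda>a. (passage T a \<omega>', T (passage T a \<omega>') \<omega>' - a)" borel] by simp
    then show "(\<integral>\<^sup>+\<omega>. \<Psi> (passage T (hit \<omega>) \<omega>') (T (passage T (hit \<omega>) \<omega>') \<omega>' - hit \<omega>) \<partial>hit_law) =
      (\<integral>\<^sup>+a. indicator {0..} a * (ennreal (\<rho> a) * \<Psi> (passage T a \<omega>') (T (passage T a \<omega>') \<omega>' - a)) \<partial>lborel)"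
      by (rule \<rho>int)
  qed
  \<comment> \<open>The density \<open>\<rho>\<close> of the level is absorbed into the test
    function, so that the identity for Lebesgue-distributed levels covers the level
    \<open>hit\<close>; the next step turns it back into an integral over
    \<open>hit_law\<close>.\<close>
  also have "\<dots> = (\<integral>\<^sup>+s. indicator {0..} s * (\<integral>\<^sup>+k. indicator {0..} k * (\<integral>\<^sup>+a. indicator {0..} a *
      ((ennreal (\<rho> a) * \<Psi> s k) * passage_density \<beta> s k a) \<partial>lborel) \<partial>lborel) \<partial>lborel)"
  proof -
    have [measurable]: "(\<lambda>v. \<Psi> (fst v) (fst (snd v))) \<in> borel_measurable (borel \<Otimes>\<^sub>M (borel \<Otimes>\<^sub>M (borel :: real measure)))"
      using measurable_compose[OF _ \<Psi>m, of "\<lambda>v. (fst v, fst (snd v))" "borel \<Otimes>\<^sub>M (borel \<Otimes>\<^sub>M (borel :: real measure))"] by simp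
    have "(\<lambda>v. ennreal (\<rho> (snd (snd v))) * \<Psi> (fst v) (fst (snd v))) \<in> borel_measurable (borel \<Otimes>\<^sub>M (borel \<Otimes>\<^sub>M borel))"
      by measurable
    from nn_integral_passage[OF this, of \<beta>] show ?thesis by simp
  qed
  also have "\<dots> = (\<integral>\<^sup>+s. indicator {0..} s * (\<integral>\<^sup>+k. indicator {0..} k * (\<Psi> s k * (\<integral>\<^sup>+\<omega>. passage_density \<beta> s k (hit \<omega>) \<partial>hit_law)) \<partial>lborel) \<partial>lborel)"
  proof -
    have "(\<integral>\<^sup>+a. indicator {0..} a * ((ennreal (\<rho> a) * \<Psi> s k) * passage_density \<beta> s k a) \<partial>lborel) =
      \<Psi> s k * (\<integral>\<^sup>+\<omega>. passage_density \<beta> s k (hit \<omega>) \<partial>hit_law)" for s k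
    proof -
      have pm[measurable]: "(\<lambda>a. passage_density \<beta> s k a) \<in> borel_measurable borel"
        using measurable_compose[OF _ passage_density_measurable, of "\<lambda>a. (s, k, a)" borel \<beta>] by simp
      have "(\<integral>\<^sup>+a. indicator {0..} a * ((ennreal (\<rho> a) * \<Psi> s k) * passage_density \<beta> s k a) \<partial>lborel) =
        (\<integral>\<^sup>+a. \<Psi> s k * (indicator {0..} a * (ennreal (\<rho> a) * passage_density \<beta> s k a)) \<partial>lborel)"
        by (intro nn_integral_cong) (simp add: mult_ac)
      also have "\<dots> = \<Psi> s k * (\<integral>\<^sup>+a. indicator {0..} a * (ennreal (\<rho> a) * passage_density \<beta> s k a) \<partial>lborel)"
        by (rule nn_integral_cmult) measurable
      also have "\<dots> = \<Psi> s k * (\<integral>\<^sup>+\<omega>. passage_density \<beta> s k (hit \<omega>) \<partial>hit_law)"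
        unfolding \<rho>int[OF pm] ..
      finally show ?thesis .
    qed
    then show ?thesis by simp
  qed
  also have "\<dots> = (\<integral>\<^sup>+s. indicator {0..} s * (\<integral>\<^sup>+x. \<phi> (s, x) * vg_p1 s x \<partial>lborel) \<partial>lborel)"
    unfolding \<Psi>_def nn_integral_marginal_overshoot[OF \<phi>] ..
  finally show ?thesis .
qed

end

section \<open>Exponential integrals and Fourier representation of the density\<close>

text \<open>Both sides of the bracket become integrals over \<open>y > \<alpha>\<close> after the substitution
  \<open>t = \<bar>x\<bar> (y - \<alpha>)\<close>; partial fractions combine them.\<close>
lemma Ei_exp_eq:
  fixes w :: complex and \<alpha> x :: real
  assumes x: "x > 0"
  shows "exp (- (x * w)) * Ei (- x * (\<alpha> - w)) = - (CLBINT y. indicator {\<alpha>..} y *\<^sub>R (exp (- complex_of_real x * complex_of_real y) / (y - w)))"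
proof -
  let ?v = "- complex_of_real x * (complex_of_real \<alpha> - w)"
  have "exp (- (x * w)) * Ei ?v = - (exp (- (x * w)) * (CLBINT t. indicator {0..} t *\<^sub>R (exp (- (complex_of_real t - ?v)) / (complex_of_real t - ?v))))"
    unfolding Ei_def set_lebesgue_integral_def by simp
  also have "exp (- (x * w)) * (CLBINT t. indicator {0..} t *\<^sub>R (exp (- (complex_of_real t - ?v)) / (complex_of_real t - ?v))) =
    (CLBINT t. exp (- (x * w)) * (indicator {0..} t *\<^sub>R (exp (- (complex_of_real t - ?v)) / (complex_of_real t - ?v))))"
    by (rule integral_mult_right_zero[symmetric])
  also have "\<dots> = \<bar>x\<bar> *\<^sub>R (CLBINT y. exp (- (x * w)) * (indicator {0..} (- x * \<alpha> + x * y) *\<^sub>R (exp (- (complex_of_real (- x * \<alpha> + x * y) - ?v)) / (complex_of_real (- x * \<alpha> + x * y) - ?v))))"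
    using x by (intro lborel_integral_real_affine) simp
  also have "\<dots> = (CLBINT y. complex_of_real x * (exp (- (x * w)) * (indicator {0..} (- x * \<alpha> + x * y) *\<^sub>R (exp (- (complex_of_real (- x * \<alpha> + x * y) - ?v)) / (complex_of_real (- x * \<alpha> + x * y) - ?v)))))"
    using x by (simp only: integral_mult_right_zero scaleR_conv_of_real abs_of_pos)
  also have "\<dots> = (CLBINT y. indicator {\<alpha>..} y *\<^sub>R (exp (- complex_of_real x * complex_of_real y) / (y - w)))"
  proof (intro Bochner_Integration.integral_cong refl)
    fix y :: real
    have i: "indicator {0..} (- x * \<alpha> + x * y) = (indicator {\<alpha>..} y :: real)"
      using x by (auto simp: indicator_def)
    have d: "complex_of_real (- x * \<alpha> + x * y) - ?v = x * (y - w)"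
      by (simp add: algebra_simps)
    have e: "exp (- (x * w)) * exp (- (complex_of_real x * (y - w))) = exp (- complex_of_real x * complex_of_real y)"
      by (simp add: exp_add[symmetric] algebra_simps)
    have "complex_of_real x * (exp (- (x * w)) * (exp (- (complex_of_real x * (y - w))) / (complex_of_real x * (y - w)))) = exp (- complex_of_real x * complex_of_real y) / (y - w)"
      unfolding e[symmetric] using x by simp
    then show "complex_of_real x * (exp (- (x * w)) * (indicator {0..} (- x * \<alpha> + x * y) *\<^sub>R (exp (- (complex_of_real (- x * \<alpha> + x * y) - ?v)) / (complex_of_real (- x * \<alpha> + x * y) - ?v)))) =
      indicator {\<alpha>..} y *\<^sub>R (exp (- complex_of_real x * complex_of_real y) / (y - w))"
      unfolding i d by (simp split: split_indicator)
  qed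
  finally show ?thesis by simp
qed

lemma integrable_exp_div:
  fixes w :: complex and \<alpha> x \<delta> :: real
  assumes x: "x > 0" and \<delta>: "0 < \<delta>" and le: "\<And>y. \<alpha> \<le> y \<Longrightarrow> \<delta> \<le> cmod (g y)"
    and g[measurable]: "g \<in> borel_measurable borel"
  shows "integrable lborel (\<lambda>y. indicator {\<alpha>..} y *\<^sub>R (exp (- complex_of_real x * complex_of_real y) / g y))"
proof (rule Bochner_Integration.integrable_bound)
  have "set_integrable lborel {\<alpha>..} (\<lambda>y. exp (- x * y))"
  proof -
    have "(\<integral>\<^sup>+y\<in>{\<alpha>..}. ennreal (exp (- x * y)) \<partial>lborel) = ennreal (0 - (- exp (- x * \<alpha>) / x))"
    proof (rule nn_integral_FTC_atLeast)
      show "((\<lambda>a. - exp (- x * a) / x) has_real_derivative exp (- x * a)) (at a)" for a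
        using x by (auto intro!: derivative_eq_intros)
      show "((\<lambda>a. - exp (- x * a) / x) \<longlongrightarrow> 0) at_top" using x by real_asymp
    qed auto
    then have "(\<integral>\<^sup>+y. ennreal (indicator {\<alpha>..} y * exp (- x * y)) \<partial>lborel) < \<infinity>"
      by (simp add: indicator_mult_ennreal mult.commute)
    then show ?thesis unfolding set_integrable_def
      by (intro integrableI_nonneg) auto
  qed
  then show "integrable lborel (\<lambda>y. (indicator {\<alpha>..} y * exp (- x * y)) * (1 / \<delta>))"
    unfolding set_integrable_def by (intro integrable_mult_left) simp
  show "AE y in lborel. norm (indicator {\<alpha>..} y *\<^sub>R (exp (- complex_of_real x * complex_of_real y) / g y)) \<le> norm ((indicator {\<alpha>..} y * exp (- x * y)) * (1 / \<delta>))"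
  proof (rule AE_I2)
    fix y :: real
    show "norm (indicator {\<alpha>..} y *\<^sub>R (exp (- complex_of_real x * complex_of_real y) / g y)) \<le> norm ((indicator {\<alpha>..} y * exp (- x * y)) * (1 / \<delta>))"
    proof (cases "\<alpha> \<le> y")
      case True
      have "exp (- x * y) / cmod (g y) \<le> exp (- x * y) / \<delta>"
        using le[OF True] \<delta> by (intro divide_left_mono mult_pos_pos) auto
      then show ?thesis using True \<delta> by (simp add: norm_divide)
    qed simp
  qed
qed measurable

text \<open>For \<open>z \<noteq> 0\<close> the root \<open>r\<close> is not real, so
  \<open>y - r\<close> and \<open>y + r\<close> stay at distance at least \<open>|Im r|\<close> from
  0. Neither integrand has a pole on the ray, both are integrable, and their difference may be
  formed under the integral.\<close>

lemma Ei_bracket: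
  fixes x \<nu> \<beta> z :: real and r :: complex
  assumes x: "x > 0" and \<nu>: "0 < \<nu>" and z: "z \<noteq> 0"
  defines "r \<equiv> csqrt (complex_of_real (\<beta>\<^sup>2) - 2 * \<i> * complex_of_real z)"
  shows "(exp (x * r) * Ei (- x * (vg_alpha \<nu> \<beta> + r)) - exp (- x * r) * Ei (- x * (vg_alpha \<nu> \<beta> - r))) / r =
    (CLBINT y. indicator {vg_alpha \<nu> \<beta>..} y *\<^sub>R (exp (- complex_of_real x * complex_of_real y) / (vg_rate \<beta> y + \<i> * z)))"
proof -
  let ?\<alpha> = "vg_alpha \<nu> \<beta>"
  have r2: "r\<^sup>2 = complex_of_real (\<beta>\<^sup>2) - 2 * \<i> * complex_of_real z" by (simp add: r_def)
  have Re0: "0 \<le> Re r" unfolding r_def by simp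
  have Im: "Im r \<noteq> 0"
  proof
    assume "Im r = 0"
    then have "Im (r\<^sup>2) = 0" by (simp add: power2_eq_square)
    then show False using z unfolding r2 by simp
  qed
  then have rne: "r \<noteq> 0" by auto
  have d1: "\<bar>Im r\<bar> \<le> cmod (complex_of_real y - r)" "\<bar>Im r\<bar> \<le> cmod (complex_of_real y - - r)" for y
    using abs_Im_le_cmod[of "complex_of_real y - r"] abs_Im_le_cmod[of "complex_of_real y - - r"] by auto
  have pf: "1 / (complex_of_real y - r) - 1 / (complex_of_real y + r) = r * (1 / (vg_rate \<beta> y + \<i> * z))" for y
  proof -
    have ne: "complex_of_real y - r \<noteq> 0" "complex_of_real y + r \<noteq> 0"
      using Im by (auto simp: complex_eq_iff)
    have "(complex_of_real y - r) * (complex_of_real y + r) = 2 * (vg_rate \<beta> y + \<i> * z)"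
    proof -
      have "(complex_of_real y - r) * (complex_of_real y + r) = (complex_of_real y)\<^sup>2 - r\<^sup>2"
        by (simp add: algebra_simps power2_eq_square)
      then show ?thesis unfolding r2 by (simp add: vg_rate_def)
    qed
    moreover have "1 / (complex_of_real y - r) - 1 / (complex_of_real y + r) = 2 * r / ((complex_of_real y - r) * (complex_of_real y + r))"
      using ne by (simp add: field_simps)
    moreover have "2 * r / (2 * X) = r * (1 / X)" for X :: complex by simp
    ultimately show ?thesis by (simp only:)
  qed
  have E1: "exp (x * r) * Ei (- x * (?\<alpha> + r)) = - (CLBINT y. indicator {?\<alpha>..} y *\<^sub>R (exp (- complex_of_real x * complex_of_real y) / (y - - r)))"
    using Ei_exp_eq[OF x, of "- r" ?\<alpha>] by simp
  have E2: "exp (- x * r) * Ei (- x * (?\<alpha> - r)) = - (CLBINT y. indicator {?\<alpha>..} y *\<^sub>R (exp (- complex_of_real x * complex_of_real y) / (y - r)))"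
    using Ei_exp_eq[OF x, of r ?\<alpha>] by simp
  have "exp (x * r) * Ei (- x * (?\<alpha> + r)) - exp (- x * r) * Ei (- x * (?\<alpha> - r)) =
    (CLBINT y. indicator {?\<alpha>..} y *\<^sub>R (exp (- complex_of_real x * complex_of_real y) / (y - r))) - (CLBINT y. indicator {?\<alpha>..} y *\<^sub>R (exp (- complex_of_real x * complex_of_real y) / (y - - r)))"
    unfolding E1 E2 by simp
  also have "\<dots> = (CLBINT y. indicator {?\<alpha>..} y *\<^sub>R (exp (- complex_of_real x * complex_of_real y) / (y - r)) - indicator {?\<alpha>..} y *\<^sub>R (exp (- complex_of_real x * complex_of_real y) / (y - - r)))"
    using Im d1 by (intro Bochner_Integration.integral_diff[symmetric] integrable_exp_div[OF x, where \<delta>="\<bar>Im r\<bar>"]) auto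
  also have "\<dots> = (CLBINT y. r * (indicator {?\<alpha>..} y *\<^sub>R (exp (- complex_of_real x * complex_of_real y) / (vg_rate \<beta> y + \<i> * z))))"
  proof (intro Bochner_Integration.integral_cong refl)
    fix y
    have "indicator {?\<alpha>..} y *\<^sub>R (exp (- complex_of_real x * complex_of_real y) / (y - r)) - indicator {?\<alpha>..} y *\<^sub>R (exp (- complex_of_real x * complex_of_real y) / (y - - r)) =
      indicator {?\<alpha>..} y *\<^sub>R (exp (- complex_of_real x * complex_of_real y) * (1 / (complex_of_real y - r) - 1 / (complex_of_real y + r)))"
      by (simp add: right_diff_distrib scaleR_diff_right)
    also have "\<dots> = r * (indicator {?\<alpha>..} y *\<^sub>R (exp (- complex_of_real x * complex_of_real y) / (vg_rate \<beta> y + \<i> * z)))"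
      unfolding pf by (simp add: scaleR_conv_of_real)
    finally show "indicator {?\<alpha>..} y *\<^sub>R (exp (- complex_of_real x * complex_of_real y) / (y - r)) - indicator {?\<alpha>..} y *\<^sub>R (exp (- complex_of_real x * complex_of_real y) / (y - - r)) =
      r * (indicator {?\<alpha>..} y *\<^sub>R (exp (- complex_of_real x * complex_of_real y) / (vg_rate \<beta> y + \<i> * z)))" .
  qed
  also have "\<dots> = r * (CLBINT y. indicator {?\<alpha>..} y *\<^sub>R (exp (- complex_of_real x * complex_of_real y) / (vg_rate \<beta> y + \<i> * z)))"
    by (rule integral_mult_right_zero)
  finally show ?thesis using rne by simp
qed

lemma integral_exp_complex:
  fixes w :: complex
  assumes w: "0 < Re w"
  shows "integrable lborel (\<lambda>t::real. indicator {0::real<..} t *\<^sub>R exp (- w * t))"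
    and "(CLBINT t. indicator {0::real<..} t *\<^sub>R exp (- w * t)) = 1 / w"
proof -
  have i: "integrable lborel (\<lambda>t. indicator {0<..} t * exp (- Re w * t))"
    using nn_integral_exp_tail[OF w, of 0]
    by (intro integrableI_nonneg) (auto simp: indicator_mult_ennreal)
  show int: "integrable lborel (\<lambda>t::real. indicator {0::real<..} t *\<^sub>R exp (- w * t))"
    by (rule Bochner_Integration.integrable_bound[OF i]) (auto simp: indicator_def)
  have eint: "einterval 0 \<infinity> = {0<..}" by (auto simp: einterval_def)
  have wne: "w \<noteq> 0" using w by auto
  have "(CLBINT t=0..\<infinity>. exp (- w * t)) = 0 - (- 1 / w)"
  proof (rule interval_integral_FTC_integrable[where F="\<lambda>t. - exp (- w * t) / w"])
    fix t :: real
    have "((\<lambda>t. - exp (- w * t) / w) has_vector_derivative (- (exp (- w * t) * (- w)) / w)) (at t)"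
      using wne by (auto intro!: derivative_eq_intros has_vector_derivative_real_field simp: field_simps)
    then show "((\<lambda>t. - exp (- w * t) / w) has_vector_derivative exp (- w * t)) (at t)" using wne by simp
    show "isCont (\<lambda>t. exp (- w * complex_of_real t)) t" by (intro continuous_intros)
  next
    show "set_integrable lborel (einterval 0 \<infinity>) (\<lambda>t. exp (- w * complex_of_real t))"
      using int unfolding eint set_integrable_def .
    have "((\<lambda>t::real. - exp (- w * t) / w) \<longlongrightarrow> - exp (- w * complex_of_real 0) / w) (at_right 0)"
      using wne by (intro tendsto_intros)
    then show "(((\<lambda>t. - exp (- w * complex_of_real t) / w) \<circ> real_of_ereal) \<longlongrightarrow> - 1 / w) (at_right 0)"
      unfolding zero_ereal_def by (subst ereal_tendsto_simps) simp
    have "((\<lambda>t. exp (- Re w * t)) \<longlongrightarrow> 0) at_top" using w by real_asymp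
    then have "((\<lambda>t::real. exp (- w * t)) \<longlongrightarrow> 0) at_top"
      by (rule Lim_null_comparison[rotated]) simp
    then have "((\<lambda>t::real. - exp (- w * t) / w) \<longlongrightarrow> - 0 / w) at_top" using wne by (intro tendsto_intros)
    then show "(((\<lambda>t. - exp (- w * complex_of_real t) / w) \<circ> real_of_ereal) \<longlongrightarrow> 0) (at_left \<infinity>)"
      by (subst ereal_tendsto_simps) simp
  qed simp
  then show "(CLBINT t. indicator {0::real<..} t *\<^sub>R exp (- w * t)) = 1 / w"
    unfolding interval_lebesgue_integral_def eint set_lebesgue_integral_def by simp
qed

context vg_setting begin

text \<open>The characteristic function of the hitting time minus \<open>T s\<close> for independent
  copies, restricted to finite hitting times.\<close>

definition vg_char :: "real \<Rightarrow> real \<Rightarrow> complex" where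
  "vg_char s z = (CLINT \<omega>|hit_law. iexp (z * hit \<omega>)) * (CLINT \<omega>|M. iexp (- (z * T s \<omega>)))"

lemma char_T:
  assumes s: "0 \<le> s"
  shows "(CLINT \<omega>|M. iexp (- (z * T s \<omega>))) = (1 + \<i> * complex_of_real (\<nu> * z)) powr (- complex_of_real (s / \<nu>))"
proof -
  have "(CLINT \<omega>|M. exp (- (\<i> * z) * complex_of_real (T s \<omega>))) = (1 + complex_of_real \<nu> * (\<i> * z)) powr (- complex_of_real (s / \<nu>))"
    by (rule laplace_transform_gamma_complex[OF prob_space_axioms T_measurable _ nu])
       (use s T_nonneg laplace_T[OF s, unfolded vg_psi_def] in auto)
  then show ?thesis by (simp add: mult_ac)
qed

lemma vg_char_eq:
  assumes "0 \<le> s" "z \<noteq> 0"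
  shows "vg_char s z = exp (- x0 * (\<beta> + csqrt (complex_of_real (\<beta>\<^sup>2) - 2 * \<i> * complex_of_real z))) *
    (1 + \<i> * complex_of_real (\<nu> * z)) powr (- complex_of_real (s / \<nu>))"
  unfolding vg_char_def char_hit[OF assms(2)] char_T[OF assms(1)] ..

lemma vg_char_measurable[measurable]: "vg_char s \<in> borel_measurable borel"
proof -
  interpret H: sigma_finite_measure hit_law by (rule sigma_finite_hit_law)
  show ?thesis unfolding vg_char_def[abs_def] by measurable
qed

text \<open>The hitting time alone supplies the decay; the factor of \<open>T s\<close> is only
  bounded by 1, so that no lower bound on \<open>s\<close> enters.\<close>

lemma vg_char_integrable: "integrable lborel (vg_char s)"
proof (rule Bochner_Integration.integrable_bound)
  show "integrable lborel (\<lambda>z. exp (- x0 * \<beta>) * exp (- x0 * sqrt \<bar>z\<bar>))"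
    by (intro integrable_mult_right integrable_exp_neg_sqrt_abs x0)
  have T1: "norm (CLINT \<omega>|M. iexp (- (z * T s \<omega>))) \<le> 1" for z
  proof -
    have "norm (CLINT \<omega>|M. iexp (- (z * T s \<omega>))) \<le> (\<integral>\<omega>. norm (iexp (- (z * T s \<omega>))) \<partial>M)"
      by (rule integral_norm_bound)
    then show ?thesis by (simp add: prob_space)
  qed
  have "AE z in lborel. z \<noteq> (0::real)" by (rule AE_lborel_singleton)
  then show "AE z in lborel. norm (vg_char s z) \<le> norm (exp (- x0 * \<beta>) * exp (- x0 * sqrt \<bar>z\<bar>))"
  proof eventually_elim
    case (elim z)
    have "norm (vg_char s z) \<le> norm (CLINT \<omega>|hit_law. iexp (z * hit \<omega>)) * 1"
      unfolding vg_char_def norm_mult by (intro mult_left_mono T1) simp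
    then show ?case using norm_char_hit_le[OF elim] by simp
  qed
qed measurable

text \<open>The law of hitting time minus \<open>T s\<close> has a density \<open>d\<close> by
  inversion, and the kernel is the Laplace transform of \<open>d\<close> on the positive half-line
  at the rate \<open>c\<close> of \<open>y\<close>. Exchanged with the inversion integral,
  \<open>exp (- c * t)\<close> becomes \<open>1 / (c + i z)\<close>; positivity of \<open>c\<close>
  makes the exchange absolutely convergent.\<close>

lemma vg_kernel_fourier:
  assumes s: "0 \<le> s"
  obtains \<kappa> where "\<And>y. vg_alpha \<nu> \<beta> < y \<Longrightarrow> vg_kernel s y = ennreal (\<kappa> y)" "\<And>y. 0 \<le> \<kappa> y"
    "\<And>y. vg_alpha \<nu> \<beta> < y \<Longrightarrow> complex_of_real (\<kappa> y) = (CLBINT z. vg_char s z / (vg_rate \<beta> y + \<i> * z)) / (2 * pi)"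
    "\<kappa> \<in> borel_measurable borel"
proof -
  interpret H: finite_measure hit_law by (rule finite_measure_hit_law)
  interpret P: pair_sigma_finite hit_law M ..
  interpret PF: finite_measure "hit_law \<Otimes>\<^sub>M M"
    by (rule finite_measure_pair_measure) unfold_locales
  define D where "D p = hit (fst p) - T s (snd p)" for p
  have [measurable]: "D \<in> borel_measurable (hit_law \<Otimes>\<^sub>M M)" unfolding D_def[abs_def] by measurable
  define m where "m = distr (hit_law \<Otimes>\<^sub>M M) borel D"
  have fin: "finite_measure m" unfolding m_def by (rule PF.finite_measure_distr) measurable
  have sets: "sets m = sets borel" by (simp add: m_def)
  have char: "char m z = vg_char s z" for z
  proof -
    have "char m z = (CLINT p|(hit_law \<Otimes>\<^sub>M M). iexp (z * D p))"
      unfolding char_def m_def by (subst integral_distr) auto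
    also have "\<dots> = (CLINT \<omega>|hit_law. (CLINT \<omega>'|M. iexp (z * D (\<omega>, \<omega>'))))"
      by (rule P.integral_fst'[symmetric], rule PF.integrable_const_bound[where B=1]) auto
    also have "\<dots> = (CLINT \<omega>|hit_law. (CLINT \<omega>'|M. iexp (z * hit \<omega>) * iexp (- (z * T s \<omega>'))))"
      by (intro Bochner_Integration.integral_cong refl) (simp add: D_def exp_add[symmetric] algebra_simps)
    also have "\<dots> = vg_char s z" unfolding vg_char_def by simp
    finally show ?thesis .
  qed
  have cint: "integrable lborel (char m)" unfolding char[abs_def] by (rule vg_char_integrable)
  obtain d where dm[measurable]: "d \<in> borel_measurable borel" and d0: "\<And>t. 0 \<le> d t"
    and dc': "\<And>t. complex_of_real (d t) = (CLBINT z. iexp (- (z * t)) * char m z) / (2 * pi)"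
    and md: "m = density lborel (\<lambda>t. ennreal (d t))"
    using density_of_integrable_char[OF fin sets cint] by blast
  note dc = dc'[unfolded char]
  define \<kappa> where "\<kappa> y = enn2real (vg_kernel s y)" for y
  have ms: "max 0 s = s" using s by simp
  have kernel: "vg_kernel s y = (\<integral>\<^sup>+t. ennreal (d t) * (indicator {0<..} t * ennreal (exp (- vg_rate \<beta> y * t))) \<partial>lborel)" for y
  proof -
    have "vg_kernel s y = (\<integral>\<^sup>+\<omega>. (\<integral>\<^sup>+\<omega>'. indicator {0<..} (D (\<omega>, \<omega>')) * ennreal (exp (- vg_rate \<beta> y * D (\<omega>, \<omega>'))) \<partial>M) \<partial>hit_law)"
      unfolding vg_kernel_def ms by (intro nn_integral_cong) (auto simp: D_def indicator_def)
    also have "\<dots> = (\<integral>\<^sup>+p. indicator {0<..} (D p) * ennreal (exp (- vg_rate \<beta> y * D p)) \<partial>(hit_law \<Otimes>\<^sub>M M))"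
      by (rule nn_integral_fst) measurable
    also have "\<dots> = (\<integral>\<^sup>+t. indicator {0<..} t * ennreal (exp (- vg_rate \<beta> y * t)) \<partial>m)"
      unfolding m_def by (subst nn_integral_distr) auto
    also have "\<dots> = (\<integral>\<^sup>+t. ennreal (d t) * (indicator {0<..} t * ennreal (exp (- vg_rate \<beta> y * t))) \<partial>lborel)"
      unfolding md by (subst nn_integral_density) auto
    finally show ?thesis .
  qed
  have rate: "0 < vg_rate \<beta> y" if "vg_alpha \<nu> \<beta> < y" for y
    using vg_rate_ge[OF nu, of \<beta> y] that nu by (auto intro: less_le_trans[of 0 "1 / \<nu>"])
  have main: "vg_kernel s y = ennreal (\<kappa> y) \<and> complex_of_real (\<kappa> y) = (CLBINT z. vg_char s z / (vg_rate \<beta> y + \<i> * z)) / (2 * pi)"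
    if y: "vg_alpha \<nu> \<beta> < y" for y
  proof -
    let ?c = "vg_rate \<beta> y"
    let ?g = "\<lambda>t z. (indicator {0::real<..} t *\<^sub>R exp (- ((complex_of_real ?c + \<i> * complex_of_real z)) * t)) * vg_char s z"
    have c: "0 < ?c" by (rule rate[OF y])
    define f where "f t = d t * (indicator {0<..} t * exp (- ?c * t))" for t
    have f0: "0 \<le> f t" for t using d0 by (simp add: f_def)
    have [measurable]: "f \<in> borel_measurable borel" unfolding f_def[abs_def] by measurable
    have kf: "vg_kernel s y = (\<integral>\<^sup>+t. ennreal (f t) \<partial>lborel)"
      unfolding kernel f_def using d0 by (intro nn_integral_cong) (auto simp: ennreal_mult indicator_mult_ennreal)
    have fin': "(\<integral>\<^sup>+t. ennreal (f t) \<partial>lborel) < \<infinity>"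
    proof -
      have "(\<integral>\<^sup>+t. ennreal (f t) \<partial>lborel) \<le> (\<integral>\<^sup>+t. ennreal (d t) \<partial>lborel)"
        using c d0 by (intro nn_integral_mono ennreal_leI) (auto simp: f_def indicator_def mult_left_le)
      also have "\<dots> = emeasure m (space m)" unfolding md by (simp add: emeasure_density)
      also have "\<dots> < \<infinity>" using finite_measure.emeasure_finite[OF fin, of "space m"] by (simp add: less_top)
      finally show ?thesis .
    qed
    have intf: "integrable lborel f" using fin' f0 by (intro integrableI_nonneg) auto
    have k: "vg_kernel s y = ennreal (\<integral>t. f t \<partial>lborel)"
      unfolding kf using intf f0 by (intro nn_integral_eq_integral) auto
    then have \<kappa>: "\<kappa> y = (\<integral>t. f t \<partial>lborel)" unfolding \<kappa>_def using f0 by (simp add: integral_nonneg)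
    have gnorm: "norm (?g t z) = indicator {0<..} t * exp (- ?c * t) * norm (vg_char s z)" for t z
      by (simp add: norm_mult indicator_def)
    have prodint: "integrable (lborel \<Otimes>\<^sub>M lborel) (\<lambda>(t, z). ?g t z)"
    proof (rule lborel_pair.Fubini_integrable)
      show "(\<lambda>(t, z). ?g t z) \<in> borel_measurable (lborel \<Otimes>\<^sub>M lborel)" by measurable
      have "integrable lborel (\<lambda>t. (indicator {0<..} t * exp (- ?c * t)) * (LBINT z. norm (vg_char s z)))"
      proof (rule integrable_mult_left)
        show "integrable lborel (\<lambda>t. indicator {0<..} t * exp (- ?c * t))"
          using nn_integral_exp_tail[OF c, of 0] by (intro integrableI_nonneg) (auto simp: indicator_mult_ennreal)
      qed
      then show "integrable lborel (\<lambda>t. LBINT z. norm (case (t, z) of (t, z) \<Rightarrow> ?g t z))"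
        by (simp only: prod.case gnorm integral_mult_right_zero)
      show "AE t in lborel. integrable lborel (\<lambda>z. case (t, z) of (t, z) \<Rightarrow> ?g t z)"
        unfolding prod.case
      proof (rule AE_I2)
        fix t :: real
        show "integrable lborel (?g t)"
        proof (rule Bochner_Integration.integrable_bound[OF vg_char_integrable[of s]])
          show "AE z in lborel. norm (?g t z) \<le> norm (vg_char s z)"
            unfolding gnorm using c by (intro AE_I2) (auto simp: indicator_def intro!: mult_left_le_one_le)
        qed measurable
      qed
    qed
    have "complex_of_real (\<integral>t. f t \<partial>lborel) = (CLBINT t. complex_of_real (f t))" by simp
    also have "\<dots> = (CLBINT t. (CLBINT z. ?g t z) / (2 * pi))"
    proof (intro Bochner_Integration.integral_cong refl)
      fix t :: real
      have "complex_of_real (f t) = (indicator {0::real<..} t *\<^sub>R exp (- complex_of_real ?c * t)) * complex_of_real (d t)"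
        by (simp add: f_def indicator_def exp_of_real[symmetric])
      also have "\<dots> = (indicator {0::real<..} t *\<^sub>R exp (- complex_of_real ?c * t)) * (CLBINT z. iexp (- (z * t)) * vg_char s z) / (2 * pi)"
        unfolding dc by simp
      also have "(indicator {0::real<..} t *\<^sub>R exp (- complex_of_real ?c * t)) * (CLBINT z. iexp (- (z * t)) * vg_char s z) =
        (CLBINT z. (indicator {0::real<..} t *\<^sub>R exp (- complex_of_real ?c * t)) * (iexp (- (z * t)) * vg_char s z))"
        by (rule integral_mult_right_zero[symmetric])
      also have "\<dots> = (CLBINT z. ?g t z)"
      proof (intro Bochner_Integration.integral_cong refl)
        fix z :: real
        have "- ((complex_of_real ?c + \<i> * complex_of_real z) * complex_of_real t) = - complex_of_real ?c * t + \<i> * complex_of_real (- (z * t))"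
          by (simp add: algebra_simps)
        then have "exp (- (complex_of_real ?c + \<i> * complex_of_real z) * t) = exp (- complex_of_real ?c * t) * iexp (- (z * t))"
          by (simp only: exp_add[symmetric] mult_minus_left)
        then show "(indicator {0::real<..} t *\<^sub>R exp (- complex_of_real ?c * t)) * (iexp (- (z * t)) * vg_char s z) = ?g t z"
          by (simp only: mult_scaleR_left mult.assoc)
      qed
      finally show "complex_of_real (f t) = (CLBINT z. ?g t z) / (2 * pi)" .
    qed
    also have "\<dots> = (CLBINT t. (CLBINT z. ?g t z)) / (2 * pi)" by simp
    also have "(CLBINT t. (CLBINT z. ?g t z)) = (CLBINT z. (CLBINT t. ?g t z))"
      by (rule lborel_pair.Fubini_integral[OF prodint, symmetric])
    also have "\<dots> = (CLBINT z. vg_char s z / (?c + \<i> * z))"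
    proof (intro Bochner_Integration.integral_cong refl)
      fix z :: real
      have "(CLBINT t. ?g t z) = (CLBINT t. indicator {0::real<..} t *\<^sub>R exp (- (complex_of_real ?c + \<i> * complex_of_real z) * t)) * vg_char s z"
        by (rule integral_mult_left_zero)
      also have "\<dots> = (1 / (complex_of_real ?c + \<i> * complex_of_real z)) * vg_char s z"
        using c by (subst integral_exp_complex(2)) auto
      finally show "(CLBINT t. ?g t z) = vg_char s z / (?c + \<i> * z)" by simp
    qed
    finally show ?thesis using k \<kappa> by simp
  qed
  have "vg_kernel s \<in> borel_measurable borel"
    using measurable_compose[OF measurable_Pair1'[of s borel borel] vg_kernel_measurable] by simp
  then have "\<kappa> \<in> borel_measurable borel" unfolding \<kappa>_def[abs_def] by measurable
  then show ?thesis using main by (intro that[of \<kappa>]) (auto simp: \<kappa>_def)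
qed

text \<open>Exchanging \<open>y\<close> and \<open>z\<close> is justified by three bounds:
  \<open>c + i z\<close> has modulus at least \<open>1 / \<nu>\<close>,
  \<open>exp (- |x| * y)\<close> is integrable over \<open>y > \<alpha>\<close> because
  \<open>x \<noteq> 0\<close>, and \<open>vg_char s\<close> is integrable. The inner integral over
  \<open>y\<close> is then the bracket of exponential integrals.\<close>

lemma vg_p1_eq_formula:
  assumes s: "0 < s" and x: "x \<noteq> 0"
  shows "vg_p1 s x < \<infinity>" "complex_of_real (enn2real (vg_p1 s x)) = vg_p1_formula \<nu> \<beta> x0 s x"
proof -
  let ?\<alpha> = "vg_alpha \<nu> \<beta>"
  have s0: "0 \<le> s" using s by simp
  obtain \<kappa> where \<kappa>: "\<And>y. ?\<alpha> < y \<Longrightarrow> vg_kernel s y = ennreal (\<kappa> y)" "\<And>y. 0 \<le> \<kappa> y"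
    and \<kappa>c: "\<And>y. ?\<alpha> < y \<Longrightarrow> complex_of_real (\<kappa> y) = (CLBINT z. vg_char s z / (vg_rate \<beta> y + \<i> * z)) / (2 * pi)"
    and \<kappa>m[measurable]: "\<kappa> \<in> borel_measurable borel"
    using vg_kernel_fourier[OF s0] by blast
  have ax: "0 < \<bar>x\<bar>" using x by simp
  \<comment> \<open>Gathers the prefactor \<open>exp (\<beta> * x) / \<nu>\<close> of
    \<open>vg_p1\<close> and the \<open>1 / (2 * pi)\<close> of Fourier inversion.\<close>
  define b where "b = exp (\<beta> * x) / \<nu> / (2 * pi)"
  let ?h = "\<lambda>y z. (indicator {?\<alpha><..} y *\<^sub>R (exp (- complex_of_real \<bar>x\<bar> * complex_of_real y) / (vg_rate \<beta> y + \<i> * z))) * vg_char s z"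
  let ?r = "\<lambda>z. csqrt (complex_of_real (\<beta>\<^sup>2) - 2 * \<i> * complex_of_real z)"
  let ?G = "\<lambda>z. (1 + \<i> * complex_of_real (\<nu> * z)) powr (- complex_of_real (s / \<nu>)) / ?r z
            * exp (- complex_of_real x0 * ?r z)
            * (exp (complex_of_real \<bar>x\<bar> * ?r z) * Ei (- complex_of_real \<bar>x\<bar> * (complex_of_real ?\<alpha> + ?r z))
               - exp (- complex_of_real \<bar>x\<bar> * ?r z) * Ei (- complex_of_real \<bar>x\<bar> * (complex_of_real ?\<alpha> - ?r z)))"
  have rate_norm: "1 / \<nu> \<le> cmod (vg_rate \<beta> y + \<i> * complex_of_real z)" if "?\<alpha> \<le> y" for y z
    using vg_rate_ge[OF nu that] abs_Re_le_cmod[of "vg_rate \<beta> y + \<i> * complex_of_real z"] by simp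
  have expint: "integrable lborel (\<lambda>y. indicator {?\<alpha><..} y * exp (- \<bar>x\<bar> * y))"
    using nn_integral_exp_tail[OF ax, of ?\<alpha>] by (intro integrableI_nonneg) (auto simp: indicator_mult_ennreal)
  have hnorm: "norm (?h y z) \<le> (indicator {?\<alpha><..} y * exp (- \<bar>x\<bar> * y)) * (\<nu> * norm (vg_char s z))" for y z
  proof (cases "?\<alpha> < y")
    case True
    have "0 < 1 / \<nu>" using nu by simp
    then have "exp (- \<bar>x\<bar> * y) / cmod (vg_rate \<beta> y + \<i> * complex_of_real z) \<le> exp (- \<bar>x\<bar> * y) / (1 / \<nu>)"
      using rate_norm[of y z] True by (intro divide_left_mono mult_pos_pos) auto
    then have "exp (- \<bar>x\<bar> * y) / cmod (vg_rate \<beta> y + \<i> * complex_of_real z) * norm (vg_char s z) \<le> exp (- \<bar>x\<bar> * y) / (1 / \<nu>) * norm (vg_char s z)"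
      by (intro mult_right_mono) auto
    then show ?thesis using True by (simp add: norm_mult norm_divide mult.assoc)
  qed simp
  have hint: "integrable lborel (?h y)" for y
  proof (rule Bochner_Integration.integrable_bound)
    show "integrable lborel (\<lambda>z. (indicator {?\<alpha><..} y * exp (- \<bar>x\<bar> * y)) * (\<nu> * norm (vg_char s z)))"
      by (intro integrable_mult_right integrable_norm vg_char_integrable)
    show "AE z in lborel. norm (?h y z) \<le> norm ((indicator {?\<alpha><..} y * exp (- \<bar>x\<bar> * y)) * (\<nu> * norm (vg_char s z)))"
      using hnorm[of y] nu by (intro AE_I2) (simp add: abs_mult)
  qed measurable
  have prodint: "integrable (lborel \<Otimes>\<^sub>M lborel) (\<lambda>(y, z). ?h y z)"
  proof (rule lborel_pair.Fubini_integrable)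
    show hm: "(\<lambda>(y, z). ?h y z) \<in> borel_measurable (lborel \<Otimes>\<^sub>M lborel)" by measurable
    show "AE y in lborel. integrable lborel (\<lambda>z. case (y, z) of (y, z) \<Rightarrow> ?h y z)"
      unfolding prod.case using hint by (intro AE_I2)
    show "integrable lborel (\<lambda>y. LBINT z. norm (case (y, z) of (y, z) \<Rightarrow> ?h y z))"
    proof (rule Bochner_Integration.integrable_bound)
      show "integrable lborel (\<lambda>y. (indicator {?\<alpha><..} y * exp (- \<bar>x\<bar> * y)) * (\<nu> * (LBINT z. norm (vg_char s z))))"
        by (rule integrable_mult_left[OF expint])
      show "(\<lambda>y. LBINT z. norm (case (y, z) of (y, z) \<Rightarrow> ?h y z)) \<in> borel_measurable lborel" by measurable
      show "AE y in lborel. norm (LBINT z. norm (case (y, z) of (y, z) \<Rightarrow> ?h y z)) \<le> norm ((indicator {?\<alpha><..} y * exp (- \<bar>x\<bar> * y)) * (\<nu> * (LBINT z. norm (vg_char s z))))"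
      proof (rule AE_I2)
        fix y :: real
        have "(LBINT z. norm (?h y z)) \<le> (LBINT z. (indicator {?\<alpha><..} y * exp (- \<bar>x\<bar> * y)) * (\<nu> * norm (vg_char s z)))"
          by (intro integral_mono integrable_norm hint hnorm integrable_mult_right vg_char_integrable)
        also have "\<dots> = (indicator {?\<alpha><..} y * exp (- \<bar>x\<bar> * y)) * (\<nu> * (LBINT z. norm (vg_char s z)))" by simp
        finally show "norm (LBINT z. norm (case (y, z) of (y, z) \<Rightarrow> ?h y z)) \<le> norm ((indicator {?\<alpha><..} y * exp (- \<bar>x\<bar> * y)) * (\<nu> * (LBINT z. norm (vg_char s z))))"
          using nu by (simp add: abs_mult)
      qed
    qed
  qed
  define f where "f y = indicator {?\<alpha><..} y * (exp (\<beta> * x - \<bar>x\<bar> * y) / \<nu> * \<kappa> y)" for y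
  have f0: "0 \<le> f y" for y using \<kappa>(2) nu by (simp add: f_def)
  have [measurable]: "f \<in> borel_measurable borel" unfolding f_def[abs_def] by measurable
  have p1: "vg_p1 s x = (\<integral>\<^sup>+y. ennreal (f y) \<partial>lborel)"
    unfolding vg_p1_def f_def using \<kappa> nu by (intro nn_integral_cong) (auto simp: indicator_def ennreal_mult'[symmetric])
  have fc: "complex_of_real (f y) = complex_of_real b * (CLBINT z. ?h y z)" for y
  proof (cases "?\<alpha> < y")
    case True
    have "(CLBINT z. ?h y z) = (CLBINT z. exp (- complex_of_real \<bar>x\<bar> * complex_of_real y) * (vg_char s z / (vg_rate \<beta> y + \<i> * z)))"
      using True by (intro Bochner_Integration.integral_cong) auto
    also have "\<dots> = exp (- complex_of_real \<bar>x\<bar> * complex_of_real y) * (CLBINT z. vg_char s z / (vg_rate \<beta> y + \<i> * z))"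
      by (rule integral_mult_right_zero)
    finally have "complex_of_real b * (CLBINT z. ?h y z) = complex_of_real (exp (\<beta> * x) / \<nu>) * exp (- complex_of_real \<bar>x\<bar> * complex_of_real y) * complex_of_real (\<kappa> y)"
      unfolding \<kappa>c[OF True] b_def by simp
    also have "\<dots> = complex_of_real (exp (\<beta> * x) / \<nu>) * complex_of_real (exp (- \<bar>x\<bar> * y)) * complex_of_real (\<kappa> y)"
      by (simp add: exp_of_real[symmetric])
    also have "complex_of_real (exp (\<beta> * x) / \<nu>) * complex_of_real (exp (- \<bar>x\<bar> * y)) * complex_of_real (\<kappa> y) = complex_of_real (f y)"
    proof -
      have "exp (\<beta> * x - \<bar>x\<bar> * y) = exp (\<beta> * x) * exp (- \<bar>x\<bar> * y)" by (simp add: exp_add[symmetric])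
      then show ?thesis using True unfolding f_def by simp
    qed
    finally show ?thesis by (rule sym)
  qed (simp add: f_def)
  have fint: "integrable lborel f"
  proof -
    have "integrable lborel (\<lambda>y. complex_of_real (f y))"
      unfolding fc by (rule integrable_mult_right[OF lborel_pair.integrable_fst[OF prodint]])
    then show ?thesis by (simp add: complex_of_real_integrable_eq)
  qed
  have p1': "vg_p1 s x = ennreal (\<integral>y. f y \<partial>lborel)"
    unfolding p1 using fint f0 by (intro nn_integral_eq_integral) auto
  then show "vg_p1 s x < \<infinity>" by simp
  have "complex_of_real (enn2real (vg_p1 s x)) = complex_of_real (\<integral>y. f y \<partial>lborel)"
    unfolding p1' using f0 by (simp add: integral_nonneg)
  also have "\<dots> = (CLBINT y. complex_of_real (f y))" by simp
  also have "\<dots> = complex_of_real b * (CLBINT y. (CLBINT z. ?h y z))"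
    unfolding fc by (rule integral_mult_right_zero)
  also have "(CLBINT y. (CLBINT z. ?h y z)) = (CLBINT z. (CLBINT y. ?h y z))"
    by (rule lborel_pair.Fubini_integral[OF prodint, symmetric])
  also have "\<dots> = (CLBINT z. complex_of_real (exp (- x0 * \<beta>)) * ?G z)"
  proof (rule integral_cong_AE)
    have FH: "(CLBINT y. ?h y z) = complex_of_real (exp (- x0 * \<beta>)) * ?G z" if z: "z \<noteq> 0" for z
    proof -
      have "(CLBINT y. ?h y z) = (CLBINT y. indicator {?\<alpha><..} y *\<^sub>R (exp (- complex_of_real \<bar>x\<bar> * complex_of_real y) / (vg_rate \<beta> y + \<i> * z))) * vg_char s z"
        by (rule integral_mult_left_zero)
      also have "(CLBINT y. indicator {?\<alpha><..} y *\<^sub>R (exp (- complex_of_real \<bar>x\<bar> * complex_of_real y) / (vg_rate \<beta> y + \<i> * z))) =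
        (CLBINT y. indicator {?\<alpha>..} y *\<^sub>R (exp (- complex_of_real \<bar>x\<bar> * complex_of_real y) / (vg_rate \<beta> y + \<i> * z)))"
      proof (rule integral_cong_AE)
        have "AE y in lborel. y \<noteq> ?\<alpha>" by (rule AE_lborel_singleton)
        then show "AE y in lborel. indicator {?\<alpha><..} y *\<^sub>R (exp (- complex_of_real \<bar>x\<bar> * complex_of_real y) / (vg_rate \<beta> y + \<i> * z)) =
           indicator {?\<alpha>..} y *\<^sub>R (exp (- complex_of_real \<bar>x\<bar> * complex_of_real y) / (vg_rate \<beta> y + \<i> * z))"
          by eventually_elim (auto simp: indicator_def)
      qed measurable
      also have "\<dots> = (exp (\<bar>x\<bar> * ?r z) * Ei (- \<bar>x\<bar> * (?\<alpha> + ?r z)) - exp (- \<bar>x\<bar> * ?r z) * Ei (- \<bar>x\<bar> * (?\<alpha> - ?r z))) / ?r z"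
        by (rule Ei_bracket[OF ax nu z, symmetric])
      finally have hB: "(CLBINT y. ?h y z) = (exp (\<bar>x\<bar> * ?r z) * Ei (- \<bar>x\<bar> * (?\<alpha> + ?r z)) - exp (- \<bar>x\<bar> * ?r z) * Ei (- \<bar>x\<bar> * (?\<alpha> - ?r z))) / ?r z * vg_char s z" .
      have vc: "vg_char s z = complex_of_real (exp (- x0 * \<beta>)) * exp (- complex_of_real x0 * ?r z) * (1 + \<i> * complex_of_real (\<nu> * z)) powr (- complex_of_real (s / \<nu>))"
        unfolding vg_char_eq[OF s0 z] by (simp add: exp_add[symmetric] exp_of_real[symmetric] algebra_simps)
      have rearrange: "B / r * (e0 * e1 * pw) = e0 * (pw / r * e1 * B)" for B r e0 e1 pw :: complex by simp
      show ?thesis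
        by (rule trans[OF hB], subst vc, unfold of_real_minus) (rule rearrange)
    qed
    show Hm: "(\<lambda>z. CLBINT y. ?h y z) \<in> borel_measurable lborel" by measurable
    \<comment> \<open>Measurability of the explicit integrand, and so of its \<open>Ei\<close>
      terms, is inherited from the integral over \<open>y\<close>, with which it agrees except at
      \<open>z = 0\<close>.\<close>
    have "(\<lambda>z. complex_of_real (exp (- x0 * \<beta>)) * ?G z) = (\<lambda>z. if z = 0 then complex_of_real (exp (- x0 * \<beta>)) * ?G 0 else (CLBINT y. ?h y z))"
      using FH by (intro ext) simp
    moreover have "(\<lambda>z. if z = 0 then complex_of_real (exp (- x0 * \<beta>)) * ?G 0 else (CLBINT y. ?h y z)) \<in> borel_measurable lborel"
      using Hm by (intro measurable_If) auto
    ultimately show "(\<lambda>z. complex_of_real (exp (- x0 * \<beta>)) * ?G z) \<in> borel_measurable lborel" by simp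
    have "AE z in lborel. z \<noteq> (0::real)" by (rule AE_lborel_singleton)
    then show "AE z in lborel. (CLBINT y. ?h y z) = complex_of_real (exp (- x0 * \<beta>)) * ?G z"
      by eventually_elim (rule FH)
  qed
  also have "\<dots> = complex_of_real (exp (- x0 * \<beta>)) * (CLBINT z. ?G z)"
    by (rule integral_mult_right_zero)
  also have "complex_of_real b * (complex_of_real (exp (- x0 * \<beta>)) * (CLBINT z. ?G z)) = complex_of_real (exp (\<beta> * (x - x0)) / (2 * pi * \<nu>)) * (CLBINT z. ?G z)"
  proof -
    have "b * exp (- x0 * \<beta>) = exp (\<beta> * (x - x0)) / (2 * pi * \<nu>)"
      unfolding b_def by (simp add: exp_add[symmetric] algebra_simps)
    then show ?thesis by (simp only: mult.assoc[symmetric] of_real_mult[symmetric])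
  qed
  also have "\<dots> = vg_p1_formula \<nu> \<beta> x0 s x"
    unfolding vg_p1_formula_def Let_def vg_alpha_def ..
  finally show "complex_of_real (enn2real (vg_p1 s x)) = vg_p1_formula \<nu> \<beta> x0 s x" .
qed

section \<open>The first passage time of the second kind\<close>

text \<open>Along a monotone path a time in the infimum can be increased to a rational one still
  below \<open>c\<close>; this gives measurability.\<close>

lemma t1star_less_iff:
  assumes w: "\<omega> \<in> space M"
  shows "t1star x0 \<beta> W T \<omega> < c \<longleftrightarrow> (\<exists>r::rat. 0 \<le> real_of_rat r \<and> ereal (real_of_rat r) < c \<and> Tstar x0 \<beta> W \<omega> \<le> ereal (T (real_of_rat r) \<omega>))"
proof
  assume "t1star x0 \<beta> W T \<omega> < c"
  then obtain t where t: "ereal t < c" "0 \<le> t" "Tstar x0 \<beta> W \<omega> \<le> ereal (T t \<omega>)"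
    unfolding t1star_def Inf_less_iff by auto
  obtain u where u: "t < u" "ereal u < c"
    using ereal_dense2[OF t(1)] by auto
  obtain r :: rat where r: "t < real_of_rat r" "real_of_rat r < u" using of_rat_dense[OF u(1)] by blast
  have "ereal (real_of_rat r) < c" using r(2) u(2) by (metis less_ereal.simps(1) less_trans)
  moreover have "Tstar x0 \<beta> W \<omega> \<le> ereal (T (real_of_rat r) \<omega>)"
    using t(3) T_monoD[OF w t(2), of "real_of_rat r"] r(1) by (meson ereal_less_eq(3) less_imp_le order_trans)
  ultimately show "\<exists>r::rat. 0 \<le> real_of_rat r \<and> ereal (real_of_rat r) < c \<and> Tstar x0 \<beta> W \<omega> \<le> ereal (T (real_of_rat r) \<omega>)"
    using order_trans[OF t(2) less_imp_le[OF r(1)]] by blast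
next
  assume "\<exists>r::rat. 0 \<le> real_of_rat r \<and> ereal (real_of_rat r) < c \<and> Tstar x0 \<beta> W \<omega> \<le> ereal (T (real_of_rat r) \<omega>)"
  then show "t1star x0 \<beta> W T \<omega> < c" unfolding t1star_def Inf_less_iff by blast
qed

lemma t1star_nonneg: "0 \<le> t1star x0 \<beta> W T \<omega>"
  unfolding t1star_def by (rule Inf_greatest) auto

lemma t1star_measurable[measurable]: "t1star x0 \<beta> W T \<in> borel_measurable M"
proof (rule borel_measurableI_less)
  fix c :: ereal
  have "{\<omega> \<in> space M. t1star x0 \<beta> W T \<omega> < c} = {\<omega> \<in> space M. \<exists>r::rat. 0 \<le> real_of_rat r \<and> ereal (real_of_rat r) < c \<and> Tstar x0 \<beta> W \<omega> \<le> ereal (T (real_of_rat r) \<omega>)}"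
    using t1star_less_iff by auto
  also have "\<dots> \<in> sets M" by measurable
  finally show "{\<omega> \<in> space M. t1star x0 \<beta> W T \<omega> < c} \<in> sets M" .
qed

lemma LSBM_t1star_measurable[measurable]:
  "(\<lambda>\<omega>. LSBM x0 \<beta> W T (real_of_ereal (t1star x0 \<beta> W T \<omega>)) \<omega>) \<in> borel_measurable M"
proof -
  have t0: "0 \<le> real_of_ereal (t1star x0 \<beta> W T \<omega>)" for \<omega>
    using t1star_nonneg by (rule real_of_ereal_pos)
  have "(\<lambda>\<omega>. T (max 0 (real_of_ereal (t1star x0 \<beta> W T \<omega>))) \<omega>) \<in> borel_measurable M" by measurable
  then have "(\<lambda>\<omega>. T (real_of_ereal (t1star x0 \<beta> W T \<omega>)) \<omega>) \<in> borel_measurable M" using t0 by (simp add: max_absorb2)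
  then show ?thesis unfolding LSBM_def by (rule Wtilde_process_measurable) (use T_nonneg t0 in auto)
qed

text \<open>Between weak and strict exceedance \<open>T\<close> would rest at the level, and then
  also at a rational time. Excluding rational times therefore makes the two infima equal.\<close>

lemma t1star_eq_passage:
  assumes w: "\<omega> \<in> Hit" "unbounded_path T \<omega>" and ne: "\<And>r::rat. 0 \<le> real_of_rat r \<Longrightarrow> T (real_of_rat r) \<omega> \<noteq> hit \<omega>"
  shows "t1star x0 \<beta> W T \<omega> = ereal (passage T (hit \<omega>) \<omega>)"
proof -
  have sp: "\<omega> \<in> space M" using w unfolding Hit_def by auto
  interpret S: subordinator_path "\<lambda>t. T t \<omega>" by (rule subordinator_path[OF sp w(2)])
  let ?f = "first_pass (\<lambda>t. T t \<omega>) (hit \<omega>)"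
  have less: "t1star x0 \<beta> W T \<omega> < ereal c \<longleftrightarrow> ?f < c" for c
  proof
    assume "t1star x0 \<beta> W T \<omega> < ereal c"
    then obtain r :: rat where r: "0 \<le> real_of_rat r" "real_of_rat r < c" "hit \<omega> \<le> T (real_of_rat r) \<omega>"
      unfolding t1star_less_iff[OF sp] Tstar_eq_hit[OF w(1)] by auto
    then have "hit \<omega> < T (real_of_rat r) \<omega>" using ne[OF r(1)] by simp
    then show "?f < c" using S.first_pass_le[OF r(1)] r(2) by fastforce
  next
    assume "?f < c"
    then obtain r :: rat where r: "?f < real_of_rat r" "real_of_rat r < c" using of_rat_dense by blast
    then have "hit \<omega> < T (real_of_rat r) \<omega>" by (intro S.first_pass_lessD)
    moreover have "0 \<le> real_of_rat r" using r(1) S.first_pass_nonneg[of "hit \<omega>"] by linarith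
    ultimately show "t1star x0 \<beta> W T \<omega> < ereal c"
      unfolding t1star_less_iff[OF sp] Tstar_eq_hit[OF w(1)] using r(2) by (intro exI[of _ r]) auto
  qed
  have "t1star x0 \<beta> W T \<omega> = ereal ?f"
  proof (rule antisym)
    show "t1star x0 \<beta> W T \<omega> \<le> ereal ?f"
    proof (rule ccontr)
      assume "\<not> t1star x0 \<beta> W T \<omega> \<le> ereal ?f"
      then obtain u where u: "ereal ?f < ereal u" "ereal u < t1star x0 \<beta> W T \<omega>"
        using ereal_dense2[of "ereal ?f" "t1star x0 \<beta> W T \<omega>"] by (auto simp: not_le)
      then show False using less[of u] by simp
    qed
    show "ereal ?f \<le> t1star x0 \<beta> W T \<omega>" using less[of ?f] by (simp add: not_less)
  qed
  then show ?thesis using w(2) by (simp add: passage_def)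
qed

text \<open>Having a density, the hitting time charges no point, and it is independent of
  \<open>T\<close> at each fixed time; the union over rational times remains null.\<close>

lemma AE_hit_ne_T: "AE \<omega> in M. \<omega> \<in> Hit \<longrightarrow> (\<forall>r::rat. 0 \<le> real_of_rat r \<longrightarrow> T (real_of_rat r) \<omega> \<noteq> hit \<omega>)"
proof -
  obtain \<rho> where \<rho>m[measurable]: "\<rho> \<in> borel_measurable borel"
    and \<rho>: "distr hit_law borel hit = density lborel (\<lambda>t. ennreal (\<rho> t))"
    using hit_density by blast
  have atom: "(\<integral>\<^sup>+\<omega>. indicator {c} (hit \<omega>) * indicator Hit \<omega> \<partial>M) = 0" for c
  proof -
    have "(\<integral>\<^sup>+\<omega>. indicator {c} (hit \<omega>) * indicator Hit \<omega> \<partial>M) = (\<integral>\<^sup>+\<omega>. indicator {c} (hit \<omega>) \<partial>hit_law)"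
      by (rule nn_integral_hit_law[symmetric]) measurable
    also have "\<dots> = (\<integral>\<^sup>+t. indicator {c} t \<partial>distr hit_law borel hit)" by (subst nn_integral_distr) auto
    also have "\<dots> = (\<integral>\<^sup>+t. ennreal (\<rho> t) * indicator {c} t \<partial>lborel)" unfolding \<rho> by (subst nn_integral_density) auto
    also have "\<dots> = (\<integral>\<^sup>+t. 0 \<partial>(lborel :: real measure))"
    proof (rule nn_integral_cong_AE)
      have "AE t in lborel. t \<noteq> c" by (rule AE_lborel_singleton)
      then show "AE t in lborel. ennreal (\<rho> t) * indicator {c} t = 0" by eventually_elim simp
    qed
    finally show ?thesis by simp
  qed
  have "AE \<omega> in M. \<omega> \<in> Hit \<longrightarrow> T q \<omega> \<noteq> hit \<omega>" for q
  proof -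
    let ?\<Phi> = "\<lambda>p. indicator {0} (hit (fst p) - T q (snd p)) * indicator Hit (fst p) :: ennreal"
    have "?\<Phi> \<in> borel_measurable (FW \<Otimes>\<^sub>M FT)" by measurable
    from nn_integral_coupling[OF this]
    have "(\<integral>\<^sup>+\<omega>. indicator {0} (hit \<omega> - T q \<omega>) * indicator Hit \<omega> \<partial>M) = (\<integral>\<^sup>+\<omega>'. (\<integral>\<^sup>+\<omega>. indicator {0} (hit \<omega> - T q \<omega>') * indicator Hit \<omega> \<partial>M) \<partial>M)"
      by simp
    also have "\<dots> = (\<integral>\<^sup>+\<omega>'. (\<integral>\<^sup>+\<omega>. indicator {T q \<omega>'} (hit \<omega>) * indicator Hit \<omega> \<partial>M) \<partial>M)"
      by (intro nn_integral_cong) (auto simp: indicator_def)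
    also have "\<dots> = 0" unfolding atom by simp
    finally have "AE \<omega> in M. indicator {0} (hit \<omega> - T q \<omega>) * indicator Hit \<omega> = (0 :: ennreal)"
      by (subst (asm) nn_integral_0_iff_AE) auto
    then show ?thesis by eventually_elim (auto simp: indicator_def split: if_splits)
  qed
  then have "AE \<omega> in M. \<forall>r::rat. \<omega> \<in> Hit \<longrightarrow> T (real_of_rat r) \<omega> \<noteq> hit \<omega>"
    by (subst AE_all_countable) auto
  then show ?thesis by eventually_elim auto
qed

text \<open>On \<open>A\<close> the time is positive and the position nonzero, which is where
  \<open>vg_p1\<close> is finite and given by the formula at every point; almost surely
  \<open>t1star\<close> is the strict passage time treated by \<open>passage_law\<close>.\<close>

lemma passage_distribution:
  assumes A: "A \<in> sets (lborel \<Otimes>\<^sub>M lborel)" and sub: "A \<subseteq> {0<..} \<times> - {0}"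
  shows "complex_of_real (measure M {\<omega> \<in> space M. t1star x0 \<beta> W T \<omega> < \<infinity> \<and>
      (real_of_ereal (t1star x0 \<beta> W T \<omega>), LSBM x0 \<beta> W T (real_of_ereal (t1star x0 \<beta> W T \<omega>)) \<omega>) \<in> A})
    = (LINT y:A|lborel \<Otimes>\<^sub>M lborel. vg_p1_formula \<nu> \<beta> x0 (fst y) (snd y))"
proof -
  define E where "E = {\<omega> \<in> space M. t1star x0 \<beta> W T \<omega> < \<infinity> \<and>
      (real_of_ereal (t1star x0 \<beta> W T \<omega>), LSBM x0 \<beta> W T (real_of_ereal (t1star x0 \<beta> W T \<omega>)) \<omega>) \<in> A}"
  have sl: "sets (lborel \<Otimes>\<^sub>M lborel) = sets (borel \<Otimes>\<^sub>M borel :: (real \<times> real) measure)"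
    by (intro sets_pair_measure_cong sets_lborel)
  have A'[measurable]: "A \<in> sets (borel \<Otimes>\<^sub>M borel)" using A sl by simp
  have E[measurable]: "E \<in> sets M" unfolding E_def by measurable
  define \<phi> :: "real \<times> real \<Rightarrow> ennreal" where "\<phi> = indicator A"
  have \<phi>m[measurable]: "\<phi> \<in> borel_measurable (borel \<Otimes>\<^sub>M borel)" unfolding \<phi>_def by measurable
  have "emeasure M E = (\<integral>\<^sup>+\<omega>. indicator E \<omega> \<partial>M)" by simp
  also have "\<dots> = (\<integral>\<^sup>+\<omega>. \<phi> (passage T (hit \<omega>) \<omega>, Wtilde x0 \<beta> W (T (passage T (hit \<omega>) \<omega>) \<omega>) \<omega>) * indicator Hit \<omega> \<partial>M)"
  proof (rule nn_integral_cong_AE)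
    show "AE \<omega> in M. indicator E \<omega> = \<phi> (passage T (hit \<omega>) \<omega>, Wtilde x0 \<beta> W (T (passage T (hit \<omega>) \<omega>) \<omega>) \<omega>) * indicator Hit \<omega>"
      using AE_hit_ne_T AE_unbounded_path AE_space
    proof eventually_elim
      case (elim \<omega>)
      show ?case
      proof (cases "\<omega> \<in> Hit")
        case True
        have t: "t1star x0 \<beta> W T \<omega> = ereal (passage T (hit \<omega>) \<omega>)"
          using elim True by (intro t1star_eq_passage) auto
        then show ?thesis using True elim(3) by (simp add: E_def \<phi>_def LSBM_def indicator_def)
      next
        case False
        then have "Tstar x0 \<beta> W \<omega> = \<infinity>" using elim(3) unfolding Hit_def by simp
        \<comment> \<open>No value of \<open>T\<close> reaches an infinite level, so the infimum is
          over the empty set.\<close>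
        then have "t1star x0 \<beta> W T \<omega> = \<infinity>" unfolding t1star_def by (simp add: top_ereal_def)
        then show ?thesis using False by (simp add: E_def)
      qed
    qed
  qed
  also have "\<dots> = (\<integral>\<^sup>+s. indicator {0..} s * (\<integral>\<^sup>+x. \<phi> (s, x) * vg_p1 s x \<partial>lborel) \<partial>lborel)"
    by (rule passage_law[OF \<phi>m])
  also have "\<dots> = (\<integral>\<^sup>+s. (\<integral>\<^sup>+x. \<phi> (s, x) * vg_p1 s x \<partial>lborel) \<partial>lborel)"
  proof (intro nn_integral_cong)
    fix s :: real
    have "\<phi> (s, x) = 0" if "\<not> 0 \<le> s" for x using sub that by (auto simp: \<phi>_def indicator_def)
    then show "indicator {0..} s * (\<integral>\<^sup>+x. \<phi> (s, x) * vg_p1 s x \<partial>lborel) = (\<integral>\<^sup>+x. \<phi> (s, x) * vg_p1 s x \<partial>lborel)"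
      by (cases "0 \<le> s") simp_all
  qed
  also have "\<dots> = (\<integral>\<^sup>+v. \<phi> v * vg_p1 (fst v) (snd v) \<partial>(lborel \<Otimes>\<^sub>M lborel))"
  proof -
    have "(\<lambda>v. \<phi> v * vg_p1 (fst v) (snd v)) \<in> borel_measurable (lborel \<Otimes>\<^sub>M lborel)"
      unfolding measurable_cong_sets[OF sl refl] by measurable
    from lborel.nn_integral_fst[OF this] show ?thesis by simp
  qed
  finally have em: "emeasure M E = (\<integral>\<^sup>+v. \<phi> v * vg_p1 (fst v) (snd v) \<partial>(lborel \<Otimes>\<^sub>M lborel))" .
  define P where "P v = indicator A v * enn2real (vg_p1 (fst v) (snd v))" for v
  have P0: "0 \<le> P v" for v by (simp add: P_def)
  have Pm: "P \<in> borel_measurable (lborel \<Otimes>\<^sub>M lborel)"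
    unfolding measurable_cong_sets[OF sl refl] P_def[abs_def] by measurable
  have "(\<integral>\<^sup>+v. \<phi> v * vg_p1 (fst v) (snd v) \<partial>(lborel \<Otimes>\<^sub>M lborel)) = (\<integral>\<^sup>+v. ennreal (P v) \<partial>(lborel \<Otimes>\<^sub>M lborel))"
  proof (intro nn_integral_cong)
    fix v :: "real \<times> real"
    show "\<phi> v * vg_p1 (fst v) (snd v) = ennreal (P v)"
    proof (cases "v \<in> A")
      case True
      then have "0 < fst v" "snd v \<noteq> 0" using sub by auto
      then have "vg_p1 (fst v) (snd v) < \<infinity>" by (rule vg_p1_eq_formula)
      then show ?thesis using True by (simp add: \<phi>_def P_def)
    qed (simp add: \<phi>_def P_def)
  qed
  then have "measure M E = (\<integral>v. P v \<partial>(lborel \<Otimes>\<^sub>M lborel))"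
    using em P0 Pm unfolding measure_def by (subst integral_eq_nn_integral) auto
  then have "complex_of_real (measure M E) = (\<integral>v. complex_of_real (P v) \<partial>(lborel \<Otimes>\<^sub>M lborel))"
    by simp
  also have "\<dots> = (LINT y:A|lborel \<Otimes>\<^sub>M lborel. vg_p1_formula \<nu> \<beta> x0 (fst y) (snd y))"
    unfolding set_lebesgue_integral_def
  proof (intro Bochner_Integration.integral_cong refl)
    fix v :: "real \<times> real"
    show "complex_of_real (P v) = indicat_real A v *\<^sub>R vg_p1_formula \<nu> \<beta> x0 (fst v) (snd v)"
    proof (cases "v \<in> A")
      case True
      then have "0 < fst v" "snd v \<noteq> 0" using sub by auto
      then show ?thesis using True vg_p1_eq_formula(2) by (simp add: P_def)
    qed (simp add: P_def)
  qed
  finally show ?thesis unfolding E_def .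
qed

end

text \<open>Equality over all these sets \<open>A\<close> is the precise content of the
  delta-function notation for the joint density.\<close>

theorem theorem5p1:
  fixes M :: "'a measure" and W T :: "real \<Rightarrow> 'a \<Rightarrow> real" and \<nu> \<beta> x0 :: real
  assumes "prob_space M"
    and "std_brownian_motion M W"
    and "gamma_subordinator M \<nu> T"
    and "prob_space.indep_var M (Pi\<^sub>M UNIV (\<lambda>_. borel)) (\<lambda>\<omega> t. W t \<omega>)
                                (Pi\<^sub>M UNIV (\<lambda>_. borel)) (\<lambda>\<omega> t. T t \<omega>)"
    and "\<nu> > 0" and "x0 > 0"
  shows "\<forall>A \<in> sets (lborel \<Otimes>\<^sub>M lborel). A \<subseteq> {0<..} \<times> - {0} \<longrightarrow>
           complex_of_real (measure M
             {\<omega> \<in> space M. t1star x0 \<beta> W T \<omega> < \<infinity> \<and>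
                (real_of_ereal (t1star x0 \<beta> W T \<omega>),
                 LSBM x0 \<beta> W T (real_of_ereal (t1star x0 \<beta> W T \<omega>)) \<omega>) \<in> A})
           = (LINT y:A|lborel \<Otimes>\<^sub>M lborel. vg_p1_formula \<nu> \<beta> x0 (fst y) (snd y))"
proof -
  interpret prob_space M by fact
  interpret vg_setting M W x0 \<beta> T \<nu>
    by unfold_locales (use assms in auto)
  show ?thesis using passage_distribution by blast
qed

end
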